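(* Let $k:\mathcal P\otimes\mathcal Q\to\mathbb R$ be differentiable at $P_0\otimes Q_0$ with canonical gradient $\widetilde k=\widetilde k_1\circ\pi_1+\widetilde k_2\circ\pi_2$, $\|\widetilde k\|_{L_2(P_0\otimes Q_0)}\neq0$, let $\alpha\in(0,1)$, and let $(n_1)_n,(n_2)_n\subset\mathbb N$ satisfy $n_1+n_2=n$ for all $n$ and $\lim_{n\to\infty}\frac{n_2}n=d\in(0,1)$. Suppose that the set $$N(\widetilde k,P_0\otimes Q_0,\mathcal P\otimes\mathcal Q)\cap K(P_0\otimes Q_0,\mathcal P\otimes\mathcal Q)$$ is dense in the vector space $N(\widetilde k,P_0\otimes Q_0,\mathcal P\otimes\mathcal Q)$ with respect to the $L_2(P_0\otimes Q_0)$-norm. Let $\psi_n=1$ if $T_n>c$ and $\psi_n=0$ if $T_n\le c$, where $$T_n=\frac{\sqrt n}{n_1}\sum_{i=1}^{n_1}\widetilde k_1(\omega_{1,i})+\frac{\sqrt n}{n_2}\sum_{j=1}^{n_2}\widetilde k_2(\omega_{2,j}),\qquad c=u_{1-\alpha}\Bigl(\frac1{1-d}\int\widetilde k_1^2\,dP_0+\frac1d\int\widetilde k_2^2\,dQ_0\Bigr)^{1/2}.$$ Then $(\psi_n)_n$ is asymptotically optimal within the set of all asymptotically level-$\alpha$-similar test sequences for $\mathcal H_1$ against $\mathcal K_1$.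
   Context: $\mathcal P,\mathcal Q$ are nonempty families of probability measures on $(\Omega_1,\mathcal A_1)$, $(\Omega_2,\mathcal A_2)$; $\mathcal P\otimes\mathcal Q=\{P\otimes Q:P\in\mathcal P,Q\in\mathcal Q\}$; $(\omega_{1,1},\dots,\omega_{1,n_1},\omega_{2,1},\dots,\omega_{2,n_2})$ is the generic point of $\Omega_1^{n_1}\times\Omega_2^{n_2}$. $\Phi$ is the standard normal distribution function, $u_{1-\alpha}=\Phi^{-1}(1-\alpha)$; tests are measurable $[0,1]$-valued functions. $L_2^{(0)}(P)=\{h\in L_2(P):\int h\,dP=0\}$. With $dP/dQ$ the density quotient (a $[0,\infty]$-valued measurable $L$ with $P(A)=\int_AL\,dQ+P(A\cap\{L=\infty\})$, $Q(L<\infty)=1$), a curve $t\mapsto R_t$, $|t|<\varepsilon$, in a family $\mathcal R$ is $L_2(R_0)$-differentiable with tangent $g\in L_2(R_0)$ if $\|2((dR_t/dR_0)^{1/2}-1)-tg\|_{L_2(R_0)}=o(|t|)$ and $R_t(dR_t/dR_0=\infty)=o(t^2)$ as $t\to0$. The tangent cone $K(R,\mathcal R)$ is the set of tangents of all such curves in $\mathcal R$ with $R_0=R$; the tangent space $T(R,\mathcal R)$ is the $L_2(R)$-closure of its linear span. A functional $k$ on $\mathcal R$ is differentiable at $R\in\mathcal R$ with gradient $\dot k\in L_2^{(0)}(R)$ if $\lim_{t\downarrow0}t^{-1}(k(R_t)-k(R))=\int\dot kg\,dR$ for each $L_2$-differentiable curve in $\mathcal R$ with $R_0=R$ and tangent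 $g$; the canonical gradient $\widetilde k$ is the unique gradient in $T(R,\mathcal R)$. $N(\widetilde k,R,\mathcal R)=\{h\in T(R,\mathcal R):\int\widetilde kh\,dR=0\}$. At $P_0\otimes Q_0$ the canonical gradient decomposes uniquely as $\widetilde k(\omega_1,\omega_2)=\widetilde k_1(\omega_1)+\widetilde k_2(\omega_2)$ with $\widetilde k_1\in L_2^{(0)}(P_0)$, $\widetilde k_2\in L_2^{(0)}(Q_0)$. $\mathcal F_2$ is the set of all sequences $(P_{t_n}\otimes Q_{t_n})_n$ (identified with the sequences $(P_{t_n}^{n_1}\otimes Q_{t_n}^{n_2})_n$) such that $t_n\to0$, $\lim_nt_n\sqrt n>0$, and there are $\varepsilon>0$ and an $L_2(P_0\otimes Q_0)$-differentiable curve $f:(-\varepsilon,\varepsilon)\to\mathcal P\otimes\mathcal Q$, $t\mapsto P_t\otimes Q_t$ (through $P_0\otimes Q_0$ at $t=0$) with $f(t_n)=P_{t_n}\otimes Q_{t_n}$ for all $n$. For an element of $\mathcal F_2$ put $\vartheta=\lim_n\sqrt n(k(P_{t_n}\otimes Q_{t_n})-k(P_0\otimes Q_0))$. $\mathcal K_1$ (implicit alternatives) is the set of elements of $\mathcal F_2$ with $\vartheta>0$, $\mathcal H_1$ (implicit hypotheses) the set of those with $\vartheta\le0$. A sequence of tests $\varphi_n$ on $\Omega_1^{n_1}\times\Omega_2^{n_2}$ is asymptotically level-$\alpha$-similar for $\mathcal H_1$ against $\mathcal K_1$ if $\lim_n\int\varphi_n\,dP_{t_n}^{n_1}\otimes Q_{t_n}^{n_2}=\alpha$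 for all elements of $\mathcal H_1$ with $\vartheta=0$. "$(\psi_n)$ is asymptotically optimal" in this class means: $(\psi_n)$ belongs to the class, and for every $(\varphi_n)$ in the class, $\limsup_n\int\varphi_n\,dP_{t_n}^{n_1}\otimes Q_{t_n}^{n_2}\le\lim_n\int\psi_n\,dP_{t_n}^{n_1}\otimes Q_{t_n}^{n_2}$ for all elements of $\mathcal K_1$ and $\liminf_n\int\varphi_n\,dP_{t_n}^{n_1}\otimes Q_{t_n}^{n_2}\ge\lim_n\int\psi_n\,dP_{t_n}^{n_1}\otimes Q_{t_n}^{n_2}$ for all elements of $\mathcal H_1$ (the limits for $\psi_n$ existing). *)

theory Defs
  imports "HOL-Probability.Probability" "HOL-Library.Landau_Symbols"
begin

text \<open>Elements of \<open>L\<^sub>2(R)\<close> are represented by functions; two functions that agree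
  almost everywhere represent the same element, and all notions below respect this.\<close>

definition L2_space :: "'a measure \<Rightarrow> ('a \<Rightarrow> real) set" where
  "L2_space R = {h \<in> borel_measurable R. integrable R (\<lambda>x. (h x)\<^sup>2)}"

definition L2_norm :: "'a measure \<Rightarrow> ('a \<Rightarrow> real) \<Rightarrow> real" where
  "L2_norm R h = sqrt (\<integral>x. (h x)\<^sup>2 \<partial>R)"

definition L2_centered :: "'a measure \<Rightarrow> ('a \<Rightarrow> real) set" where
  "L2_centered R = {h \<in> L2_space R. (\<integral>x. h x \<partial>R) = 0}"

definition L2_closure :: "'a measure \<Rightarrow> ('a \<Rightarrow> real) set \<Rightarrow> ('a \<Rightarrow> real) set" where
  "L2_closure R S = {h \<in> L2_space R. \<forall>e>0. \<exists>f\<in>S. L2_norm R (\<lambda>x. h x - f x) < e}"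

definition fun_span :: "('a \<Rightarrow> real) set \<Rightarrow> ('a \<Rightarrow> real) set" where
  "fun_span S = {\<lambda>x. \<Sum>i<m. a i * g i x | (m::nat) a g. \<forall>i<m. g i \<in> S}"

definition is_density_quotient ::
    "'a measure \<Rightarrow> 'a measure \<Rightarrow> ('a \<Rightarrow> ennreal) \<Rightarrow> bool" where
  "is_density_quotient P Q L \<longleftrightarrow>
     L \<in> borel_measurable Q \<and>
     emeasure Q {x \<in> space Q. L x < \<infinity>} = 1 \<and>
     (\<forall>A\<in>sets Q. emeasure P A =
        (\<integral>\<^sup>+x\<in>A. L x \<partial>Q) + emeasure P (A \<inter> {x \<in> space Q. L x = \<infinity>}))"

text \<open>The curve is \<open>R t\<close> for \<open>\<bar>t\<bar> < \<epsilon>\<close>; the values of \<open>R\<close> outside this interval are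
  irrelevant.  \<open>L t\<close> is a version of \<open>dR\<^sub>t/dR\<^sub>0\<close>.  Versions exist, and neither condition
  depends on the one chosen.  Under \<open>R 0\<close> the quotient is finite almost surely, so
  \<open>enn2real\<close> loses nothing in the first condition.\<close>

definition L2_differentiable_curve ::
    "real \<Rightarrow> (real \<Rightarrow> 'a measure) \<Rightarrow> ('a \<Rightarrow> real) \<Rightarrow> bool" where
  "L2_differentiable_curve \<epsilon> R g \<longleftrightarrow>
     0 < \<epsilon> \<and> g \<in> L2_space (R 0) \<and>
     (\<exists>L. (\<forall>t. \<bar>t\<bar> < \<epsilon> \<longrightarrow> is_density_quotient (R t) (R 0) (L t)) \<and>
        (\<lambda>t. L2_norm (R 0) (\<lambda>x. 2 * (sqrt (enn2real (L t x)) - 1) - t * g x))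
           \<in> o[at 0](\<lambda>t. \<bar>t\<bar>) \<and>
        (\<lambda>t. measure (R t) {x \<in> space (R t). L t x = \<infinity>}) \<in> o[at 0](\<lambda>t. t\<^sup>2))"

definition curve_through ::
    "'a measure set \<Rightarrow> 'a measure \<Rightarrow> real \<Rightarrow> (real \<Rightarrow> 'a measure) \<Rightarrow> ('a \<Rightarrow> real) \<Rightarrow> bool" where
  "curve_through \<R> R0 \<epsilon> R g \<longleftrightarrow>
     R 0 = R0 \<and> (\<forall>t. \<bar>t\<bar> < \<epsilon> \<longrightarrow> R t \<in> \<R>) \<and> L2_differentiable_curve \<epsilon> R g"

definition tangent_cone :: "'a measure \<Rightarrow> 'a measure set \<Rightarrow> ('a \<Rightarrow> real) set" where
  "tangent_cone R0 \<R> = {g. \<exists>\<epsilon> R. curve_through \<R> R0 \<epsilon> R g}"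

definition tangent_space :: "'a measure \<Rightarrow> 'a measure set \<Rightarrow> ('a \<Rightarrow> real) set" where
  "tangent_space R0 \<R> = L2_closure R0 (fun_span (tangent_cone R0 \<R>))"

definition is_gradient ::
    "('a measure \<Rightarrow> real) \<Rightarrow> 'a measure \<Rightarrow> 'a measure set \<Rightarrow> ('a \<Rightarrow> real) \<Rightarrow> bool" where
  "is_gradient k R0 \<R> \<kappa> \<longleftrightarrow>
     \<kappa> \<in> L2_centered R0 \<and>
     (\<forall>\<epsilon> R g. curve_through \<R> R0 \<epsilon> R g \<longrightarrow>
        ((\<lambda>t. (k (R t) - k R0) / t) \<longlongrightarrow> (\<integral>x. \<kappa> x * g x \<partial>R0)) (at_right 0))"

definition functional_differentiable ::
    "('a measure \<Rightarrow> real) \<Rightarrow> 'a measure \<Rightarrow> 'a measure set \<Rightarrow> bool" where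
  "functional_differentiable k R0 \<R> \<longleftrightarrow> (\<exists>\<kappa>. is_gradient k R0 \<R> \<kappa>)"

definition is_canonical_gradient ::
    "('a measure \<Rightarrow> real) \<Rightarrow> 'a measure \<Rightarrow> 'a measure set \<Rightarrow> ('a \<Rightarrow> real) \<Rightarrow> bool" where
  "is_canonical_gradient k R0 \<R> \<kappa> \<longleftrightarrow> is_gradient k R0 \<R> \<kappa> \<and> \<kappa> \<in> tangent_space R0 \<R>"

definition gradient_kernel ::
    "('a \<Rightarrow> real) \<Rightarrow> 'a measure \<Rightarrow> 'a measure set \<Rightarrow> ('a \<Rightarrow> real) set" where
  "gradient_kernel \<kappa> R0 \<R> = {h \<in> tangent_space R0 \<R>. (\<integral>x. \<kappa> x * h x \<partial>R0) = 0}"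

definition product_family ::
    "'a measure set \<Rightarrow> 'b measure set \<Rightarrow> ('a \<times> 'b) measure set" where
  "product_family \<P> \<Q> = {P \<Otimes>\<^sub>M Q | P Q. P \<in> \<P> \<and> Q \<in> \<Q>}"

definition normal_quantile :: "real \<Rightarrow> real" where
  "normal_quantile p = inv (cdf std_normal_distribution) p"

text \<open>The two-sample product measure \<open>P\<^sup>m \<otimes> Q\<^sup>l\<close>; applied to measures that only serve as
  carriers of a \<open>\<sigma>\<close>-algebra, it also supplies the measurable space of the samples.\<close>

definition two_sample ::
    "nat \<Rightarrow> nat \<Rightarrow> 'a measure \<Rightarrow> 'b measure \<Rightarrow> ((nat \<Rightarrow> 'a) \<times> (nat \<Rightarrow> 'b)) measure" where
  "two_sample m l P Q = (\<Pi>\<^sub>M i\<in>{1..m}. P) \<Otimes>\<^sub>M (\<Pi>\<^sub>M j\<in>{1..l}. Q)"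

text \<open>A sequence \<open>(P\<^sub>n \<otimes> Q\<^sub>n)\<^sub>n\<close> of product probability measures is stored as the pair of
  sequences of its (uniquely determined) factors, from which both \<open>P\<^sub>n \<otimes> Q\<^sub>n\<close> and the
  corresponding two-sample measures are formed.\<close>

type_synonym ('a, 'b) product_seq = "(nat \<Rightarrow> 'a measure) \<times> (nat \<Rightarrow> 'b measure)"

definition F2 ::
    "'a measure set \<Rightarrow> 'b measure set \<Rightarrow> 'a measure \<Rightarrow> 'b measure \<Rightarrow> ('a, 'b) product_seq set" where
  "F2 \<P> \<Q> P0 Q0 = {(Ps, Qs).
     (\<forall>n. Ps n \<in> \<P> \<and> Qs n \<in> \<Q>) \<and>
     (\<exists>(t :: nat \<Rightarrow> real) (\<tau> :: real) \<epsilon> f g.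
        t \<longlonglongrightarrow> 0 \<and>
        (\<lambda>n. t n * sqrt (real n)) \<longlonglongrightarrow> \<tau> \<and> 0 < \<tau> \<and>
        curve_through (product_family \<P> \<Q>) (P0 \<Otimes>\<^sub>M Q0) \<epsilon> f g \<and>
        (\<forall>n. \<bar>t n\<bar> < \<epsilon> \<and> f (t n) = Ps n \<Otimes>\<^sub>M Qs n))}"

text \<open>For sequences in \<open>F2\<close> this limit exists whenever \<open>k\<close> is differentiable at
  \<open>P0 \<otimes> Q0\<close>.\<close>

definition local_parameter ::
    "(('a \<times> 'b) measure \<Rightarrow> real) \<Rightarrow> 'a measure \<Rightarrow> 'b measure \<Rightarrow> ('a, 'b) product_seq \<Rightarrow> real" where
  "local_parameter k P0 Q0 s =
     lim (\<lambda>n. sqrt (real n) * (k (fst s n \<Otimes>\<^sub>M snd s n) - k (P0 \<Otimes>\<^sub>M Q0)))"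

definition implicit_alternatives ::
    "'a measure set \<Rightarrow> 'b measure set \<Rightarrow> (('a \<times> 'b) measure \<Rightarrow> real)
      \<Rightarrow> 'a measure \<Rightarrow> 'b measure \<Rightarrow> ('a, 'b) product_seq set" where
  "implicit_alternatives \<P> \<Q> k P0 Q0 = {s \<in> F2 \<P> \<Q> P0 Q0. local_parameter k P0 Q0 s > 0}"

definition implicit_hypotheses ::
    "'a measure set \<Rightarrow> 'b measure set \<Rightarrow> (('a \<times> 'b) measure \<Rightarrow> real)
      \<Rightarrow> 'a measure \<Rightarrow> 'b measure \<Rightarrow> ('a, 'b) product_seq set" where
  "implicit_hypotheses \<P> \<Q> k P0 Q0 = {s \<in> F2 \<P> \<Q> P0 Q0. local_parameter k P0 Q0 s \<le> 0}"

type_synonym ('a, 'b) test_seq = "nat \<Rightarrow> (nat \<Rightarrow> 'a) \<times> (nat \<Rightarrow> 'b) \<Rightarrow> real"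

definition is_test_seq ::
    "'a measure \<Rightarrow> 'b measure \<Rightarrow> (nat \<Rightarrow> nat) \<Rightarrow> (nat \<Rightarrow> nat) \<Rightarrow> ('a, 'b) test_seq \<Rightarrow> bool" where
  "is_test_seq M1 M2 n1 n2 \<phi> \<longleftrightarrow>
     (\<forall>n. \<phi> n \<in> borel_measurable (two_sample (n1 n) (n2 n) M1 M2) \<and>
        (\<forall>w\<in>space (two_sample (n1 n) (n2 n) M1 M2). 0 \<le> \<phi> n w \<and> \<phi> n w \<le> 1))"

definition expected_value ::
    "(nat \<Rightarrow> nat) \<Rightarrow> (nat \<Rightarrow> nat) \<Rightarrow> ('a, 'b) test_seq \<Rightarrow> ('a, 'b) product_seq \<Rightarrow> nat \<Rightarrow> real" where
  "expected_value n1 n2 \<phi> s n =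
     (\<integral>w. \<phi> n w \<partial>two_sample (n1 n) (n2 n) (fst s n) (snd s n))"

definition asymptotically_similar_tests ::
    "'a measure \<Rightarrow> 'b measure \<Rightarrow> 'a measure set \<Rightarrow> 'b measure set \<Rightarrow> (('a \<times> 'b) measure \<Rightarrow> real)
      \<Rightarrow> 'a measure \<Rightarrow> 'b measure \<Rightarrow> (nat \<Rightarrow> nat) \<Rightarrow> (nat \<Rightarrow> nat) \<Rightarrow> real \<Rightarrow> ('a, 'b) test_seq set" where
  "asymptotically_similar_tests M1 M2 \<P> \<Q> k P0 Q0 n1 n2 \<alpha> =
     {\<phi>. is_test_seq M1 M2 n1 n2 \<phi> \<and>
        (\<forall>s\<in>implicit_hypotheses \<P> \<Q> k P0 Q0. local_parameter k P0 Q0 s = 0 \<longrightarrow>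
           expected_value n1 n2 \<phi> s \<longlonglongrightarrow> \<alpha>)}"

definition asymptotically_optimal ::
    "('a, 'b) test_seq set \<Rightarrow> ('a, 'b) product_seq set \<Rightarrow> ('a, 'b) product_seq set
      \<Rightarrow> (nat \<Rightarrow> nat) \<Rightarrow> (nat \<Rightarrow> nat) \<Rightarrow> ('a, 'b) test_seq \<Rightarrow> bool" where
  "asymptotically_optimal C H K n1 n2 \<psi> \<longleftrightarrow>
     \<psi> \<in> C \<and>
     (\<forall>s\<in>H \<union> K. convergent (expected_value n1 n2 \<psi> s)) \<and>
     (\<forall>\<phi>\<in>C.
        (\<forall>s\<in>K. limsup (\<lambda>n. ereal (expected_value n1 n2 \<phi> s n))
                  \<le> ereal (lim (expected_value n1 n2 \<psi> s))) \<and>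
        (\<forall>s\<in>H. liminf (\<lambda>n. ereal (expected_value n1 n2 \<phi> s n))
                  \<ge> ereal (lim (expected_value n1 n2 \<psi> s))))"

definition test_statistic ::
    "('a \<Rightarrow> real) \<Rightarrow> ('b \<Rightarrow> real) \<Rightarrow> (nat \<Rightarrow> nat) \<Rightarrow> (nat \<Rightarrow> nat)
      \<Rightarrow> nat \<Rightarrow> (nat \<Rightarrow> 'a) \<times> (nat \<Rightarrow> 'b) \<Rightarrow> real" where
  "test_statistic \<kappa>1 \<kappa>2 n1 n2 n w =
     sqrt (real n) / real (n1 n) * (\<Sum>i=1..n1 n. \<kappa>1 (fst w i)) +
     sqrt (real n) / real (n2 n) * (\<Sum>j=1..n2 n. \<kappa>2 (snd w j))"

definition critical_value ::
    "('a \<Rightarrow> real) \<Rightarrow> ('b \<Rightarrow> real) \<Rightarrow> 'a measure \<Rightarrow> 'b measure \<Rightarrow> real \<Rightarrow> real \<Rightarrow> real" where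
  "critical_value \<kappa>1 \<kappa>2 P0 Q0 d \<alpha> = normal_quantile (1 - \<alpha>) *
     sqrt (1 / (1 - d) * (\<integral>x. (\<kappa>1 x)\<^sup>2 \<partial>P0) + 1 / d * (\<integral>y. (\<kappa>2 y)\<^sup>2 \<partial>Q0))"

end

theory Submission
  imports Defs
begin

text \<open>
  Write \<open>g = g\<^sub>1 + g\<^sub>2\<close> for the tangent of a curve \<open>P\<^sub>t \<otimes> Q\<^sub>t\<close>, where \<open>g\<^sub>1(x) = \<integral>g(x, y) dQ\<^sub>0(y)\<close> and
  \<open>g\<^sub>2(y) = \<integral>g(x, y) dP\<^sub>0(x)\<close>.  Since the density quotients factorise, the two factors are themselves
  \<open>L\<^sub>2\<close>-differentiable with tangents \<open>g\<^sub>1\<close> and \<open>g\<^sub>2\<close>.  Along the curve each single observation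
  contributes a characteristic function \<open>1 + z/n + o(1/n)\<close>, so Levy's theorem gives the limit
  \<open>N(\<vartheta>, v)\<close> of \<open>T\<^sub>n\<close> and hence the limiting power of \<open>\<psi>\<^sub>n\<close>; in the same way the log-likelihood
  ratio of two curves with tangents \<open>g\<close>, \<open>h\<close> (at scale \<open>1/\<surd>n\<close>) tends to \<open>N(-\<Delta>\<^sup>2/2, \<Delta>\<^sup>2)\<close> with
  \<open>\<Delta>\<^sup>2 = (1 - d) \<parallel>g\<^sub>1 - h\<^sub>1\<parallel>\<^sup>2 + d \<parallel>g\<^sub>2 - h\<^sub>2\<parallel>\<^sup>2\<close>.  The Neyman-Pearson lemma then bounds the power of
  any test at \<open>g\<close> that has level \<open>\<alpha>\<close> along \<open>h\<close>.  The least favourable \<open>h\<close> is the projection of \<open>g\<close>,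
  in the weighted inner product, onto \<open>{h. \<integral>\<kappa> h = 0}\<close>; it lies in the tangent space because that
  space splits into its two marginal parts, and by density it is a limit of tangents of implicit
  hypotheses with \<open>\<vartheta> = 0\<close>.  There the bound equals the power of \<open>\<psi>\<^sub>n\<close>.
\<close>

section \<open>Square-integrable functions\<close>

text \<open>The main obstacle is that likelihood ratios may be zero or infinite, so that their
  logarithms and moments need not exist. Two sequences under comparison are therefore cut down to
  the window where both root densities lie within \<open>1/2\<close> of \<open>1\<close>. The lost
  mass is \<open>o(1/n)\<close> per observation, hence negligible after \<open>n\<close> factors,
  while inside the window the log ratio is bounded and its moments can be expanded. Limits are
  computed under the normalised cut measures and carried back by domination; contiguity and Le Cam's
  third lemma are replaced by direct computation of the drift. The second obstacle is that the
  tangent cone is not assumed linear. The level of a test is known only along curves in the family,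
  and the least favourable direction is merely a limit of tangents of such curves. So the bound is
  proved for each approximating tangent and then passed to the limit by continuity of the normal
  distribution function. The bound depends on the local parameter through its modulus; applied to
  the complementary test it also settles the hypotheses with negative parameter.\<close>

lemma L2_spaceD:
  assumes "f \<in> L2_space M"
  shows "f \<in> borel_measurable M" "integrable M (\<lambda>x. (f x)\<^sup>2)"
  using assms by (auto simp: L2_space_def)

lemma L2_norm_nonneg [simp]: "0 \<le> L2_norm M f"
  by (simp add: L2_norm_def)

lemma L2_norm_power2: "(L2_norm M f)\<^sup>2 = (\<integral>x. (f x)\<^sup>2 \<partial>M)"
  by (simp add: L2_norm_def)

lemma L2_norm_cong_AE:
  assumes "AE x in M. f x = g x" "f \<in> borel_measurable M" "g \<in> borel_measurable M"
  shows "L2_norm M f = L2_norm M g"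
  unfolding L2_norm_def
  by (rule arg_cong[where f=sqrt], rule integral_cong_AE) (use assms in auto)

lemma L2_mult_integrable:
  assumes "f \<in> L2_space M" "g \<in> L2_space M"
  shows "integrable M (\<lambda>x. f x * g x)"
proof (rule Bochner_Integration.integrable_bound)
  show "integrable M (\<lambda>x. (f x)\<^sup>2 + (g x)\<^sup>2)"
    using assms by (auto simp: L2_space_def)
  show "(\<lambda>x. f x * g x) \<in> borel_measurable M"
    using assms by (auto simp: L2_space_def)
  have "\<bar>a * b\<bar> \<le> a\<^sup>2 + b\<^sup>2" for a b :: real
  proof -
    have "2 * (\<bar>a\<bar> * \<bar>b\<bar>) \<le> a\<^sup>2 + b\<^sup>2" "0 \<le> \<bar>a\<bar> * \<bar>b\<bar>"
      using sum_squares_bound[of "\<bar>a\<bar>" "\<bar>b\<bar>"] by auto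
    then show ?thesis unfolding abs_mult by linarith
  qed
  then show "AE x in M. norm (f x * g x) \<le> norm ((f x)\<^sup>2 + (g x)\<^sup>2)"
    by (intro AE_I2) (auto simp: sum_power2_ge_zero)
qed

lemma L2_add:
  assumes "f \<in> L2_space M" "g \<in> L2_space M"
  shows "(\<lambda>x. f x + g x) \<in> L2_space M"
proof -
  have "integrable M (\<lambda>x. (f x)\<^sup>2 + 2 * (f x * g x) + (g x)\<^sup>2)"
    using assms L2_mult_integrable[OF assms] by (auto simp: L2_space_def)
  then show ?thesis
    using assms by (auto simp: L2_space_def power2_sum algebra_simps)
qed

lemma L2_cmult: "f \<in> L2_space M \<Longrightarrow> (\<lambda>x. c * f x) \<in> L2_space M"
  by (auto simp: L2_space_def power_mult_distrib)

lemma L2_diff: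
  assumes "f \<in> L2_space M" "g \<in> L2_space M"
  shows "(\<lambda>x. f x - g x) \<in> L2_space M"
  using L2_add[OF assms(1) L2_cmult[OF assms(2), of "-1"]] by simp

lemma L2_zero: "(\<lambda>x. 0) \<in> L2_space M"
  by (simp add: L2_space_def)

lemma L2_sum:
  assumes "\<And>i. i \<in> I \<Longrightarrow> f i \<in> L2_space M"
  shows "(\<lambda>x. \<Sum>i\<in>I. f i x) \<in> L2_space M"
  using assms
proof (induction I rule: infinite_finite_induct)
  case (insert i I)
  then show ?case using L2_add[of "f i" M "\<lambda>x. \<Sum>i\<in>I. f i x"] by simp
qed (auto simp: L2_zero)

lemma L2_bounded_mult:
  assumes "f \<in> L2_space M" "u \<in> borel_measurable M" "\<And>x. x \<in> space M \<Longrightarrow> \<bar>u x\<bar> \<le> C"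
  shows "(\<lambda>x. f x * u x) \<in> L2_space M"
proof -
  have "integrable M (\<lambda>x. (f x * u x)\<^sup>2)"
  proof (rule Bochner_Integration.integrable_bound)
    show "integrable M (\<lambda>x. (f x)\<^sup>2 * C\<^sup>2)" using assms by (auto simp: L2_space_def)
    show "(\<lambda>x. (f x * u x)\<^sup>2) \<in> borel_measurable M" using assms by (auto simp: L2_space_def)
    show "AE x in M. norm ((f x * u x)\<^sup>2) \<le> norm ((f x)\<^sup>2 * C\<^sup>2)"
    proof (rule AE_I2)
      fix x assume "x \<in> space M"
      then have "(u x)\<^sup>2 \<le> C\<^sup>2" using assms(3) by (metis abs_le_square_iff abs_of_nonneg abs_ge_zero order_trans)
      then show "norm ((f x * u x)\<^sup>2) \<le> norm ((f x)\<^sup>2 * C\<^sup>2)"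
        by (simp add: power_mult_distrib mult_left_mono)
    qed
  qed
  then show ?thesis using assms by (auto simp: L2_space_def)
qed

lemma (in prob_space) L2_const: "(\<lambda>x. c) \<in> L2_space M"
  by (simp add: L2_space_def)

lemma (in prob_space) L2_bounded:
  assumes "u \<in> borel_measurable M" "\<And>x. x \<in> space M \<Longrightarrow> \<bar>u x\<bar> \<le> C"
  shows "u \<in> L2_space M"
  using L2_bounded_mult[OF L2_const[of 1] assms] by simp

lemma (in prob_space) L2_integrable:
  assumes "f \<in> L2_space M" shows "integrable M f"
  using L2_mult_integrable[OF assms L2_const[of 1]] by simp

text \<open>The quadratic \<open>A - 2 r C + r^2 B\<close> is nonnegative for every
  \<open>r\<close>. Its value at the minimiser \<open>r = C / B\<close> gives the claim. For
  \<open>B = 0\<close> it is affine in \<open>r\<close>, and \<open>r = (A + 1) / (2 C)\<close>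
  would make it \<open>-1\<close> unless \<open>C = 0\<close>.\<close>

lemma L2_CS:
  assumes "f \<in> L2_space M" "g \<in> L2_space M"
  shows "\<bar>\<integral>x. f x * g x \<partial>M\<bar> \<le> L2_norm M f * L2_norm M g"
proof -
  define A B C where "A = (\<integral>x. (f x)\<^sup>2 \<partial>M)" "B = (\<integral>x. (g x)\<^sup>2 \<partial>M)" "C = (\<integral>x. f x * g x \<partial>M)"
  note ABC = this
  have AB: "0 \<le> A" "0 \<le> B" by (auto simp: ABC)
  have q: "0 \<le> A - 2 * r * C + r\<^sup>2 * B" for r
  proof -
    have "0 \<le> (\<integral>x. (f x - r * g x)\<^sup>2 \<partial>M)" by simp
    also have "(\<lambda>x. (f x - r * g x)\<^sup>2) = (\<lambda>x. (f x)\<^sup>2 - 2 * r * (f x * g x) + r\<^sup>2 * (g x)\<^sup>2)"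
      by (auto simp: power2_eq_square algebra_simps)
    also have "(\<integral>x. (f x)\<^sup>2 - 2 * r * (f x * g x) + r\<^sup>2 * (g x)\<^sup>2 \<partial>M) = A - 2 * r * C + r\<^sup>2 * B"
      using assms L2_mult_integrable[OF assms] by (simp add: ABC L2_space_def)
    finally show ?thesis .
  qed
  have "C\<^sup>2 \<le> A * B"
  proof (cases "B = 0")
    case True
    have "C = 0"
    proof (rule ccontr)
      assume "C \<noteq> 0"
      then have "2 * ((A + 1) / (2 * C)) * C = A + 1" by simp
      then show False using q[of "(A + 1) / (2 * C)"] True by simp
    qed
    then show ?thesis using True by simp
  next
    case False
    then have "0 < B" using AB by simp
    then show ?thesis using q[of "C / B"]
      by (simp add: field_simps power2_eq_square)
  qed
  then have "sqrt (C\<^sup>2) \<le> sqrt (A * B)" by (rule real_sqrt_le_mono)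
  then show ?thesis by (simp add: ABC L2_norm_def real_sqrt_mult)
qed

lemma L2_norm_triangle:
  assumes "f \<in> L2_space M" "g \<in> L2_space M"
  shows "L2_norm M (\<lambda>x. f x + g x) \<le> L2_norm M f + L2_norm M g"
proof (rule power2_le_imp_le)
  have "(\<integral>x. (f x + g x)\<^sup>2 \<partial>M) = (\<integral>x. (f x)\<^sup>2 + 2 * (f x * g x) + (g x)\<^sup>2 \<partial>M)"
    by (rule Bochner_Integration.integral_cong) (auto simp: power2_sum)
  also have "\<dots> = (L2_norm M f)\<^sup>2 + 2 * (\<integral>x. f x * g x \<partial>M) + (L2_norm M g)\<^sup>2"
    using assms L2_mult_integrable[OF assms] by (simp add: L2_norm_power2 L2_space_def)
  also have "\<dots> \<le> (L2_norm M f + L2_norm M g)\<^sup>2"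
    using L2_CS[OF assms] by (simp add: power2_sum)
  finally show "(L2_norm M (\<lambda>x. f x + g x))\<^sup>2 \<le> (L2_norm M f + L2_norm M g)\<^sup>2"
    by (simp add: L2_norm_power2)
qed simp

lemma L2_norm_cmult: "L2_norm M (\<lambda>x. c * f x) = \<bar>c\<bar> * L2_norm M f"
  by (simp add: L2_norm_def power_mult_distrib real_sqrt_mult)

lemma L2_norm_minus_commute: "L2_norm M (\<lambda>x. f x - g x) = L2_norm M (\<lambda>x. g x - f x)"
  by (simp add: L2_norm_def power2_commute)

lemma L2_norm_triangle_diff:
  assumes "f \<in> L2_space M" "g \<in> L2_space M"
  shows "L2_norm M (\<lambda>x. f x - g x) \<le> L2_norm M f + L2_norm M g"
  using L2_norm_triangle[OF assms(1) L2_cmult[OF assms(2), of "-1"]] L2_norm_cmult[of M "-1" g] by simp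

lemma L2_norm_mono:
  assumes "f \<in> borel_measurable M" "g \<in> L2_space M" "AE x in M. \<bar>f x\<bar> \<le> \<bar>g x\<bar>"
  shows "L2_norm M f \<le> L2_norm M g" "f \<in> L2_space M"
proof -
  have ae: "AE x in M. (f x)\<^sup>2 \<le> (g x)\<^sup>2" using assms(3) by (auto simp: abs_le_square_iff)
  have "integrable M (\<lambda>x. (f x)\<^sup>2)"
    by (rule Bochner_Integration.integrable_bound[of _ "\<lambda>x. (g x)\<^sup>2"]) (use assms ae in \<open>auto simp: L2_space_def\<close>)
  then show "f \<in> L2_space M" using assms by (auto simp: L2_space_def)
  then show "L2_norm M f \<le> L2_norm M g"
    unfolding L2_norm_def using ae assms by (auto intro!: integral_mono_AE simp: L2_space_def)
qed

text \<open>Membership of all terms and of the limit is built in: without square-integrability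
  \<open>L2_norm\<close> rests on the default value \<open>0\<close> of the integral and carries no
  information.\<close>

definition L2_tendsto :: "'a measure \<Rightarrow> (nat \<Rightarrow> 'a \<Rightarrow> real) \<Rightarrow> ('a \<Rightarrow> real) \<Rightarrow> bool" where
  "L2_tendsto M F f \<longleftrightarrow> (\<forall>n. F n \<in> L2_space M) \<and> f \<in> L2_space M \<and>
     (\<lambda>n. L2_norm M (\<lambda>x. F n x - f x)) \<longlonglongrightarrow> 0"

lemma L2_tendstoD:
  assumes "L2_tendsto M F f"
  shows "F n \<in> L2_space M" "f \<in> L2_space M" "(\<lambda>n. L2_norm M (\<lambda>x. F n x - f x)) \<longlonglongrightarrow> 0"
  using assms by (auto simp: L2_tendsto_def)

lemma L2_tendsto_const: "f \<in> L2_space M \<Longrightarrow> L2_tendsto M (\<lambda>_. f) f"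
  by (simp add: L2_tendsto_def L2_norm_def)

lemma L2_tendstoI:
  assumes "\<And>n. F n \<in> L2_space M" "f \<in> L2_space M" "e \<longlonglongrightarrow> 0"
    "\<And>n. L2_norm M (\<lambda>x. F n x - f x) \<le> e n"
  shows "L2_tendsto M F f"
  unfolding L2_tendsto_def using assms
  by (auto intro!: tendsto_sandwich[OF _ _ tendsto_const assms(3)] always_eventually)

lemma L2_tendsto_add:
  assumes F: "L2_tendsto M F f" and G: "L2_tendsto M G g"
  shows "L2_tendsto M (\<lambda>n x. F n x + G n x) (\<lambda>x. f x + g x)"
proof (rule L2_tendstoI)
  note D = L2_tendstoD[OF F] L2_tendstoD[OF G]
  show "(\<lambda>n. L2_norm M (\<lambda>x. F n x - f x) + L2_norm M (\<lambda>x. G n x - g x)) \<longlonglongrightarrow> 0"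
    using tendsto_add[OF D(3,6)] by simp
  show "L2_norm M (\<lambda>x. F n x + G n x - (f x + g x)) \<le>
      L2_norm M (\<lambda>x. F n x - f x) + L2_norm M (\<lambda>x. G n x - g x)" for n
    using L2_norm_triangle[OF L2_diff[OF D(1,2)] L2_diff[OF D(4,5)]] by (simp add: algebra_simps)
qed (intro L2_add L2_tendstoD[OF F] L2_tendstoD[OF G])+

lemma L2_tendsto_scale:
  assumes F: "L2_tendsto M F f" and c: "c \<longlonglongrightarrow> a"
  shows "L2_tendsto M (\<lambda>n x. c n * F n x) (\<lambda>x. a * f x)"
proof (rule L2_tendstoI)
  note D = L2_tendstoD[OF F]
  show "(\<lambda>n. \<bar>c n\<bar> * L2_norm M (\<lambda>x. F n x - f x) + \<bar>c n - a\<bar> * L2_norm M f) \<longlonglongrightarrow> 0"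
  proof -
    have "(\<lambda>n. \<bar>c n - a\<bar>) \<longlonglongrightarrow> 0" using c by (simp add: LIM_zero_iff tendsto_rabs_zero)
    then have "(\<lambda>n. \<bar>c n\<bar> * L2_norm M (\<lambda>x. F n x - f x) + \<bar>c n - a\<bar> * L2_norm M f)
        \<longlonglongrightarrow> \<bar>a\<bar> * 0 + 0 * L2_norm M f"
      by (intro tendsto_intros c D)
    then show ?thesis by simp
  qed
  show "L2_norm M (\<lambda>x. c n * F n x - a * f x) \<le>
      \<bar>c n\<bar> * L2_norm M (\<lambda>x. F n x - f x) + \<bar>c n - a\<bar> * L2_norm M f" for n
  proof -
    have "(\<lambda>x. c n * F n x - a * f x) = (\<lambda>x. c n * (F n x - f x) + (c n - a) * f x)"
      by (simp add: algebra_simps)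
    then show ?thesis
      using L2_norm_triangle[OF L2_cmult[OF L2_diff[OF D(1,2)], of "c n" n] L2_cmult[OF D(2), of "c n - a"]]
      by (simp add: L2_norm_cmult)
  qed
qed (intro L2_cmult L2_tendstoD[OF F])+

lemma L2_tendsto_cmult:
  "L2_tendsto M F f \<Longrightarrow> L2_tendsto M (\<lambda>n x. c * F n x) (\<lambda>x. c * f x)"
  by (rule L2_tendsto_scale[OF _ tendsto_const])

lemma L2_tendsto_diff:
  assumes "L2_tendsto M F f" "L2_tendsto M G g"
  shows "L2_tendsto M (\<lambda>n x. F n x - G n x) (\<lambda>x. f x - g x)"
  using L2_tendsto_add[OF assms(1) L2_tendsto_cmult[OF assms(2), of "-1"]] by simp

lemma L2_tendsto_norm:
  assumes F: "L2_tendsto M F f"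
  shows "(\<lambda>n. L2_norm M (F n)) \<longlonglongrightarrow> L2_norm M f"
proof -
  note D = L2_tendstoD[OF F]
  have "\<bar>L2_norm M (F n) - L2_norm M f\<bar> \<le> L2_norm M (\<lambda>x. F n x - f x)" for n
    using L2_norm_triangle[OF D(2) L2_diff[OF D(1)[of n] D(2)]]
      L2_norm_triangle_diff[OF D(1)[of n] L2_diff[OF D(1)[of n] D(2)]] by simp
  then have "(\<lambda>n. L2_norm M (F n) - L2_norm M f) \<longlonglongrightarrow> 0"
    by (intro Lim_null_comparison[OF _ D(3)] always_eventually) auto
  then show ?thesis by (simp add: LIM_zero_iff)
qed

lemma L2_tendsto_inner:
  assumes F: "L2_tendsto M F f" and G: "L2_tendsto M G g"
  shows "(\<lambda>n. \<integral>x. F n x * G n x \<partial>M) \<longlonglongrightarrow> (\<integral>x. f x * g x \<partial>M)"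
proof -
  note D = L2_tendstoD[OF F] L2_tendstoD[OF G]
  let ?e = "\<lambda>n. L2_norm M (\<lambda>x. F n x - f x) * L2_norm M (G n) + L2_norm M f * L2_norm M (\<lambda>x. G n x - g x)"
  have "?e \<longlonglongrightarrow> 0 * L2_norm M g + L2_norm M f * 0"
    by (intro tendsto_intros D L2_tendsto_norm[OF G])
  then have e: "?e \<longlonglongrightarrow> 0" by simp
  have "\<bar>(\<integral>x. F n x * G n x \<partial>M) - (\<integral>x. f x * g x \<partial>M)\<bar> \<le> ?e n" for n
  proof -
    have 1: "\<bar>\<integral>x. (F n x - f x) * G n x \<partial>M\<bar> \<le> L2_norm M (\<lambda>x. F n x - f x) * L2_norm M (G n)"
      by (intro L2_CS L2_diff D)
    have 2: "\<bar>\<integral>x. f x * (G n x - g x) \<partial>M\<bar> \<le> L2_norm M f * L2_norm M (\<lambda>x. G n x - g x)"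
      by (intro L2_CS L2_diff D)
    have "(\<integral>x. (F n x - f x) * G n x \<partial>M) + (\<integral>x. f x * (G n x - g x) \<partial>M)
        = (\<integral>x. (F n x - f x) * G n x + f x * (G n x - g x) \<partial>M)"
      by (subst Bochner_Integration.integral_add) (auto intro!: L2_mult_integrable L2_diff D)
    also have "\<dots> = (\<integral>x. F n x * G n x - f x * g x \<partial>M)"
      by (simp add: algebra_simps)
    also have "\<dots> = (\<integral>x. F n x * G n x \<partial>M) - (\<integral>x. f x * g x \<partial>M)"
      by (subst Bochner_Integration.integral_diff) (auto intro!: L2_mult_integrable D)
    finally show ?thesis using 1 2 by linarith
  qed
  then have "(\<lambda>n. (\<integral>x. F n x * G n x \<partial>M) - (\<integral>x. f x * g x \<partial>M)) \<longlonglongrightarrow> 0"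
    by (intro Lim_null_comparison[OF _ e] always_eventually) auto
  then show ?thesis by (simp add: LIM_zero_iff)
qed

section \<open>Convergence in measure to a constant\<close>

definition tendsto_in_measure :: "'a measure \<Rightarrow> (nat \<Rightarrow> 'a \<Rightarrow> real) \<Rightarrow> real \<Rightarrow> bool" where
  "tendsto_in_measure M U u \<longleftrightarrow> (\<forall>n. U n \<in> borel_measurable M) \<and>
     (\<forall>e>0. (\<lambda>n. measure M {x \<in> space M. e \<le> \<bar>U n x - u\<bar>}) \<longlonglongrightarrow> 0)"

context prob_space
begin

lemma tendsto_in_measure_compose:
  fixes F :: "real \<Rightarrow> real \<Rightarrow> real"
  assumes a: "tendsto_in_measure M A 0" and b: "tendsto_in_measure M B 0"
    and m: "case_prod F \<in> borel_measurable borel"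
    and F: "\<And>e. e > 0 \<Longrightarrow> \<exists>r>0. \<forall>x y. \<bar>x\<bar> < r \<longrightarrow> \<bar>y\<bar> < r \<longrightarrow> \<bar>F x y - u\<bar> < e"
  shows "tendsto_in_measure M (\<lambda>n x. F (A n x) (B n x)) u"
proof -
  have [measurable]: "A n \<in> borel_measurable M" "B n \<in> borel_measurable M" for n
    using a b by (auto simp: tendsto_in_measure_def)
  have Fm [measurable]: "(\<lambda>x. F (A n x) (B n x)) \<in> borel_measurable M" for n
  proof -
    have "(\<lambda>x. case_prod F (A n x, B n x)) \<in> borel_measurable M"
      by (rule measurable_compose[OF _ m]) (simp add: borel_prod[symmetric])
    then show ?thesis by simp
  qed
  show ?thesis unfolding tendsto_in_measure_def
  proof (intro conjI allI impI)
    fix e :: real assume "e > 0"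
    then obtain r where r: "r > 0" "\<And>x y. \<bar>x\<bar> < r \<Longrightarrow> \<bar>y\<bar> < r \<Longrightarrow> \<bar>F x y - u\<bar> < e"
      using F by blast
    let ?p = "\<lambda>C n. measure M {x \<in> space M. r \<le> \<bar>C n x - 0\<bar>}"
    have l: "(\<lambda>n. ?p A n + ?p B n) \<longlonglongrightarrow> 0"
      using a b r(1) tendsto_add[of "?p A" 0 sequentially "?p B" 0] by (auto simp: tendsto_in_measure_def)
    have "measure M {x \<in> space M. e \<le> \<bar>F (A n x) (B n x) - u\<bar>} \<le> ?p A n + ?p B n" for n
    proof -
      have "measure M {x \<in> space M. e \<le> \<bar>F (A n x) (B n x) - u\<bar>} \<le>
         measure M ({x \<in> space M. r \<le> \<bar>A n x - 0\<bar>} \<union> {x \<in> space M. r \<le> \<bar>B n x - 0\<bar>})"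
        by (rule finite_measure_mono) (use r(2) in \<open>force simp: not_le[symmetric]\<close>, measurable)
      also have "\<dots> \<le> ?p A n + ?p B n" by (rule measure_Un_le) measurable
      finally show ?thesis .
    qed
    then show "(\<lambda>n. measure M {x \<in> space M. e \<le> \<bar>F (A n x) (B n x) - u\<bar>}) \<longlonglongrightarrow> 0"
      by (intro tendsto_sandwich[OF _ _ tendsto_const l] always_eventually) auto
  qed (rule Fm)
qed

text \<open>On \<open>E n\<close> the square of \<open>f\<close> is at most \<open>k\<close> plus
  its own tail above \<open>k\<close>. The tail integral is small for large \<open>k\<close> by
  dominated convergence, and \<open>k\<close> is fixed before \<open>n\<close> grows.\<close>

lemma L2_integral_small_sets:
  assumes f: "f \<in> L2_space M" and E: "\<And>n. E n \<in> sets M" "(\<lambda>n. measure M (E n)) \<longlonglongrightarrow> 0"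
  shows "(\<lambda>n. \<integral>x. (f x)\<^sup>2 * indicator (E n) x \<partial>M) \<longlonglongrightarrow> 0"
proof -
  have [measurable]: "f \<in> borel_measurable M" "E n \<in> sets M" for n using f E by (auto simp: L2_space_def)
  have fi: "integrable M (\<lambda>x. (f x)\<^sup>2)" using f by (simp add: L2_space_def)
  have i1: "integrable M (\<lambda>x. (f x)\<^sup>2 * indicator (E n) x)" for n
    by (rule integrable_real_mult_indicator[OF E(1) fi])
  have tail: "(\<lambda>k. \<integral>x. (f x)\<^sup>2 * indicator {x \<in> space M. real k < (f x)\<^sup>2} x \<partial>M) \<longlonglongrightarrow> (\<integral>x. 0 \<partial>M)"
  proof (rule integral_dominated_convergence[OF _ _ fi])
    show "AE x in M. (\<lambda>k. (f x)\<^sup>2 * indicator {x \<in> space M. real k < (f x)\<^sup>2} x) \<longlonglongrightarrow> 0"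
    proof (rule AE_I2)
      fix x
      obtain K where "(f x)\<^sup>2 < real K" using reals_Archimedean2 by blast
      then have "\<forall>\<^sub>F k in sequentially. (f x)\<^sup>2 * indicator {x \<in> space M. real k < (f x)\<^sup>2} x = 0"
        by (intro eventually_sequentiallyI[of K]) (auto simp: indicator_def)
      then show "(\<lambda>k. (f x)\<^sup>2 * indicator {x \<in> space M. real k < (f x)\<^sup>2} x) \<longlonglongrightarrow> 0"
        by (rule tendsto_eventually)
    qed
  qed (auto simp: indicator_def)
  show ?thesis
  proof (rule LIMSEQ_I)
    fix e :: real assume e: "0 < e"
    then obtain k where k: "(\<integral>x. (f x)\<^sup>2 * indicator {x \<in> space M. real k < (f x)\<^sup>2} x \<partial>M) < e / 2"
      using LIMSEQ_D[OF tail, of "e/2"] by (auto simp: abs_less_iff)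
    \<comment> \<open>The \<open>+ 1\<close> keeps the denominator positive for
      \<open>k = 0\<close>.\<close>
    have "e / (2 * (real k + 1)) > 0" using e by simp
    then obtain N where N: "\<And>n. n \<ge> N \<Longrightarrow> measure M (E n) < e / (2 * (real k + 1))"
      using LIMSEQ_D[OF E(2)] by fastforce
    have "norm ((\<integral>x. (f x)\<^sup>2 * indicator (E n) x \<partial>M) - 0) < e" if n: "n \<ge> N" for n
    proof -
      have ik: "integrable M (\<lambda>x. (f x)\<^sup>2 * indicator {x \<in> space M. real k < (f x)\<^sup>2} x)"
        by (rule integrable_real_mult_indicator[OF _ fi]) measurable
      have "(\<integral>x. (f x)\<^sup>2 * indicator (E n) x \<partial>M) \<le>
         (\<integral>x. real k * indicator (E n) x + (f x)\<^sup>2 * indicator {x \<in> space M. real k < (f x)\<^sup>2} x \<partial>M)"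
      proof (rule integral_mono[OF i1])
        show "integrable M (\<lambda>x. real k * indicator (E n) x + (f x)\<^sup>2 * indicator {x \<in> space M. real k < (f x)\<^sup>2} x)"
          by (rule Bochner_Integration.integrable_add[OF _ ik]) (auto intro!: integrable_real_indicator simp: E less_top[symmetric])
      qed (auto simp: indicator_def)
      also have "\<dots> = real k * measure M (E n) + (\<integral>x. (f x)\<^sup>2 * indicator {x \<in> space M. real k < (f x)\<^sup>2} x \<partial>M)"
        by (subst Bochner_Integration.integral_add[OF _ ik])
           (auto intro!: integrable_real_indicator simp: less_top[symmetric])
      also have "real k * measure M (E n) \<le> real k * (e / (2 * (real k + 1)))"
        using N[OF n] by (intro mult_left_mono) auto
      also have "\<dots> \<le> e / 2" using e by (simp add: field_simps)
      finally have "(\<integral>x. (f x)\<^sup>2 * indicator (E n) x \<partial>M) < e" using k by linarith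
      moreover have "0 \<le> (\<integral>x. (f x)\<^sup>2 * indicator (E n) x \<partial>M)" by (intro integral_nonneg_AE) auto
      ultimately show ?thesis by simp
    qed
    then show "\<exists>N. \<forall>n\<ge>N. norm ((\<integral>x. (f x)\<^sup>2 * indicator (E n) x \<partial>M) - 0) < e" by blast
  qed
qed

text \<open>Split \<open>F n U n - u f\<close> into \<open>(F n - f) U n\<close>, controlled by the
  bound \<open>C\<close>, and \<open>f (U n - u)\<close>, whose second factor is small off a set of
  vanishing measure and bounded on it. Thanks to this, each remainder in the expansions below needs
  only a bound and a limit in measure.\<close>

lemma L2_tendsto_mult_bounded:
  assumes F: "L2_tendsto M F f" and U: "tendsto_in_measure M U u"
    and bd: "\<And>n x. x \<in> space M \<Longrightarrow> \<bar>U n x\<bar> \<le> C"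
  shows "L2_tendsto M (\<lambda>n x. F n x * U n x) (\<lambda>x. u * f x)"
proof -
  note D = L2_tendstoD[OF F]
  have Um [measurable]: "U n \<in> borel_measurable M" for n using U by (auto simp: tendsto_in_measure_def)
  have fm [measurable]: "f \<in> borel_measurable M" using D(2) by (simp add: L2_space_def)
  have fi: "integrable M (\<lambda>x. (f x)\<^sup>2)" using D(2) by (simp add: L2_space_def)
  have FU: "(\<lambda>x. F n x * U n x) \<in> L2_space M" for n
    by (rule L2_bounded_mult[OF D(1) Um bd])
  have C0: "0 \<le> C" using bd not_empty by (meson abs_ge_zero all_not_in_conv order_trans)
  have bd': "\<bar>U n x - u\<bar> \<le> C + \<bar>u\<bar>" if "x \<in> space M" for n x using bd[OF that, of n] by linarith
  have fU: "(\<lambda>x. f x * (U n x - u)) \<in> L2_space M" for n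
    by (rule L2_bounded_mult[OF D(2) _ bd']) auto
  have dU: "(\<lambda>x. (F n x - f x) * U n x) \<in> L2_space M" for n
    by (rule L2_bounded_mult[OF L2_diff[OF D(1,2)] Um bd])
  have main: "(\<lambda>n. \<integral>x. (f x * (U n x - u))\<^sup>2 \<partial>M) \<longlonglongrightarrow> 0"
  proof (rule LIMSEQ_I)
    fix e :: real assume e: "0 < e"
    define A where "A = (\<integral>x. (f x)\<^sup>2 \<partial>M) + 1"
    have A: "A > 0" unfolding A_def by (intro add_nonneg_pos) auto
    \<comment> \<open>With this \<open>r\<close> the part off \<open>E n\<close> contributes at most
      \<open>r^2 A = e / 2\<close>; the \<open>+ 1\<close> in \<open>A\<close> makes it positive
      even if \<open>f\<close> vanishes.\<close>
    define r where "r = sqrt (e / (2 * A))"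
    have r: "r > 0" "r\<^sup>2 = e / (2 * A)" using e A by (auto simp: r_def)
    define E where "E n = {x \<in> space M. r \<le> \<bar>U n x - u\<bar>}" for n
    have Em [measurable]: "E n \<in> sets M" for n unfolding E_def by measurable
    have "(\<lambda>n. measure M (E n)) \<longlonglongrightarrow> 0" using U r(1) by (auto simp: E_def tendsto_in_measure_def)
    from L2_integral_small_sets[OF D(2) Em this]
    have "(\<lambda>n. (C + \<bar>u\<bar>)\<^sup>2 * (\<integral>x. (f x)\<^sup>2 * indicator (E n) x \<partial>M)) \<longlonglongrightarrow> 0"
      by (rule tendsto_mult_right_zero)
    from LIMSEQ_D[OF this, of "e/2"] obtain N where
      N: "\<And>n. n \<ge> N \<Longrightarrow> (C + \<bar>u\<bar>)\<^sup>2 * (\<integral>x. (f x)\<^sup>2 * indicator (E n) x \<partial>M) < e / 2"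
      using e by (auto simp: abs_less_iff)
    have "norm ((\<integral>x. (f x * (U n x - u))\<^sup>2 \<partial>M) - 0) < e" if "n \<ge> N" for n
    proof -
      have i: "integrable M (\<lambda>x. (f x)\<^sup>2 * indicator (E n) x)"
        by (rule integrable_real_mult_indicator[OF Em fi])
      have "(\<integral>x. (f x * (U n x - u))\<^sup>2 \<partial>M) \<le>
         (\<integral>x. r\<^sup>2 * (f x)\<^sup>2 + (C + \<bar>u\<bar>)\<^sup>2 * ((f x)\<^sup>2 * indicator (E n) x) \<partial>M)"
      proof (rule integral_mono)
        show "integrable M (\<lambda>x. (f x * (U n x - u))\<^sup>2)" using fU by (simp add: L2_space_def)
        show "integrable M (\<lambda>x. r\<^sup>2 * (f x)\<^sup>2 + (C + \<bar>u\<bar>)\<^sup>2 * ((f x)\<^sup>2 * indicator (E n) x))"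
          using fi i by auto
        fix x assume x: "x \<in> space M"
        show "(f x * (U n x - u))\<^sup>2 \<le> r\<^sup>2 * (f x)\<^sup>2 + (C + \<bar>u\<bar>)\<^sup>2 * ((f x)\<^sup>2 * indicator (E n) x)"
        proof (cases "x \<in> E n")
          case True
          have "(U n x - u)\<^sup>2 \<le> (C + \<bar>u\<bar>)\<^sup>2" using bd'[OF x, of n] C0 by (metis abs_le_square_iff abs_of_nonneg add_nonneg_nonneg abs_ge_zero)
          then have "(f x)\<^sup>2 * (U n x - u)\<^sup>2 \<le> (f x)\<^sup>2 * (C + \<bar>u\<bar>)\<^sup>2" by (intro mult_left_mono) auto
          then show ?thesis using True by (simp add: power_mult_distrib mult.commute add_increasing)
        next
          case False
          then have "\<bar>U n x - u\<bar> \<le> r" using x by (auto simp: E_def)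
          then have "(U n x - u)\<^sup>2 \<le> r\<^sup>2" using r by (metis abs_le_square_iff abs_of_pos)
          then have "(f x)\<^sup>2 * (U n x - u)\<^sup>2 \<le> (f x)\<^sup>2 * r\<^sup>2" by (intro mult_left_mono) auto
          then show ?thesis using False by (simp add: power_mult_distrib mult.commute)
        qed
      qed
      also have "\<dots> = r\<^sup>2 * (\<integral>x. (f x)\<^sup>2 \<partial>M) + (C + \<bar>u\<bar>)\<^sup>2 * (\<integral>x. (f x)\<^sup>2 * indicator (E n) x \<partial>M)"
        using fi i by simp
      also have "\<dots> < e / 2 + e / 2"
      proof (rule add_le_less_mono)
        have "r\<^sup>2 * (\<integral>x. (f x)\<^sup>2 \<partial>M) \<le> r\<^sup>2 * A" unfolding A_def by (intro mult_left_mono) auto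
        then show "r\<^sup>2 * (\<integral>x. (f x)\<^sup>2 \<partial>M) \<le> e / 2" using A by (simp add: r(2))
      qed (rule N[OF that])
      finally show ?thesis by simp
    qed
    then show "\<exists>N. \<forall>n\<ge>N. norm ((\<integral>x. (f x * (U n x - u))\<^sup>2 \<partial>M) - 0) < e" by blast
  qed
  have main': "(\<lambda>n. L2_norm M (\<lambda>x. f x * (U n x - u))) \<longlonglongrightarrow> 0"
    using tendsto_real_sqrt[OF main] by (simp add: L2_norm_def)
  show ?thesis
  proof (rule L2_tendstoI[OF FU L2_cmult[OF D(2)]])
    have "(\<lambda>n. C * L2_norm M (\<lambda>x. F n x - f x) + L2_norm M (\<lambda>x. f x * (U n x - u))) \<longlonglongrightarrow> C * 0 + 0"
      by (intro tendsto_intros D main')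
    then show "(\<lambda>n. C * L2_norm M (\<lambda>x. F n x - f x) + L2_norm M (\<lambda>x. f x * (U n x - u))) \<longlonglongrightarrow> 0"
      by simp
    fix n
    have "L2_norm M (\<lambda>x. F n x * U n x - u * f x) \<le>
       L2_norm M (\<lambda>x. (F n x - f x) * U n x) + L2_norm M (\<lambda>x. f x * (U n x - u))"
      using L2_norm_triangle[OF dU[of n] fU[of n]] by (simp add: algebra_simps)
    also have "L2_norm M (\<lambda>x. (F n x - f x) * U n x) \<le> L2_norm M (\<lambda>x. C * (F n x - f x))"
    proof (rule L2_norm_mono(1))
      show "AE x in M. \<bar>(F n x - f x) * U n x\<bar> \<le> \<bar>C * (F n x - f x)\<bar>"
        using bd C0 by (intro AE_I2) (simp add: abs_mult mult.commute mult_right_mono)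
    qed (use dU L2_cmult[OF L2_diff[OF D(1,2)]] in \<open>auto simp: L2_space_def\<close>)
    also have "\<dots> = C * L2_norm M (\<lambda>x. F n x - f x)" using C0 by (simp add: L2_norm_cmult)
    finally show "L2_norm M (\<lambda>x. F n x * U n x - u * f x) \<le>
      C * L2_norm M (\<lambda>x. F n x - f x) + L2_norm M (\<lambda>x. f x * (U n x - u))" by simp
  qed
qed

lemma L2_tendsto_inner_bounded:
  assumes F: "L2_tendsto M F f" and G: "L2_tendsto M G g" and U: "tendsto_in_measure M U u"
    and bd: "\<And>n x. x \<in> space M \<Longrightarrow> \<bar>U n x\<bar> \<le> C"
  shows "(\<lambda>n. \<integral>x. F n x * G n x * U n x \<partial>M) \<longlonglongrightarrow> u * (\<integral>x. f x * g x \<partial>M)"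
  using L2_tendsto_inner[OF F L2_tendsto_mult_bounded[OF G U bd]]
  by (simp add: mult.left_commute mult.assoc)

text \<open>Chebyshev: the probability of \<open>|F n| \<ge> e sqrt n\<close> is at most
  \<open>\<parallel>F n\<parallel>^2 / (e^2 n)\<close>, and the norms converge.\<close>

lemma L2_tendsto_imp_small:
  assumes F: "L2_tendsto M F f"
  shows "tendsto_in_measure M (\<lambda>n x. F n x / sqrt (real n)) 0"
  unfolding tendsto_in_measure_def
proof (intro conjI allI impI)
  note D = L2_tendstoD[OF F]
  have [measurable]: "F n \<in> borel_measurable M" for n using D(1) by (simp add: L2_space_def)
  show "(\<lambda>x. F n x / sqrt (real n)) \<in> borel_measurable M" for n by simp
  fix e :: real assume e: "0 < e"
  have l: "(\<lambda>n. (L2_norm M (F n))\<^sup>2 / (e\<^sup>2 * real n)) \<longlonglongrightarrow> 0"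
  proof -
    have "(\<lambda>n. ((L2_norm M (F n))\<^sup>2 / e\<^sup>2) * inverse (real n)) \<longlonglongrightarrow> ((L2_norm M f)\<^sup>2 / e\<^sup>2) * 0"
      using e by (intro tendsto_intros L2_tendsto_norm[OF F] LIMSEQ_inverse_real_of_nat lim_inverse_n) auto
    then show ?thesis by (simp add: field_simps)
  qed
  have "measure M {x \<in> space M. e \<le> \<bar>F n x / sqrt (real n) - 0\<bar>} \<le> (L2_norm M (F n))\<^sup>2 / (e\<^sup>2 * real n)"
    if n: "n > 0" for n
  proof -
    have "{x \<in> space M. e \<le> \<bar>F n x / sqrt (real n) - 0\<bar>} = {x \<in> space M. e\<^sup>2 * real n \<le> (F n x)\<^sup>2}"
    proof -
      have "e \<le> \<bar>F n x / sqrt (real n)\<bar> \<longleftrightarrow> e\<^sup>2 * real n \<le> (F n x)\<^sup>2" for x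
      proof -
        have "e \<le> \<bar>F n x / sqrt (real n)\<bar> \<longleftrightarrow> e * sqrt (real n) \<le> \<bar>F n x\<bar>"
          using n by (simp add: field_simps)
        also have "\<dots> \<longleftrightarrow> (e * sqrt (real n))\<^sup>2 \<le> (F n x)\<^sup>2"
          using e abs_le_square_iff[of "e * sqrt (real n)" "F n x"] by (simp add: abs_mult)
        finally show ?thesis by (simp add: power_mult_distrib)
      qed
      then show ?thesis by simp
    qed
    also have "measure M \<dots> \<le> (\<integral>x. (F n x)\<^sup>2 \<partial>M) / (e\<^sup>2 * real n)"
      by (rule integral_Markov_inequality_measure[where A="{}"]) (use e n D(1) in \<open>auto simp: L2_space_def\<close>)
    finally show ?thesis by (simp add: L2_norm_power2)
  qed
  then show "(\<lambda>n. measure M {x \<in> space M. e \<le> \<bar>F n x / sqrt (real n) - 0\<bar>}) \<longlonglongrightarrow> 0"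
    by (intro tendsto_sandwich[OF _ _ tendsto_const l])
       (auto intro!: always_eventually eventually_sequentiallyI[of 1])
qed

end

section \<open>A central limit theorem for two-sample arrays\<close>

text \<open>Moment conditions for row-wise i.i.d. arrays with a number of summands of order
  \<open>n\<close>. Means of order \<open>1/n\<close> are allowed and produce the drift
  \<open>m\<close>; their squares are negligible, so \<open>v\<close> is also the limit of the
  variances. The truncated third moment is the remainder in the second-order expansion of a
  characteristic function and takes the place of Lindeberg's tail condition.\<close>

definition lindeberg :: "(nat \<Rightarrow> 'a measure) \<Rightarrow> (nat \<Rightarrow> 'a \<Rightarrow> real) \<Rightarrow> real \<Rightarrow> real \<Rightarrow> bool" where
  "lindeberg \<mu> X m v \<longleftrightarrow> (\<forall>n. X n \<in> L2_space (\<mu> n)) \<and>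
     (\<lambda>n. real n * (\<integral>x. X n x \<partial>\<mu> n)) \<longlonglongrightarrow> m \<and>
     (\<lambda>n. real n * (\<integral>x. (X n x)\<^sup>2 \<partial>\<mu> n)) \<longlonglongrightarrow> v \<and>
     (\<lambda>n. real n * (\<integral>x. min ((X n x)\<^sup>2) (\<bar>X n x\<bar> ^ 3) \<partial>\<mu> n)) \<longlonglongrightarrow> 0"

lemma L2_min_integrable:
  assumes "f \<in> L2_space M"
  shows "integrable M (\<lambda>x. min ((f x)\<^sup>2) (\<bar>f x\<bar> ^ 3))"
  by (rule Bochner_Integration.integrable_bound[of _ "\<lambda>x. (f x)\<^sup>2"]) (use assms in \<open>auto simp: L2_space_def\<close>)

lemma lindeberg_scale:
  assumes X: "lindeberg \<mu> X m v" and c: "c \<longlonglongrightarrow> a"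
  shows "lindeberg \<mu> (\<lambda>n x. c n * X n x) (a * m) (a\<^sup>2 * v)"
  unfolding lindeberg_def
proof (intro conjI allI)
  have L: "X n \<in> L2_space (\<mu> n)" for n using X by (simp add: lindeberg_def)
  show "(\<lambda>x. c n * X n x) \<in> L2_space (\<mu> n)" for n by (rule L2_cmult[OF L])
  have "(\<lambda>n. c n * (real n * (\<integral>x. X n x \<partial>\<mu> n))) \<longlonglongrightarrow> a * m"
    using X by (intro tendsto_mult[OF c]) (simp add: lindeberg_def)
  then show "(\<lambda>n. real n * (\<integral>x. c n * X n x \<partial>\<mu> n)) \<longlonglongrightarrow> a * m"
    by (simp add: mult.left_commute)
  have "(\<lambda>n. (c n)\<^sup>2 * (real n * (\<integral>x. (X n x)\<^sup>2 \<partial>\<mu> n))) \<longlonglongrightarrow> a\<^sup>2 * v"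
    using X by (intro tendsto_mult[OF tendsto_power[OF c]]) (simp add: lindeberg_def)
  then show "(\<lambda>n. real n * (\<integral>x. (c n * X n x)\<^sup>2 \<partial>\<mu> n)) \<longlonglongrightarrow> a\<^sup>2 * v"
    by (simp add: mult.left_commute power_mult_distrib)
  let ?Y = "\<lambda>n x. min ((X n x)\<^sup>2) (\<bar>X n x\<bar> ^ 3)"
  have "(\<lambda>n. (1 + \<bar>c n\<bar>) ^ 3 * (real n * (\<integral>x. ?Y n x \<partial>\<mu> n))) \<longlonglongrightarrow> (1 + \<bar>a\<bar>) ^ 3 * 0"
    using X by (intro tendsto_intros c) (simp add: lindeberg_def)
  then have lim: "(\<lambda>n. (1 + \<bar>c n\<bar>) ^ 3 * (real n * (\<integral>x. ?Y n x \<partial>\<mu> n))) \<longlonglongrightarrow> 0" by simp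
  \<comment> \<open>The factor \<open>(1 + |b|)^3\<close> dominates both \<open>b^2\<close> and
    \<open>|b|^3\<close>, so it works whichever term attains the minimum.\<close>
  have le: "min ((b * y)\<^sup>2) (\<bar>b * y\<bar> ^ 3) \<le> (1 + \<bar>b\<bar>) ^ 3 * min (y\<^sup>2) (\<bar>y\<bar> ^ 3)" for b y :: real
  proof -
    have "\<bar>b\<bar>\<^sup>2 \<le> (1 + \<bar>b\<bar>)\<^sup>2" by (intro power_mono) auto
    also have "\<dots> \<le> (1 + \<bar>b\<bar>) ^ 3" by (intro power_increasing) auto
    finally have 1: "b\<^sup>2 * y\<^sup>2 \<le> (1 + \<bar>b\<bar>) ^ 3 * y\<^sup>2" by (intro mult_right_mono) auto
    have 2: "\<bar>b\<bar> ^ 3 * \<bar>y\<bar> ^ 3 \<le> (1 + \<bar>b\<bar>) ^ 3 * \<bar>y\<bar> ^ 3"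
      by (intro mult_right_mono power_mono) auto
    show ?thesis using 1 2 by (auto simp: min_def power_mult_distrib abs_mult)
  qed
  have "real n * (\<integral>x. min ((c n * X n x)\<^sup>2) (\<bar>c n * X n x\<bar> ^ 3) \<partial>\<mu> n)
      \<le> (1 + \<bar>c n\<bar>) ^ 3 * (real n * (\<integral>x. ?Y n x \<partial>\<mu> n))" for n
  proof -
    have "(\<integral>x. min ((c n * X n x)\<^sup>2) (\<bar>c n * X n x\<bar> ^ 3) \<partial>\<mu> n) \<le> (\<integral>x. (1 + \<bar>c n\<bar>) ^ 3 * ?Y n x \<partial>\<mu> n)"
      by (intro integral_mono L2_min_integrable L2_cmult L integrable_mult_right le)
    then have "real n * (\<integral>x. min ((c n * X n x)\<^sup>2) (\<bar>c n * X n x\<bar> ^ 3) \<partial>\<mu> n)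
      \<le> real n * (\<integral>x. (1 + \<bar>c n\<bar>) ^ 3 * ?Y n x \<partial>\<mu> n)" by (rule mult_left_mono) simp
    then show ?thesis by (simp add: mult.left_commute)
  qed
  then show "(\<lambda>n. real n * (\<integral>x. min ((c n * X n x)\<^sup>2) (\<bar>c n * X n x\<bar> ^ 3) \<partial>\<mu> n)) \<longlonglongrightarrow> 0"
    by (intro tendsto_sandwich[OF _ _ tendsto_const lim] always_eventually allI)
       (auto intro!: mult_nonneg_nonneg integral_nonneg_AE)
qed

text \<open>Second-order Taylor expansion; its remainder \<open>min (6 x^2) (|s| |x|^3)\<close> is
  at most \<open>(6 + |s|) min (x^2) (|x|^3)\<close>. This separates \<open>s\<close> from
  \<open>X\<close>, so that the last clause of \<open>lindeberg\<close> applies for every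
  \<open>s\<close>.\<close>

lemma (in prob_space) char_distr_approx:
  assumes X: "X \<in> L2_space M"
  shows "cmod (char (distr M borel X) s - (1 + \<i> * s * expectation X - s\<^sup>2 / 2 * expectation (\<lambda>x. (X x)\<^sup>2)))
    \<le> s\<^sup>2 / 6 * (6 + \<bar>s\<bar>) * expectation (\<lambda>x. min ((X x)\<^sup>2) (\<bar>X x\<bar> ^ 3))"
proof -
  have Xm [measurable]: "X \<in> borel_measurable M" using X by (simp add: L2_space_def)
  interpret D: real_distribution "distr M borel X" by (rule real_distribution_distr) simp
  have int: "integrable (distr M borel X) (\<lambda>x. x ^ k)" if "k \<le> 2" for k
  proof -
    have "k = 0 \<or> k = 1 \<or> k = 2" using that by auto
    then show ?thesis using X L2_integrable[OF X] by (auto simp: integrable_distr_eq L2_space_def)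
  qed
  have "cmod (char (distr M borel X) s - (\<Sum>k \<le> 2. ((\<i> * s) ^ k / fact k) * D.expectation (\<lambda>x. x ^ k)))
     \<le> (\<bar>s\<bar>\<^sup>2 / fact (Suc 2)) * D.expectation (\<lambda>x. min (2 * \<bar>x\<bar>\<^sup>2 * Suc 2) (\<bar>s\<bar> * \<bar>x\<bar> ^ Suc 2))"
    by (rule D.char_approx2) (rule int)
  also have "(\<Sum>k \<le> 2. ((\<i> * s) ^ k / fact k) * D.expectation (\<lambda>x. x ^ k)) =
     1 + \<i> * s * expectation X - s\<^sup>2 / 2 * expectation (\<lambda>x. (X x)\<^sup>2)"
    by (simp add: numeral_2_eq_2 integral_distr prob_space complex_eq_iff power2_eq_square D.prob_space[simplified])
  also have "D.expectation (\<lambda>x. min (2 * \<bar>x\<bar>\<^sup>2 * Suc 2) (\<bar>s\<bar> * \<bar>x\<bar> ^ Suc 2)) =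
     expectation (\<lambda>x. min (6 * (X x)\<^sup>2) (\<bar>s\<bar> * \<bar>X x\<bar> ^ 3))"
    by (subst integral_distr) (auto simp: eval_nat_numeral)
  also have "\<bar>s\<bar>\<^sup>2 / fact (Suc 2) * expectation (\<lambda>x. min (6 * (X x)\<^sup>2) (\<bar>s\<bar> * \<bar>X x\<bar> ^ 3)) \<le>
     s\<^sup>2 / 6 * ((6 + \<bar>s\<bar>) * expectation (\<lambda>x. min ((X x)\<^sup>2) (\<bar>X x\<bar> ^ 3)))"
  proof -
    have le: "min (6 * y\<^sup>2) (\<bar>s\<bar> * \<bar>y\<bar> ^ 3) \<le> (6 + \<bar>s\<bar>) * min (y\<^sup>2) (\<bar>y\<bar> ^ 3)" for y :: real
    proof -
      have "6 * y\<^sup>2 \<le> (6 + \<bar>s\<bar>) * y\<^sup>2" "\<bar>s\<bar> * \<bar>y\<bar> ^ 3 \<le> (6 + \<bar>s\<bar>) * \<bar>y\<bar> ^ 3"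
        by (intro mult_right_mono; simp)+
      then show ?thesis by (auto simp: min_def)
    qed
    have "expectation (\<lambda>x. min (6 * (X x)\<^sup>2) (\<bar>s\<bar> * \<bar>X x\<bar> ^ 3)) \<le>
        expectation (\<lambda>x. (6 + \<bar>s\<bar>) * min ((X x)\<^sup>2) (\<bar>X x\<bar> ^ 3))"
    proof (rule integral_mono)
      show "integrable M (\<lambda>x. min (6 * (X x)\<^sup>2) (\<bar>s\<bar> * \<bar>X x\<bar> ^ 3))"
        by (rule Bochner_Integration.integrable_bound[of _ "\<lambda>x. 6 * (X x)\<^sup>2"]) (use X in \<open>auto simp: L2_space_def\<close>)
    qed (auto intro!: integrable_mult_right L2_min_integrable X le)
    then have "s\<^sup>2 / 6 * expectation (\<lambda>x. min (6 * (X x)\<^sup>2) (\<bar>s\<bar> * \<bar>X x\<bar> ^ 3)) \<le>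
        s\<^sup>2 / 6 * expectation (\<lambda>x. (6 + \<bar>s\<bar>) * min ((X x)\<^sup>2) (\<bar>X x\<bar> ^ 3))"
      by (rule mult_left_mono) simp
    then show ?thesis by (simp add: eval_nat_numeral)
  qed
  finally show ?thesis by simp
qed

lemma lindeberg_char:
  assumes X: "lindeberg \<mu> X m v" and p: "\<And>n. prob_space (\<mu> n)"
  shows "(\<lambda>n. of_nat n * (char (distr (\<mu> n) borel (X n)) s - 1)) \<longlonglongrightarrow> \<i> * s * m - s\<^sup>2 / 2 * v"
proof -
  let ?a = "\<lambda>n. \<integral>x. X n x \<partial>\<mu> n" and ?b = "\<lambda>n. \<integral>x. (X n x)\<^sup>2 \<partial>\<mu> n"
  let ?Y = "\<lambda>n x. min ((X n x)\<^sup>2) (\<bar>X n x\<bar> ^ 3)"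
  have "(\<lambda>n. s\<^sup>2 / 6 * (6 + \<bar>s\<bar>) * (real n * (\<integral>x. ?Y n x \<partial>\<mu> n))) \<longlonglongrightarrow> s\<^sup>2 / 6 * (6 + \<bar>s\<bar>) * 0"
    using X by (intro tendsto_mult_left) (simp add: lindeberg_def)
  then have e: "(\<lambda>n. s\<^sup>2 / 6 * (6 + \<bar>s\<bar>) * (real n * (\<integral>x. ?Y n x \<partial>\<mu> n))) \<longlonglongrightarrow> 0" by simp
  have "(\<lambda>n. of_nat n * (char (distr (\<mu> n) borel (X n)) s - 1) -
      (\<i> * s * of_real (real n * ?a n) - of_real (s\<^sup>2 / 2 * (real n * ?b n)))) \<longlonglongrightarrow> 0"
  proof (rule Lim_null_comparison[OF always_eventually e], intro allI)
    fix n
    interpret prob_space "\<mu> n" by (rule p)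
    have "of_nat n * (char (distr (\<mu> n) borel (X n)) s - 1) -
      (\<i> * s * of_real (real n * ?a n) - of_real (s\<^sup>2 / 2 * (real n * ?b n))) =
      of_nat n * (char (distr (\<mu> n) borel (X n)) s - (1 + \<i> * s * ?a n - s\<^sup>2 / 2 * ?b n))"
      by (simp add: algebra_simps)
    then have "norm (of_nat n * (char (distr (\<mu> n) borel (X n)) s - 1) -
      (\<i> * s * of_real (real n * ?a n) - of_real (s\<^sup>2 / 2 * (real n * ?b n)))) =
      real n * norm (char (distr (\<mu> n) borel (X n)) s - (1 + \<i> * s * ?a n - s\<^sup>2 / 2 * ?b n))"
      by (simp add: norm_mult)
    also have "\<dots> \<le> real n * (s\<^sup>2 / 6 * (6 + \<bar>s\<bar>) * (\<integral>x. ?Y n x \<partial>\<mu> n))"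
      by (intro mult_left_mono char_distr_approx) (use X in \<open>auto simp: lindeberg_def\<close>)
    finally show "norm (of_nat n * (char (distr (\<mu> n) borel (X n)) s - 1) -
      (\<i> * s * of_real (real n * ?a n) - of_real (s\<^sup>2 / 2 * (real n * ?b n)))) \<le>
      s\<^sup>2 / 6 * (6 + \<bar>s\<bar>) * (real n * (\<integral>x. ?Y n x \<partial>\<mu> n))" by (simp add: mult_ac)
  qed
  moreover have "(\<lambda>n. \<i> * s * of_real (real n * ?a n) - of_real (s\<^sup>2 / 2 * (real n * ?b n)))
      \<longlonglongrightarrow> \<i> * s * of_real m - of_real (s\<^sup>2 / 2 * v)"
    using X by (intro tendsto_diff tendsto_mult tendsto_const tendsto_of_real) (auto simp: lindeberg_def)
  ultimately show ?thesis by (rule Lim_transform[rotated])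
qed

text \<open>Here \<open>z n = 1 + w / n + o(1 / n)\<close>. The Caratheodory slope \<open>g\<close>
  of \<open>Ln\<close> at \<open>1\<close> gives \<open>k Ln z = (k / n) (n (z - 1)) g(z)\<close>
  without a case distinction at \<open>z = 1\<close>, and \<open>g(z n)\<close> tends to
  \<open>g(1) = 1\<close> by continuity.\<close>

lemma tendsto_power_exp:
  fixes z :: "nat \<Rightarrow> complex"
  assumes z: "(\<lambda>n. of_nat n * (z n - 1)) \<longlonglongrightarrow> w" and k: "(\<lambda>n. real (k n) / real n) \<longlonglongrightarrow> \<rho>"
  shows "(\<lambda>n. z n ^ k n) \<longlonglongrightarrow> exp (of_real \<rho> * w)"
proof -
  have z1: "z \<longlonglongrightarrow> 1"
  proof -
    have "(\<lambda>n. (of_nat n * (z n - 1)) * inverse (of_nat n)) \<longlonglongrightarrow> w * 0"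
      by (intro tendsto_mult z lim_inverse_n)
    moreover have "\<forall>\<^sub>F n in sequentially. (of_nat n * (z n - 1)) * inverse (of_nat n) = z n - 1"
      by (intro eventually_sequentiallyI[of 1]) (simp add: field_simps)
    ultimately have "(\<lambda>n. z n - 1) \<longlonglongrightarrow> 0" by (simp add: tendsto_cong)
    then show ?thesis by (simp add: LIM_zero_iff)
  qed
  have "(Ln has_field_derivative 1) (at 1)"
    using has_field_derivative_Ln[of 1] by (simp add: complex_nonpos_Reals_iff)
  then obtain g where g: "\<And>z. Ln z - Ln 1 = g z * (z - 1)" "isCont g 1" "g 1 = 1"
    unfolding CARAT_DERIV by blast
  have "(\<lambda>n. g (z n)) \<longlonglongrightarrow> 1" using isCont_tendsto_compose[OF g(2) z1] g(3) by simp
  then have "(\<lambda>n. of_real (real (k n) / real n) * (of_nat n * (z n - 1)) * g (z n)) \<longlonglongrightarrow> of_real \<rho> * w * 1"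
    by (intro tendsto_mult tendsto_of_real k z)
  then have "(\<lambda>n. exp (of_real (real (k n) / real n) * (of_nat n * (z n - 1)) * g (z n))) \<longlonglongrightarrow> exp (of_real \<rho> * w)"
    by (auto dest: tendsto_exp)
  moreover have "\<forall>\<^sub>F n in sequentially.
    exp (of_real (real (k n) / real n) * (of_nat n * (z n - 1)) * g (z n)) = z n ^ k n"
  proof -
    have "\<forall>\<^sub>F n in sequentially. z n \<noteq> 0"
      using tendsto_imp_eventually_ne[OF z1, of 0] by simp
    then show ?thesis using eventually_gt_at_top[of 0]
    proof eventually_elim
      case (elim n)
      have "of_real (real (k n) / real n) * (of_nat n * (z n - 1)) * g (z n) = of_nat (k n) * Ln (z n)"
      proof -
        have "of_real (real (k n) / real n) * (of_nat n * (z n - 1)) * g (z n) = of_nat (k n) * (g (z n) * (z n - 1))"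
          using elim(2) by (simp add: mult_ac)
        also have "\<dots> = of_nat (k n) * Ln (z n)" unfolding g(1)[symmetric] by simp
        finally show ?thesis .
      qed
      then show ?case using elim(1) by (simp add: exp_of_nat_mult exp_Ln)
    qed
  qed
  ultimately show ?thesis by (rule Lim_transform_eventually)
qed

section \<open>Two-sample product measures and their characteristic functions\<close>

lemma sets_two_sample_cong:
  "sets P = sets P' \<Longrightarrow> sets Q = sets Q' \<Longrightarrow> sets (two_sample k l P Q) = sets (two_sample k l P' Q')"
  unfolding two_sample_def by (intro sets_pair_measure_cong sets_PiM_cong) auto

lemma prob_space_two_sample:
  assumes "prob_space P" "prob_space Q"
  shows "prob_space (two_sample k l P Q)"
proof -
  interpret A: prob_space "PiM {1..k} (\<lambda>_. P)" by (rule prob_space_PiM) (rule assms)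
  interpret B: prob_space "PiM {1..l} (\<lambda>_. Q)" by (rule prob_space_PiM) (rule assms)
  interpret pair_prob_space "PiM {1..k} (\<lambda>_. P)" "PiM {1..l} (\<lambda>_. Q)" ..
  show ?thesis unfolding two_sample_def by (rule prob_space_axioms)
qed

lemma measurable_two_sample_fst [measurable]:
  assumes "X \<in> borel_measurable P" "i \<in> {1..k}"
  shows "(\<lambda>w. X (fst w i)) \<in> borel_measurable (two_sample k l P Q)"
  unfolding two_sample_def
  by (rule measurable_compose[OF measurable_compose[OF measurable_fst measurable_component_singleton[OF assms(2)]] assms(1)])

lemma measurable_two_sample_snd [measurable]:
  assumes "X \<in> borel_measurable Q" "j \<in> {1..l}"
  shows "(\<lambda>w. X (snd w j)) \<in> borel_measurable (two_sample k l P Q)"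
  unfolding two_sample_def
  by (rule measurable_compose[OF measurable_compose[OF measurable_snd measurable_component_singleton[OF assms(2)]] assms(1)])

lemma measurable_two_sample_sum:
  fixes X :: "'a \<Rightarrow> real" and Y :: "'b \<Rightarrow> real"
  assumes "X \<in> borel_measurable P" "Y \<in> borel_measurable Q"
  shows "(\<lambda>w. (\<Sum>i=1..k. X (fst w i)) + (\<Sum>j=1..l. Y (snd w j))) \<in> borel_measurable (two_sample k l P Q)"
  by (intro borel_measurable_add borel_measurable_sum measurable_two_sample_fst measurable_two_sample_snd assms)

lemma char_two_sample_sum:
  assumes P: "prob_space P" and Q: "prob_space Q"
    and X [measurable]: "X \<in> borel_measurable P" and Y [measurable]: "Y \<in> borel_measurable Q"
  shows "char (distr (two_sample k l P Q) borel (\<lambda>w. (\<Sum>i=1..k. X (fst w i)) + (\<Sum>j=1..l. Y (snd w j)))) s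
    = char (distr P borel X) s ^ k * char (distr Q borel Y) s ^ l"
proof -
  interpret P: prob_space P by (rule P)
  interpret Q: prob_space Q by (rule Q)
  interpret A: prob_space "PiM {1..k} (\<lambda>_. P)" by (rule prob_space_PiM) (rule assms)
  interpret B: prob_space "PiM {1..l} (\<lambda>_. Q)" by (rule prob_space_PiM) (rule assms)
  interpret AB: pair_prob_space "PiM {1..k} (\<lambda>_. P)" "PiM {1..l} (\<lambda>_. Q)" ..
  interpret PP: product_sigma_finite "\<lambda>_::nat. P" ..
  interpret QQ: product_sigma_finite "\<lambda>_::nat. Q" ..
  let ?f = "\<lambda>x. \<Prod>i=1..k. iexp (s * X (x i))" and ?g = "\<lambda>y. \<Prod>j=1..l. iexp (s * Y (y j))"
  have [measurable]: "?f \<in> borel_measurable (PiM {1..k} (\<lambda>_. P))" "?g \<in> borel_measurable (PiM {1..l} (\<lambda>_. Q))"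
    by measurable
  have int: "integrable (PiM {1..k} (\<lambda>_. P) \<Otimes>\<^sub>M PiM {1..l} (\<lambda>_. Q)) (\<lambda>(x, y). ?f x * ?g y)"
    by (rule AB.integrable_const_bound[of _ 1]) (auto simp: norm_mult prod_norm[symmetric])
  have "char (distr (two_sample k l P Q) borel (\<lambda>w. (\<Sum>i=1..k. X (fst w i)) + (\<Sum>j=1..l. Y (snd w j)))) s
     = (CLINT w|two_sample k l P Q. iexp (s * ((\<Sum>i=1..k. X (fst w i)) + (\<Sum>j=1..l. Y (snd w j)))))"
    unfolding char_def by (rule integral_distr) (auto intro!: measurable_two_sample_sum)
  also have "\<dots> = (CLINT w|PiM {1..k} (\<lambda>_. P) \<Otimes>\<^sub>M PiM {1..l} (\<lambda>_. Q). (case w of (x, y) \<Rightarrow> ?f x * ?g y))"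
    unfolding two_sample_def
    by (rule Bochner_Integration.integral_cong)
       (auto simp: exp_add[symmetric] exp_sum[symmetric] ring_distribs sum_distrib_left)
  also have "\<dots> = (CLINT x|PiM {1..k} (\<lambda>_. P). CLINT y|PiM {1..l} (\<lambda>_. Q). ?f x * ?g y)"
    using AB.integral_fst'[OF int] by simp
  also have "\<dots> = (CLINT x|PiM {1..k} (\<lambda>_. P). ?f x) * (CLINT y|PiM {1..l} (\<lambda>_. Q). ?g y)"
    by simp
  also have "(CLINT x|PiM {1..k} (\<lambda>_. P). ?f x) = (\<Prod>i=1..k. CLINT x|P. iexp (s * X x))"
    by (rule PP.product_integral_prod) (auto intro!: P.integrable_iexp)
  also have "(CLINT y|PiM {1..l} (\<lambda>_. Q). ?g y) = (\<Prod>j=1..l. CLINT y|Q. iexp (s * Y y))"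
    by (rule QQ.product_integral_prod) (auto intro!: Q.integrable_iexp)
  also have "(CLINT x|P. iexp (s * X x)) = char (distr P borel X) s"
    unfolding char_def by (subst integral_distr) auto
  also have "(CLINT x|Q. iexp (s * Y x)) = char (distr Q borel Y) s"
    unfolding char_def by (subst integral_distr) auto
  finally show ?thesis by simp
qed

lemma char_distr_affine:
  assumes [measurable]: "S \<in> borel_measurable M"
  shows "char (distr M borel (\<lambda>w. (S w - m) / r)) s = iexp (- (s / r * m)) * char (distr M borel S) (s / r)"
proof -
  have "char (distr M borel (\<lambda>w. (S w - m) / r)) s = (CLINT w|M. iexp (s * ((S w - m) / r)))"
    unfolding char_def by (rule integral_distr) auto
  also have "\<dots> = (CLINT w|M. iexp (- (s / r * m)) * iexp (s / r * S w))"
    by (rule Bochner_Integration.integral_cong) (auto simp: exp_add[symmetric] field_simps diff_divide_distrib)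
  also have "\<dots> = iexp (- (s / r * m)) * (CLINT w|M. iexp (s / r * S w))" by simp
  also have "(CLINT w|M. iexp (s / r * S w)) = char (distr M borel S) (s / r)"
    unfolding char_def by (subst integral_distr) auto
  finally show ?thesis .
qed

text \<open>At \<open>r = s / sqrt v\<close> the characteristic function is a product of two powers,
  and each has an exponential limit by \<open>tendsto_power_exp\<close>. The linear terms cancel
  against the phase coming from the centring at \<open>m\<close>, and
  \<open>- r^2 v / 2 = - s^2 / 2\<close> remains; Levy's theorem does the rest.\<close>

theorem two_sample_clt:
  fixes \<mu> :: "nat \<Rightarrow> 'a measure" and \<nu> :: "nat \<Rightarrow> 'b measure"
  assumes \<mu>: "\<And>n. prob_space (\<mu> n)" and \<nu>: "\<And>n. prob_space (\<nu> n)"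
    and X: "lindeberg \<mu> X m1 v1" and Y: "lindeberg \<nu> Y m2 v2"
    and k: "(\<lambda>n. real (k n) / real n) \<longlonglongrightarrow> \<rho>1" and l: "(\<lambda>n. real (l n) / real n) \<longlonglongrightarrow> \<rho>2"
    and m: "m = \<rho>1 * m1 + \<rho>2 * m2" and v: "v = \<rho>1 * v1 + \<rho>2 * v2" "0 < v"
  shows "weak_conv_m (\<lambda>n. distr (two_sample (k n) (l n) (\<mu> n) (\<nu> n)) borel
     (\<lambda>w. ((\<Sum>i=1..k n. X n (fst w i)) + (\<Sum>j=1..l n. Y n (snd w j)) - m) / sqrt v)) std_normal_distribution"
proof (rule levy_continuity)
  have Xm: "X n \<in> borel_measurable (\<mu> n)" for n using X by (simp add: lindeberg_def L2_space_def)
  have Ym: "Y n \<in> borel_measurable (\<nu> n)" for n using Y by (simp add: lindeberg_def L2_space_def)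
  have Sm [measurable]: "(\<lambda>w. (\<Sum>i=1..k n. X n (fst w i)) + (\<Sum>j=1..l n. Y n (snd w j)))
     \<in> borel_measurable (two_sample (k n) (l n) (\<mu> n) (\<nu> n))" for n
    by (rule measurable_two_sample_sum[OF Xm Ym])
  show "real_distribution (distr (two_sample (k n) (l n) (\<mu> n) (\<nu> n)) borel
     (\<lambda>w. ((\<Sum>i=1..k n. X n (fst w i)) + (\<Sum>j=1..l n. Y n (snd w j)) - m) / sqrt v))" for n
  proof -
    interpret prob_space "two_sample (k n) (l n) (\<mu> n) (\<nu> n)"
      by (rule prob_space_two_sample[OF \<mu> \<nu>])
    show ?thesis
      by (rule real_distribution_distr) (intro borel_measurable_divide borel_measurable_diff Sm borel_measurable_const)
  qed
  show "real_distribution std_normal_distribution" by (rule real_dist_normal_dist)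
  fix s :: real
  define r where "r = s / sqrt v"
  have r2: "r\<^sup>2 * v = s\<^sup>2" using v(2) by (simp add: r_def power_divide)
  have "(\<lambda>n. iexp (- (r * m)) * (char (distr (\<mu> n) borel (X n)) r ^ k n * char (distr (\<nu> n) borel (Y n)) r ^ l n))
     \<longlonglongrightarrow> iexp (- (r * m)) * (exp (of_real \<rho>1 * (\<i> * r * m1 - r\<^sup>2 / 2 * v1)) * exp (of_real \<rho>2 * (\<i> * r * m2 - r\<^sup>2 / 2 * v2)))"
    by (intro tendsto_mult tendsto_const tendsto_power_exp[OF lindeberg_char[OF X \<mu>] k]
        tendsto_power_exp[OF lindeberg_char[OF Y \<nu>] l])
  also have "iexp (- (r * m)) * (exp (of_real \<rho>1 * (\<i> * r * m1 - r\<^sup>2 / 2 * v1)) * exp (of_real \<rho>2 * (\<i> * r * m2 - r\<^sup>2 / 2 * v2)))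
     = exp (of_real (- (r\<^sup>2 * v) / 2))"
    unfolding exp_add[symmetric] by (rule arg_cong[where f=exp]) (simp add: m v(1) algebra_simps add_divide_distrib)
  also have "\<dots> = char std_normal_distribution s"
    unfolding r2 by (simp only: char_std_normal_distribution exp_of_real)
  finally show "(\<lambda>n. char (distr (two_sample (k n) (l n) (\<mu> n) (\<nu> n)) borel
     (\<lambda>w. ((\<Sum>i=1..k n. X n (fst w i)) + (\<Sum>j=1..l n. Y n (snd w j)) - m) / sqrt v)) s)
     \<longlonglongrightarrow> char std_normal_distribution s"
    unfolding char_distr_affine[OF Sm] char_two_sample_sum[OF \<mu> \<nu> Xm Ym] r_def .
qed

section \<open>Dominated product measures and the Neyman-Pearson inequality\<close>

text \<open>The measure with \<open>\<mu>\<close>-density \<open>p\<close> lies below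
  \<open>P\<close>. The inequality is required for all nonnegative integrands and not just for sets,
  so that it can be used inside iterated integrals.\<close>

definition dominates :: "'a measure \<Rightarrow> ('a \<Rightarrow> ennreal) \<Rightarrow> 'a measure \<Rightarrow> bool" where
  "dominates P p \<mu> \<longleftrightarrow> sets P = sets \<mu> \<and> p \<in> borel_measurable \<mu> \<and>
     (\<forall>f\<in>borel_measurable \<mu>. (\<integral>\<^sup>+x. f x * p x \<partial>\<mu>) \<le> (\<integral>\<^sup>+x. f x \<partial>P))"

lemma dominatesD:
  assumes "dominates P p \<mu>"
  shows "sets P = sets \<mu>" "p \<in> borel_measurable \<mu>"
    "f \<in> borel_measurable \<mu> \<Longrightarrow> (\<integral>\<^sup>+x. f x * p x \<partial>\<mu>) \<le> (\<integral>\<^sup>+x. f x \<partial>P)"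
  using assms by (auto simp: dominates_def)

lemma dominatesI:
  assumes s: "sets P = sets \<mu>" and p: "p \<in> borel_measurable \<mu>"
    and le: "\<And>A. A \<in> sets \<mu> \<Longrightarrow> (\<integral>\<^sup>+x\<in>A. p x \<partial>\<mu>) \<le> emeasure P A"
  shows "dominates P p \<mu>"
  unfolding dominates_def
proof (intro conjI ballI s p)
  fix f :: "'a \<Rightarrow> ennreal" assume f: "f \<in> borel_measurable \<mu>"
  have "density \<mu> p \<le> P"
    by (subst le_measure) (use s p le in \<open>auto simp: emeasure_density\<close>)
  then have "(\<integral>\<^sup>+x. f x \<partial>density \<mu> p) \<le> (\<integral>\<^sup>+x. f x \<partial>P)"
    by (intro nn_integral_mono_measure) (simp_all add: s)
  then show "(\<integral>\<^sup>+x. f x * p x \<partial>\<mu>) \<le> (\<integral>\<^sup>+x. f x \<partial>P)"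
    using f p by (simp add: nn_integral_density mult.commute)
qed

text \<open>Integrate out coordinate \<open>i\<close> first: there \<open>p\<close> is traded for
  \<open>P\<close>, and the induction hypothesis treats the resulting function of the other
  coordinates. This is why the induction runs over arbitrary \<open>f\<close>.\<close>

lemma dominates_PiM:
  assumes P: "prob_space P" and \<mu>: "prob_space \<mu>" and d: "dominates P p \<mu>" and "finite I"
    and f: "f \<in> borel_measurable (PiM I (\<lambda>_. \<mu>))"
  shows "(\<integral>\<^sup>+w. f w * (\<Prod>i\<in>I. p (w i)) \<partial>PiM I (\<lambda>_. \<mu>)) \<le> (\<integral>\<^sup>+w. f w \<partial>PiM I (\<lambda>_. P))"
  using \<open>finite I\<close> f
proof (induction I arbitrary: f rule: finite_induct)
  case empty
  then show ?case by (simp add: PiM_empty nn_integral_count_space_finite)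
next
  case (insert i I)
  interpret P: prob_space P by (rule P)
  interpret \<mu>: prob_space \<mu> by (rule \<mu>)
  interpret PP: product_sigma_finite "\<lambda>_. P" ..
  interpret QQ: product_sigma_finite "\<lambda>_. \<mu>" ..
  have s [measurable_cong]: "sets P = sets \<mu>" and [measurable]: "p \<in> borel_measurable \<mu>"
    using dominatesD[OF d] by auto
  have sI: "sets (PiM J (\<lambda>_. P)) = sets (PiM J (\<lambda>_. \<mu>))" for J
    by (rule sets_PiM_cong) (auto simp: s)
  note [measurable] = insert.prems
  have f': "f \<in> borel_measurable (PiM (insert i I) (\<lambda>_. P))"
    using insert.prems by (simp add: measurable_cong_sets[OF sI refl])
  have upd: "(\<lambda>(w, y). w(i := y)) \<in> measurable (PiM I (\<lambda>_. \<mu>) \<Otimes>\<^sub>M \<mu>) (PiM (insert i I) (\<lambda>_. \<mu>))"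
    by (rule measurable_add_dim)
  have g: "(\<lambda>w. \<integral>\<^sup>+y. f (w(i := y)) \<partial>P) \<in> borel_measurable (PiM I (\<lambda>_. \<mu>))"
  proof -
    have "(\<lambda>(w, y). f (w(i := y))) \<in> borel_measurable (PiM I (\<lambda>_. \<mu>) \<Otimes>\<^sub>M \<mu>)"
      using measurable_compose[OF upd insert.prems] by (simp add: case_prod_beta')
    then have "(\<lambda>(w, y). f (w(i := y))) \<in> borel_measurable (PiM I (\<lambda>_. \<mu>) \<Otimes>\<^sub>M P)"
      by (simp add: measurable_cong_sets[OF sets_pair_measure_cong[OF refl s] refl])
    from P.borel_measurable_nn_integral[OF this] show ?thesis by simp
  qed
  have fp: "(\<lambda>w. f w * (\<Prod>i\<in>insert i I. p (w i))) \<in> borel_measurable (PiM (insert i I) (\<lambda>_. \<mu>))"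
  proof -
    have [measurable]: "(\<lambda>w. \<Prod>i\<in>insert i I. p (w i)) \<in> borel_measurable (PiM (insert i I) (\<lambda>_. \<mu>))"
      by (rule borel_measurable_prod_ennreal) (auto intro!: measurable_compose[OF measurable_component_singleton])
    show ?thesis by measurable
  qed
  have "(\<integral>\<^sup>+w. f w * (\<Prod>i\<in>insert i I. p (w i)) \<partial>PiM (insert i I) (\<lambda>_. \<mu>))
     = (\<integral>\<^sup>+w. \<integral>\<^sup>+y. f (w(i := y)) * (\<Prod>j\<in>insert i I. p ((w(i := y)) j)) \<partial>\<mu> \<partial>PiM I (\<lambda>_. \<mu>))"
    by (rule QQ.product_nn_integral_insert[OF insert.hyps fp])
  also have "\<dots> = (\<integral>\<^sup>+w. (\<integral>\<^sup>+y. f (w(i := y)) * p y \<partial>\<mu>) * (\<Prod>j\<in>I. p (w j)) \<partial>PiM I (\<lambda>_. \<mu>))"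
  proof (rule nn_integral_cong)
    fix w assume w: "w \<in> space (PiM I (\<lambda>_. \<mu>))"
    have [measurable]: "(\<lambda>y. f (w(i := y))) \<in> borel_measurable \<mu>"
      using measurable_compose[OF measurable_compose[OF measurable_Pair1'[OF w] upd] insert.prems] by (simp add: fun_upd_def)
    have "(\<Prod>j\<in>insert i I. p ((w(i := y)) j)) = p y * (\<Prod>j\<in>I. p (w j))" for y
    proof -
      have "(\<Prod>j\<in>I. p ((w(i := y)) j)) = (\<Prod>j\<in>I. p (w j))"
        by (rule prod.cong) (use insert.hyps in auto)
      then show ?thesis using insert.hyps by simp
    qed
    then have "(\<integral>\<^sup>+y. f (w(i := y)) * (\<Prod>j\<in>insert i I. p ((w(i := y)) j)) \<partial>\<mu>)
       = (\<integral>\<^sup>+y. (f (w(i := y)) * p y) * (\<Prod>j\<in>I. p (w j)) \<partial>\<mu>)" by (simp add: mult.assoc)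
    also have "\<dots> = (\<integral>\<^sup>+y. f (w(i := y)) * p y \<partial>\<mu>) * (\<Prod>j\<in>I. p (w j))"
      by (rule nn_integral_multc) measurable
    finally show "(\<integral>\<^sup>+y. f (w(i := y)) * (\<Prod>j\<in>insert i I. p ((w(i := y)) j)) \<partial>\<mu>) = \<dots>" .
  qed
  also have "\<dots> \<le> (\<integral>\<^sup>+w. (\<integral>\<^sup>+y. f (w(i := y)) \<partial>P) * (\<Prod>j\<in>I. p (w j)) \<partial>PiM I (\<lambda>_. \<mu>))"
  proof (intro nn_integral_mono mult_right_mono)
    fix w assume w: "w \<in> space (PiM I (\<lambda>_. \<mu>))"
    have "(\<lambda>y. f (w(i := y))) \<in> borel_measurable \<mu>"
      using measurable_compose[OF measurable_compose[OF measurable_Pair1'[OF w] upd] insert.prems] by (simp add: fun_upd_def)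
    then show "(\<integral>\<^sup>+y. f (w(i := y)) * p y \<partial>\<mu>) \<le> (\<integral>\<^sup>+y. f (w(i := y)) \<partial>P)"
      by (rule dominatesD(3)[OF d])
  qed simp
  also have "\<dots> \<le> (\<integral>\<^sup>+w. (\<integral>\<^sup>+y. f (w(i := y)) \<partial>P) \<partial>PiM I (\<lambda>_. P))"
    by (rule insert.IH[OF g])
  also have "\<dots> = (\<integral>\<^sup>+w. f w \<partial>PiM (insert i I) (\<lambda>_. P))"
    by (rule PP.product_nn_integral_insert[symmetric, OF insert.hyps f'])
  finally show ?case .
qed

lemma dominates_two_sample:
  assumes prob: "prob_space P" "prob_space Q" "prob_space \<mu>" "prob_space \<nu>"
    and d: "dominates P p \<mu>" "dominates Q q \<nu>"
    and f: "f \<in> borel_measurable (two_sample k l \<mu> \<nu>)"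
  shows "(\<integral>\<^sup>+w. f w * ((\<Prod>i=1..k. p (fst w i)) * (\<Prod>j=1..l. q (snd w j))) \<partial>two_sample k l \<mu> \<nu>)
     \<le> (\<integral>\<^sup>+w. f w \<partial>two_sample k l P Q)"
proof -
  let ?A = "PiM {1..k} (\<lambda>_. \<mu>)" and ?B = "PiM {1..l} (\<lambda>_. \<nu>)"
  let ?A' = "PiM {1..k} (\<lambda>_. P)" and ?B' = "PiM {1..l} (\<lambda>_. Q)"
  interpret B: prob_space ?B by (rule prob_space_PiM) (rule prob)
  interpret B': prob_space ?B' by (rule prob_space_PiM) (rule prob)
  have [measurable]: "p \<in> borel_measurable \<mu>" "q \<in> borel_measurable \<nu>"
    using dominatesD[OF d(1)] dominatesD[OF d(2)] by auto
  have s: "sets ?A' = sets ?A" "sets ?B' = sets ?B"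
    using dominatesD(1)[OF d(1)] dominatesD(1)[OF d(2)] by (auto intro!: sets_PiM_cong)
  let ?p = "\<lambda>x. \<Prod>i=1..k. p (x i)" and ?q = "\<lambda>y. \<Prod>j=1..l. q (y j)"
  have pm [measurable]: "?p \<in> borel_measurable ?A" "?q \<in> borel_measurable ?B"
    by (auto intro!: borel_measurable_prod_ennreal measurable_compose[OF measurable_component_singleton])
  have f1 [measurable]: "f \<in> borel_measurable (?A \<Otimes>\<^sub>M ?B)" using f by (simp add: two_sample_def)
  have f2: "f \<in> borel_measurable (?A \<Otimes>\<^sub>M ?B')"
    using f1 measurable_cong_sets[OF sets_pair_measure_cong[OF refl s(2)] refl] by blast
  have f3: "f \<in> borel_measurable (?A' \<Otimes>\<^sub>M ?B')"
    using f1 measurable_cong_sets[OF sets_pair_measure_cong[OF s] refl] by blast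
  have g: "(\<lambda>x. \<integral>\<^sup>+y. f (x, y) \<partial>?B') \<in> borel_measurable ?A"
    by (rule B'.borel_measurable_nn_integral_fst[OF f2])
  have "(\<integral>\<^sup>+w. f w * (?p (fst w) * ?q (snd w)) \<partial>(?A \<Otimes>\<^sub>M ?B))
     = (\<integral>\<^sup>+x. \<integral>\<^sup>+y. f (x, y) * (?p x * ?q y) \<partial>?B \<partial>?A)"
  proof (subst B.nn_integral_fst[symmetric])
    note [measurable] = measurable_compose[OF measurable_fst pm(1)] measurable_compose[OF measurable_snd pm(2)]
    show "(\<lambda>w. f w * (?p (fst w) * ?q (snd w))) \<in> borel_measurable (?A \<Otimes>\<^sub>M ?B)" by measurable
  qed simp
  also have "\<dots> = (\<integral>\<^sup>+x. (\<integral>\<^sup>+y. f (x, y) * ?q y \<partial>?B) * ?p x \<partial>?A)"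
  proof (rule nn_integral_cong)
    fix x assume [measurable]: "x \<in> space ?A"
    have "(\<integral>\<^sup>+y. f (x, y) * (?p x * ?q y) \<partial>?B) = (\<integral>\<^sup>+y. (f (x, y) * ?q y) * ?p x \<partial>?B)"
      by (simp add: mult_ac)
    also have "\<dots> = (\<integral>\<^sup>+y. f (x, y) * ?q y \<partial>?B) * ?p x"
      by (rule nn_integral_multc) measurable
    finally show "(\<integral>\<^sup>+y. f (x, y) * (?p x * ?q y) \<partial>?B) = \<dots>" .
  qed
  also have "\<dots> \<le> (\<integral>\<^sup>+x. (\<integral>\<^sup>+y. f (x, y) \<partial>?B') * ?p x \<partial>?A)"
    by (intro nn_integral_mono mult_right_mono dominates_PiM[OF prob(2,4) d(2)]
        measurable_compose[OF measurable_Pair1' f1]) auto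
  also have "\<dots> \<le> (\<integral>\<^sup>+x. (\<integral>\<^sup>+y. f (x, y) \<partial>?B') \<partial>?A')"
    by (rule dominates_PiM[OF prob(1,3) d(1) _ g]) simp
  also have "\<dots> = (\<integral>\<^sup>+w. f w \<partial>(?A' \<Otimes>\<^sub>M ?B'))"
    by (rule B'.nn_integral_fst[OF f3])
  finally show ?thesis by (simp add: two_sample_def)
qed

text \<open>The dominated densities may have total mass smaller than one, which is how the singular
  parts are discarded.\<close>

lemma neyman_pearson_bound:
  fixes X :: "'a \<Rightarrow> real" and Y :: "'b \<Rightarrow> real" and \<phi> :: "(nat \<Rightarrow> 'a) \<times> (nat \<Rightarrow> 'b) \<Rightarrow> real"
  assumes prob: "prob_space PA" "prob_space QA" "prob_space PB" "prob_space QB" "prob_space \<mu>" "prob_space \<nu>"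
    and m: "0 \<le> m1" "0 \<le> m2" "0 \<le> c"
    and dA: "dominates PA (\<lambda>_. ennreal m1) \<mu>" "dominates QA (\<lambda>_. ennreal m2) \<nu>"
    and dB: "dominates PB (\<lambda>x. ennreal (m1 * exp (X x))) \<mu>" "dominates QB (\<lambda>y. ennreal (m2 * exp (Y y))) \<nu>"
    and XY: "X \<in> borel_measurable \<mu>" "Y \<in> borel_measurable \<nu>"
    and \<phi>: "\<phi> \<in> borel_measurable (two_sample k l \<mu> \<nu>)"
      "\<And>w. w \<in> space (two_sample k l \<mu> \<nu>) \<Longrightarrow> 0 \<le> \<phi> w \<and> \<phi> w \<le> 1"
  shows "m1 ^ k * m2 ^ l *
      (\<integral>w. min (exp ((\<Sum>i=1..k. X (fst w i)) + (\<Sum>j=1..l. Y (snd w j)))) c \<partial>two_sample k l \<mu> \<nu>)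
    \<le> (1 - (\<integral>w. \<phi> w \<partial>two_sample k l PB QB)) + c * (\<integral>w. \<phi> w \<partial>two_sample k l PA QA)"
proof -
  let ?R = "two_sample k l \<mu> \<nu>" and ?A = "two_sample k l PA QA" and ?B = "two_sample k l PB QB"
  let ?S = "\<lambda>w. (\<Sum>i=1..k. X (fst w i)) + (\<Sum>j=1..l. Y (snd w j))"
  let ?M = "m1 ^ k * m2 ^ l"
  interpret R: prob_space ?R by (rule prob_space_two_sample[OF prob(5,6)])
  interpret A: prob_space ?A by (rule prob_space_two_sample[OF prob(1,2)])
  interpret B: prob_space ?B by (rule prob_space_two_sample[OF prob(3,4)])
  have sA: "sets ?A = sets ?R" using dominatesD(1)[OF dA(1)] dominatesD(1)[OF dA(2)] by (rule sets_two_sample_cong)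
  have sB: "sets ?B = sets ?R" using dominatesD(1)[OF dB(1)] dominatesD(1)[OF dB(2)] by (rule sets_two_sample_cong)
  note [measurable_cong] = sA sB
  have sp: "space ?A = space ?R" "space ?B = space ?R" by (rule sets_eq_imp_space_eq[OF sA], rule sets_eq_imp_space_eq[OF sB])
  have B1: "measure ?B (space ?R) = 1" using B.prob_space by (simp only: sp(2))
  have Sm [measurable]: "?S \<in> borel_measurable ?R" by (rule measurable_two_sample_sum[OF XY])
  note [measurable] = \<phi>(1)
  have iA: "integrable ?A \<phi>" and iB: "integrable ?B \<phi>"
    using \<phi>(2) by (auto intro!: A.integrable_const_bound[of _ 1] B.integrable_const_bound[of _ 1] AE_I2 simp: sp abs_le_iff)
  have iR: "integrable ?R (\<lambda>w. min (exp (?S w)) c)"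
  proof (rule R.integrable_const_bound[of _ c])
    show "(\<lambda>w. min (exp (?S w)) c) \<in> borel_measurable ?R" by (intro borel_measurable_min measurable_compose[OF Sm borel_measurable_exp]) simp
  qed (use m in \<open>auto simp: min_def abs_if not_le\<close>)
  have "ennreal (?M * (\<integral>w. min (exp (?S w)) c \<partial>?R)) = (\<integral>\<^sup>+w. ennreal (?M * min (exp (?S w)) c) \<partial>?R)"
    using m iR by (subst nn_integral_eq_integral) (auto intro!: AE_I2)
  also have "\<dots> \<le> (\<integral>\<^sup>+w. ennreal (1 - \<phi> w) * (ennreal (?M * exp (?S w))) + ennreal (c * \<phi> w) * ennreal ?M \<partial>?R)"
  proof (rule nn_integral_mono)
    fix w assume "w \<in> space ?R"
    then have p: "0 \<le> \<phi> w" "\<phi> w \<le> 1" using \<phi>(2) by auto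
    \<comment> \<open>The minimum lies below both entries, hence below their mixture with weights
      \<open>1 - \<phi>\<close> and \<open>\<phi>\<close>. Integrated, the mixture becomes the error
      of the second kind plus \<open>c\<close> times the size, which is the Neyman-Pearson
      inequality without constructing the optimal test.\<close>
    have "min (exp (?S w)) c = (1 - \<phi> w) * min (exp (?S w)) c + \<phi> w * min (exp (?S w)) c"
      by (simp add: algebra_simps)
    also have "\<dots> \<le> (1 - \<phi> w) * exp (?S w) + \<phi> w * c"
      using p by (intro add_mono mult_left_mono) auto
    finally have "?M * min (exp (?S w)) c \<le> ?M * ((1 - \<phi> w) * exp (?S w) + \<phi> w * c)"
      using m by (intro mult_left_mono) auto
    then have "ennreal (?M * min (exp (?S w)) c) \<le> ennreal ((1 - \<phi> w) * (?M * exp (?S w)) + (c * \<phi> w) * ?M)"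
      by (intro ennreal_leI) (simp add: algebra_simps)
    also have "\<dots> = ennreal (1 - \<phi> w) * ennreal (?M * exp (?S w)) + ennreal (c * \<phi> w) * ennreal ?M"
      using p m by (subst ennreal_plus) (auto simp: ennreal_mult)
    finally show "ennreal (?M * min (exp (?S w)) c) \<le> \<dots>" .
  qed
  also have "\<dots> = (\<integral>\<^sup>+w. ennreal (1 - \<phi> w) * (ennreal (?M * exp (?S w))) \<partial>?R) + (\<integral>\<^sup>+w. ennreal (c * \<phi> w) * ennreal ?M \<partial>?R)"
    by (rule nn_integral_add) measurable
  also have "(\<integral>\<^sup>+w. ennreal (1 - \<phi> w) * (ennreal (?M * exp (?S w))) \<partial>?R) \<le> (\<integral>\<^sup>+w. ennreal (1 - \<phi> w) \<partial>?B)"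
  proof -
    have "ennreal (?M * exp (?S w)) = (\<Prod>i=1..k. ennreal (m1 * exp (X (fst w i)))) * (\<Prod>j=1..l. ennreal (m2 * exp (Y (snd w j))))" for w
      using m by (simp add: prod_ennreal ennreal_mult[symmetric] prod.distrib exp_add exp_sum prod_nonneg mult_ac)
    then show ?thesis
      using dominates_two_sample[OF prob(3,4,5,6) dB, of "\<lambda>w. ennreal (1 - \<phi> w)" k l] by simp
  qed
  also have "(\<integral>\<^sup>+w. ennreal (c * \<phi> w) * ennreal ?M \<partial>?R) \<le> (\<integral>\<^sup>+w. ennreal (c * \<phi> w) \<partial>?A)"
    using dominates_two_sample[OF prob(1,2,5,6) dA, of "\<lambda>w. ennreal (c * \<phi> w)" k l] m
    by (simp add: ennreal_power ennreal_mult)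
  also have "(\<integral>\<^sup>+w. ennreal (1 - \<phi> w) \<partial>?B) = ennreal (1 - (\<integral>w. \<phi> w \<partial>?B))"
    using \<phi>(2) iB by (subst nn_integral_eq_integral) (auto simp: sp B1)
  also have "(\<integral>\<^sup>+w. ennreal (c * \<phi> w) \<partial>?A) = ennreal (c * (\<integral>w. \<phi> w \<partial>?A))"
    using \<phi>(2) iA m by (subst nn_integral_eq_integral) (auto simp: sp)
  also have "ennreal (1 - (\<integral>w. \<phi> w \<partial>?B)) + ennreal (c * (\<integral>w. \<phi> w \<partial>?A)) =
     ennreal ((1 - (\<integral>w. \<phi> w \<partial>?B)) + c * (\<integral>w. \<phi> w \<partial>?A))"
  proof (rule ennreal_plus[symmetric])
    have "(\<integral>w. \<phi> w \<partial>?B) \<le> (\<integral>w. 1 \<partial>?B)" using \<phi>(2) by (intro integral_mono iB) (auto simp: sp)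
    then show "0 \<le> 1 - (\<integral>w. \<phi> w \<partial>?B)" by (simp add: B.prob_space)
    show "0 \<le> c * (\<integral>w. \<phi> w \<partial>?A)" using \<phi>(2) m by (auto intro!: mult_nonneg_nonneg integral_nonneg_AE AE_I2 simp: sp)
  qed
  finally have le: "ennreal (?M * (\<integral>w. min (exp (?S w)) c \<partial>?R)) \<le>
    ennreal ((1 - (\<integral>w. \<phi> w \<partial>?B)) + c * (\<integral>w. \<phi> w \<partial>?A))" by (auto simp: add_mono)
  have "(\<integral>w. \<phi> w \<partial>?B) \<le> (\<integral>w. 1 \<partial>?B)" using \<phi>(2) by (intro integral_mono iB) (auto simp: sp)
  moreover have "0 \<le> c * (\<integral>w. \<phi> w \<partial>?A)" using \<phi>(2) m by (auto intro!: mult_nonneg_nonneg integral_nonneg_AE AE_I2 simp: sp)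
  ultimately have "0 \<le> (1 - (\<integral>w. \<phi> w \<partial>?B)) + c * (\<integral>w. \<phi> w \<partial>?A)" by (simp add: B.prob_space)
  with le show ?thesis by (simp add: ennreal_le_iff)
qed

text \<open>The product built from \<open>P\<close> and \<open>Q\<close> lies above
  \<open>m1 ^ k * m2 ^ l\<close> times the reference product. Using this for \<open>\<phi>\<close>
  and for \<open>1 - \<phi>\<close> bounds the difference on both sides by the missing mass. It
  carries limits from cut measures back to the actual ones.\<close>

lemma dominated_test_bound:
  assumes prob: "prob_space P" "prob_space Q" "prob_space \<mu>" "prob_space \<nu>"
    and m: "0 \<le> m1" "m1 \<le> 1" "0 \<le> m2" "m2 \<le> 1"
    and d: "dominates P (\<lambda>_. ennreal m1) \<mu>" "dominates Q (\<lambda>_. ennreal m2) \<nu>"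
    and \<phi>: "\<phi> \<in> borel_measurable (two_sample k l \<mu> \<nu>)"
      "\<And>w. w \<in> space (two_sample k l \<mu> \<nu>) \<Longrightarrow> 0 \<le> \<phi> w \<and> \<phi> w \<le> (1 :: real)"
  shows "\<bar>(\<integral>w. \<phi> w \<partial>two_sample k l P Q) - (\<integral>w. \<phi> w \<partial>two_sample k l \<mu> \<nu>)\<bar> \<le> 1 - m1 ^ k * m2 ^ l"
proof -
  let ?R = "two_sample k l \<mu> \<nu>" and ?A = "two_sample k l P Q" and ?M = "m1 ^ k * m2 ^ l"
  interpret R: prob_space ?R by (rule prob_space_two_sample[OF prob(3,4)])
  interpret A: prob_space ?A by (rule prob_space_two_sample[OF prob(1,2)])
  have sA: "sets ?A = sets ?R" using dominatesD(1)[OF d(1)] dominatesD(1)[OF d(2)] by (rule sets_two_sample_cong)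
  note [measurable_cong] = sA
  have sp: "space ?A = space ?R" by (rule sets_eq_imp_space_eq[OF sA])
  have main: "?M * (\<integral>w. f w \<partial>?R) \<le> (\<integral>w. f w \<partial>?A)"
    if [measurable]: "f \<in> borel_measurable ?R" and f: "\<And>w. w \<in> space ?R \<Longrightarrow> 0 \<le> f w \<and> f w \<le> 1" for f :: "_ \<Rightarrow> real"
  proof -
    have bd: "norm (f w) \<le> 1" if "w \<in> space ?R" for w using f[OF that] by auto
    have i: "integrable ?A f" "integrable ?R f"
      by (auto intro!: A.integrable_const_bound[of _ 1] R.integrable_const_bound[of _ 1] AE_I2 bd simp: sp simp del: real_norm_def)
    have "ennreal (?M * (\<integral>w. f w \<partial>?R)) = (\<integral>\<^sup>+w. ennreal (?M * f w) \<partial>?R)"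
      using m i f by (subst nn_integral_eq_integral) (auto intro!: AE_I2)
    also have "\<dots> = (\<integral>\<^sup>+w. ennreal (f w) * ((\<Prod>i=1..k. ennreal m1) * (\<Prod>j=1..l. ennreal m2)) \<partial>?R)"
      using m f by (intro nn_integral_cong) (simp add: ennreal_power ennreal_mult mult_ac)
    also have "\<dots> \<le> (\<integral>\<^sup>+w. ennreal (f w) \<partial>?A)"
      by (rule dominates_two_sample[OF prob d]) measurable
    also have "\<dots> = ennreal (\<integral>w. f w \<partial>?A)"
      using i f by (intro nn_integral_eq_integral) (auto simp: sp)
    finally show ?thesis
      using f by (subst (asm) ennreal_le_iff) (auto intro!: integral_nonneg_AE AE_I2 simp: sp)
  qed
  have bd: "norm (\<phi> w) \<le> 1" if "w \<in> space ?R" for w using \<phi>(2)[OF that] by auto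
  note [measurable] = \<phi>(1)
  have i: "integrable ?A \<phi>" "integrable ?R \<phi>"
    by (auto intro!: A.integrable_const_bound[of _ 1] R.integrable_const_bound[of _ 1] AE_I2 bd simp: sp simp del: real_norm_def)
  have 1: "?M * (\<integral>w. \<phi> w \<partial>?R) \<le> (\<integral>w. \<phi> w \<partial>?A)" by (rule main[OF \<phi>])
  have "?M * (\<integral>w. 1 - \<phi> w \<partial>?R) \<le> (\<integral>w. 1 - \<phi> w \<partial>?A)"
    by (rule main) (use \<phi>(2) in auto)
  then have 2: "?M * (1 - (\<integral>w. \<phi> w \<partial>?R)) \<le> 1 - (\<integral>w. \<phi> w \<partial>?A)"
    using i by (simp add: A.prob_space R.prob_space)
  have M: "0 \<le> ?M" "?M \<le> 1" using m by (auto intro!: mult_le_one power_le_one)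
  have r: "0 \<le> (\<integral>w. \<phi> w \<partial>?R)" using \<phi>(2) by (auto intro!: integral_nonneg_AE AE_I2)
  have "(\<integral>w. \<phi> w \<partial>?R) \<le> (\<integral>w. 1 \<partial>?R)" using \<phi>(2) by (intro integral_mono i) auto
  then have r': "(\<integral>w. \<phi> w \<partial>?R) \<le> 1" by (simp add: R.prob_space)
  have "(1 - ?M) * (\<integral>w. \<phi> w \<partial>?R) \<le> (1 - ?M) * 1" "(1 - ?M) * (1 - (\<integral>w. \<phi> w \<partial>?R)) \<le> (1 - ?M) * 1"
    using M r r' by (intro mult_left_mono; simp)+
  then show ?thesis using 1 2 by (auto simp: abs_le_iff algebra_simps)
qed

section \<open>Local expansion of likelihood ratios\<close>

lemma L2_tendsto_abs:
  assumes F: "L2_tendsto M F f"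
  shows "L2_tendsto M (\<lambda>n x. \<bar>F n x\<bar>) (\<lambda>x. \<bar>f x\<bar>)"
proof (rule L2_tendstoI[OF _ _ L2_tendstoD(3)[OF F]])
  note D = L2_tendstoD[OF F]
  show "(\<lambda>x. \<bar>F n x\<bar>) \<in> L2_space M" "(\<lambda>x. \<bar>f x\<bar>) \<in> L2_space M" for n
    using D(1)[of n] D(2) by (auto simp: L2_space_def)
  show "L2_norm M (\<lambda>x. \<bar>F n x\<bar> - \<bar>f x\<bar>) \<le> L2_norm M (\<lambda>x. F n x - f x)" for n
    by (rule L2_norm_mono(1)[OF _ L2_diff[OF D(1,2)]]) (use D(1)[of n] D(2) in \<open>auto simp: L2_space_def\<close>)
qed

text \<open>Indicator of the window in which two root densities \<open>1 + a\<close> and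
  \<open>1 + b\<close> both lie in \<open>[1/2, 3/2]\<close>. The radius is the one for which
  \<open>abs_ln_one_plus_x_minus_x_bound\<close> is available.\<close>

definition near :: "real \<Rightarrow> real \<Rightarrow> real" where
  "near a b = (if \<bar>a\<bar> \<le> 1/2 \<and> \<bar>b\<bar> \<le> 1/2 then 1 else 0)"

text \<open>Second-order Taylor quotient of \<open>ln (1 + x)\<close>, with the value that makes it
  continuous at \<open>0\<close>. The identity \<open>ln_lnrem\<close> is thereby exact for every
  \<open>x\<close>, and on the window the remainder is just a bounded factor.\<close>

definition lnrem :: "real \<Rightarrow> real" where
  "lnrem x = (if x = 0 then -1/2 else (ln (1 + x) - x) / x\<^sup>2)"

lemma ln_lnrem: "ln (1 + x) = x + x\<^sup>2 * lnrem x"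
  by (simp add: lnrem_def)

lemma lnrem_bound:
  assumes "\<bar>x\<bar> \<le> 1/2" shows "\<bar>lnrem x\<bar> \<le> 2"
proof (cases "x = 0")
  case False
  have "\<bar>ln (1 + x) - x\<bar> \<le> 2 * x\<^sup>2" by (rule abs_ln_one_plus_x_minus_x_bound[OF assms])
  then show ?thesis using False by (simp add: lnrem_def abs_divide field_simps)
qed (simp add: lnrem_def)

lemma isCont_lnrem: "isCont lnrem 0"
proof -
  have ev: "\<forall>\<^sub>F x in at 0. \<bar>x\<bar> < 1/2 \<and> x \<noteq> (0::real)"
    by (auto simp: eventually_at intro!: exI[of _ "1/2"])
  have "((\<lambda>x::real. (ln (1 + x) - x) / x\<^sup>2) \<longlongrightarrow> -1/2) (at 0)"
  proof (rule lhopital[where f'="\<lambda>x. 1 / (1 + x) - 1" and g'="\<lambda>x. 2 * x"])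
    show "((\<lambda>x::real. ln (1 + x) - x) \<longlongrightarrow> 0) (at 0)"
      by (rule tendsto_eq_intros refl | simp)+
    show "((\<lambda>x::real. x\<^sup>2) \<longlongrightarrow> 0) (at 0)" by (rule tendsto_eq_intros refl | simp)+
    show "\<forall>\<^sub>F x in at 0. x\<^sup>2 \<noteq> (0::real)" "\<forall>\<^sub>F x in at 0. 2 * x \<noteq> (0::real)"
      using ev by (auto elim: eventually_mono)
    show "\<forall>\<^sub>F x in at 0. ((\<lambda>x. ln (1 + x) - x) has_real_derivative 1 / (1 + x) - 1) (at x)"
      using ev by eventually_elim (auto intro!: derivative_eq_intros)
    show "\<forall>\<^sub>F x in at 0. ((\<lambda>x::real. x\<^sup>2) has_real_derivative 2 * x) (at x)"
      by (auto intro!: always_eventually derivative_eq_intros)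
    have "((\<lambda>x::real. - 1 / (2 * (1 + x))) \<longlongrightarrow> -1/2) (at 0)" by (rule tendsto_eq_intros refl | simp)+
    then show "((\<lambda>x::real. (1 / (1 + x) - 1) / (2 * x)) \<longlongrightarrow> -1/2) (at 0)"
    proof (rule Lim_transform_eventually)
      show "\<forall>\<^sub>F x in at 0. - 1 / (2 * (1 + x)) = (1 / (1 + x) - 1) / (2 * (x::real))"
        using ev
      proof eventually_elim
        case (elim x)
        then have "1 + x \<noteq> 0" by (auto simp: abs_if split: if_splits)
        then have "1 / (1 + x) - 1 = - x / (1 + x)" by (simp add: field_simps)
        then show ?case using elim by simp
      qed
    qed
  qed
  then have "(lnrem \<longlongrightarrow> -1/2) (at 0)"
    by (rule Lim_transform_eventually) (use ev in \<open>eventually_elim, auto simp: lnrem_def\<close>)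
  then show ?thesis by (simp add: isCont_def lnrem_def)
qed

lemma borel_measurable_near [measurable]: "case_prod near \<in> borel_measurable borel"
  unfolding near_def borel_prod[symmetric] by measurable

lemma borel_measurable_lnrem [measurable]: "lnrem \<in> borel_measurable borel"
  unfolding lnrem_def by measurable

lemma isCont_near: "isCont (case_prod near) (0, 0)"
proof -
  have "\<forall>\<^sub>F z in nhds (0, 0). (1::real) = case_prod near z"
  proof -
    have "open ({-1/2<..<1/2::real} \<times> {-1/2<..<1/2::real})" by (intro open_Times) auto
    then show ?thesis
      by (intro eventually_nhds[THEN iffD2] exI[of _ "{-1/2<..<1/2} \<times> {-1/2<..<1/2}"]) (auto simp: near_def)
  qed
  then have "(case_prod near \<longlongrightarrow> 1) (nhds (0, 0))"
    by (rule Lim_transform_eventually[OF tendsto_const])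
  then have "(case_prod near \<longlongrightarrow> 1) (at (0, 0))"
    by (rule tendsto_mono[OF at_within_le_nhds])
  then show ?thesis by (simp add: isCont_def near_def)
qed

section \<open>Continuous images of sequences converging in measure\<close>

context prob_space
begin

lemma tendsto_in_measure_const: "tendsto_in_measure M (\<lambda>_ _. c) c"
  by (simp add: tendsto_in_measure_def)

lemma tendsto_in_measure_continuous2:
  assumes U: "tendsto_in_measure M U u" and V: "tendsto_in_measure M V v"
    and m: "case_prod F \<in> borel_measurable borel" and c: "isCont (case_prod F) (u, v)"
  shows "tendsto_in_measure M (\<lambda>n x. F (U n x) (V n x)) (F u v)"
proof -
  have s: "tendsto_in_measure M (\<lambda>n x. U n x - u) 0" "tendsto_in_measure M (\<lambda>n x. V n x - v) 0"
    using U V unfolding tendsto_in_measure_def by (auto intro!: borel_measurable_diff)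
  have "tendsto_in_measure M (\<lambda>n x. F (u + (U n x - u)) (v + (V n x - v))) (F u v)"
  proof (rule tendsto_in_measure_compose[OF s])
    have "(\<lambda>z. case_prod F (u + fst z, v + snd z)) \<in> borel_measurable (borel :: (real \<times> real) measure)"
      by (rule measurable_compose[OF _ m]) (intro borel_measurable_continuous_onI continuous_intros)
    then show "(\<lambda>(x, y). F (u + x) (v + y)) \<in> borel_measurable borel" by (simp add: case_prod_beta')
    fix e :: real assume "e > 0"
    then obtain d where d: "d > 0" "\<And>z. dist z (u, v) < d \<Longrightarrow> dist (case_prod F z) (F u v) < e"
      using c by (auto simp: continuous_at_eps_delta)
    show "\<exists>r>0. \<forall>x y. \<bar>x\<bar> < r \<longrightarrow> \<bar>y\<bar> < r \<longrightarrow> \<bar>F (u + x) (v + y) - F u v\<bar> < e"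
    proof (intro exI[of _ "d/2"] conjI allI impI)
      fix x y assume xy: "\<bar>x\<bar> < d/2" "\<bar>y\<bar> < d/2"
      have "dist (u + x, v + y) (u, v) \<le> \<bar>x\<bar> + \<bar>y\<bar>"
        using sqrt_sum_squares_le_sum_abs[of x y] by (simp add: dist_Pair_Pair dist_real_def)
      then show "\<bar>F (u + x) (v + y) - F u v\<bar> < e"
        using d(2)[of "(u + x, v + y)"] xy by (simp add: dist_real_def)
    qed (use d in auto)
  qed
  then show ?thesis by simp
qed

lemma tendsto_in_measure_compose1:
  assumes U: "tendsto_in_measure M U u" and m: "f \<in> borel_measurable borel" and c: "isCont f u"
  shows "tendsto_in_measure M (\<lambda>n x. f (U n x)) (f u)"
proof (rule tendsto_in_measure_continuous2[OF U tendsto_in_measure_const[of 0], where F="\<lambda>x y. f x"])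
  have "(\<lambda>z. f (fst z)) \<in> borel_measurable (borel :: (real \<times> real) measure)"
    by (rule measurable_compose[OF _ m]) (intro borel_measurable_continuous_onI continuous_intros)
  then show "(\<lambda>(x, y). f x) \<in> borel_measurable (borel :: (real \<times> real) measure)" by (simp add: case_prod_beta')
  show "isCont (\<lambda>(x, y). f x) (u, 0::real)"
    using isCont_o2[of "(u, 0::real)" fst f] c by (simp add: case_prod_beta')
qed

lemma tendsto_in_measure_add:
  assumes "tendsto_in_measure M U u" "tendsto_in_measure M V v"
  shows "tendsto_in_measure M (\<lambda>n x. U n x + V n x) (u + v)"
proof (rule tendsto_in_measure_continuous2[OF assms])
  show "(\<lambda>(x, y). x + y) \<in> borel_measurable (borel :: (real \<times> real) measure)"
    unfolding case_prod_beta' by (intro borel_measurable_continuous_onI continuous_intros)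
  show "isCont (\<lambda>(x, y). x + y) (u, v)" unfolding case_prod_beta' by (intro continuous_intros)
qed

lemma tendsto_in_measure_mult:
  assumes "tendsto_in_measure M U u" "tendsto_in_measure M V v"
  shows "tendsto_in_measure M (\<lambda>n x. U n x * V n x) (u * v)"
proof (rule tendsto_in_measure_continuous2[OF assms])
  show "(\<lambda>(x, y). x * y) \<in> borel_measurable (borel :: (real \<times> real) measure)"
    unfolding case_prod_beta' by (intro borel_measurable_continuous_onI continuous_intros)
  show "isCont (\<lambda>(x, y). x * y) (u, v)" unfolding case_prod_beta' by (intro continuous_intros)
qed

text \<open>Products of \<open>L2\<close>-convergent sequences are uniformly integrable, and the
  complement of the window has vanishing probability. With absolute values inside, the integral can
  serve as an error bound.\<close>

lemma L2_mult_far: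
  assumes F: "L2_tendsto M F f" and G: "L2_tendsto M G g"
    and ab: "tendsto_in_measure M a 0" "tendsto_in_measure M b 0"
  shows "(\<lambda>n. \<integral>x. \<bar>F n x\<bar> * \<bar>G n x\<bar> * (1 - near (a n x) (b n x)) \<partial>M) \<longlonglongrightarrow> 0"
proof -
  have W: "tendsto_in_measure M (\<lambda>n x. near (a n x) (b n x)) 1"
    using tendsto_in_measure_continuous2[OF ab borel_measurable_near isCont_near] by (simp add: near_def)
  have "tendsto_in_measure M (\<lambda>n x. 1 - near (a n x) (b n x)) 0"
    using tendsto_in_measure_add[OF tendsto_in_measure_const[of 1] tendsto_in_measure_mult[OF tendsto_in_measure_const[of "-1"] W]]
    by simp
  from L2_tendsto_inner_bounded[OF L2_tendsto_abs[OF F] L2_tendsto_abs[OF G] this, of 1]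
  show ?thesis by (simp add: near_def)
qed

end

text \<open>A sequence of measures whose square-root densities with respect to \<open>M\<close> expand with
  tangent \<open>h\<close>; only the absolutely continuous parts \<open>(\<xi> n)\<^sup>2\<close> enter, as lower bounds.\<close>

definition local_seq :: "'a measure \<Rightarrow> (nat \<Rightarrow> 'a measure) \<Rightarrow> ('a \<Rightarrow> real) \<Rightarrow> bool" where
  "local_seq M A h \<longleftrightarrow> (\<forall>n. prob_space (A n) \<and> sets (A n) = sets M) \<and> h \<in> L2_space M \<and>
     (\<exists>\<xi>. (\<forall>n. dominates (A n) (\<lambda>x. ennreal ((\<xi> n x)\<^sup>2)) M) \<and> (\<forall>n. \<xi> n \<in> L2_space M) \<and>
        L2_tendsto M (\<lambda>n x. sqrt (real n) * (\<xi> n x - 1)) (\<lambda>x. h x / 2) \<and>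
        (\<lambda>n. real n * ((\<integral>x. (\<xi> n x)\<^sup>2 \<partial>M) - 1)) \<longlonglongrightarrow> 0)"

text \<open>\<open>1 + a n\<close> and \<open>1 + b n\<close> stand for the square roots of the
  absolutely continuous parts of two sequences of measures; \<open>\<alpha>\<close> and
  \<open>\<beta>\<close> are the deviations on the scale \<open>1 / sqrt n\<close>, so
  \<open>\<alpha>\<close> is not the level here. The mass conditions say that only
  \<open>o(1/n)\<close> is missing from these parts.\<close>

locale local_pair = prob_space M for M :: "'a measure" +
  fixes a b \<alpha> \<beta> :: "nat \<Rightarrow> 'a \<Rightarrow> real" and h\<alpha> h\<beta> :: "'a \<Rightarrow> real"
  assumes \<alpha>_def: "\<alpha> = (\<lambda>n x. sqrt (real n) * a n x)" and \<beta>_def: "\<beta> = (\<lambda>n x. sqrt (real n) * b n x)"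
    and aL: "\<And>n. a n \<in> L2_space M" and bL: "\<And>n. b n \<in> L2_space M"
    and \<alpha>: "L2_tendsto M \<alpha> h\<alpha>" and \<beta>: "L2_tendsto M \<beta> h\<beta>"
    and massa: "(\<lambda>n. real n * ((\<integral>x. (1 + a n x)\<^sup>2 \<partial>M) - 1)) \<longlonglongrightarrow> 0"
    and massb: "(\<lambda>n. real n * ((\<integral>x. (1 + b n x)\<^sup>2 \<partial>M) - 1)) \<longlonglongrightarrow> 0"
begin

lemma \<alpha>L: "\<alpha> n \<in> L2_space M" and \<beta>L: "\<beta> n \<in> L2_space M"
  using L2_tendstoD(1)[OF \<alpha>] L2_tendstoD(1)[OF \<beta>] by auto

lemma ab_measurable [measurable]:
  "a n \<in> borel_measurable M" "b n \<in> borel_measurable M" "\<alpha> n \<in> borel_measurable M" "\<beta> n \<in> borel_measurable M"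
  using aL bL \<alpha>L \<beta>L by (auto simp: L2_space_def)

lemma scaled_L2_tendsto_0:
  assumes "L2_tendsto M \<gamma> h" "\<gamma> = (\<lambda>n x. sqrt (real n) * c n x)" and [measurable]: "\<And>n. c n \<in> borel_measurable M"
  shows "tendsto_in_measure M c 0"
proof -
  have t: "tendsto_in_measure M (\<lambda>n x. \<gamma> n x / sqrt (real n)) 0" by (rule L2_tendsto_imp_small[OF assms(1)])
  show ?thesis unfolding tendsto_in_measure_def
  proof (intro conjI allI impI)
    fix e :: real assume "0 < e"
    then have "(\<lambda>n. prob {x \<in> space M. e \<le> \<bar>\<gamma> n x / sqrt (real n) - 0\<bar>}) \<longlonglongrightarrow> 0"
      using t by (auto simp: tendsto_in_measure_def)
    \<comment> \<open>Only \<open>n = 0\<close> has to be left out, where the factor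
      \<open>sqrt n\<close> erases \<open>c n\<close>.\<close>
    then show "(\<lambda>n. prob {x \<in> space M. e \<le> \<bar>c n x - 0\<bar>}) \<longlonglongrightarrow> 0"
      by (rule Lim_transform_eventually) (auto intro!: eventually_sequentiallyI[of 1] simp: assms(2))
  qed simp
qed

lemma a_tendsto_0: "tendsto_in_measure M a 0" by (rule scaled_L2_tendsto_0[OF \<alpha> \<alpha>_def]) measurable
lemma b_tendsto_0: "tendsto_in_measure M b 0" by (rule scaled_L2_tendsto_0[OF \<beta> \<beta>_def]) measurable

definition W :: "nat \<Rightarrow> 'a \<Rightarrow> real" where "W n x = near (a n x) (b n x)"

lemma W_cases: "W n x = 0 \<or> W n x = 1" "0 \<le> W n x" "W n x \<le> 1" by (auto simp: W_def near_def)

lemma W_eq_1D: "W n x = 1 \<Longrightarrow> \<bar>a n x\<bar> \<le> 1/2 \<and> \<bar>b n x\<bar> \<le> 1/2"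
  by (auto simp: W_def near_def split: if_splits)

lemma W_eq_0D: "W n x = 0 \<Longrightarrow> 1/2 < \<bar>a n x\<bar> \<or> 1/2 < \<bar>b n x\<bar>"
  by (auto simp: W_def near_def split: if_splits)

lemma W_measurable [measurable]: "W n \<in> borel_measurable M"
  unfolding W_def near_def by measurable

lemma W_tendsto_1: "tendsto_in_measure M W 1"
  using tendsto_in_measure_continuous2[OF a_tendsto_0 b_tendsto_0 borel_measurable_near isCont_near]
  by (simp add: near_def W_def[abs_def])

lemmas far_tendsto_0 = L2_mult_far[OF _ _ a_tendsto_0 b_tendsto_0, folded W_def]

lemma lnrem_a_tendsto: "tendsto_in_measure M (\<lambda>n x. lnrem (a n x)) (-1/2)"
  using tendsto_in_measure_compose1[OF a_tendsto_0 borel_measurable_lnrem isCont_lnrem] by (simp add: lnrem_def)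

lemma lnrem_b_tendsto: "tendsto_in_measure M (\<lambda>n x. lnrem (b n x)) (-1/2)"
  using tendsto_in_measure_compose1[OF b_tendsto_0 borel_measurable_lnrem isCont_lnrem] by (simp add: lnrem_def)

lemmas in_measure_intros = tendsto_in_measure_add tendsto_in_measure_mult tendsto_in_measure_const a_tendsto_0 b_tendsto_0 lnrem_a_tendsto lnrem_b_tendsto W_tendsto_1

text \<open>The density of the first sequence cut down to the window. The second sequence enters
  only through the window, which makes the log ratio bounded wherever \<open>D\<close> is
  positive.\<close>

definition D :: "nat \<Rightarrow> 'a \<Rightarrow> real" where "D n x = W n x * (1 + a n x)\<^sup>2"

lemma D_measurable [measurable]: "D n \<in> borel_measurable M" unfolding D_def by measurable

lemma D_bounds: "0 \<le> D n x" "D n x \<le> 4"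
proof -
  show "0 \<le> D n x" using W_cases(2) by (simp add: D_def)
  show "D n x \<le> 4"
  proof (cases "W n x = 1")
    case True
    then have "\<bar>1 + a n x\<bar> \<le> 2" using W_eq_1D[OF True] by linarith
    then have "(1 + a n x)\<^sup>2 \<le> 2\<^sup>2" by (metis abs_le_square_iff abs_numeral)
    then show ?thesis using True by (simp add: D_def)
  next
    case False
    then have "W n x = 0" using W_cases(1)[of n x] by blast
    then show ?thesis by (simp add: D_def)
  qed
qed

lemma abs_D: "\<bar>D n x\<bar> \<le> 4" using D_bounds[of n x] by simp

lemma D_tendsto_1: "tendsto_in_measure M D 1"
proof -
  have "tendsto_in_measure M (\<lambda>n x. W n x * ((1 + a n x) * (1 + a n x))) (1 * ((1 + 0) * (1 + 0)))"
    by (intro in_measure_intros)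
  then show ?thesis by (simp add: D_def[abs_def] power2_eq_square)
qed

definition mass :: "nat \<Rightarrow> real" where "mass n = (\<integral>x. D n x \<partial>M)"

lemma D_integrable: "integrable M (D n)"
  by (rule integrable_const_bound[of _ 4]) (auto simp: abs_D)

lemma mass_nonneg: "0 \<le> mass n" unfolding mass_def using D_bounds by (auto intro!: integral_nonneg_AE)

lemma square_integrable: "integrable M (\<lambda>x. (1 + a n x)\<^sup>2)" "integrable M (\<lambda>x. (1 + b n x)\<^sup>2)"
  using L2_add[OF L2_const[of 1] aL[of n]] L2_add[OF L2_const[of 1] bL[of n]] by (auto simp: L2_space_def)

lemma \<alpha>\<beta>_square: "(\<alpha> n x)\<^sup>2 = real n * (a n x)\<^sup>2" "(\<beta> n x)\<^sup>2 = real n * (b n x)\<^sup>2"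
  by (auto simp: \<alpha>_def \<beta>_def power_mult_distrib)

text \<open>Off the window \<open>|a|\<close> or \<open>|b|\<close> exceeds \<open>1/2\<close>, so a
  factor \<open>sqrt n\<close> can be traded for deviations. This turns terms of order
  \<open>sqrt n\<close> into products of the kind that \<open>far_tendsto_0\<close> makes
  vanish.\<close>

lemma sqrt_le_of_far: "W n x = 0 \<Longrightarrow> sqrt (real n) \<le> 2 * (\<bar>\<alpha> n x\<bar> + \<bar>\<beta> n x\<bar>)"
proof -
  assume "W n x = 0"
  then have "1 \<le> 2 * (\<bar>a n x\<bar> + \<bar>b n x\<bar>)" using W_eq_0D[of n x] by auto
  then have "sqrt (real n) * 1 \<le> sqrt (real n) * (2 * (\<bar>a n x\<bar> + \<bar>b n x\<bar>))" by (intro mult_left_mono) auto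
  then show ?thesis by (simp add: \<alpha>_def \<beta>_def abs_mult algebra_simps)
qed

lemma prod_bdd_int:
  assumes "F \<in> L2_space M" "G \<in> L2_space M" "U \<in> borel_measurable M" "\<And>x. x \<in> space M \<Longrightarrow> \<bar>U x\<bar> \<le> C"
  shows "integrable M (\<lambda>x. F x * G x * U x)"
  using L2_mult_integrable[OF assms(1) L2_bounded_mult[OF assms(2-4)]] by (simp add: mult.assoc)

lemma abs_L2: "F \<in> L2_space M \<Longrightarrow> (\<lambda>x. \<bar>F x\<bar>) \<in> L2_space M"
  by (auto simp: L2_space_def)

lemma far_int:
  assumes "F \<in> L2_space M" "G \<in> L2_space M"
  shows "integrable M (\<lambda>x. \<bar>F x\<bar> * \<bar>G x\<bar> * (1 - W n x))"
  by (rule prod_bdd_int[OF abs_L2[OF assms(1)] abs_L2[OF assms(2)], of _ 1]) (use W_cases in auto)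

text \<open>The deficit consists of what is missing from \<open>(1 + a)^2\<close> and of its mass
  off the window. Off the window \<open>n\<close> times the density is at most
  \<open>10 (\<alpha>^2 + \<beta>^2)\<close>, whose integral there vanishes. The rate matters
  because the mass will be raised to a power of order \<open>n\<close>.\<close>

lemma mass_lim: "(\<lambda>n. real n * (1 - mass n)) \<longlonglongrightarrow> 0"
proof -
  let ?e = "\<lambda>n. 10 * ((\<integral>x. \<bar>\<alpha> n x\<bar> * \<bar>\<alpha> n x\<bar> * (1 - W n x) \<partial>M) + (\<integral>x. \<bar>\<beta> n x\<bar> * \<bar>\<beta> n x\<bar> * (1 - W n x) \<partial>M))"
  have "?e \<longlonglongrightarrow> 10 * (0 + 0)" by (intro tendsto_intros far_tendsto_0[OF \<alpha> \<alpha>] far_tendsto_0[OF \<beta> \<beta>])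
  then have e: "?e \<longlonglongrightarrow> 0" by simp
  have le: "real n * (\<integral>x. (1 - W n x) * (1 + a n x)\<^sup>2 \<partial>M) \<le> ?e n" for n
  proof -
    have i: "integrable M (\<lambda>x. (1 - W n x) * (1 + a n x)\<^sup>2)"
      using L2_bounded_mult[OF L2_add[OF L2_const[of 1] aL[of n]], of "\<lambda>x. 1 - W n x" 1] W_cases[of n]
        Bochner_Integration.integrable_diff[OF square_integrable(1)[of n] D_integrable[of n]] by (simp add: D_def algebra_simps)
    have "real n * (\<integral>x. (1 - W n x) * (1 + a n x)\<^sup>2 \<partial>M) = (\<integral>x. real n * ((1 - W n x) * (1 + a n x)\<^sup>2) \<partial>M)" by simp
    also have "\<dots> \<le> (\<integral>x. 10 * (\<bar>\<alpha> n x\<bar> * \<bar>\<alpha> n x\<bar> * (1 - W n x) + \<bar>\<beta> n x\<bar> * \<bar>\<beta> n x\<bar> * (1 - W n x)) \<partial>M)"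
    proof (rule integral_mono)
      show "integrable M (\<lambda>x. 10 * (\<bar>\<alpha> n x\<bar> * \<bar>\<alpha> n x\<bar> * (1 - W n x) + \<bar>\<beta> n x\<bar> * \<bar>\<beta> n x\<bar> * (1 - W n x)))"
        by (intro integrable_mult_right Bochner_Integration.integrable_add far_int \<alpha>L \<beta>L)
      show "real n * ((1 - W n x) * (1 + a n x)\<^sup>2) \<le>
          10 * (\<bar>\<alpha> n x\<bar> * \<bar>\<alpha> n x\<bar> * (1 - W n x) + \<bar>\<beta> n x\<bar> * \<bar>\<beta> n x\<bar> * (1 - W n x))" for x
      proof (cases "W n x = 1")
        case False
        then have W0: "W n x = 0" using W_cases(1)[of n x] by blast
        \<comment> \<open>\<open>(1 + a)^2 \<le> 2 + 2 a^2\<close>, and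
          \<open>1 \<le> 4 (a^2 + b^2)\<close> off the window: the constant is
          \<open>8 + 2\<close>.\<close>
        have "(1 + a n x)\<^sup>2 \<le> 10 * ((a n x)\<^sup>2 + (b n x)\<^sup>2)"
        proof -
          have "1 \<le> 4 * (a n x)\<^sup>2 \<or> 1 \<le> 4 * (b n x)\<^sup>2"
            using W_eq_0D[OF W0] abs_le_square_iff[of "1/2" "a n x"] abs_le_square_iff[of "1/2" "b n x"]
            by (auto simp: power_divide)
          then have "1 \<le> 4 * ((a n x)\<^sup>2 + (b n x)\<^sup>2)"
            by (auto simp: distrib_left intro: add_increasing add_increasing2)
          moreover have "(1 + a n x)\<^sup>2 \<le> 2 + 2 * (a n x)\<^sup>2"
            using sum_squares_bound[of 1 "a n x"] by (simp add: power2_sum)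
          ultimately show ?thesis
            using zero_le_power2[of "b n x"] unfolding distrib_left by linarith
        qed
        then have "real n * (1 + a n x)\<^sup>2 \<le> real n * (10 * ((a n x)\<^sup>2 + (b n x)\<^sup>2))" by (rule mult_left_mono) simp
        then show ?thesis using W0 by (simp add: abs_mult[symmetric] power2_eq_square[symmetric] \<alpha>\<beta>_square algebra_simps)
      qed simp
    qed (use i in simp)
    also have "\<dots> = ?e n"
      by (simp only: integral_mult_right_zero Bochner_Integration.integral_add[OF far_int[OF \<alpha>L \<alpha>L] far_int[OF \<beta>L \<beta>L]])
    finally show ?thesis .
  qed
  have "0 \<le> real n * (\<integral>x. (1 - W n x) * (1 + a n x)\<^sup>2 \<partial>M)" for n
    using W_cases by (intro mult_nonneg_nonneg integral_nonneg_AE) auto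
  then have l2: "(\<lambda>n. real n * (\<integral>x. (1 - W n x) * (1 + a n x)\<^sup>2 \<partial>M)) \<longlonglongrightarrow> 0"
    by (intro tendsto_sandwich[OF _ _ tendsto_const e] always_eventually allI le)
  have "real n * (1 - mass n) = - (real n * ((\<integral>x. (1 + a n x)\<^sup>2 \<partial>M) - 1)) + real n * (\<integral>x. (1 - W n x) * (1 + a n x)\<^sup>2 \<partial>M)" for n
  proof -
    have "(\<integral>x. (1 - W n x) * (1 + a n x)\<^sup>2 \<partial>M) = (\<integral>x. (1 + a n x)\<^sup>2 - D n x \<partial>M)"
      by (simp add: D_def algebra_simps)
    also have "\<dots> = (\<integral>x. (1 + a n x)\<^sup>2 \<partial>M) - mass n"
      unfolding mass_def by (rule Bochner_Integration.integral_diff[OF square_integrable(1) D_integrable])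
    finally have eq: "(\<integral>x. (1 - W n x) * (1 + a n x)\<^sup>2 \<partial>M) = (\<integral>x. (1 + a n x)\<^sup>2 \<partial>M) - mass n" .
    show ?thesis unfolding eq by (simp add: algebra_simps)
  qed
  then show ?thesis using tendsto_add[OF tendsto_minus[OF massa] l2] by simp
qed

lemma mass_1: "mass \<longlonglongrightarrow> 1"
proof -
  have "(\<lambda>n. (real n * (1 - mass n)) * inverse (real n)) \<longlonglongrightarrow> 0 * 0"
    by (intro tendsto_mult mass_lim lim_inverse_n)
  moreover have "\<forall>\<^sub>F n in sequentially. (real n * (1 - mass n)) * inverse (real n) = 1 - mass n"
    by (intro eventually_sequentiallyI[of 1]) (simp add: field_simps)
  ultimately have "(\<lambda>n. 1 - mass n) \<longlonglongrightarrow> 0" by (simp add: tendsto_cong)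
  from tendsto_diff[OF tendsto_const[of 1] this] show ?thesis by simp
qed

text \<open>The fallback \<open>M\<close> keeps every \<open>\<mu> n\<close> a probability measure;
  by \<open>mass_1\<close> it occurs for finitely many \<open>n\<close> only.\<close>

definition \<mu> :: "nat \<Rightarrow> 'a measure" where
  "\<mu> n = (if mass n > 0 then density M (\<lambda>x. ennreal (D n x / mass n)) else M)"

lemma sets_\<mu> [measurable_cong, simp]: "sets (\<mu> n) = sets M" by (simp add: \<mu>_def)

lemma prob_\<mu>: "prob_space (\<mu> n)"
proof (cases "mass n > 0")
  case True
  have "emeasure (density M (\<lambda>x. ennreal (D n x / mass n))) (space M) = (\<integral>\<^sup>+x. ennreal (D n x / mass n) \<partial>M)"
    by (subst emeasure_density) (auto intro!: nn_integral_cong)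
  also have "\<dots> = ennreal (\<integral>x. D n x / mass n \<partial>M)"
    using D_bounds True by (intro nn_integral_eq_integral) (auto intro!: D_integrable)
  also have "\<dots> = 1" using True by (simp add: mass_def)
  finally show ?thesis using True by (auto intro!: prob_spaceI simp: \<mu>_def)
qed (simp add: \<mu>_def prob_space_axioms)

lemma integral_\<mu>:
  fixes f :: "'a \<Rightarrow> real"
  assumes "f \<in> borel_measurable M" "mass n > 0"
  shows "(\<integral>x. f x \<partial>\<mu> n) = (\<integral>x. f x * D n x \<partial>M) / mass n"
proof -
  have "(\<integral>x. f x \<partial>\<mu> n) = (\<integral>x. (D n x / mass n) *\<^sub>R f x \<partial>M)"
    using assms D_bounds by (simp add: \<mu>_def integral_density)
  also have "\<dots> = (\<integral>x. f x * D n x / mass n \<partial>M)" by (simp add: mult.commute)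
  finally show ?thesis by simp
qed

lemma L2_\<mu>:
  assumes "f \<in> L2_space M" shows "f \<in> L2_space (\<mu> n)"
proof (cases "mass n > 0")
  case True
  have [measurable]: "f \<in> borel_measurable M" using assms by (simp add: L2_space_def)
  have "integrable M (\<lambda>x. (f x * f x) * (D n x / mass n))"
    by (rule prod_bdd_int[OF assms assms, of _ "4 / mass n"])
       (use True D_bounds in \<open>auto simp: abs_divide divide_right_mono\<close>)
  then have "integrable (\<mu> n) (\<lambda>x. (f x)\<^sup>2)"
    using True D_bounds by (simp add: \<mu>_def integrable_density power2_eq_square mult.commute)
  then show ?thesis by (simp add: L2_space_def)
qed (use assms in \<open>simp add: \<mu>_def\<close>)

lemma \<mu>_limit:
  assumes "\<And>n. f n \<in> borel_measurable M" "(\<lambda>n. real n * (\<integral>x. f n x * D n x \<partial>M)) \<longlonglongrightarrow> (L::real)"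
  shows "(\<lambda>n. real n * (\<integral>x. f n x \<partial>\<mu> n)) \<longlonglongrightarrow> L"
proof -
  have "(\<lambda>n. real n * (\<integral>x. f n x * D n x \<partial>M) / mass n) \<longlonglongrightarrow> L / 1"
    by (intro tendsto_divide assms mass_1) simp
  moreover have "\<forall>\<^sub>F n in sequentially. real n * (\<integral>x. f n x * D n x \<partial>M) / mass n = real n * (\<integral>x. f n x \<partial>\<mu> n)"
  proof -
    have "\<forall>\<^sub>F n in sequentially. mass n > 0" using order_tendstoD(1)[OF mass_1, of 0] by simp
    then show ?thesis by eventually_elim (simp add: integral_\<mu>[OF assms(1)])
  qed
  ultimately show ?thesis using Lim_transform_eventually by fastforce
qed

end

lemma integral_add_diff3:
  fixes f g h :: "'a \<Rightarrow> real"
  assumes "integrable M f" "integrable M g" "integrable M h"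
  shows "(\<integral>x. f x - g x + c * h x \<partial>M) = (\<integral>x. f x \<partial>M) - (\<integral>x. g x \<partial>M) + c * (\<integral>x. h x \<partial>M)"
  using assms by simp

lemma integral_add_diff6:
  fixes f1 :: "'a \<Rightarrow> real"
  assumes "integrable M f1" "integrable M f2" "integrable M f3" "integrable M f4" "integrable M f5" "integrable M f6"
  shows "(\<integral>x. c * f1 x - c * f2 x - f3 x + f4 x + f5 x - f6 x \<partial>M) =
    c * (\<integral>x. f1 x \<partial>M) - c * (\<integral>x. f2 x \<partial>M) - (\<integral>x. f3 x \<partial>M) + (\<integral>x. f4 x \<partial>M) + (\<integral>x. f5 x \<partial>M) - (\<integral>x. f6 x \<partial>M)"
  using assms by simp

section \<open>Moments of the log-likelihood ratio and of the scores under the cut measures\<close>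

context local_pair
begin

lemma \<alpha>\<beta>_eq: "\<alpha> n x = sqrt (real n) * a n x" "\<beta> n x = sqrt (real n) * b n x"
  by (simp_all add: \<alpha>_def \<beta>_def)

text \<open>The log-likelihood ratio \<open>ln ((1 + b)^2 / (1 + a)^2)\<close> of the absolutely
  continuous parts, set to \<open>0\<close> where \<open>D\<close> vanishes because of the
  window.\<close>

definition X :: "nat \<Rightarrow> 'a \<Rightarrow> real" where "X n x = 2 * (ln (1 + b n x) - ln (1 + a n x)) * W n x"

lemma X_eq: "X n x = 2 * ((b n x + (b n x * b n x) * lnrem (b n x)) + (-1) * (a n x + (a n x * a n x) * lnrem (a n x))) * W n x"
  unfolding X_def ln_lnrem by (simp add: power2_eq_square)

lemma Xm [measurable]: "X n \<in> borel_measurable M" unfolding X_def by measurable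

lemma X_tendsto_0: "tendsto_in_measure M X 0"
proof -
  have "tendsto_in_measure M X (2 * ((0 + (0 * 0) * (-1/2)) + (-1) * (0 + (0 * 0) * (-1/2))) * 1)"
    unfolding X_eq[abs_def] by (intro in_measure_intros)
  then show ?thesis by simp
qed

text \<open>Half of \<open>sqrt n X\<close>, arranged as \<open>L2\<close>-convergent sequences
  times bounded factors that tend to \<open>1\<close> in measure, the form to which
  \<open>L2_tendsto_mult_bounded\<close> applies.\<close>

definition Z :: "nat \<Rightarrow> 'a \<Rightarrow> real" where
  "Z n x = \<beta> n x * ((1 + b n x * lnrem (b n x)) * W n x) - \<alpha> n x * ((1 + a n x * lnrem (a n x)) * W n x)"

lemma X_Z: "sqrt (real n) * X n x = 2 * Z n x"
  unfolding X_eq Z_def \<alpha>\<beta>_eq by (simp add: algebra_simps)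

lemma lnrem_factor_bound:
  "\<bar>(1 + b n x * lnrem (b n x)) * W n x\<bar> \<le> 2" "\<bar>(1 + a n x * lnrem (a n x)) * W n x\<bar> \<le> 2"
proof -
  have *: "\<bar>1 + y * lnrem y\<bar> \<le> 2" if "\<bar>y\<bar> \<le> 1/2" for y
  proof -
    have "\<bar>y\<bar> * \<bar>lnrem y\<bar> \<le> 1/2 * 2" by (intro mult_mono that lnrem_bound) auto
    then show ?thesis by (simp add: abs_mult[symmetric])
  qed
  show "\<bar>(1 + b n x * lnrem (b n x)) * W n x\<bar> \<le> 2" "\<bar>(1 + a n x * lnrem (a n x)) * W n x\<bar> \<le> 2"
    using W_cases(1)[of n x] W_eq_1D[of n x] *[of "a n x"] *[of "b n x"] by auto
qed

lemma Z_tendsto: "L2_tendsto M Z (\<lambda>x. h\<beta> x - h\<alpha> x)"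
proof -
  have "L2_tendsto M (\<lambda>n x. \<beta> n x * ((1 + b n x * lnrem (b n x)) * W n x)) (\<lambda>x. (1 + 0 * (-1/2)) * 1 * h\<beta> x)"
    by (rule L2_tendsto_mult_bounded[OF \<beta> _ lnrem_factor_bound(1)]) (intro in_measure_intros)
  moreover have "L2_tendsto M (\<lambda>n x. \<alpha> n x * ((1 + a n x * lnrem (a n x)) * W n x)) (\<lambda>x. (1 + 0 * (-1/2)) * 1 * h\<alpha> x)"
    by (rule L2_tendsto_mult_bounded[OF \<alpha> _ lnrem_factor_bound(2)]) (intro in_measure_intros)
  ultimately show ?thesis unfolding Z_def[abs_def] using L2_tendsto_diff by fastforce
qed

lemma X_bound: "\<bar>X n x\<bar> \<le> 4"
proof -
  have *: "\<bar>ln (1 + y)\<bar> \<le> 1" if "\<bar>y\<bar> \<le> 1/2" for y :: real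
  proof -
    have "\<bar>ln (1 + y) - y\<bar> \<le> 2 * y\<^sup>2" by (rule abs_ln_one_plus_x_minus_x_bound[OF that])
    moreover have "y\<^sup>2 \<le> (1/2)\<^sup>2" using that by (metis abs_le_square_iff abs_of_nonneg zero_le_divide_1_iff zero_le_numeral)
    ultimately show ?thesis using that by (simp add: power_divide)
  qed
  show ?thesis
    using W_cases(1)[of n x] W_eq_1D[of n x] *[of "a n x"] *[of "b n x"] by (auto simp: X_def abs_mult)
qed

lemma n_X2: "real n * (X n x)\<^sup>2 = 4 * (Z n x * Z n x)"
proof -
  have "real n * (X n x)\<^sup>2 = (sqrt (real n) * X n x)\<^sup>2" by (simp add: power_mult_distrib)
  then show ?thesis unfolding X_Z by (simp add: power2_eq_square)
qed

lemma lim_X2: "(\<lambda>n. real n * (\<integral>x. (X n x)\<^sup>2 * D n x \<partial>M)) \<longlonglongrightarrow> 4 * (\<integral>x. (h\<beta> x - h\<alpha> x)\<^sup>2 \<partial>M)"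
proof -
  have "(\<lambda>n. 4 * (\<integral>x. Z n x * Z n x * D n x \<partial>M)) \<longlonglongrightarrow> 4 * (1 * (\<integral>x. (h\<beta> x - h\<alpha> x) * (h\<beta> x - h\<alpha> x) \<partial>M))"
    by (intro tendsto_mult_left L2_tendsto_inner_bounded[OF Z_tendsto Z_tendsto D_tendsto_1 abs_D])
  moreover have "real n * (\<integral>x. (X n x)\<^sup>2 * D n x \<partial>M) = 4 * (\<integral>x. Z n x * Z n x * D n x \<partial>M)" for n
  proof -
    have "real n * (\<integral>x. (X n x)\<^sup>2 * D n x \<partial>M) = (\<integral>x. (real n * (X n x)\<^sup>2) * D n x \<partial>M)" by (simp add: mult.assoc)
    then show ?thesis unfolding n_X2 by (simp add: mult.assoc)
  qed
  ultimately show ?thesis by (simp add: power2_eq_square)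
qed

lemma min_cube: "min (y\<^sup>2) (\<bar>y\<bar> ^ 3) = y\<^sup>2 * min 1 \<bar>y :: real\<bar>"
  by (simp add: mult_min_right power3_eq_cube power2_eq_square)

lemma D_min_tendsto_0: "tendsto_in_measure M U 0 \<Longrightarrow> tendsto_in_measure M (\<lambda>n x. D n x * min 1 \<bar>U n x\<bar>) 0"
proof -
  assume U: "tendsto_in_measure M U 0"
  have "tendsto_in_measure M (\<lambda>n x. min 1 \<bar>U n x\<bar>) (min 1 \<bar>0\<bar>)"
    by (rule tendsto_in_measure_compose1[OF U]) (auto intro!: continuous_intros)
  from tendsto_in_measure_mult[OF D_tendsto_1 this] show ?thesis by simp
qed

lemma Dmin_bound: "\<bar>D n x * min 1 \<bar>y\<bar>\<bar> \<le> 4"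
proof -
  have "\<bar>D n x\<bar> * \<bar>min 1 \<bar>y\<bar>\<bar> \<le> 4 * 1" by (intro mult_mono abs_D) auto
  then show ?thesis by (simp add: abs_mult)
qed

text \<open>By \<open>min_cube\<close> the integrand is \<open>X^2 min 1 |X|\<close>. Here
  \<open>n X^2 = 4 Z^2\<close> is a product of \<open>L2\<close>-convergent sequences, and the extra
  factor is bounded and tends to \<open>0\<close> in measure.\<close>

lemma lim_X3: "(\<lambda>n. real n * (\<integral>x. min ((X n x)\<^sup>2) (\<bar>X n x\<bar> ^ 3) * D n x \<partial>M)) \<longlonglongrightarrow> 0"
proof -
  have "(\<lambda>n. 4 * (\<integral>x. Z n x * Z n x * (D n x * min 1 \<bar>X n x\<bar>) \<partial>M)) \<longlonglongrightarrow> 4 * (0 * (\<integral>x. (h\<beta> x - h\<alpha> x) * (h\<beta> x - h\<alpha> x) \<partial>M))"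
    by (intro tendsto_mult_left L2_tendsto_inner_bounded[OF Z_tendsto Z_tendsto D_min_tendsto_0[OF X_tendsto_0] Dmin_bound])
  moreover have "real n * (\<integral>x. min ((X n x)\<^sup>2) (\<bar>X n x\<bar> ^ 3) * D n x \<partial>M) = 4 * (\<integral>x. Z n x * Z n x * (D n x * min 1 \<bar>X n x\<bar>) \<partial>M)" for n
  proof -
    have "real n * (\<integral>x. min ((X n x)\<^sup>2) (\<bar>X n x\<bar> ^ 3) * D n x \<partial>M) = (\<integral>x. (real n * (X n x)\<^sup>2) * (D n x * min 1 \<bar>X n x\<bar>) \<partial>M)"
      unfolding min_cube by (simp add: mult_ac)
    then show ?thesis unfolding n_X2 by (simp add: mult.assoc)
  qed
  ultimately show ?thesis by simp
qed

text \<open>Expand \<open>(1 + c)^2\<close>: its integral is \<open>1 + o(1/n)\<close>, so twice the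
  mean of \<open>c\<close> must compensate the mean of \<open>c^2\<close>. Hence the mean of
  \<open>c\<close> is of order \<open>1/n\<close> although \<open>c\<close> itself lives on the
  scale \<open>1 / sqrt n\<close>.\<close>

lemma lim_mean:
  assumes \<gamma>: "L2_tendsto M \<gamma> h" and eq: "\<gamma> = (\<lambda>n x. sqrt (real n) * c n x)" and cL: "\<And>n. c n \<in> L2_space M"
    and mass: "(\<lambda>n. real n * ((\<integral>x. (1 + c n x)\<^sup>2 \<partial>M) - 1)) \<longlonglongrightarrow> 0"
  shows "(\<lambda>n. real n * (\<integral>x. c n x \<partial>M)) \<longlonglongrightarrow> - (1/2) * (\<integral>x. (h x)\<^sup>2 \<partial>M)"
proof -
  have l: "(\<lambda>n. \<integral>x. \<gamma> n x * \<gamma> n x \<partial>M) \<longlonglongrightarrow> (\<integral>x. h x * h x \<partial>M)" by (rule L2_tendsto_inner[OF \<gamma> \<gamma>])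
  have "real n * (\<integral>x. c n x \<partial>M) = (real n * ((\<integral>x. (1 + c n x)\<^sup>2 \<partial>M) - 1) - (\<integral>x. \<gamma> n x * \<gamma> n x \<partial>M)) / 2" for n
  proof -
    have "(\<integral>x. (1 + c n x)\<^sup>2 \<partial>M) = (\<integral>x. 1 + 2 * c n x + (c n x)\<^sup>2 \<partial>M)"
      by (intro Bochner_Integration.integral_cong) (simp_all add: power2_sum)
    also have "\<dots> = 1 + 2 * (\<integral>x. c n x \<partial>M) + (\<integral>x. (c n x)\<^sup>2 \<partial>M)"
      using cL[of n] L2_integrable[OF cL[of n]] by (simp add: L2_space_def prob_space)
    finally have 1: "(\<integral>x. (1 + c n x)\<^sup>2 \<partial>M) = 1 + 2 * (\<integral>x. c n x \<partial>M) + (\<integral>x. (c n x)\<^sup>2 \<partial>M)" .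
    have "(\<integral>x. \<gamma> n x * \<gamma> n x \<partial>M) = (\<integral>x. real n * (c n x)\<^sup>2 \<partial>M)"
      by (simp add: eq power2_eq_square algebra_simps)
    also have "\<dots> = real n * (\<integral>x. (c n x)\<^sup>2 \<partial>M)" by simp
    finally show ?thesis using 1 by (simp add: algebra_simps)
  qed
  then have eq': "(\<lambda>n. real n * (\<integral>x. c n x \<partial>M)) = (\<lambda>n. (real n * ((\<integral>x. (1 + c n x)\<^sup>2 \<partial>M) - 1) - (\<integral>x. \<gamma> n x * \<gamma> n x \<partial>M)) / 2)"
    by (rule ext)
  have "(\<lambda>n. (real n * ((\<integral>x. (1 + c n x)\<^sup>2 \<partial>M) - 1) - (\<integral>x. \<gamma> n x * \<gamma> n x \<partial>M)) / 2) \<longlonglongrightarrow> (0 - (\<integral>x. h x * h x \<partial>M)) / 2"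
    by (intro tendsto_intros mass l) simp
  then show ?thesis unfolding eq' by (simp add: power2_eq_square[of "h _"])
qed

lemma near_factor_bound: "\<bar>(2 + a n x) * W n x\<bar> \<le> 3"
  using W_cases(1)[of n x] W_eq_1D[of n x] by (auto simp: abs_if split: if_splits)

lemma D_lnrem_bound: "\<bar>D n x * lnrem (a n x)\<bar> \<le> 8" "\<bar>D n x * lnrem (b n x)\<bar> \<le> 8"
proof -
  have *: "\<bar>D n x * lnrem y\<bar> \<le> 8" if "W n x = 1 \<Longrightarrow> \<bar>y\<bar> \<le> 1/2" for y
  proof (cases "W n x = 1")
    case True
    have "\<bar>D n x\<bar> * \<bar>lnrem y\<bar> \<le> 4 * 2" by (intro mult_mono abs_D lnrem_bound that True) auto
    then show ?thesis by (simp add: abs_mult)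
  next
    case False
    then have "W n x = 0" using W_cases(1)[of n x] by blast
    then show ?thesis by (simp add: D_def)
  qed
  show "\<bar>D n x * lnrem (a n x)\<bar> \<le> 8" "\<bar>D n x * lnrem (b n x)\<bar> \<le> 8" by (rule *; use W_eq_1D in blast)+
qed

text \<open>As \<open>X\<close> lives on the scale \<open>1 / sqrt n\<close>, \<open>n\<close> times
  its mean is decided by second-order terms: the mean deviations of both root densities, the cross
  term of \<open>b - a\<close> with the density \<open>(1 + a)^2\<close>, and the quadratic
  remainders of the two logarithms. Their limits combine to a complete square.\<close>

lemma lim_X1: "(\<lambda>n. real n * (\<integral>x. X n x * D n x \<partial>M)) \<longlonglongrightarrow> -2 * (\<integral>x. (h\<beta> x - h\<alpha> x)\<^sup>2 \<partial>M)"
proof -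
  note aI = L2_integrable[OF aL] and bI = L2_integrable[OF bL]
  let ?I1 = "\<lambda>n. \<integral>x. real n * (b n x - a n x) * (1 - W n x) \<partial>M"
  let ?I2 = "\<lambda>n. \<integral>x. \<alpha> n x * (\<beta> n x - \<alpha> n x) * ((2 + a n x) * W n x) \<partial>M"
  let ?I3 = "\<lambda>n. \<integral>x. \<beta> n x * \<beta> n x * (D n x * lnrem (b n x)) \<partial>M"
  let ?I4 = "\<lambda>n. \<integral>x. \<alpha> n x * \<alpha> n x * (D n x * lnrem (a n x)) \<partial>M"
  have i1: "integrable M (\<lambda>x. real n * (b n x - a n x) * (1 - W n x))" for n
    by (rule Bochner_Integration.integrable_bound[of _ "\<lambda>x. real n * (b n x - a n x)"])
       (use W_cases[of n] aI bI in \<open>auto simp: abs_mult mult_left_le intro!: mult_left_mono\<close>)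
  have i2: "integrable M (\<lambda>x. \<alpha> n x * (\<beta> n x - \<alpha> n x) * ((2 + a n x) * W n x))" for n
    by (rule prod_bdd_int[OF \<alpha>L L2_diff[OF \<beta>L \<alpha>L] _ near_factor_bound]) measurable
  have i3: "integrable M (\<lambda>x. \<beta> n x * \<beta> n x * (D n x * lnrem (b n x)))" for n
    by (rule prod_bdd_int[OF \<beta>L \<beta>L _ D_lnrem_bound(2)]) measurable
  have i4: "integrable M (\<lambda>x. \<alpha> n x * \<alpha> n x * (D n x * lnrem (a n x)))" for n
    by (rule prod_bdd_int[OF \<alpha>L \<alpha>L _ D_lnrem_bound(1)]) measurable
  have eq: "real n * (\<integral>x. X n x * D n x \<partial>M) =
     2 * (real n * (\<integral>x. b n x \<partial>M) - real n * (\<integral>x. a n x \<partial>M) - ?I1 n + ?I2 n + ?I3 n - ?I4 n)" for n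
  proof -
    have sq: "\<beta> n x * \<beta> n x = real n * (b n x)\<^sup>2" "\<alpha> n x * \<alpha> n x = real n * (a n x)\<^sup>2"
      "\<alpha> n x * (\<beta> n x - \<alpha> n x) = real n * (a n x * (b n x - a n x))" for x
    proof -
      have s: "sqrt (real n) * (sqrt (real n) * z) = real n * z" for z by (simp add: mult.assoc[symmetric])
      show "\<beta> n x * \<beta> n x = real n * (b n x)\<^sup>2" "\<alpha> n x * \<alpha> n x = real n * (a n x)\<^sup>2"
        "\<alpha> n x * (\<beta> n x - \<alpha> n x) = real n * (a n x * (b n x - a n x))"
        using \<alpha>\<beta>_square[of n x] by (simp_all add: power2_eq_square \<alpha>\<beta>_eq algebra_simps s)
    qed
    \<comment> \<open>On the window \<open>(1 + a)^2 = 1 + a (2 + a)\<close> turns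
      \<open>(b - a) (1 + a)^2\<close> into \<open>b - a\<close> plus a product of two small
      factors. The term with \<open>1 - W\<close> makes the identity hold off the window, where the
      left side is \<open>0\<close>.\<close>
    have pt: "real n * (X n x * D n x) = 2 * (real n * b n x - real n * a n x - real n * (b n x - a n x) * (1 - W n x)
       + \<alpha> n x * (\<beta> n x - \<alpha> n x) * ((2 + a n x) * W n x) + \<beta> n x * \<beta> n x * (D n x * lnrem (b n x))
       - \<alpha> n x * \<alpha> n x * (D n x * lnrem (a n x)))" for x
      unfolding sq X_eq D_def using W_cases(1)[of n x]
      by (elim disjE) (simp_all add: power2_eq_square algebra_simps)
    have "real n * (\<integral>x. X n x * D n x \<partial>M) = (\<integral>x. real n * (X n x * D n x) \<partial>M)" by simp
    also have "\<dots> = 2 * (\<integral>x. real n * b n x - real n * a n x - real n * (b n x - a n x) * (1 - W n x)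
       + \<alpha> n x * (\<beta> n x - \<alpha> n x) * ((2 + a n x) * W n x) + \<beta> n x * \<beta> n x * (D n x * lnrem (b n x))
       - \<alpha> n x * \<alpha> n x * (D n x * lnrem (a n x)) \<partial>M)" unfolding pt by (rule integral_mult_right_zero)
    also have "\<dots> = 2 * (real n * (\<integral>x. b n x \<partial>M) - real n * (\<integral>x. a n x \<partial>M) - ?I1 n + ?I2 n + ?I3 n - ?I4 n)"
      by (simp only: integral_add_diff6[OF bI aI i1 i2 i3 i4])
    finally show ?thesis .
  qed
  \<comment> \<open>Off the window \<open>n |b - a| = sqrt n |\<beta> - \<alpha>| \<le> 2
    (|\<alpha>| + |\<beta>|)^2\<close>, which is at most
    \<open>4 (\<alpha>^2 + \<beta>^2)\<close>.\<close>
  have L1: "?I1 \<longlonglongrightarrow> 0"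
  proof -
    let ?e = "\<lambda>n. 4 * ((\<integral>x. \<bar>\<alpha> n x\<bar> * \<bar>\<alpha> n x\<bar> * (1 - W n x) \<partial>M) + (\<integral>x. \<bar>\<beta> n x\<bar> * \<bar>\<beta> n x\<bar> * (1 - W n x) \<partial>M))"
    have "?e \<longlonglongrightarrow> 4 * (0 + 0)" by (intro tendsto_intros far_tendsto_0[OF \<alpha> \<alpha>] far_tendsto_0[OF \<beta> \<beta>])
    then have e: "?e \<longlonglongrightarrow> 0" by simp
    have "norm (?I1 n) \<le> ?e n" for n
    proof -
      have "norm (?I1 n) \<le> (\<integral>x. norm (real n * (b n x - a n x) * (1 - W n x)) \<partial>M)" by (rule integral_norm_bound)
      also have "\<dots> \<le> (\<integral>x. 4 * (\<bar>\<alpha> n x\<bar> * \<bar>\<alpha> n x\<bar> * (1 - W n x) + \<bar>\<beta> n x\<bar> * \<bar>\<beta> n x\<bar> * (1 - W n x)) \<partial>M)"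
      proof (rule integral_mono)
        show "integrable M (\<lambda>x. 4 * (\<bar>\<alpha> n x\<bar> * \<bar>\<alpha> n x\<bar> * (1 - W n x) + \<bar>\<beta> n x\<bar> * \<bar>\<beta> n x\<bar> * (1 - W n x)))"
          by (intro integrable_mult_right Bochner_Integration.integrable_add far_int \<alpha>L \<beta>L)
        show "norm (real n * (b n x - a n x) * (1 - W n x)) \<le>
            4 * (\<bar>\<alpha> n x\<bar> * \<bar>\<alpha> n x\<bar> * (1 - W n x) + \<bar>\<beta> n x\<bar> * \<bar>\<beta> n x\<bar> * (1 - W n x))" for x
        proof (cases "W n x = 1")
          case False
          then have W0: "W n x = 0" using W_cases(1)[of n x] by blast
          have "\<bar>real n * (b n x - a n x)\<bar> = sqrt (real n) * \<bar>\<beta> n x - \<alpha> n x\<bar>"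
            by (simp add: \<alpha>\<beta>_eq abs_mult right_diff_distrib[symmetric])
          also have "\<dots> \<le> 2 * (\<bar>\<alpha> n x\<bar> + \<bar>\<beta> n x\<bar>) * (\<bar>\<alpha> n x\<bar> + \<bar>\<beta> n x\<bar>)"
            using sqrt_le_of_far[OF W0] by (intro mult_mono) auto
          also have "\<dots> \<le> 4 * (\<bar>\<alpha> n x\<bar> * \<bar>\<alpha> n x\<bar> + \<bar>\<beta> n x\<bar> * \<bar>\<beta> n x\<bar>)"
            using sum_squares_bound[of "\<bar>\<alpha> n x\<bar>" "\<bar>\<beta> n x\<bar>"] by (simp add: power2_eq_square algebra_simps)
          finally show ?thesis using W0 by simp
        qed simp
      qed (use i1[of n] in simp)
      also have "\<dots> = ?e n"
        by (simp only: integral_mult_right_zero Bochner_Integration.integral_add[OF far_int[OF \<alpha>L \<alpha>L] far_int[OF \<beta>L \<beta>L]])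
      finally show ?thesis .
    qed
    then show ?thesis by (intro Lim_null_comparison[OF _ e] always_eventually) auto
  qed
  have L2: "?I2 \<longlonglongrightarrow> ((2 + 0) * 1) * (\<integral>x. h\<alpha> x * (h\<beta> x - h\<alpha> x) \<partial>M)"
    by (rule L2_tendsto_inner_bounded[OF \<alpha> L2_tendsto_diff[OF \<beta> \<alpha>] _ near_factor_bound]) (intro in_measure_intros)
  have L3: "?I3 \<longlonglongrightarrow> (1 * (-1/2)) * (\<integral>x. h\<beta> x * h\<beta> x \<partial>M)"
    by (rule L2_tendsto_inner_bounded[OF \<beta> \<beta> _ D_lnrem_bound(2)]) (intro in_measure_intros D_tendsto_1)
  have L4: "?I4 \<longlonglongrightarrow> (1 * (-1/2)) * (\<integral>x. h\<alpha> x * h\<alpha> x \<partial>M)"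
    by (rule L2_tendsto_inner_bounded[OF \<alpha> \<alpha> _ D_lnrem_bound(1)]) (intro in_measure_intros D_tendsto_1)
  have "(\<lambda>n. real n * (\<integral>x. X n x * D n x \<partial>M)) \<longlonglongrightarrow> 2 * (- (1/2) * (\<integral>x. (h\<beta> x)\<^sup>2 \<partial>M) - - (1/2) * (\<integral>x. (h\<alpha> x)\<^sup>2 \<partial>M) - 0
    + ((2 + 0) * 1) * (\<integral>x. h\<alpha> x * (h\<beta> x - h\<alpha> x) \<partial>M) + (1 * (-1/2)) * (\<integral>x. h\<beta> x * h\<beta> x \<partial>M) - (1 * (-1/2)) * (\<integral>x. h\<alpha> x * h\<alpha> x \<partial>M))"
    unfolding eq
    by (intro tendsto_mult_left tendsto_diff tendsto_add L1 L2 L3 L4 lim_mean[OF \<alpha> \<alpha>_def aL massa] lim_mean[OF \<beta> \<beta>_def bL massb])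
  also have "2 * (- (1/2) * (\<integral>x. (h\<beta> x)\<^sup>2 \<partial>M) - - (1/2) * (\<integral>x. (h\<alpha> x)\<^sup>2 \<partial>M) - 0
    + ((2 + 0) * 1) * (\<integral>x. h\<alpha> x * (h\<beta> x - h\<alpha> x) \<partial>M) + (1 * (-1/2)) * (\<integral>x. h\<beta> x * h\<beta> x \<partial>M) - (1 * (-1/2)) * (\<integral>x. h\<alpha> x * h\<alpha> x \<partial>M))
    = -2 * (\<integral>x. (h\<beta> x - h\<alpha> x)\<^sup>2 \<partial>M)"
  proof -
    note h = L2_tendstoD(2)[OF \<alpha>] L2_tendstoD(2)[OF \<beta>]
    have 1: "(\<integral>x. h\<alpha> x * (h\<beta> x - h\<alpha> x) \<partial>M) = (\<integral>x. h\<alpha> x * h\<beta> x \<partial>M) - (\<integral>x. (h\<alpha> x)\<^sup>2 \<partial>M)"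
      using L2_mult_integrable[OF h(1,2)] L2_mult_integrable[OF h(1,1)]
      by (simp add: right_diff_distrib power2_eq_square)
    have "(\<integral>x. (h\<beta> x - h\<alpha> x)\<^sup>2 \<partial>M) = (\<integral>x. (h\<beta> x)\<^sup>2 - 2 * (h\<alpha> x * h\<beta> x) + (h\<alpha> x)\<^sup>2 \<partial>M)"
      by (rule Bochner_Integration.integral_cong) (auto simp: power2_eq_square algebra_simps)
    also have "\<dots> = (\<integral>x. (h\<beta> x)\<^sup>2 \<partial>M) - 2 * (\<integral>x. h\<alpha> x * h\<beta> x \<partial>M) + (\<integral>x. (h\<alpha> x)\<^sup>2 \<partial>M)"
      using L2_mult_integrable[OF h(1,2)] h by (simp add: L2_space_def)
    finally show ?thesis using 1 by (simp add: power2_eq_square)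
  qed
  finally show ?thesis .
qed

lemma lindeberg_X: "lindeberg \<mu> X (-2 * (\<integral>x. (h\<beta> x - h\<alpha> x)\<^sup>2 \<partial>M)) (4 * (\<integral>x. (h\<beta> x - h\<alpha> x)\<^sup>2 \<partial>M))"
  unfolding lindeberg_def
proof (intro conjI allI \<mu>_limit lim_X1 lim_X2 lim_X3)
  show "X n \<in> L2_space (\<mu> n)" for n
    by (rule L2_\<mu>[OF L2_bounded[OF _ X_bound]]) measurable
qed measurable

text \<open>The drift comes from the density: \<open>D\<close> exceeds \<open>W\<close> by
  \<open>a (2 + a) W\<close>, whose correlation with \<open>\<kappa>\<close> is of order
  \<open>1 / sqrt n\<close>, while \<open>\<integral>\<kappa> = 0\<close> removes the term of order
  \<open>sqrt n\<close>. This plays the part of Le Cam's third lemma.\<close>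

lemma lindeberg_\<kappa>:
  assumes \<kappa>: "\<kappa> \<in> L2_space M" "(\<integral>x. \<kappa> x \<partial>M) = 0"
  shows "lindeberg \<mu> (\<lambda>n x. \<kappa> x / sqrt (real n)) (2 * (\<integral>x. \<kappa> x * h\<alpha> x \<partial>M)) (\<integral>x. (\<kappa> x)\<^sup>2 \<partial>M)"
proof -
  have [measurable]: "\<kappa> \<in> borel_measurable M" using \<kappa> by (simp add: L2_space_def)
  note \<kappa>t = L2_tendsto_const[OF \<kappa>(1)]
  note \<kappa>I = L2_integrable[OF \<kappa>(1)]
  have t\<kappa>: "tendsto_in_measure M (\<lambda>n x. \<kappa> x / sqrt (real n)) 0" by (rule L2_tendsto_imp_small[OF \<kappa>t])
  let ?I1 = "\<lambda>n. \<integral>x. sqrt (real n) * \<kappa> x * (1 - W n x) \<partial>M"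
  let ?I2 = "\<lambda>n. \<integral>x. \<kappa> x * \<alpha> n x * ((2 + a n x) * W n x) \<partial>M"
  have i1: "integrable M (\<lambda>x. sqrt (real n) * \<kappa> x * (1 - W n x))" for n
    by (rule Bochner_Integration.integrable_bound[of _ "\<lambda>x. sqrt (real n) * \<kappa> x"])
       (use W_cases[of n] \<kappa>I in \<open>auto simp: abs_mult mult_left_le intro!: mult_left_mono\<close>)
  have i2: "integrable M (\<lambda>x. \<kappa> x * \<alpha> n x * ((2 + a n x) * W n x))" for n
    by (rule prod_bdd_int[OF \<kappa>(1) \<alpha>L _ near_factor_bound]) measurable
  have eq: "real n * (\<integral>x. \<kappa> x / sqrt (real n) * D n x \<partial>M) = ?I2 n - ?I1 n" for n
  proof -
    have pt: "real n * (\<kappa> x / sqrt (real n) * D n x) = \<kappa> x * \<alpha> n x * ((2 + a n x) * W n x) - sqrt (real n) * \<kappa> x * (1 - W n x) + sqrt (real n) * \<kappa> x" for x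
    proof -
      have "real n * (\<kappa> x / sqrt (real n) * D n x) = sqrt (real n) * \<kappa> x * D n x"
      proof (cases "n = 0")
        case False
        then have "real n / sqrt (real n) = sqrt (real n)" by (simp add: real_div_sqrt)
        then show ?thesis by (metis (no_types, opaque_lifting) mult.assoc mult.commute times_divide_eq_right)
      qed simp
      then show ?thesis unfolding D_def \<alpha>\<beta>_eq using W_cases(1)[of n x]
        by (elim disjE) (simp_all add: power2_eq_square algebra_simps)
    qed
    have "real n * (\<integral>x. \<kappa> x / sqrt (real n) * D n x \<partial>M) = (\<integral>x. real n * (\<kappa> x / sqrt (real n) * D n x) \<partial>M)" by simp
    also have "\<dots> = ?I2 n - ?I1 n + sqrt (real n) * (\<integral>x. \<kappa> x \<partial>M)"
      unfolding pt by (rule integral_add_diff3[OF i2 i1 \<kappa>I])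
    finally show ?thesis using \<kappa>(2) by simp
  qed
  have L1: "?I1 \<longlonglongrightarrow> 0"
  proof -
    let ?e = "\<lambda>n. 2 * ((\<integral>x. \<bar>\<kappa> x\<bar> * \<bar>\<alpha> n x\<bar> * (1 - W n x) \<partial>M) + (\<integral>x. \<bar>\<kappa> x\<bar> * \<bar>\<beta> n x\<bar> * (1 - W n x) \<partial>M))"
    have "?e \<longlonglongrightarrow> 2 * (0 + 0)" by (intro tendsto_intros far_tendsto_0[OF \<kappa>t \<alpha>] far_tendsto_0[OF \<kappa>t \<beta>])
    then have e: "?e \<longlonglongrightarrow> 0" by simp
    have "norm (?I1 n) \<le> ?e n" for n
    proof -
      have "norm (?I1 n) \<le> (\<integral>x. norm (sqrt (real n) * \<kappa> x * (1 - W n x)) \<partial>M)" by (rule integral_norm_bound)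
      also have "\<dots> \<le> (\<integral>x. 2 * (\<bar>\<kappa> x\<bar> * \<bar>\<alpha> n x\<bar> * (1 - W n x) + \<bar>\<kappa> x\<bar> * \<bar>\<beta> n x\<bar> * (1 - W n x)) \<partial>M)"
      proof (rule integral_mono)
        show "integrable M (\<lambda>x. 2 * (\<bar>\<kappa> x\<bar> * \<bar>\<alpha> n x\<bar> * (1 - W n x) + \<bar>\<kappa> x\<bar> * \<bar>\<beta> n x\<bar> * (1 - W n x)))"
          by (intro integrable_mult_right Bochner_Integration.integrable_add far_int \<alpha>L \<beta>L \<kappa>)
        show "norm (sqrt (real n) * \<kappa> x * (1 - W n x)) \<le>
            2 * (\<bar>\<kappa> x\<bar> * \<bar>\<alpha> n x\<bar> * (1 - W n x) + \<bar>\<kappa> x\<bar> * \<bar>\<beta> n x\<bar> * (1 - W n x))" for x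
        proof (cases "W n x = 1")
          case False
          then have W0: "W n x = 0" using W_cases(1)[of n x] by blast
          have "sqrt (real n) * \<bar>\<kappa> x\<bar> \<le> 2 * (\<bar>\<alpha> n x\<bar> + \<bar>\<beta> n x\<bar>) * \<bar>\<kappa> x\<bar>"
            using sqrt_le_of_far[OF W0] by (intro mult_right_mono) auto
          then show ?thesis using W0 by (simp add: abs_mult algebra_simps)
        qed simp
      qed (use i1[of n] in simp)
      also have "\<dots> = ?e n"
        by (simp only: integral_mult_right_zero Bochner_Integration.integral_add[OF far_int[OF \<kappa>(1) \<alpha>L] far_int[OF \<kappa>(1) \<beta>L]])
      finally show ?thesis .
    qed
    then show ?thesis by (intro Lim_null_comparison[OF _ e] always_eventually) auto
  qed
  have L2: "?I2 \<longlonglongrightarrow> ((2 + 0) * 1) * (\<integral>x. \<kappa> x * h\<alpha> x \<partial>M)"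
    by (rule L2_tendsto_inner_bounded[OF \<kappa>t \<alpha> _ near_factor_bound]) (intro in_measure_intros)
  have l1: "(\<lambda>n. real n * (\<integral>x. \<kappa> x / sqrt (real n) * D n x \<partial>M)) \<longlonglongrightarrow> 2 * (\<integral>x. \<kappa> x * h\<alpha> x \<partial>M)"
    unfolding eq using tendsto_diff[OF L2 L1] by simp
  \<comment> \<open>For \<open>n = 0\<close> the left side is \<open>0\<close>, hence the
    restriction and the passage to eventual equality below.\<close>
  have nsq: "real n * (\<kappa> x / sqrt (real n))\<^sup>2 = \<kappa> x * \<kappa> x" if "n \<ge> 1" for n x
    using that by (simp add: power_divide power2_eq_square)
  have l2: "(\<lambda>n. real n * (\<integral>x. (\<kappa> x / sqrt (real n))\<^sup>2 * D n x \<partial>M)) \<longlonglongrightarrow> (\<integral>x. (\<kappa> x)\<^sup>2 \<partial>M)"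
  proof -
    have "(\<lambda>n. \<integral>x. \<kappa> x * \<kappa> x * D n x \<partial>M) \<longlonglongrightarrow> 1 * (\<integral>x. \<kappa> x * \<kappa> x \<partial>M)"
      by (rule L2_tendsto_inner_bounded[OF \<kappa>t \<kappa>t D_tendsto_1 abs_D])
    then have "(\<lambda>n. \<integral>x. \<kappa> x * \<kappa> x * D n x \<partial>M) \<longlonglongrightarrow> (\<integral>x. (\<kappa> x)\<^sup>2 \<partial>M)" by (simp add: power2_eq_square)
    then show ?thesis
    proof (rule Lim_transform_eventually)
      show "\<forall>\<^sub>F n in sequentially. (\<integral>x. \<kappa> x * \<kappa> x * D n x \<partial>M) = real n * (\<integral>x. (\<kappa> x / sqrt (real n))\<^sup>2 * D n x \<partial>M)"
      proof (rule eventually_sequentiallyI)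
        fix n :: nat assume n: "n \<ge> 1"
        have "real n * (\<integral>x. (\<kappa> x / sqrt (real n))\<^sup>2 * D n x \<partial>M) = (\<integral>x. (real n * (\<kappa> x / sqrt (real n))\<^sup>2) * D n x \<partial>M)"
          by (simp add: mult.assoc)
        then show "(\<integral>x. \<kappa> x * \<kappa> x * D n x \<partial>M) = real n * (\<integral>x. (\<kappa> x / sqrt (real n))\<^sup>2 * D n x \<partial>M)"
          unfolding nsq[OF n] by simp
      qed
    qed
  qed
  have l3: "(\<lambda>n. real n * (\<integral>x. min ((\<kappa> x / sqrt (real n))\<^sup>2) (\<bar>\<kappa> x / sqrt (real n)\<bar> ^ 3) * D n x \<partial>M)) \<longlonglongrightarrow> 0"
  proof -
    have "(\<lambda>n. \<integral>x. \<kappa> x * \<kappa> x * (D n x * min 1 \<bar>\<kappa> x / sqrt (real n)\<bar>) \<partial>M) \<longlonglongrightarrow> 0 * (\<integral>x. \<kappa> x * \<kappa> x \<partial>M)"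
      by (rule L2_tendsto_inner_bounded[OF \<kappa>t \<kappa>t D_min_tendsto_0[OF t\<kappa>] Dmin_bound])
    then have "(\<lambda>n. \<integral>x. \<kappa> x * \<kappa> x * (D n x * min 1 \<bar>\<kappa> x / sqrt (real n)\<bar>) \<partial>M) \<longlonglongrightarrow> 0" by simp
    then show ?thesis
    proof (rule Lim_transform_eventually)
      show "\<forall>\<^sub>F n in sequentially. (\<integral>x. \<kappa> x * \<kappa> x * (D n x * min 1 \<bar>\<kappa> x / sqrt (real n)\<bar>) \<partial>M) =
        real n * (\<integral>x. min ((\<kappa> x / sqrt (real n))\<^sup>2) (\<bar>\<kappa> x / sqrt (real n)\<bar> ^ 3) * D n x \<partial>M)"
      proof (rule eventually_sequentiallyI)
        fix n :: nat assume n: "n \<ge> 1"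
        have "real n * (\<integral>x. min ((\<kappa> x / sqrt (real n))\<^sup>2) (\<bar>\<kappa> x / sqrt (real n)\<bar> ^ 3) * D n x \<partial>M) =
           (\<integral>x. (real n * (\<kappa> x / sqrt (real n))\<^sup>2) * (D n x * min 1 \<bar>\<kappa> x / sqrt (real n)\<bar>) \<partial>M)"
          unfolding min_cube integral_mult_right_zero[symmetric] by (simp only: mult_ac)
        then show "(\<integral>x. \<kappa> x * \<kappa> x * (D n x * min 1 \<bar>\<kappa> x / sqrt (real n)\<bar>) \<partial>M) =
          real n * (\<integral>x. min ((\<kappa> x / sqrt (real n))\<^sup>2) (\<bar>\<kappa> x / sqrt (real n)\<bar> ^ 3) * D n x \<partial>M)"
          unfolding nsq[OF n] by simp
      qed
    qed
  qed
  show ?thesis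
    unfolding lindeberg_def
  proof (intro conjI allI \<mu>_limit l1 l2 l3)
    show "(\<lambda>x. \<kappa> x / sqrt (real n)) \<in> L2_space (\<mu> n)" for n
      using L2_cmult[OF L2_\<mu>[OF \<kappa>(1)], of "1 / sqrt (real n)"] by simp
  qed measurable
qed

end

section \<open>Asymptotic power\<close>

context local_pair
begin

text \<open>The normalisation cancels: \<open>(D / mass) (mass e) = D e \<le> r\<close>. It is
  applied with \<open>e = 1\<close> to the first sequence and with \<open>e = exp X\<close> to the
  second.\<close>

lemma dominates_\<mu>:
  assumes d: "dominates A (\<lambda>x. ennreal (r x)) M"
    and e [measurable]: "e \<in> borel_measurable M" and e0: "\<And>x. 0 \<le> e x"
    and le: "\<And>x. D n x * e x \<le> r x"
  shows "dominates A (\<lambda>x. ennreal (mass n * e x)) (\<mu> n)"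
  unfolding dominates_def
proof (intro conjI ballI)
  show "sets A = sets (\<mu> n)" using dominatesD(1)[OF d] by simp
  show "(\<lambda>x. ennreal (mass n * e x)) \<in> borel_measurable (\<mu> n)" by measurable
  fix f :: "'a \<Rightarrow> ennreal" assume "f \<in> borel_measurable (\<mu> n)"
  then have [measurable]: "f \<in> borel_measurable M" by (simp add: measurable_cong_sets[OF sets_\<mu> refl])
  show "(\<integral>\<^sup>+x. f x * ennreal (mass n * e x) \<partial>\<mu> n) \<le> (\<integral>\<^sup>+x. f x \<partial>A)"
  proof (cases "mass n > 0")
    case True
    have "(\<integral>\<^sup>+x. f x * ennreal (mass n * e x) \<partial>\<mu> n) = (\<integral>\<^sup>+x. ennreal (D n x / mass n) * (f x * ennreal (mass n * e x)) \<partial>M)"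
      using True by (simp add: \<mu>_def nn_integral_density)
    also have "\<dots> = (\<integral>\<^sup>+x. f x * ennreal (D n x * e x) \<partial>M)"
    proof (rule nn_integral_cong)
      fix x
      have "ennreal (D n x / mass n) * ennreal (mass n * e x) = ennreal (D n x * e x)"
        using True D_bounds(1) e0 by (simp add: ennreal_mult[symmetric])
      then show "ennreal (D n x / mass n) * (f x * ennreal (mass n * e x)) = f x * ennreal (D n x * e x)"
        by (metis mult.left_commute)
    qed
    also have "\<dots> \<le> (\<integral>\<^sup>+x. f x * ennreal (r x) \<partial>M)"
      by (intro nn_integral_mono mult_left_mono ennreal_leI le) simp
    also have "\<dots> \<le> (\<integral>\<^sup>+x. f x \<partial>A)" by (rule dominatesD(3)[OF d]) measurable
    finally show ?thesis .
  next
    case False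
    then have "mass n = 0" using mass_nonneg[of n] by linarith
    then show ?thesis by simp
  qed
qed

lemma D_le: "D n x * 1 \<le> (1 + a n x)\<^sup>2"
  using W_cases[of n x] by (simp add: D_def mult_left_le_one_le)

lemma D_exp_le: "D n x * exp (X n x) \<le> (1 + b n x)\<^sup>2"
proof (cases "W n x = 1")
  case True
  then have p: "0 < 1 + a n x" "0 < 1 + b n x" using W_eq_1D[OF True] by auto
  have "exp (X n x) = (exp (ln (1 + b n x) - ln (1 + a n x)))\<^sup>2"
    using True by (simp add: X_def exp_double[symmetric])
  also have "\<dots> = ((1 + b n x) / (1 + a n x))\<^sup>2"
    using p by (simp add: exp_diff)
  finally show ?thesis using True p by (simp add: D_def power_divide)
next
  case False
  then have "W n x = 0" using W_cases(1)[of n x] by blast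
  then show ?thesis by (simp add: D_def)
qed

lemma mass_le_1:
  assumes "dominates A (\<lambda>_. ennreal (mass n)) (\<mu> n)" "prob_space A"
  shows "mass n \<le> 1"
proof -
  interpret A: prob_space A by (rule assms)
  interpret N: prob_space "\<mu> n" by (rule prob_\<mu>)
  have "(\<integral>\<^sup>+x. 1 * ennreal (mass n) \<partial>\<mu> n) \<le> (\<integral>\<^sup>+x. 1 \<partial>A)"
    by (rule dominatesD(3)[OF assms(1)]) simp
  then have "ennreal (mass n) \<le> ennreal 1" by (simp add: A.emeasure_space_1 N.emeasure_space_1)
  then show ?thesis by (subst (asm) ennreal_le_iff) auto
qed

end

text \<open>One cut measure serves both sequences: scaled by \<open>m n\<close> it lies below
  \<open>A n\<close>, and with the further density \<open>exp (X n)\<close> below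
  \<open>B n\<close>. The mean of the log ratio is minus half its variance, as for a Gaussian shift.
  Later limits for tests rest on these facts alone, without reference to root densities.\<close>

theorem localization:
  assumes M: "prob_space M" and A: "local_seq M A hA" and B: "local_seq M B hB"
  obtains \<mu> m X where
    "\<And>n. prob_space (\<mu> n)" "\<And>n. sets (\<mu> n) = sets M" "\<And>n. 0 \<le> m n" "\<And>n. m n \<le> (1::real)"
    "\<And>n. dominates (A n) (\<lambda>_. ennreal (m n)) (\<mu> n)"
    "\<And>n. dominates (B n) (\<lambda>x. ennreal (m n * exp (X n x))) (\<mu> n)"
    "(\<lambda>n. real n * (1 - m n)) \<longlonglongrightarrow> 0"
    "lindeberg \<mu> X (- (1/2) * (\<integral>x. (hB x - hA x)\<^sup>2 \<partial>M)) (\<integral>x. (hB x - hA x)\<^sup>2 \<partial>M)"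
    "\<And>\<kappa>. \<kappa> \<in> L2_centered M \<Longrightarrow>
       lindeberg \<mu> (\<lambda>n x. \<kappa> x / sqrt (real n)) (\<integral>x. \<kappa> x * hA x \<partial>M) (\<integral>x. (\<kappa> x)\<^sup>2 \<partial>M)"
proof -
  interpret prob_space M by (rule M)
  obtain \<xi> where \<xi>: "\<And>n. dominates (A n) (\<lambda>x. ennreal ((\<xi> n x)\<^sup>2)) M" "\<And>n. \<xi> n \<in> L2_space M"
    "L2_tendsto M (\<lambda>n x. sqrt (real n) * (\<xi> n x - 1)) (\<lambda>x. hA x / 2)"
    "(\<lambda>n. real n * ((\<integral>x. (\<xi> n x)\<^sup>2 \<partial>M) - 1)) \<longlonglongrightarrow> 0"
    using A by (auto simp: local_seq_def)
  obtain \<zeta> where \<zeta>: "\<And>n. dominates (B n) (\<lambda>x. ennreal ((\<zeta> n x)\<^sup>2)) M" "\<And>n. \<zeta> n \<in> L2_space M"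
    "L2_tendsto M (\<lambda>n x. sqrt (real n) * (\<zeta> n x - 1)) (\<lambda>x. hB x / 2)"
    "(\<lambda>n. real n * ((\<integral>x. (\<zeta> n x)\<^sup>2 \<partial>M) - 1)) \<longlonglongrightarrow> 0"
    using B by (auto simp: local_seq_def)
  interpret L: local_pair M "\<lambda>n x. \<xi> n x - 1" "\<lambda>n x. \<zeta> n x - 1"
    "\<lambda>n x. sqrt (real n) * (\<xi> n x - 1)" "\<lambda>n x. sqrt (real n) * (\<zeta> n x - 1)" "\<lambda>x. hA x / 2" "\<lambda>x. hB x / 2"
    by unfold_locales (use \<xi> \<zeta> in \<open>auto intro!: L2_diff[OF _ L2_const]\<close>)
  have dA: "dominates (A n) (\<lambda>_. ennreal (L.mass n)) (L.\<mu> n)" for n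
    using L.dominates_\<mu>[OF \<xi>(1), of "\<lambda>_. 1"] L.D_le by simp
  have dB: "dominates (B n) (\<lambda>x. ennreal (L.mass n * exp (L.X n x))) (L.\<mu> n)" for n
    using L.D_exp_le by (intro L.dominates_\<mu>[OF \<zeta>(1)]) auto
  \<comment> \<open>Root densities have tangents \<open>h / 2\<close>, so the constants
    \<open>-2\<close> and \<open>4\<close> of \<open>lindeberg_X\<close> become \<open>-1/2\<close>
    and \<open>1\<close>.\<close>
  have "(\<integral>x. (hB x / 2 - hA x / 2)\<^sup>2 \<partial>M) = (\<integral>x. (hB x - hA x)\<^sup>2 / 4 \<partial>M)"
    by (simp add: diff_divide_distrib[symmetric] power_divide)
  then have D: "(\<integral>x. (hB x / 2 - hA x / 2)\<^sup>2 \<partial>M) = (\<integral>x. (hB x - hA x)\<^sup>2 \<partial>M) / 4" by simp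
  show thesis
  proof (rule that[OF L.prob_\<mu> L.sets_\<mu> L.mass_nonneg L.mass_le_1[OF dA] dA dB L.mass_lim])
    show "prob_space (A n)" for n using A by (auto simp: local_seq_def)
    show "lindeberg L.\<mu> L.X (- (1/2) * (\<integral>x. (hB x - hA x)\<^sup>2 \<partial>M)) (\<integral>x. (hB x - hA x)\<^sup>2 \<partial>M)"
      using L.lindeberg_X unfolding D by simp
    show "lindeberg L.\<mu> (\<lambda>n x. \<kappa> x / sqrt (real n)) (\<integral>x. \<kappa> x * hA x \<partial>M) (\<integral>x. (\<kappa> x)\<^sup>2 \<partial>M)"
      if "\<kappa> \<in> L2_centered M" for \<kappa>
      using L.lindeberg_\<kappa>[of \<kappa>] that by (simp add: L2_centered_def)
  qed
qed

text \<open>Bernoulli's inequality gives \<open>m ^ k \<ge> 1 - k (1 - m)\<close>, and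
  \<open>k (1 - m) = (k / n) (n (1 - m))\<close> tends to \<open>0\<close>.\<close>

lemma mass_power_tendsto_1:
  assumes m: "(\<lambda>n. real n * (1 - m n)) \<longlonglongrightarrow> 0" "\<And>n. 0 \<le> m n" "\<And>n. m n \<le> 1"
    and k: "(\<lambda>n. real (k n) / real n) \<longlonglongrightarrow> \<rho>"
  shows "(\<lambda>n. m n ^ k n) \<longlonglongrightarrow> (1::real)"
proof -
  have "(\<lambda>n. 1 - (real (k n) / real n) * (real n * (1 - m n))) \<longlonglongrightarrow> 1 - \<rho> * 0"
    by (intro tendsto_intros k m)
  then have l: "(\<lambda>n. 1 - (real (k n) / real n) * (real n * (1 - m n))) \<longlonglongrightarrow> 1" by simp
  show ?thesis
  proof (rule tendsto_sandwich[OF _ _ l tendsto_const])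
    show "\<forall>\<^sub>F n in sequentially. 1 - (real (k n) / real n) * (real n * (1 - m n)) \<le> m n ^ k n"
    proof (rule eventually_sequentiallyI[of 1])
      fix n :: nat assume n: "1 \<le> n"
      have "-1 \<le> m n - 1" using m(2)[of n] by linarith
      from Bernoulli_inequality[OF this, of "k n"]
      show "1 - (real (k n) / real n) * (real n * (1 - m n)) \<le> m n ^ k n" using n by (simp add: algebra_simps)
    qed
    show "\<forall>\<^sub>F n in sequentially. m n ^ k n \<le> 1" using m by (auto intro!: always_eventually power_le_one)
  qed
qed

section \<open>The standard normal distribution function\<close>

abbreviation \<Phi> :: "real \<Rightarrow> real" where "\<Phi> \<equiv> cdf std_normal_distribution"

interpretation std_normal: real_distribution std_normal_distribution
  by (rule real_dist_normal_dist)

lemma isCont_\<Phi>: "isCont \<Phi> x"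
proof -
  have "emeasure std_normal_distribution {x} = 0"
    by (subst emeasure_density) (auto simp: nn_integral_cmult_indicator intro!: nn_integral_null_set[where N="{x}", simplified])
  then show ?thesis by (simp add: std_normal.isCont_cdf measure_def)
qed

text \<open>\<open>normal_quantile\<close> is an \<open>inv\<close>, which is meaningful at
  \<open>p\<close> only if \<open>p\<close> is attained; the intermediate value theorem provides
  this.\<close>

lemma \<Phi>_surj:
  assumes "0 < p" "p < 1" shows "\<exists>x. \<Phi> x = p"
proof -
  have "\<forall>\<^sub>F x in at_bot. \<Phi> x < p" using std_normal.cdf_lim_at_bot assms by (auto dest: order_tendstoD)
  then obtain a where a: "\<Phi> a < p" by (auto simp: eventually_at_bot_linorder)
  have "\<forall>\<^sub>F x in at_top. p < \<Phi> x" using std_normal.cdf_lim_at_top_prob assms by (auto dest: order_tendstoD)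
  then obtain b where b: "p < \<Phi> b" by (auto simp: eventually_at_top_linorder)
  have "a \<le> b" using a b std_normal.cdf_nondecreasing[of b a] by (smt (verit))
  then show ?thesis using IVT[of \<Phi> a p b] a b isCont_\<Phi> by auto
qed

lemma \<Phi>_normal_quantile:
  assumes "0 < p" "p < 1" shows "\<Phi> (normal_quantile p) = p"
  unfolding normal_quantile_def using \<Phi>_surj[OF assms] by (intro f_inv_into_f) (auto simp: image_iff)

text \<open>Used when a test is exchanged for its complement, which turns the quantile
  \<open>u\<close> into \<open>- u\<close>.\<close>

lemma \<Phi>_minus: "\<Phi> (- x) = 1 - \<Phi> x"
proof -
  have "distr std_normal_distribution borel uminus = std_normal_distribution"
  proof -
    have "distr (density lborel std_normal_density) lborel uminus = density lborel (\<lambda>x. ennreal (std_normal_density (- x)))"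
    proof -
      have l: "distr lborel lborel uminus = (lborel :: real measure)"
        using lborel_distr_uminus by (simp cong: distr_cong)
      have "density (distr lborel lborel uminus) (\<lambda>x. ennreal (std_normal_density (- x))) =
        distr (density lborel (\<lambda>x. ennreal (std_normal_density (- (- x))))) lborel uminus"
        by (rule density_distr) auto
      then show ?thesis unfolding l by simp
    qed
    also have "\<dots> = std_normal_distribution" by (simp add: normal_density_def)
    finally show ?thesis by (simp cong: distr_cong)
  qed
  then have "\<Phi> (- x) = measure (distr std_normal_distribution borel uminus) {..-x}" by (simp add: cdf_def)
  also have "\<dots> = measure std_normal_distribution {x..}"
    by (subst measure_distr) (auto intro!: arg_cong2[where f=measure])
  also have "\<dots> = measure std_normal_distribution {x<..}"
  proof -
    have z: "measure std_normal_distribution {x} = 0" using isCont_\<Phi>[of x] by (simp add: std_normal.isCont_cdf)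
    have eq: "{x..} = {x<..} \<union> {x}" by auto
    have "measure std_normal_distribution {x..} = measure std_normal_distribution {x<..} + measure std_normal_distribution {x}"
      unfolding eq by (rule std_normal.finite_measure_Union) auto
    then show ?thesis using z by simp
  qed
  also have "\<dots> = 1 - \<Phi> x"
    using std_normal.prob_compl[of "{..x}"] by (simp add: cdf_def Compl_eq_Diff_UNIV[symmetric])
  finally show ?thesis .
qed

text \<open>The weight \<open>sqrt n / n1\<close> splits into \<open>n / n1\<close>, whose limit is
  absorbed by \<open>lindeberg_scale\<close>, and the factor \<open>1 / sqrt n\<close> under which
  \<open>localization\<close> provides the moments.\<close>

lemma two_sample_test_statistic:
  "test_statistic \<kappa>1 \<kappa>2 n1 n2 n w =
     (\<Sum>i=1..n1 n. (real n / real (n1 n)) * (\<kappa>1 (fst w i) / sqrt (real n))) +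
     (\<Sum>j=1..n2 n. (real n / real (n2 n)) * (\<kappa>2 (snd w j) / sqrt (real n)))"
proof -
  have "real n / real k * (z / sqrt (real n)) = sqrt (real n) / real k * z" for k z
  proof (cases "n = 0")
    case False
    then have "real n / sqrt (real n) = sqrt (real n)" by (simp add: real_div_sqrt)
    moreover have "real n / real k * (z / sqrt (real n)) = (real n / sqrt (real n)) / real k * z" by simp
    ultimately show ?thesis by simp
  qed simp
  then show ?thesis by (simp add: test_statistic_def sum_distrib_left)
qed

theorem test_power_limit:
  fixes P0 :: "'a measure" and Q0 :: "'b measure"
  assumes P0: "prob_space P0" and Q0: "prob_space Q0"
    and A: "local_seq P0 Ps g1" and B: "local_seq Q0 Qs g2"
    and \<kappa>1: "\<kappa>1 \<in> L2_centered P0" and \<kappa>2: "\<kappa>2 \<in> L2_centered Q0"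
    and n1: "(\<lambda>n. real (n1 n) / real n) \<longlonglongrightarrow> 1 - d" and n2: "(\<lambda>n. real (n2 n) / real n) \<longlonglongrightarrow> d"
    and d: "0 < d" "d < 1"
    and v: "v = 1 / (1 - d) * (\<integral>x. (\<kappa>1 x)\<^sup>2 \<partial>P0) + 1 / d * (\<integral>y. (\<kappa>2 y)\<^sup>2 \<partial>Q0)" "0 < v"
    and \<theta>: "\<theta> = (\<integral>x. \<kappa>1 x * g1 x \<partial>P0) + (\<integral>y. \<kappa>2 y * g2 y \<partial>Q0)"
  shows "(\<lambda>n. \<integral>w. (if test_statistic \<kappa>1 \<kappa>2 n1 n2 n w > c then 1 else 0) \<partial>two_sample (n1 n) (n2 n) (Ps n) (Qs n))
     \<longlonglongrightarrow> 1 - \<Phi> ((c - \<theta>) / sqrt v)"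
proof -
  \<comment> \<open>The sequence is compared with itself: only the cut measure and the drift of
    \<open>\<kappa>1\<close> are wanted, not a likelihood ratio.\<close>
  obtain \<mu> m X where \<mu>: "\<And>n. prob_space (\<mu> n)" "\<And>n. sets (\<mu> n) = sets P0" "\<And>n. 0 \<le> m n" "\<And>n. m n \<le> (1::real)"
    "\<And>n. dominates (Ps n) (\<lambda>_. ennreal (m n)) (\<mu> n)" "(\<lambda>n. real n * (1 - m n)) \<longlonglongrightarrow> 0"
    "lindeberg \<mu> (\<lambda>n x. \<kappa>1 x / sqrt (real n)) (\<integral>x. \<kappa>1 x * g1 x \<partial>P0) (\<integral>x. (\<kappa>1 x)\<^sup>2 \<partial>P0)"
    by (rule localization[OF P0 A A]) (use \<kappa>1 in blast)
  obtain \<nu> l Y where \<nu>: "\<And>n. prob_space (\<nu> n)" "\<And>n. sets (\<nu> n) = sets Q0" "\<And>n. 0 \<le> l n" "\<And>n. l n \<le> (1::real)"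
    "\<And>n. dominates (Qs n) (\<lambda>_. ennreal (l n)) (\<nu> n)" "(\<lambda>n. real n * (1 - l n)) \<longlonglongrightarrow> 0"
    "lindeberg \<nu> (\<lambda>n x. \<kappa>2 x / sqrt (real n)) (\<integral>x. \<kappa>2 x * g2 x \<partial>Q0) (\<integral>x. (\<kappa>2 x)\<^sup>2 \<partial>Q0)"
    by (rule localization[OF Q0 B B]) (use \<kappa>2 in blast)
  have r1: "(\<lambda>n. real n / real (n1 n)) \<longlonglongrightarrow> 1 / (1 - d)"
    using tendsto_inverse[OF n1] d by (simp add: inverse_eq_divide)
  have r2: "(\<lambda>n. real n / real (n2 n)) \<longlonglongrightarrow> 1 / d"
    using tendsto_inverse[OF n2] d by (simp add: inverse_eq_divide)
  let ?T = "test_statistic \<kappa>1 \<kappa>2 n1 n2"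
  let ?R = "\<lambda>n. two_sample (n1 n) (n2 n) (\<mu> n) (\<nu> n)"
  have weak: "weak_conv_m (\<lambda>n. distr (?R n) borel (\<lambda>w. (?T n w - \<theta>) / sqrt v)) std_normal_distribution"
    unfolding two_sample_test_statistic
  proof (rule two_sample_clt[OF \<mu>(1) \<nu>(1) lindeberg_scale[OF \<mu>(7) r1] lindeberg_scale[OF \<nu>(7) r2] n1 n2 _ _ v(2)])
    show "\<theta> = (1 - d) * (1 / (1 - d) * (\<integral>x. \<kappa>1 x * g1 x \<partial>P0)) + d * (1 / d * (\<integral>x. \<kappa>2 x * g2 x \<partial>Q0))"
      using d by (simp add: \<theta>)
    show "v = (1 - d) * ((1 / (1 - d))\<^sup>2 * (\<integral>x. (\<kappa>1 x)\<^sup>2 \<partial>P0)) + d * ((1 / d)\<^sup>2 * (\<integral>x. (\<kappa>2 x)\<^sup>2 \<partial>Q0))"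
      using d by (simp add: v(1) power2_eq_square)
  qed
  have \<kappa>m: "\<kappa>1 \<in> borel_measurable (\<mu> n)" "\<kappa>2 \<in> borel_measurable (\<nu> n)" for n
    using \<kappa>1 \<kappa>2 by (simp_all add: L2_centered_def L2_space_def measurable_cong_sets[OF \<mu>(2) refl] measurable_cong_sets[OF \<nu>(2) refl])
  have Tm: "?T n \<in> borel_measurable (?R n)" for n
    unfolding test_statistic_def[abs_def]
    by (intro borel_measurable_add borel_measurable_times borel_measurable_const borel_measurable_sum
        measurable_two_sample_fst measurable_two_sample_snd \<kappa>m)
  have t: "(\<lambda>w. if ?T n w > c then 1 else 0 :: real) \<in> borel_measurable (?R n)" for n
    using Tm[of n] by measurable
  have "(\<lambda>n. cdf (distr (?R n) borel (\<lambda>w. (?T n w - \<theta>) / sqrt v)) ((c - \<theta>) / sqrt v)) \<longlonglongrightarrow> \<Phi> ((c - \<theta>) / sqrt v)"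
    using weak isCont_\<Phi> by (auto simp: weak_conv_m_def weak_conv_def)
  then have "(\<lambda>n. 1 - cdf (distr (?R n) borel (\<lambda>w. (?T n w - \<theta>) / sqrt v)) ((c - \<theta>) / sqrt v)) \<longlonglongrightarrow> 1 - \<Phi> ((c - \<theta>) / sqrt v)"
    by (intro tendsto_intros)
  moreover have "1 - cdf (distr (?R n) borel (\<lambda>w. (?T n w - \<theta>) / sqrt v)) ((c - \<theta>) / sqrt v) =
      (\<integral>w. (if ?T n w > c then 1 else 0) \<partial>?R n)" for n
  proof -
    interpret R: prob_space "?R n" by (rule prob_space_two_sample[OF \<mu>(1) \<nu>(1)])
    note [measurable] = Tm[of n]
    have "cdf (distr (?R n) borel (\<lambda>w. (?T n w - \<theta>) / sqrt v)) ((c - \<theta>) / sqrt v) =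
      measure (?R n) {w \<in> space (?R n). ?T n w \<le> c}"
      unfolding cdf_def by (subst measure_distr) (use v in \<open>auto intro!: arg_cong2[where f=measure] simp: divide_le_cancel\<close>)
    then have "1 - cdf (distr (?R n) borel (\<lambda>w. (?T n w - \<theta>) / sqrt v)) ((c - \<theta>) / sqrt v) =
      measure (?R n) {w \<in> space (?R n). \<not> ?T n w \<le> c}"
      by (subst R.prob_neg) auto
    also have "\<dots> = (\<integral>w. indicator {w \<in> space (?R n). \<not> ?T n w \<le> c} w \<partial>?R n)" by simp
    also have "\<dots> = (\<integral>w. (if ?T n w > c then 1 else 0) \<partial>?R n)"
      by (rule Bochner_Integration.integral_cong) (auto simp: indicator_def)
    finally show ?thesis .
  qed
  ultimately have lim: "(\<lambda>n. \<integral>w. (if ?T n w > c then 1 else 0) \<partial>?R n) \<longlonglongrightarrow> 1 - \<Phi> ((c - \<theta>) / sqrt v)" by simp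
  \<comment> \<open>So far the limit holds under the cut measures. Passing to the actual ones
    changes each expectation by at most the missing mass of the whole product.\<close>
  have "(\<lambda>n. 1 - m n ^ n1 n * l n ^ n2 n) \<longlonglongrightarrow> 1 - 1 * 1"
    by (intro tendsto_intros mass_power_tendsto_1[OF \<mu>(6,3,4) n1] mass_power_tendsto_1[OF \<nu>(6,3,4) n2])
  then have e: "(\<lambda>n. 1 - m n ^ n1 n * l n ^ n2 n) \<longlonglongrightarrow> 0" by simp
  have pr: "prob_space (Ps n)" "prob_space (Qs n)" for n using A B by (auto simp: local_seq_def)
  have "(\<lambda>n. (\<integral>w. (if ?T n w > c then 1 else 0) \<partial>two_sample (n1 n) (n2 n) (Ps n) (Qs n))
      - (\<integral>w. (if ?T n w > c then 1 else 0) \<partial>?R n)) \<longlonglongrightarrow> (0 :: real)"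
  proof (rule Lim_null_comparison[OF always_eventually e], intro allI)
    fix n
    show "norm ((\<integral>w. (if ?T n w > c then 1 else 0 :: real) \<partial>two_sample (n1 n) (n2 n) (Ps n) (Qs n))
      - (\<integral>w. (if ?T n w > c then 1 else 0) \<partial>?R n)) \<le> 1 - m n ^ n1 n * l n ^ n2 n"
      unfolding real_norm_def
      by (rule dominated_test_bound[OF pr \<mu>(1) \<nu>(1) \<mu>(3,4) \<nu>(3,4) \<mu>(5) \<nu>(5) t]) auto
  qed
  from tendsto_add[OF this lim] show ?thesis by simp
qed

text \<open>\<open>exp (\<Delta> z - \<Delta>^2 / 2)\<close> is the density of
  \<open>N(\<Delta>, 1)\<close> with respect to \<open>N(0, 1)\<close>, and the cap is its value at
  \<open>z = u\<close>. Below \<open>u\<close> the shifted normal law leaves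
  \<open>\<Phi> (u - \<Delta>)\<close>; above \<open>u\<close> the cap times the upper tail
  remains.\<close>

lemma normal_min_exp_integral:
  assumes \<Delta>: "0 < \<Delta>"
  shows "(\<integral>z. min (exp (\<Delta> * z - \<Delta>\<^sup>2 / 2)) (exp (\<Delta> * u - \<Delta>\<^sup>2 / 2)) \<partial>std_normal_distribution)
    = \<Phi> (u - \<Delta>) + exp (\<Delta> * u - \<Delta>\<^sup>2 / 2) * (1 - \<Phi> u)"
proof -
  let ?c = "exp (\<Delta> * u - \<Delta>\<^sup>2 / 2)"
  have min: "min (exp (\<Delta> * z - \<Delta>\<^sup>2 / 2)) ?c = exp (\<Delta> * z - \<Delta>\<^sup>2 / 2) * indicator {..u} z + ?c * indicator {u<..} z" for z
    using \<Delta> by (auto simp: indicator_def min_def not_le not_less)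
  have dens: "std_normal_density z * exp (\<Delta> * z - \<Delta>\<^sup>2 / 2) = std_normal_density (z - \<Delta>)" for z
  proof -
    have "- z\<^sup>2 / 2 + (\<Delta> * z - \<Delta>\<^sup>2 / 2) = - (z - \<Delta>)\<^sup>2 / 2" by (simp add: power2_diff field_simps)
    then show ?thesis by (simp add: std_normal_density_def exp_add[symmetric])
  qed
  have cdfI: "(\<integral>z. std_normal_density z * indicator {..x} z \<partial>lborel) = \<Phi> x" for x
  proof -
    have "\<Phi> x = (\<integral>z. indicator {..x} z \<partial>std_normal_distribution)" by (simp add: cdf_def)
    also have "\<dots> = (\<integral>z. std_normal_density z *\<^sub>R indicator {..x} z \<partial>lborel)"
      by (rule integral_density) auto
    finally show ?thesis by simp
  qed
  have i1: "integrable std_normal_distribution (\<lambda>z. exp (\<Delta> * z - \<Delta>\<^sup>2 / 2) * indicator {..u} z)"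
    by (rule std_normal.integrable_const_bound[of _ ?c]) (use \<Delta> in \<open>auto simp: indicator_def\<close>)
  have i2: "integrable std_normal_distribution (\<lambda>z. ?c * indicator {u<..} z)"
    by (rule std_normal.integrable_const_bound[of _ ?c]) (auto simp: indicator_def)
  have "(\<integral>z. exp (\<Delta> * z - \<Delta>\<^sup>2 / 2) * indicator {..u} z \<partial>std_normal_distribution) =
     (\<integral>z. std_normal_density z *\<^sub>R (exp (\<Delta> * z - \<Delta>\<^sup>2 / 2) * indicator {..u} z) \<partial>lborel)"
    by (rule integral_density) auto
  also have "\<dots> = (\<integral>z. std_normal_density (z - \<Delta>) * indicator {..u - \<Delta>} (z - \<Delta>) \<partial>lborel)"
    by (rule Bochner_Integration.integral_cong) (auto simp: dens mult.assoc[symmetric] indicator_def)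
  also have "\<dots> = (\<integral>z. std_normal_density z * indicator {..u - \<Delta>} z \<partial>lborel)"
    using lborel_integral_real_affine[of 1 "\<lambda>z. std_normal_density z * indicator {..u - \<Delta>} z" "- \<Delta>"]
    by simp
  also have "\<dots> = \<Phi> (u - \<Delta>)" by (rule cdfI)
  finally have e1: "(\<integral>z. exp (\<Delta> * z - \<Delta>\<^sup>2 / 2) * indicator {..u} z \<partial>std_normal_distribution) = \<Phi> (u - \<Delta>)" .
  have e2: "measure std_normal_distribution {u<..} = 1 - \<Phi> u"
    using std_normal.prob_compl[of "{..u}"] by (simp add: cdf_def Compl_eq_Diff_UNIV[symmetric])
  show ?thesis unfolding min using i1 i2 by (simp add: e1 e2)
qed

text \<open>In the limit the experiment is a Gaussian shift by \<open>\<Delta>\<close>, and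
  \<open>c\<close> is its likelihood-ratio threshold for level \<open>1 - \<Phi> u\<close>. With
  this choice the two terms containing \<open>c\<close> cancel, and the power of the optimal
  Gaussian test is left.\<close>

theorem neyman_pearson_limsup:
  fixes P0 :: "'a measure" and Q0 :: "'b measure"
  assumes P0: "prob_space P0" and Q0: "prob_space Q0"
    and PA: "local_seq P0 PA a1" and QA: "local_seq Q0 QA a2"
    and PB: "local_seq P0 PB b1" and QB: "local_seq Q0 QB b2"
    and n1: "(\<lambda>n. real (n1 n) / real n) \<longlonglongrightarrow> 1 - d" and n2: "(\<lambda>n. real (n2 n) / real n) \<longlonglongrightarrow> d"
    and \<Delta>: "\<Delta>\<^sup>2 = (1 - d) * (\<integral>x. (b1 x - a1 x)\<^sup>2 \<partial>P0) + d * (\<integral>y. (b2 y - a2 y)\<^sup>2 \<partial>Q0)" "0 < \<Delta>"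
    and \<phi>: "is_test_seq P0 Q0 n1 n2 \<phi>"
    and level: "(\<lambda>n. \<integral>w. \<phi> n w \<partial>two_sample (n1 n) (n2 n) (PA n) (QA n)) \<longlonglongrightarrow> 1 - \<Phi> u"
  shows "limsup (\<lambda>n. ereal (\<integral>w. \<phi> n w \<partial>two_sample (n1 n) (n2 n) (PB n) (QB n))) \<le> ereal (1 - \<Phi> (u - \<Delta>))"
proof -
  obtain \<mu> m X where \<mu>: "\<And>n. prob_space (\<mu> n)" "\<And>n. sets (\<mu> n) = sets P0" "\<And>n. 0 \<le> m n" "\<And>n. m n \<le> (1::real)"
    "\<And>n. dominates (PA n) (\<lambda>_. ennreal (m n)) (\<mu> n)" "(\<lambda>n. real n * (1 - m n)) \<longlonglongrightarrow> 0"
    "\<And>n. dominates (PB n) (\<lambda>x. ennreal (m n * exp (X n x))) (\<mu> n)"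
    "lindeberg \<mu> X (- (1/2) * (\<integral>x. (b1 x - a1 x)\<^sup>2 \<partial>P0)) (\<integral>x. (b1 x - a1 x)\<^sup>2 \<partial>P0)"
    by (rule localization[OF P0 PA PB]) blast
  obtain \<nu> l Y where \<nu>: "\<And>n. prob_space (\<nu> n)" "\<And>n. sets (\<nu> n) = sets Q0" "\<And>n. 0 \<le> l n" "\<And>n. l n \<le> (1::real)"
    "\<And>n. dominates (QA n) (\<lambda>_. ennreal (l n)) (\<nu> n)" "(\<lambda>n. real n * (1 - l n)) \<longlonglongrightarrow> 0"
    "\<And>n. dominates (QB n) (\<lambda>x. ennreal (l n * exp (Y n x))) (\<nu> n)"
    "lindeberg \<nu> Y (- (1/2) * (\<integral>x. (b2 x - a2 x)\<^sup>2 \<partial>Q0)) (\<integral>x. (b2 x - a2 x)\<^sup>2 \<partial>Q0)"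
    by (rule localization[OF Q0 QA QB]) blast
  let ?R = "\<lambda>n. two_sample (n1 n) (n2 n) (\<mu> n) (\<nu> n)"
  let ?S = "\<lambda>n w. (\<Sum>i=1..n1 n. X n (fst w i)) + (\<Sum>j=1..n2 n. Y n (snd w j))"
  let ?U = "\<lambda>n w. (?S n w - (- \<Delta>\<^sup>2 / 2)) / sqrt (\<Delta>\<^sup>2)"
  define c where "c = exp (\<Delta> * u - \<Delta>\<^sup>2 / 2)"
  let ?f = "\<lambda>z. min (exp (\<Delta> * z - \<Delta>\<^sup>2 / 2)) c"
  have sq: "sqrt (\<Delta>\<^sup>2) = \<Delta>" using \<Delta>(2) by simp
  have weak: "weak_conv_m (\<lambda>n. distr (?R n) borel (?U n)) std_normal_distribution"
    by (rule two_sample_clt[OF \<mu>(1) \<nu>(1) \<mu>(8) \<nu>(8) n1 n2]) (use \<Delta> in \<open>auto simp: field_simps\<close>)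
  have XYm: "X n \<in> borel_measurable (\<mu> n)" "Y n \<in> borel_measurable (\<nu> n)" for n
    using \<mu>(8) \<nu>(8) by (auto simp: lindeberg_def L2_space_def)
  have Sm: "?S n \<in> borel_measurable (?R n)" for n by (rule measurable_two_sample_sum[OF XYm])
  \<comment> \<open>The cap makes the integrand bounded as well as continuous, so weak convergence
    passes to the integral.\<close>
  have lim: "(\<lambda>n. \<integral>z. ?f z \<partial>distr (?R n) borel (?U n)) \<longlonglongrightarrow> (\<integral>z. ?f z \<partial>std_normal_distribution)"
  proof (rule weak_conv_imp_integral_bdd_continuous_conv[OF _ _ weak])
    show "real_distribution (distr (?R n) borel (?U n))" for n
    proof -
      interpret prob_space "?R n" by (rule prob_space_two_sample[OF \<mu>(1) \<nu>(1)])
      show ?thesis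
        by (rule real_distribution_distr) (intro borel_measurable_divide borel_measurable_diff Sm borel_measurable_const)
    qed
    show "isCont ?f x" for x by (intro continuous_intros)
    show "norm (?f x) \<le> c" for x by (auto simp: c_def min_def)
  qed (rule real_dist_normal_dist)
  have E: "(\<integral>z. ?f z \<partial>distr (?R n) borel (?U n)) = (\<integral>w. min (exp (?S n w)) c \<partial>?R n)" for n
  proof -
    have "(\<integral>z. ?f z \<partial>distr (?R n) borel (?U n)) = (\<integral>w. ?f (?U n w) \<partial>?R n)"
    proof (rule integral_distr)
      show "?U n \<in> measurable (?R n) borel"
        by (intro borel_measurable_divide borel_measurable_diff Sm borel_measurable_const)
    qed simp
    also have "\<dots> = (\<integral>w. min (exp (?S n w)) c \<partial>?R n)"
    proof -
      have "\<Delta> * ((s - (- \<Delta>\<^sup>2 / 2)) / \<Delta>) - \<Delta>\<^sup>2 / 2 = s" for s using \<Delta>(2) by simp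
      then show ?thesis by (simp only: sq)
    qed
    finally show ?thesis .
  qed
  let ?L = "\<Phi> (u - \<Delta>) + c * (1 - \<Phi> u)"
  let ?a = "\<lambda>n. \<integral>w. \<phi> n w \<partial>two_sample (n1 n) (n2 n) (PA n) (QA n)"
  let ?b = "\<lambda>n. \<integral>w. \<phi> n w \<partial>two_sample (n1 n) (n2 n) (PB n) (QB n)"
  let ?y = "\<lambda>n. 1 + c * ?a n - m n ^ n1 n * l n ^ n2 n * (\<integral>w. min (exp (?S n w)) c \<partial>?R n)"
  have "?y \<longlonglongrightarrow> 1 + c * (1 - \<Phi> u) - 1 * 1 * ?L"
    by (intro tendsto_intros level lim[unfolded E normal_min_exp_integral[OF \<Delta>(2), of u, folded c_def]] mass_power_tendsto_1[OF \<mu>(6,3,4) n1] mass_power_tendsto_1[OF \<nu>(6,3,4) n2])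
  then have y: "?y \<longlonglongrightarrow> 1 - \<Phi> (u - \<Delta>)" by simp
  have pr: "prob_space (PA n)" "prob_space (QA n)" "prob_space (PB n)" "prob_space (QB n)" for n
    using PA QA PB QB by (auto simp: local_seq_def)
  have "?b n \<le> ?y n" for n
  proof -
    have s: "sets (?R n) = sets (two_sample (n1 n) (n2 n) P0 Q0)" by (rule sets_two_sample_cong[OF \<mu>(2) \<nu>(2)])
    have \<phi>': "\<phi> n \<in> borel_measurable (?R n)" "\<And>w. w \<in> space (?R n) \<Longrightarrow> 0 \<le> \<phi> n w \<and> \<phi> n w \<le> 1"
      using \<phi> measurable_cong_sets[OF s refl, of borel] sets_eq_imp_space_eq[OF s] by (auto simp: is_test_seq_def)
    have "0 \<le> c" by (simp add: c_def)
    from neyman_pearson_bound[OF pr \<mu>(1) \<nu>(1) \<mu>(3) \<nu>(3) this \<mu>(5) \<nu>(5) \<mu>(7) \<nu>(7) XYm \<phi>'] show ?thesis by simp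
  qed
  then have "limsup (\<lambda>n. ereal (?b n)) \<le> limsup (\<lambda>n. ereal (?y n))" by (intro Limsup_mono always_eventually) simp
  also have "\<dots> = ereal (1 - \<Phi> (u - \<Delta>))" using y by (intro lim_imp_Limsup) auto
  finally show ?thesis .
qed

section \<open>Density quotients and marginals of differentiable curves\<close>

text \<open>Both measures have densities \<open>p\<close> and \<open>q\<close> with respect to their
  sum, and \<open>p / q\<close> is a quotient, infinite where \<open>q\<close> vanishes so as to
  collect the singular part. Existence matters because a curve in the product family comes with
  quotients of the products only, not of their factors.\<close>

lemma density_quotient_exists:
  assumes P: "prob_space P" and Q: "prob_space Q" and s: "sets P = sets Q"
  shows "\<exists>L. is_density_quotient P Q L"
proof -
  interpret P: prob_space P by (rule P)
  interpret Q: prob_space Q by (rule Q)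
  define S where "S = measure_of (space Q) (sets Q) (\<lambda>A. emeasure P A + emeasure Q A)"
  have sS [measurable_cong, simp]: "sets S = sets Q" by (simp add: S_def sets.sets_measure_of_eq)
  have spS: "space S = space Q" by (rule sets_eq_imp_space_eq[OF sS])
  note [measurable_cong] = s
  have ca: "countably_additive (sets Q) (\<lambda>A. emeasure P A + emeasure Q A)"
  proof (rule countably_additiveI)
    fix A :: "nat \<Rightarrow> 'a set"
    assume A: "range A \<subseteq> sets Q" "disjoint_family A" "(\<Union>i. A i) \<in> sets Q"
    then show "(\<Sum>i. emeasure P (A i) + emeasure Q (A i)) = emeasure P (\<Union>i. A i) + emeasure Q (\<Union>i. A i)"
      using suminf_emeasure[of A P] suminf_emeasure[of A Q] s
      by (simp add: suminf_add[symmetric] summableI)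
  qed
  have eS: "emeasure S A = emeasure P A + emeasure Q A" if "A \<in> sets Q" for A
    unfolding S_def
    by (rule emeasure_measure_of_sigma[OF sets.sigma_algebra_axioms _ ca that]) (simp add: positive_def)
  interpret S: finite_measure S
    by (rule finite_measureI) (simp add: spS eS P.emeasure_eq_measure Q.emeasure_eq_measure)
  have "absolutely_continuous S P" "absolutely_continuous S Q"
    by (auto simp: absolutely_continuous_def null_sets_def eS s)
  then obtain p q where p: "p \<in> borel_measurable S" "density S p = P" and q: "q \<in> borel_measurable S" "density S q = Q"
    using S.Radon_Nikodym[of P] S.Radon_Nikodym[of Q] s by auto
  have pm [measurable]: "p \<in> borel_measurable Q" "q \<in> borel_measurable Q"
    using p(1) q(1) by (simp_all add: measurable_cong_sets[OF sS refl])
  have spP: "space P = space Q" by (rule sets_eq_imp_space_eq[OF s])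
  have fin: "AE x in S. p x \<noteq> \<infinity>" "AE x in S. q x \<noteq> \<infinity>"
  proof -
    have "(\<integral>\<^sup>+x. p x \<partial>S) = emeasure (density S p) (space S)" unfolding emeasure_density[OF p(1) sets.top] by (rule nn_integral_cong) simp
    also have "\<dots> = 1" using P.emeasure_space_1 p(2) by (simp add: spS spP)
    finally show "AE x in S. p x \<noteq> \<infinity>" using p(1) by (intro nn_integral_PInf_AE) auto
    have "(\<integral>\<^sup>+x. q x \<partial>S) = emeasure (density S q) (space S)" unfolding emeasure_density[OF q(1) sets.top] by (rule nn_integral_cong) simp
    also have "\<dots> = 1" using Q.emeasure_space_1 q(2) by (simp add: spS)
    finally show "AE x in S. q x \<noteq> \<infinity>" using q(1) by (intro nn_integral_PInf_AE) auto
  qed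
  \<comment> \<open>Infinite values of \<open>p\<close> or \<open>q\<close> form a null set of
    \<open>S\<close>; sending them to \<open>\<infinity>\<close> makes \<open>q L = p\<close> exact
    wherever \<open>L\<close> is finite.\<close>
  define L where "L x = (if q x = 0 \<or> q x = \<infinity> \<or> p x = \<infinity> then \<infinity> else p x / q x)" for x
  have Lm [measurable]: "L \<in> borel_measurable Q" unfolding L_def[abs_def] by measurable
  have finL: "L x = \<infinity> \<longleftrightarrow> q x = 0 \<or> q x = \<infinity> \<or> p x = \<infinity>" for x
    by (auto simp: L_def ennreal_divide_eq_top_iff)
  have aeL: "AE x in Q. L x \<noteq> \<infinity>"
  proof -
    have "AE x in density S q. L x \<noteq> \<infinity>"
      unfolding AE_density[OF q(1)] finL using fin by eventually_elim auto
    then show ?thesis by (simp only: q(2))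
  qed
  have "is_density_quotient P Q L"
    unfolding is_density_quotient_def
  proof (intro conjI ballI)
    have "emeasure Q {x \<in> space Q. L x < \<infinity>} = emeasure Q (space Q)"
      by (rule emeasure_eq_AE) (use aeL in \<open>auto simp: less_top\<close>)
    then show "emeasure Q {x \<in> space Q. L x < \<infinity>} = 1" by (simp add: Q.emeasure_space_1)
    fix A assume A [measurable]: "A \<in> sets Q"
    let ?N = "{x \<in> space Q. L x = \<infinity>}"
    have [measurable]: "?N \<in> sets Q" by measurable
    have "A = (A - ?N) \<union> (A \<inter> ?N)" by auto
    then have "emeasure P A = emeasure P (A - ?N) + emeasure P (A \<inter> ?N)"
      using s by (subst plus_emeasure) (auto simp: s)
    also have "emeasure P (A - ?N) = emeasure (density S p) (A - ?N)" by (simp add: p(2))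
    also have "\<dots> = (\<integral>\<^sup>+x. p x * indicator (A - ?N) x \<partial>S)"
      using p(1) by (subst emeasure_density) auto
    also have "\<dots> = (\<integral>\<^sup>+x. q x * (L x * indicator (A - ?N) x) \<partial>S)"
    proof (rule nn_integral_cong)
      fix x assume x: "x \<in> space S"
      show "p x * indicator (A - ?N) x = q x * (L x * indicator (A - ?N) x)"
      proof (cases "L x = \<infinity>")
        case True
        then show ?thesis using x by (auto simp: indicator_def spS)
      next
        case False
        then have "q x * L x = p x"
          unfolding finL by (simp add: L_def ennreal_times_divide mult_divide_eq_ennreal mult.commute)
        then show ?thesis by (metis mult.assoc)
      qed
    qed
    also have "\<dots> = (\<integral>\<^sup>+x. L x * indicator (A - ?N) x \<partial>density S q)"
      using q(1) by (subst nn_integral_density) auto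
    also have "\<dots> = (\<integral>\<^sup>+x. L x * indicator A x \<partial>Q)"
      unfolding q(2) by (rule nn_integral_cong_AE) (use aeL in \<open>auto simp: indicator_def elim!: eventually_mono\<close>)
    finally show "emeasure P A = (\<integral>\<^sup>+x\<in>A. L x \<partial>Q) + emeasure P (A \<inter> ?N)" .
  qed measurable
  then show ?thesis by (rule exI[of _ L])
qed

lemma density_quotientD:
  assumes "is_density_quotient P Q L" "prob_space Q"
  shows "L \<in> borel_measurable Q" "AE x in Q. L x < \<infinity>"
    "A \<in> sets Q \<Longrightarrow> emeasure P A = (\<integral>\<^sup>+x\<in>A. L x \<partial>Q) + emeasure P (A \<inter> {x \<in> space Q. L x = \<infinity>})"
proof -
  interpret Q: prob_space Q by (rule assms)
  show m [measurable]: "L \<in> borel_measurable Q" using assms by (simp add: is_density_quotient_def)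
  show "AE x in Q. L x < \<infinity>"
  proof -
    have "AE x in Q. x \<in> {x \<in> space Q. L x < \<infinity>}"
      using assms(1) by (intro Q.AE_prob_1) (simp add: is_density_quotient_def Q.emeasure_eq_measure)
    then show ?thesis by eventually_elim simp
  qed
  show "A \<in> sets Q \<Longrightarrow> emeasure P A = (\<integral>\<^sup>+x\<in>A. L x \<partial>Q) + emeasure P (A \<inter> {x \<in> space Q. L x = \<infinity>})"
    using assms(1) unfolding is_density_quotient_def by blast
qed

lemma density_quotient_density:
  assumes L: "is_density_quotient P Q L" and Q: "prob_space Q" and s: "sets P = sets Q"
    and G: "G \<in> sets Q" "\<And>x. x \<in> G \<Longrightarrow> L x \<noteq> \<infinity>"
  shows "density P (indicator G) = density Q (\<lambda>x. L x * indicator G x)"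
proof (rule measure_eqI)
  fix A assume "A \<in> sets (density P (indicator G))"
  then have A: "A \<in> sets Q" using s by simp
  have e: "A \<inter> G \<inter> {x \<in> space Q. L x = \<infinity>} = {}" using G by auto
  have [measurable]: "L \<in> borel_measurable Q" by (rule density_quotientD[OF L Q])
  have "emeasure (density P (indicator G)) A = emeasure P (A \<inter> G)"
    using A G s by (subst emeasure_density) (auto simp: indicator_inter_arith[symmetric] Int_commute)
  also have "\<dots> = (\<integral>\<^sup>+x\<in>A \<inter> G. L x \<partial>Q)"
    using density_quotientD(3)[OF L Q, of "A \<inter> G"] A G e by simp
  also have "\<dots> = emeasure (density Q (\<lambda>x. L x * indicator G x)) A"
    using A G by (subst emeasure_density) (auto simp: indicator_inter_arith mult_ac)
  finally show "emeasure (density P (indicator G)) A = emeasure (density Q (\<lambda>x. L x * indicator G x)) A" .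
qed (simp add: s)

lemma density_quotient_nn_integral:
  assumes L: "is_density_quotient P Q L" and Q: "prob_space Q" and s: "sets P = sets Q"
    and f: "f \<in> borel_measurable Q" "\<And>x. x \<in> space Q \<Longrightarrow> L x = \<infinity> \<Longrightarrow> f x = 0"
  shows "(\<integral>\<^sup>+x. f x \<partial>P) = (\<integral>\<^sup>+x. f x * L x \<partial>Q)"
proof -
  have [measurable]: "L \<in> borel_measurable Q" by (rule density_quotientD[OF L Q])
  note [measurable] = f(1)
  note [measurable_cong] = s
  let ?G = "{x \<in> space Q. L x \<noteq> \<infinity>}"
  have Gm [measurable]: "?G \<in> sets Q" by measurable
  have sp: "space P = space Q" by (rule sets_eq_imp_space_eq[OF s])
  have "(\<integral>\<^sup>+x. f x \<partial>P) = (\<integral>\<^sup>+x. indicator ?G x * f x \<partial>P)"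
    by (rule nn_integral_cong) (use f(2) in \<open>auto simp: indicator_def sp\<close>)
  also have "\<dots> = (\<integral>\<^sup>+x. f x \<partial>density P (indicator ?G))"
    by (subst nn_integral_density) auto
  also have "\<dots> = (\<integral>\<^sup>+x. f x \<partial>density Q (\<lambda>x. L x * indicator ?G x))"
    by (subst density_quotient_density[OF L Q s Gm]) auto
  also have "\<dots> = (\<integral>\<^sup>+x. L x * indicator ?G x * f x \<partial>Q)"
    by (subst nn_integral_density) auto
  also have "\<dots> = (\<integral>\<^sup>+x. f x * L x \<partial>Q)"
    by (rule nn_integral_cong) (use f(2) in \<open>auto simp: indicator_def mult.commute\<close>)
  finally show ?thesis .
qed

lemma density_quotient_unique:
  assumes L: "is_density_quotient P Q L" and L': "is_density_quotient P Q L'" and Q: "prob_space Q" and s: "sets P = sets Q"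
  shows "AE x in Q. L x = L' x"
proof -
  interpret Q: prob_space Q by (rule Q)
  have [measurable]: "L \<in> borel_measurable Q" "L' \<in> borel_measurable Q"
    by (rule density_quotientD[OF L Q], rule density_quotientD[OF L' Q])
  let ?G = "{x \<in> space Q. L x < \<infinity> \<and> L' x < \<infinity>}"
  have Gm [measurable]: "?G \<in> sets Q" by measurable
  have "density Q (\<lambda>x. L x * indicator ?G x) = density Q (\<lambda>x. L' x * indicator ?G x)"
  proof (rule trans[OF sym])
    show "density P (indicator ?G) = density Q (\<lambda>x. L x * indicator ?G x)"
      by (rule density_quotient_density[OF L Q s Gm]) auto
    show "density P (indicator ?G) = density Q (\<lambda>x. L' x * indicator ?G x)"
      by (rule density_quotient_density[OF L' Q s Gm]) auto
  qed
  then have "AE x in Q. L x * indicator ?G x = L' x * indicator ?G x"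
    by (intro Q.density_unique) auto
  then show ?thesis
    using density_quotientD(2)[OF L Q] density_quotientD(2)[OF L' Q] AE_space[of Q]
    by eventually_elim (auto simp: indicator_def)
qed

lemma density_quotient_refl: "prob_space Q \<Longrightarrow> is_density_quotient Q Q (\<lambda>_. 1)"
  using prob_space.emeasure_space_1[of Q]
  by (auto simp: is_density_quotient_def)

text \<open>Fubini, one factor at a time, off the singular set. Since
  \<open>0 * \<infinity> = 0\<close> in \<open>ennreal\<close>, the bare product could be finite at
  points where one quotient is infinite; the explicit case makes the singular set exactly the union
  of the two cylinders.\<close>

lemma density_quotient_pair:
  assumes P0: "prob_space P0" and Q0: "prob_space Q0" and P: "prob_space P" and Q: "prob_space Q"
    and s: "sets P = sets P0" "sets Q = sets Q0"
    and L1: "is_density_quotient P P0 L1" and L2: "is_density_quotient Q Q0 L2"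
  shows "is_density_quotient (P \<Otimes>\<^sub>M Q) (P0 \<Otimes>\<^sub>M Q0)
     (\<lambda>w. if L1 (fst w) = \<infinity> \<or> L2 (snd w) = \<infinity> then \<infinity> else L1 (fst w) * L2 (snd w))"
    (is "is_density_quotient _ _ ?L")
proof -
  interpret P0: prob_space P0 by (rule P0)
  interpret Q0: prob_space Q0 by (rule Q0)
  interpret P: prob_space P by (rule P)
  interpret Q: prob_space Q by (rule Q)
  interpret R0: pair_prob_space P0 Q0 ..
  have [measurable]: "L1 \<in> borel_measurable P0" "L2 \<in> borel_measurable Q0"
    by (rule density_quotientD[OF L1 P0], rule density_quotientD[OF L2 Q0])
  have sR: "sets (P \<Otimes>\<^sub>M Q) = sets (P0 \<Otimes>\<^sub>M Q0)" by (rule sets_pair_measure_cong[OF s])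
  have Lm [measurable]: "?L \<in> borel_measurable (P0 \<Otimes>\<^sub>M Q0)" by measurable
  have Linf: "?L w = \<infinity> \<longleftrightarrow> L1 (fst w) = \<infinity> \<or> L2 (snd w) = \<infinity>" for w
    by (auto simp: ennreal_mult_eq_top_iff)
  have ae: "AE w in P0 \<Otimes>\<^sub>M Q0. ?L w < \<infinity>"
  proof -
    have "AE x in P0. AE y in Q0. ?L (x, y) < \<infinity>"
      using density_quotientD(2)[OF L1 P0]
    proof eventually_elim
      case (elim x)
      show ?case using density_quotientD(2)[OF L2 Q0]
        by eventually_elim (use elim in \<open>auto simp: less_top[symmetric] ennreal_mult_eq_top_iff\<close>)
    qed
    then show ?thesis by (intro R0.AE_pair_measure) auto
  qed
  show ?thesis
    unfolding is_density_quotient_def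
  proof (intro conjI ballI Lm)
    have "emeasure (P0 \<Otimes>\<^sub>M Q0) {w \<in> space (P0 \<Otimes>\<^sub>M Q0). ?L w < \<infinity>} = emeasure (P0 \<Otimes>\<^sub>M Q0) (space (P0 \<Otimes>\<^sub>M Q0))"
      by (rule emeasure_eq_AE) (use ae in auto)
    then show "emeasure (P0 \<Otimes>\<^sub>M Q0) {w \<in> space (P0 \<Otimes>\<^sub>M Q0). ?L w < \<infinity>} = 1" by (simp add: R0.emeasure_space_1)
    fix A assume A [measurable]: "A \<in> sets (P0 \<Otimes>\<^sub>M Q0)"
    let ?N = "{w \<in> space (P0 \<Otimes>\<^sub>M Q0). ?L w = \<infinity>}"
    have [measurable]: "?N \<in> sets (P0 \<Otimes>\<^sub>M Q0)" by measurable
    let ?f = "\<lambda>w. indicator (A - ?N) w :: ennreal"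
    have fm [measurable]: "?f \<in> borel_measurable (P0 \<Otimes>\<^sub>M Q0)" by measurable
    have fm1: "?f \<in> borel_measurable (P0 \<Otimes>\<^sub>M Q)"
      using fm measurable_cong_sets[OF sets_pair_measure_cong[OF refl s(2)] refl] by blast
    have fm2: "?f \<in> borel_measurable (P \<Otimes>\<^sub>M Q)"
      using fm measurable_cong_sets[OF sR refl] by blast
    have ip: "A = (A - ?N) \<union> (A \<inter> ?N)" by auto
    have "emeasure (P \<Otimes>\<^sub>M Q) A = emeasure (P \<Otimes>\<^sub>M Q) (A - ?N) + emeasure (P \<Otimes>\<^sub>M Q) (A \<inter> ?N)"
      by (subst ip, rule plus_emeasure[symmetric]) (auto simp: sR)
    also have "emeasure (P \<Otimes>\<^sub>M Q) (A - ?N) = (\<integral>\<^sup>+w. ?f w \<partial>(P \<Otimes>\<^sub>M Q))"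
      by (rule nn_integral_indicator[symmetric]) (simp add: sR)
    also have "\<dots> = (\<integral>\<^sup>+x. \<integral>\<^sup>+y. ?f (x, y) \<partial>Q \<partial>P)"
      by (rule Q.nn_integral_fst[symmetric, OF fm2])
    also have "\<dots> = (\<integral>\<^sup>+x. (\<integral>\<^sup>+y. ?f (x, y) \<partial>Q) * L1 x \<partial>P0)"
    proof (rule density_quotient_nn_integral[OF L1 P0 s(1)])
      show "(\<lambda>x. \<integral>\<^sup>+y. ?f (x, y) \<partial>Q) \<in> borel_measurable P0"
        by (rule Q.borel_measurable_nn_integral_fst[OF fm1])
      fix x assume x: "x \<in> space P0" "L1 x = \<infinity>"
      have "(\<integral>\<^sup>+y. ?f (x, y) \<partial>Q) = (\<integral>\<^sup>+y. 0 \<partial>Q)"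
        by (rule nn_integral_cong) (use x sets_eq_imp_space_eq[OF s(2)] in \<open>auto simp: indicator_def space_pair_measure\<close>)
      then show "(\<integral>\<^sup>+y. ?f (x, y) \<partial>Q) = 0" by simp
    qed
    also have "\<dots> = (\<integral>\<^sup>+x. (\<integral>\<^sup>+y. ?f (x, y) * L2 y \<partial>Q0) * L1 x \<partial>P0)"
    proof (rule nn_integral_cong)
      fix x assume x [measurable]: "x \<in> space P0"
      have "(\<integral>\<^sup>+y. ?f (x, y) \<partial>Q) = (\<integral>\<^sup>+y. ?f (x, y) * L2 y \<partial>Q0)"
        by (rule density_quotient_nn_integral[OF L2 Q0 s(2)])
           (use x in \<open>auto simp: indicator_def space_pair_measure\<close>)
      then show "(\<integral>\<^sup>+y. ?f (x, y) \<partial>Q) * L1 x = (\<integral>\<^sup>+y. ?f (x, y) * L2 y \<partial>Q0) * L1 x" by simp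
    qed
    also have "\<dots> = (\<integral>\<^sup>+x. \<integral>\<^sup>+y. ?f (x, y) * (L1 x * L2 y) \<partial>Q0 \<partial>P0)"
    proof (rule nn_integral_cong)
      fix x assume x [measurable]: "x \<in> space P0"
      have "(\<integral>\<^sup>+y. ?f (x, y) * L2 y \<partial>Q0) * L1 x = (\<integral>\<^sup>+y. ?f (x, y) * L2 y * L1 x \<partial>Q0)"
        by (rule nn_integral_multc[symmetric]) measurable
      then show "(\<integral>\<^sup>+y. ?f (x, y) * L2 y \<partial>Q0) * L1 x = (\<integral>\<^sup>+y. ?f (x, y) * (L1 x * L2 y) \<partial>Q0)"
        by (simp add: mult_ac)
    qed
    also have "\<dots> = (\<integral>\<^sup>+w. ?f w * (L1 (fst w) * L2 (snd w)) \<partial>(P0 \<Otimes>\<^sub>M Q0))"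
      by (subst Q0.nn_integral_fst[symmetric]) auto
    also have "\<dots> = (\<integral>\<^sup>+w. ?L w * indicator A w \<partial>(P0 \<Otimes>\<^sub>M Q0))"
    proof (rule nn_integral_cong_AE)
      show "AE w in P0 \<Otimes>\<^sub>M Q0. ?f w * (L1 (fst w) * L2 (snd w)) = ?L w * indicator A w"
        using ae AE_space
      proof eventually_elim
        case (elim w)
        then have "?L w \<noteq> \<infinity>" by simp
        then have "?L w = L1 (fst w) * L2 (snd w)" "?f w = indicator A w"
          using elim(2) unfolding Linf by (auto simp: indicator_def)
        then show ?case by (simp only: mult.commute)
      qed
    qed
    finally show "emeasure (P \<Otimes>\<^sub>M Q) A = (\<integral>\<^sup>+w\<in>A. ?L w \<partial>(P0 \<Otimes>\<^sub>M Q0)) + emeasure (P \<Otimes>\<^sub>M Q) (A \<inter> ?N)" .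
  qed
qed

text \<open>Mass balance: evaluating the defining identity on the whole space shows that what the
  squared root density lacks from total mass \<open>1\<close> is the singular mass. Conditions on
  singular parts thus become conditions on \<open>L2\<close> norms.\<close>

lemma density_quotient_sqrt:
  assumes L: "is_density_quotient P Q L" and P: "prob_space P" and Q: "prob_space Q" and s: "sets P = sets Q"
  defines "\<xi> \<equiv> \<lambda>x. sqrt (enn2real (L x))"
  shows "\<xi> \<in> L2_space Q" "(\<integral>x. (\<xi> x)\<^sup>2 \<partial>Q) = 1 - measure P {x \<in> space P. L x = \<infinity>}"
    "dominates P (\<lambda>x. ennreal ((\<xi> x)\<^sup>2)) Q"
proof -
  interpret P: prob_space P by (rule P)
  interpret Q: prob_space Q by (rule Q)
  have Lm [measurable]: "L \<in> borel_measurable Q" by (rule density_quotientD[OF L Q])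
  have \<xi>m [measurable]: "\<xi> \<in> borel_measurable Q" unfolding \<xi>_def by measurable
  have sp: "space P = space Q" by (rule sets_eq_imp_space_eq[OF s])
  have ae: "AE x in Q. ennreal ((\<xi> x)\<^sup>2) = L x"
    using density_quotientD(2)[OF L Q] by eventually_elim (simp add: \<xi>_def)
  have "1 = (\<integral>\<^sup>+x. L x \<partial>Q) + emeasure P {x \<in> space P. L x = \<infinity>}"
  proof -
    have "emeasure P (space Q) = (\<integral>\<^sup>+x\<in>space Q. L x \<partial>Q) + emeasure P (space Q \<inter> {x \<in> space Q. L x = \<infinity>})"
      by (rule density_quotientD(3)[OF L Q]) simp
    moreover have "(\<integral>\<^sup>+x\<in>space Q. L x \<partial>Q) = (\<integral>\<^sup>+x. L x \<partial>Q)" by (rule nn_integral_cong) simp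
    moreover have "space Q \<inter> {x \<in> space Q. L x = \<infinity>} = {x \<in> space P. L x = \<infinity>}" by (auto simp: sp)
    ultimately show ?thesis using P.emeasure_space_1 by (simp add: sp)
  qed
  moreover have n: "(\<integral>\<^sup>+x. L x \<partial>Q) = (\<integral>\<^sup>+x. ennreal ((\<xi> x)\<^sup>2) \<partial>Q)"
    by (rule nn_integral_cong_AE) (use ae in auto)
  ultimately have 1: "1 = (\<integral>\<^sup>+x. ennreal ((\<xi> x)\<^sup>2) \<partial>Q) + emeasure P {x \<in> space P. L x = \<infinity>}" by simp
  then have "(\<integral>\<^sup>+x. ennreal ((\<xi> x)\<^sup>2) \<partial>Q) \<noteq> \<infinity>"
    by (metis ennreal_add_eq_top ennreal_one_neq_top infinity_ennreal_def)
  then have i: "integrable Q (\<lambda>x. (\<xi> x)\<^sup>2)"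
    by (intro integrableI_nonneg) (auto simp: less_top)
  then show "\<xi> \<in> L2_space Q" by (simp add: L2_space_def)
  have "1 = ennreal (\<integral>x. (\<xi> x)\<^sup>2 \<partial>Q) + ennreal (measure P {x \<in> space P. L x = \<infinity>})"
    using 1 i by (simp add: nn_integral_eq_integral P.emeasure_eq_measure)
  then have "ennreal 1 = ennreal ((\<integral>x. (\<xi> x)\<^sup>2 \<partial>Q) + measure P {x \<in> space P. L x = \<infinity>})"
    by (subst ennreal_plus) auto
  then have "1 = (\<integral>x. (\<xi> x)\<^sup>2 \<partial>Q) + measure P {x \<in> space P. L x = \<infinity>}"
    by (subst (asm) ennreal_inj) (auto intro!: add_nonneg_nonneg)
  then show "(\<integral>x. (\<xi> x)\<^sup>2 \<partial>Q) = 1 - measure P {x \<in> space P. L x = \<infinity>}" by simp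
  show "dominates P (\<lambda>x. ennreal ((\<xi> x)\<^sup>2)) Q"
  proof (rule dominatesI[OF s])
    fix A assume A: "A \<in> sets Q"
    have "(\<integral>\<^sup>+x\<in>A. ennreal ((\<xi> x)\<^sup>2) \<partial>Q) = (\<integral>\<^sup>+x\<in>A. L x \<partial>Q)"
      by (rule nn_integral_cong_AE) (use ae in \<open>auto elim: eventually_mono\<close>)
    also have "\<dots> \<le> emeasure P A" by (subst density_quotientD(3)[OF L Q A]) simp
    finally show "(\<integral>\<^sup>+x\<in>A. ennreal ((\<xi> x)\<^sup>2) \<partial>Q) \<le> emeasure P A" .
  qed measurable
qed

section \<open>Partial integrals on a product space\<close>

definition marginal1 :: "'b measure \<Rightarrow> ('a \<times> 'b \<Rightarrow> real) \<Rightarrow> 'a \<Rightarrow> real" where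
  "marginal1 Q h x = (\<integral>y. h (x, y) \<partial>Q)"

definition marginal2 :: "'a measure \<Rightarrow> ('a \<times> 'b \<Rightarrow> real) \<Rightarrow> 'b \<Rightarrow> real" where
  "marginal2 P h y = (\<integral>x. h (x, y) \<partial>P)"

context pair_prob_space
begin

lemma L2_section:
  assumes "h \<in> L2_space (M1 \<Otimes>\<^sub>M M2)"
  shows "AE x in M1. (\<lambda>y. h (x, y)) \<in> L2_space M2"
proof -
  have [measurable]: "h \<in> borel_measurable (M1 \<Otimes>\<^sub>M M2)" using assms by (simp add: L2_space_def)
  have "AE x in M1. integrable M2 (\<lambda>y. (h (x, y))\<^sup>2)"
    using AE_integrable_fst'[of "\<lambda>w. (h w)\<^sup>2"] assms by (simp add: L2_space_def)
  then show ?thesis using AE_space[of M1]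
    by eventually_elim (simp add: L2_space_def)
qed

lemma marginal1_measurable:
  assumes "h \<in> L2_space (M1 \<Otimes>\<^sub>M M2)" shows "marginal1 M2 h \<in> borel_measurable M1"
  unfolding marginal1_def[abs_def]
  by (rule M2.borel_measurable_lebesgue_integral) (use assms in \<open>simp add: L2_space_def\<close>)

text \<open>Cauchy-Schwarz against the constant \<open>1\<close> in almost every section, then
  Fubini. The map is a contraction, which later lets approximations on the product descend to the
  factors.\<close>

lemma marginal1_L2:
  assumes h: "h \<in> L2_space (M1 \<Otimes>\<^sub>M M2)"
  shows "marginal1 M2 h \<in> L2_space M1" "L2_norm M1 (marginal1 M2 h) \<le> L2_norm (M1 \<Otimes>\<^sub>M M2) h"
proof -
  have m [measurable]: "marginal1 M2 h \<in> borel_measurable M1" by (rule marginal1_measurable[OF h])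
  have hi: "integrable (M1 \<Otimes>\<^sub>M M2) (\<lambda>w. (h w)\<^sup>2)" using h by (simp add: L2_space_def)
  have ii: "integrable M1 (\<lambda>x. \<integral>y. (h (x, y))\<^sup>2 \<partial>M2)" by (rule integrable_fst'[OF hi])
  have le: "AE x in M1. (marginal1 M2 h x)\<^sup>2 \<le> (\<integral>y. (h (x, y))\<^sup>2 \<partial>M2)"
    using L2_section[OF h]
  proof eventually_elim
    case (elim x)
    have "\<bar>\<integral>y. h (x, y) * 1 \<partial>M2\<bar> \<le> L2_norm M2 (\<lambda>y. h (x, y)) * L2_norm M2 (\<lambda>y. 1)"
      by (rule L2_CS[OF elim M2.L2_const])
    then have "\<bar>marginal1 M2 h x\<bar> \<le> L2_norm M2 (\<lambda>y. h (x, y))"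
      by (simp add: marginal1_def L2_norm_def M2.prob_space)
    then have "(marginal1 M2 h x)\<^sup>2 \<le> (L2_norm M2 (\<lambda>y. h (x, y)))\<^sup>2"
      using abs_le_square_iff by fastforce
    then show ?case by (simp add: L2_norm_power2)
  qed
  have i: "integrable M1 (\<lambda>x. (marginal1 M2 h x)\<^sup>2)"
    by (rule Bochner_Integration.integrable_bound[OF ii]) (use le in \<open>auto elim!: eventually_mono\<close>)
  then show "marginal1 M2 h \<in> L2_space M1" by (simp add: L2_space_def)
  have "(\<integral>x. (marginal1 M2 h x)\<^sup>2 \<partial>M1) \<le> (\<integral>x. \<integral>y. (h (x, y))\<^sup>2 \<partial>M2 \<partial>M1)"
    by (rule integral_mono_AE[OF i ii le])
  also have "\<dots> = (\<integral>w. (h w)\<^sup>2 \<partial>(M1 \<Otimes>\<^sub>M M2))" using integral_fst'[OF hi] by simp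
  finally show "L2_norm M1 (marginal1 M2 h) \<le> L2_norm (M1 \<Otimes>\<^sub>M M2) h" by (simp add: L2_norm_def)
qed

lemma L2_fst:
  assumes f: "f \<in> L2_space M1"
  shows "(\<lambda>w. f (fst w)) \<in> L2_space (M1 \<Otimes>\<^sub>M M2)" "L2_norm (M1 \<Otimes>\<^sub>M M2) (\<lambda>w. f (fst w)) = L2_norm M1 f"
    "(\<integral>w. f (fst w) \<partial>(M1 \<Otimes>\<^sub>M M2)) = (\<integral>x. f x \<partial>M1)"
proof -
  have d: "distr (M1 \<Otimes>\<^sub>M M2) M1 fst = M1" by (rule M2.distr_pair_fst)
  have [measurable]: "f \<in> borel_measurable M1" using f by (simp add: L2_space_def)
  have "integrable (distr (M1 \<Otimes>\<^sub>M M2) M1 fst) (\<lambda>x. (f x)\<^sup>2)" using f by (simp add: d L2_space_def)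
  then show "(\<lambda>w. f (fst w)) \<in> L2_space (M1 \<Otimes>\<^sub>M M2)" by (simp add: L2_space_def integrable_distr_eq)
  have e: "(\<integral>w. u (fst w) \<partial>(M1 \<Otimes>\<^sub>M M2)) = (\<integral>x. u x \<partial>M1)" if "u \<in> borel_measurable M1" for u :: "_ \<Rightarrow> real"
    using integral_distr[of fst "M1 \<Otimes>\<^sub>M M2" M1 u] that by (simp add: d)
  show "(\<integral>w. f (fst w) \<partial>(M1 \<Otimes>\<^sub>M M2)) = (\<integral>x. f x \<partial>M1)" by (rule e) simp
  show "L2_norm (M1 \<Otimes>\<^sub>M M2) (\<lambda>w. f (fst w)) = L2_norm M1 f" unfolding L2_norm_def by (subst e) auto
qed

lemma marginal1_inner:
  assumes f: "f \<in> L2_space M1" and h: "h \<in> L2_space (M1 \<Otimes>\<^sub>M M2)"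
  shows "(\<integral>x. f x * marginal1 M2 h x \<partial>M1) = (\<integral>w. f (fst w) * h w \<partial>(M1 \<Otimes>\<^sub>M M2))"
proof -
  have "(\<integral>w. f (fst w) * h w \<partial>(M1 \<Otimes>\<^sub>M M2)) = (\<integral>x. \<integral>y. f x * h (x, y) \<partial>M2 \<partial>M1)"
    using integral_fst'[OF L2_mult_integrable[OF L2_fst(1)[OF f] h]] by simp
  then show ?thesis by (simp add: marginal1_def)
qed

text \<open>Only almost everywhere, since exceptional sections may fail to be integrable, and there
  the integral has its default value.\<close>

lemma marginal1_lincomb:
  assumes h: "h \<in> L2_space (M1 \<Otimes>\<^sub>M M2)" and k: "k \<in> L2_space (M1 \<Otimes>\<^sub>M M2)"
  shows "AE x in M1. marginal1 M2 (\<lambda>w. c * h w + c' * k w) x = c * marginal1 M2 h x + c' * marginal1 M2 k x"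
  using L2_section[OF h] L2_section[OF k]
proof eventually_elim
  case (elim x)
  then show ?case using M2.L2_integrable[OF elim(1)] M2.L2_integrable[OF elim(2)] by (simp add: marginal1_def)
qed

lemma L2_swap:
  assumes h: "h \<in> L2_space (M1 \<Otimes>\<^sub>M M2)"
  shows "(\<lambda>w. h (snd w, fst w)) \<in> L2_space (M2 \<Otimes>\<^sub>M M1)"
    "L2_norm (M2 \<Otimes>\<^sub>M M1) (\<lambda>w. h (snd w, fst w)) = L2_norm (M1 \<Otimes>\<^sub>M M2) h"
    "(\<integral>w. h (snd w, fst w) \<partial>(M2 \<Otimes>\<^sub>M M1)) = (\<integral>w. h w \<partial>(M1 \<Otimes>\<^sub>M M2))"
proof -
  have [measurable]: "h \<in> borel_measurable (M1 \<Otimes>\<^sub>M M2)" using h by (simp add: L2_space_def)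
  have "integrable (M2 \<Otimes>\<^sub>M M1) (\<lambda>(x, y). (h (y, x))\<^sup>2)"
    by (rule integrable_product_swap) (use h in \<open>simp add: L2_space_def\<close>)
  then show "(\<lambda>w. h (snd w, fst w)) \<in> L2_space (M2 \<Otimes>\<^sub>M M1)"
    by (simp add: L2_space_def case_prod_beta')
  have e: "(\<integral>w. u (snd w, fst w) \<partial>(M2 \<Otimes>\<^sub>M M1)) = (\<integral>w. u w \<partial>(M1 \<Otimes>\<^sub>M M2))"
    if "u \<in> borel_measurable (M1 \<Otimes>\<^sub>M M2)" for u :: "_ \<Rightarrow> real"
    using integral_product_swap[OF that] by (simp add: case_prod_beta')
  show "(\<integral>w. h (snd w, fst w) \<partial>(M2 \<Otimes>\<^sub>M M1)) = (\<integral>w. h w \<partial>(M1 \<Otimes>\<^sub>M M2))" by (rule e) simp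
  show "L2_norm (M2 \<Otimes>\<^sub>M M1) (\<lambda>w. h (snd w, fst w)) = L2_norm (M1 \<Otimes>\<^sub>M M2) h"
    unfolding L2_norm_def by (subst e[symmetric]) auto
qed

end

lemma L2_space_cong_AE:
  assumes "AE x in M. f x = g x" "f \<in> borel_measurable M" "g \<in> L2_space M"
  shows "f \<in> L2_space M"
  by (rule L2_norm_mono(2)[OF assms(2,3)]) (use assms(1) in \<open>auto elim: eventually_mono\<close>)

text \<open>Let \<open>c1\<close> and \<open>c2\<close> be the means of the root densities, that is,
  Hellinger affinities. Integrating the remainder of the product over the second coordinate gives
  \<open>2 (c2 \<xi>1 - 1) - t g1\<close> with \<open>g1\<close> the partial integral of
  \<open>g\<close>; this differs from the wanted remainder only through \<open>1 - c2\<close>. The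
  latter is of second order, because \<open>1 - c2 \<le> 1 - c1 c2\<close>, and
  \<open>1 - c1 c2\<close> is half of the squared norm of \<open>\<xi>1 \<xi>2 - 1\<close> plus half
  the lost mass \<open>s\<close>.\<close>

lemma (in pair_prob_space) marginal1_expansion:
  fixes g :: "'a \<times> 'b \<Rightarrow> real" and t :: real
  assumes \<xi>1: "\<xi>1 \<in> L2_space M1" "\<And>x. 0 \<le> \<xi>1 x" "(\<integral>x. (\<xi>1 x)\<^sup>2 \<partial>M1) \<le> 1"
    and \<xi>2: "\<xi>2 \<in> L2_space M2" "\<And>y. 0 \<le> \<xi>2 y" "(\<integral>y. (\<xi>2 y)\<^sup>2 \<partial>M2) \<le> 1"
    and \<xi>: "(\<lambda>w. \<xi>1 (fst w) * \<xi>2 (snd w)) \<in> L2_space (M1 \<Otimes>\<^sub>M M2)"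
    and g: "g \<in> L2_space (M1 \<Otimes>\<^sub>M M2)"
  defines "N \<equiv> L2_norm (M1 \<Otimes>\<^sub>M M2) (\<lambda>w. 2 * (\<xi>1 (fst w) * \<xi>2 (snd w) - 1) - t * g w)"
    and "s \<equiv> 1 - (\<integral>w. (\<xi>1 (fst w) * \<xi>2 (snd w))\<^sup>2 \<partial>(M1 \<Otimes>\<^sub>M M2))"
  defines "q \<equiv> ((N + \<bar>t\<bar> * L2_norm (M1 \<Otimes>\<^sub>M M2) g)\<^sup>2 / 4 + s) / 2"
  shows "(1 - q) * L2_norm M1 (\<lambda>x. 2 * (\<xi>1 x - 1) - t * marginal1 M2 g x)
    \<le> N + q * (2 + \<bar>t\<bar> * L2_norm (M1 \<Otimes>\<^sub>M M2) g)"
proof -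
  let ?R = "M1 \<Otimes>\<^sub>M M2" and ?\<xi> = "\<lambda>w. \<xi>1 (fst w) * \<xi>2 (snd w)"
  define c1 c2 where "c1 = (\<integral>x. \<xi>1 x \<partial>M1)" "c2 = (\<integral>y. \<xi>2 y \<partial>M2)"
  note c = this
  have one: "L2_norm M1 (\<lambda>_. 1) = 1" "L2_norm M2 (\<lambda>_. 1) = 1" "L2_norm M1 (\<lambda>_. 2) = 2"
    by (simp_all add: L2_norm_def M1.prob_space M2.prob_space)
  have c0: "0 \<le> c1" "0 \<le> c2" using \<xi>1(2) \<xi>2(2) by (auto simp: c intro!: integral_nonneg_AE)
  have n1: "L2_norm M1 \<xi>1 \<le> 1" "L2_norm M2 \<xi>2 \<le> 1" using \<xi>1(3) \<xi>2(3) by (auto simp: L2_norm_def)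
  have c1: "c1 \<le> 1" using L2_CS[OF \<xi>1(1) M1.L2_const[of 1]] n1 by (simp add: one c)
  have c2: "c2 \<le> 1" using L2_CS[OF \<xi>2(1) M2.L2_const[of 1]] n1 by (simp add: one c)
  have int\<xi>: "(\<integral>w. ?\<xi> w \<partial>?R) = c1 * c2"
    using integral_fst'[OF L2_integrable[OF \<xi>]] by (simp add: c)
  have \<xi>1': "(\<lambda>w. ?\<xi> w - 1) \<in> L2_space ?R" by (rule L2_diff[OF \<xi> L2_const])
  have "(L2_norm ?R (\<lambda>w. ?\<xi> w - 1))\<^sup>2 = (\<integral>w. (?\<xi> w)\<^sup>2 - 2 * ?\<xi> w + 1 \<partial>?R)"
    unfolding L2_norm_power2 by (intro Bochner_Integration.integral_cong) (auto simp: power2_diff)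
  also have "\<dots> = (\<integral>w. (?\<xi> w)\<^sup>2 \<partial>?R) - 2 * (\<integral>w. ?\<xi> w \<partial>?R) + 1"
    using L2_integrable[OF \<xi>] L2_spaceD(2)[OF \<xi>] by (simp add: prob_space)
  finally have norm1: "1 - c1 * c2 = ((L2_norm ?R (\<lambda>w. ?\<xi> w - 1))\<^sup>2 + s) / 2"
    unfolding int\<xi> by (simp add: s_def)
  have r: "(\<lambda>w. 2 * (?\<xi> w - 1) - t * g w) \<in> L2_space ?R"
    by (intro L2_diff L2_cmult \<xi>1' g)
  have "2 * L2_norm ?R (\<lambda>w. ?\<xi> w - 1) = L2_norm ?R (\<lambda>w. (2 * (?\<xi> w - 1) - t * g w) + t * g w)"
    using L2_norm_cmult[of ?R 2 "\<lambda>w. ?\<xi> w - 1"] by simp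
  also have "\<dots> \<le> N + \<bar>t\<bar> * L2_norm ?R g"
    using L2_norm_triangle[OF r L2_cmult[OF g, of t]] by (simp add: N_def L2_norm_cmult)
  finally have "(L2_norm ?R (\<lambda>w. ?\<xi> w - 1))\<^sup>2 \<le> ((N + \<bar>t\<bar> * L2_norm ?R g) / 2)\<^sup>2"
    by (intro power_mono) auto
  then have cq: "1 - c1 * c2 \<le> q" unfolding norm1 q_def by (simp add: power_divide)
  \<comment> \<open>\<open>c1 \<le> 1\<close> gives \<open>c1 c2 \<le> c2\<close>: the affinity of
    the product controls that of a factor.\<close>
  have c2q: "1 - c2 \<le> q" using cq mult_right_mono[OF c1 c0(2)] by simp
  let ?m = "marginal1 M2 g"
  let ?G = "\<lambda>x. 2 * (\<xi>1 x - 1) - t * ?m x"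
  have m: "?m \<in> L2_space M1" "L2_norm M1 ?m \<le> L2_norm ?R g" by (rule marginal1_L2[OF g])+
  have GL: "?G \<in> L2_space M1" by (intro L2_diff L2_cmult \<xi>1 M1.L2_const m)
  have KL: "(\<lambda>x. 2 + t * ?m x) \<in> L2_space M1" by (intro L2_add L2_cmult M1.L2_const m)
  have ae: "AE x in M1. c2 * ?G x = marginal1 M2 (\<lambda>w. 2 * (?\<xi> w - 1) - t * g w) x + (1 - c2) * (2 + t * ?m x)"
    using L2_section[OF \<xi>] L2_section[OF g]
  proof eventually_elim
    case (elim x)
    have "marginal1 M2 (\<lambda>w. 2 * (?\<xi> w - 1) - t * g w) x = 2 * (\<integral>y. \<xi>1 x * \<xi>2 y \<partial>M2) - 2 - t * ?m x"
      using M2.L2_integrable[OF elim(1)] M2.L2_integrable[OF elim(2)]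
      by (simp add: marginal1_def M2.prob_space right_diff_distrib del: Bochner_Integration.integral_mult_right_zero)
    then show ?case by (simp add: c algebra_simps)
  qed
  have "c2 * L2_norm M1 ?G = L2_norm M1 (\<lambda>x. c2 * ?G x)" using c0 by (simp only: L2_norm_cmult abs_of_nonneg)
  also have "\<dots> = L2_norm M1 (\<lambda>x. marginal1 M2 (\<lambda>w. 2 * (?\<xi> w - 1) - t * g w) x + (1 - c2) * (2 + t * ?m x))"
    by (rule L2_norm_cong_AE[OF ae L2_spaceD(1)[OF L2_cmult[OF GL]]
          L2_spaceD(1)[OF L2_add[OF marginal1_L2(1)[OF r] L2_cmult[OF KL]]]])
  also have "\<dots> \<le> L2_norm M1 (marginal1 M2 (\<lambda>w. 2 * (?\<xi> w - 1) - t * g w)) + L2_norm M1 (\<lambda>x. (1 - c2) * (2 + t * ?m x))"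
    by (rule L2_norm_triangle[OF marginal1_L2(1)[OF r] L2_cmult[OF KL]])
  also have "\<dots> \<le> N + q * (2 + \<bar>t\<bar> * L2_norm ?R g)"
  proof (rule add_mono)
    show "L2_norm M1 (marginal1 M2 (\<lambda>w. 2 * (?\<xi> w - 1) - t * g w)) \<le> N"
      unfolding N_def by (rule marginal1_L2(2)[OF r])
    have "L2_norm M1 (\<lambda>x. 2 + t * ?m x) \<le> 2 + \<bar>t\<bar> * L2_norm M1 ?m"
      using L2_norm_triangle[OF M1.L2_const[of 2] L2_cmult[OF m(1)]] by (simp add: one L2_norm_cmult)
    also have "\<dots> \<le> 2 + \<bar>t\<bar> * L2_norm ?R g" using m(2) by (intro add_left_mono mult_left_mono) auto
    finally have "(1 - c2) * L2_norm M1 (\<lambda>x. 2 + t * ?m x) \<le> q * (2 + \<bar>t\<bar> * L2_norm ?R g)"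
      using c2 c2q by (intro mult_mono) auto
    then show "L2_norm M1 (\<lambda>x. (1 - c2) * (2 + t * ?m x)) \<le> q * (2 + \<bar>t\<bar> * L2_norm ?R g)"
      using c2 by (simp add: L2_norm_cmult)
  qed
  finally have "c2 * L2_norm M1 ?G \<le> N + q * (2 + \<bar>t\<bar> * L2_norm ?R g)" .
  moreover have "(1 - q) * L2_norm M1 ?G \<le> c2 * L2_norm M1 ?G" using c2q by (intro mult_right_mono) auto
  ultimately show ?thesis by linarith
qed

text \<open>\<open>N\<close> is \<open>o(|t|)\<close> and \<open>s\<close> is \<open>o(t^2)\<close>,
  so the quadratic term \<open>q\<close> is \<open>O(t^2)\<close>. After division by
  \<open>|t|\<close> the right side vanishes, and the factor \<open>1 - q\<close> on the left tends
  to \<open>1\<close>.\<close>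

lemma expansion_smallo:
  fixes N s G :: "real \<Rightarrow> real"
  assumes N: "N \<in> o[at 0](\<lambda>t. \<bar>t\<bar>)" and s: "s \<in> o[at 0](\<lambda>t. t\<^sup>2)" and G0: "\<And>t. 0 \<le> G t"
    and le: "\<forall>\<^sub>F t in at 0. (1 - ((N t + \<bar>t\<bar> * K)\<^sup>2 / 4 + s t) / 2) * G t
       \<le> N t + ((N t + \<bar>t\<bar> * K)\<^sup>2 / 4 + s t) / 2 * (2 + \<bar>t\<bar> * K)"
  shows "G \<in> o[at 0](\<lambda>t. \<bar>t\<bar>)"
proof -
  have ne: "\<forall>\<^sub>F t in at 0. t \<noteq> (0::real)" by (simp add: eventually_at_filter)
  have tN: "((\<lambda>t. N t / \<bar>t\<bar>) \<longlongrightarrow> 0) (at 0)" by (rule smalloD_tendsto[OF N])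
  have ts: "((\<lambda>t. s t / t\<^sup>2) \<longlongrightarrow> 0) (at 0)" by (rule smalloD_tendsto[OF s])
  define q where "q t = ((N t + \<bar>t\<bar> * K)\<^sup>2 / 4 + s t) / 2" for t
  have qt: "((\<lambda>t. q t / \<bar>t\<bar>) \<longlongrightarrow> 0) (at 0)"
  proof -
    have "((\<lambda>t. \<bar>t\<bar> * (((N t / \<bar>t\<bar> + K)\<^sup>2 / 4 + s t / t\<^sup>2) / 2)) \<longlongrightarrow> \<bar>0\<bar> * (((0 + K)\<^sup>2 / 4 + 0) / 2)) (at 0)"
      by (intro tendsto_intros tN ts) auto
    then have "((\<lambda>t. \<bar>t\<bar> * (((N t / \<bar>t\<bar> + K)\<^sup>2 / 4 + s t / t\<^sup>2) / 2)) \<longlongrightarrow> 0) (at 0)" by simp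
    then show ?thesis
    proof (rule Lim_transform_eventually)
      show "\<forall>\<^sub>F t in at 0. \<bar>t\<bar> * (((N t / \<bar>t\<bar> + K)\<^sup>2 / 4 + s t / t\<^sup>2) / 2) = q t / \<bar>t\<bar>"
        using ne
      proof eventually_elim
        case (elim t)
        have 1: "N t / \<bar>t\<bar> + K = (N t + \<bar>t\<bar> * K) / \<bar>t\<bar>" using elim by (simp add: field_simps)
        have "\<bar>t\<bar> * (((N t / \<bar>t\<bar> + K)\<^sup>2 / 4 + s t / t\<^sup>2) / 2) = \<bar>t\<bar> * (q t / t\<^sup>2)"
          unfolding 1 q_def power_divide power2_abs by (simp add: add_divide_distrib)
        also have "\<dots> = q t / \<bar>t\<bar>" using elim by (simp add: power2_eq_square abs_if)
        finally show ?case .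
      qed
    qed
  qed
  have q0: "(q \<longlongrightarrow> 0) (at 0)"
  proof -
    have "((\<lambda>t. q t / \<bar>t\<bar> * \<bar>t\<bar>) \<longlongrightarrow> 0 * \<bar>0\<bar>) (at 0)" by (intro tendsto_intros qt)
    then have "((\<lambda>t. q t / \<bar>t\<bar> * \<bar>t\<bar>) \<longlongrightarrow> 0) (at 0)" by simp
    then show ?thesis
    proof (rule Lim_transform_eventually)
      show "\<forall>\<^sub>F t in at 0. q t / \<bar>t\<bar> * \<bar>t\<bar> = q t" using ne by eventually_elim simp
    qed
  qed
  let ?e = "\<lambda>t. (N t / \<bar>t\<bar> + q t / \<bar>t\<bar> * (2 + \<bar>t\<bar> * K)) / (1 - q t)"
  have "(?e \<longlongrightarrow> (0 + 0 * (2 + \<bar>0\<bar> * K)) / (1 - 0)) (at 0)"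
    by (intro tendsto_intros tN qt q0) auto
  then have e: "(?e \<longlongrightarrow> 0) (at 0)" by simp
  have "((\<lambda>t. G t / \<bar>t\<bar>) \<longlongrightarrow> 0) (at 0)"
  proof (rule tendsto_sandwich[OF _ _ tendsto_const e])
    show "\<forall>\<^sub>F t in at 0. 0 \<le> G t / \<bar>t\<bar>" using G0 by (auto intro!: always_eventually)
    have "\<forall>\<^sub>F t in at 0. q t < 1" by (rule order_tendstoD(2)[OF q0]) simp
    then show "\<forall>\<^sub>F t in at 0. G t / \<bar>t\<bar> \<le> ?e t" using le ne
    proof eventually_elim
      case (elim t)
      have "G t * (1 - q t) \<le> N t + q t * (2 + \<bar>t\<bar> * K)" using elim(2) by (simp add: q_def mult.commute)
      then have "G t \<le> (N t + q t * (2 + \<bar>t\<bar> * K)) / (1 - q t)" using elim(1) by (simp add: pos_le_divide_eq)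
      then have "G t / \<bar>t\<bar> \<le> (N t + q t * (2 + \<bar>t\<bar> * K)) / (1 - q t) / \<bar>t\<bar>" by (rule divide_right_mono) simp
      also have "\<dots> = ?e t" by (simp add: add_divide_distrib mult.commute)
      finally show ?case .
    qed
  qed
  then show ?thesis
  proof (rule smalloI_tendsto)
    show "\<forall>\<^sub>F t in at 0. \<bar>t\<bar> \<noteq> (0::real)" using ne by eventually_elim simp
  qed
qed

lemma smallo_mono:
  fixes f g :: "real \<Rightarrow> real"
  assumes "g \<in> o[F](h)" "\<forall>\<^sub>F t in F. \<bar>f t\<bar> \<le> \<bar>g t\<bar>"
  shows "f \<in> o[F](h)"
  by (rule landau_o.big_small_trans[OF bigoI[where c=1] assms(1)]) (use assms(2) in simp)

text \<open>Cylinders recover the factors. This is needed because \<open>F2\<close> stores factors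
  while a curve supplies only products, so two factorisations of the same measure have to be
  identified.\<close>

lemma pair_measure_factor_eq:
  assumes "prob_space P" "prob_space Q" "prob_space P'" "prob_space Q'"
    and s: "sets P = sets P'" "sets Q = sets Q'" and eq: "P \<Otimes>\<^sub>M Q = P' \<Otimes>\<^sub>M Q'"
  shows "P = P'" "Q = Q'"
proof -
  interpret P: prob_space P by fact
  interpret Q: prob_space Q by fact
  interpret P': prob_space P' by fact
  interpret Q': prob_space Q' by fact
  have sp: "space P = space P'" "space Q = space Q'" by (rule sets_eq_imp_space_eq[OF s(1)], rule sets_eq_imp_space_eq[OF s(2)])
  show "P = P'"
  proof (rule measure_eqI[OF s(1)])
    fix A assume A: "A \<in> sets P"
    have "emeasure P A = emeasure (P \<Otimes>\<^sub>M Q) (A \<times> space Q)"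
      using A by (simp add: Q.emeasure_pair_measure_Times Q.emeasure_space_1)
    also have "\<dots> = emeasure P' A"
      unfolding eq sp using A s Q'.emeasure_pair_measure_Times[of A P' "space Q'"] by (simp add: Q'.emeasure_space_1)
    finally show "emeasure P A = emeasure P' A" .
  qed
  show "Q = Q'"
  proof (rule measure_eqI[OF s(2)])
    fix A assume A: "A \<in> sets Q"
    have "emeasure Q A = emeasure (P \<Otimes>\<^sub>M Q) (space P \<times> A)"
      using A by (simp add: Q.emeasure_pair_measure_Times P.emeasure_space_1)
    also have "\<dots> = emeasure Q' A"
      unfolding eq sp using A s Q'.emeasure_pair_measure_Times[of "space P'" P' A] by (simp add: P'.emeasure_space_1)
    finally show "emeasure Q A = emeasure Q' A" .
  qed
qed

text \<open>The quotients of the factors combine to a quotient of the product, which almost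
  everywhere is the given one. So the root density of the product factorises, and
  \<open>marginal1_expansion\<close> together with \<open>expansion_smallo\<close> yields the
  expansion of each factor.\<close>

lemma curve_marginals:
  fixes \<P> :: "'a measure set" and \<Q> :: "'b measure set"
  assumes fam1: "\<And>P. P \<in> \<P> \<Longrightarrow> prob_space P \<and> sets P = sets M1"
    and fam2: "\<And>Q. Q \<in> \<Q> \<Longrightarrow> prob_space Q \<and> sets Q = sets M2"
    and base: "P0 \<in> \<P>" "Q0 \<in> \<Q>"
    and c: "curve_through (product_family \<P> \<Q>) (P0 \<Otimes>\<^sub>M Q0) \<epsilon> f g"
  obtains P Q where "P 0 = P0" "Q 0 = Q0"
    "\<And>t. \<bar>t\<bar> < \<epsilon> \<Longrightarrow> P t \<in> \<P> \<and> Q t \<in> \<Q> \<and> f t = P t \<Otimes>\<^sub>M Q t"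
    "L2_differentiable_curve \<epsilon> P (marginal1 Q0 g)" "L2_differentiable_curve \<epsilon> Q (marginal2 P0 g)"
proof -
  let ?R = "P0 \<Otimes>\<^sub>M Q0"
  interpret P0: prob_space P0 using fam1 base by auto
  interpret Q0: prob_space Q0 using fam2 base by auto
  interpret PQ: pair_prob_space P0 Q0 ..
  interpret QP: pair_prob_space Q0 P0 ..
  have f0: "f 0 = ?R" and fin: "\<And>t. \<bar>t\<bar> < \<epsilon> \<Longrightarrow> f t \<in> product_family \<P> \<Q>"
    and \<epsilon>: "0 < \<epsilon>" and g: "g \<in> L2_space ?R"
    using c by (auto simp: curve_through_def L2_differentiable_curve_def)
  obtain L where L: "\<And>t. \<bar>t\<bar> < \<epsilon> \<Longrightarrow> is_density_quotient (f t) ?R (L t)"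
    "(\<lambda>t. L2_norm ?R (\<lambda>x. 2 * (sqrt (enn2real (L t x)) - 1) - t * g x)) \<in> o[at 0](\<lambda>t. \<bar>t\<bar>)"
    "(\<lambda>t. measure (f t) {x \<in> space (f t). L t x = \<infinity>}) \<in> o[at 0](\<lambda>t. t\<^sup>2)"
    using c f0 by (auto simp: curve_through_def L2_differentiable_curve_def)
  have "\<forall>t. \<exists>p. \<bar>t\<bar> < \<epsilon> \<longrightarrow> fst p \<in> \<P> \<and> snd p \<in> \<Q> \<and> f t = fst p \<Otimes>\<^sub>M snd p"
    using fin by (fastforce simp: product_family_def)
  then obtain p where p: "\<And>t. \<bar>t\<bar> < \<epsilon> \<Longrightarrow> fst (p t) \<in> \<P> \<and> snd (p t) \<in> \<Q> \<and> f t = fst (p t) \<Otimes>\<^sub>M snd (p t)"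
    by metis
  \<comment> \<open>Choice supplies some factorisation for each \<open>t\<close>; at
    \<open>0\<close> it is overridden by the base factors, from which the curves have to
    start.\<close>
  define P where "P t = (if t = 0 then P0 else fst (p t))" for t
  define Q where "Q t = (if t = 0 then Q0 else snd (p t))" for t
  have PQ: "P t \<in> \<P> \<and> Q t \<in> \<Q> \<and> f t = P t \<Otimes>\<^sub>M Q t" if "\<bar>t\<bar> < \<epsilon>" for t
    using p[OF that] base f0 by (auto simp: P_def Q_def)
  have pr: "prob_space (P t)" "prob_space (Q t)" "sets (P t) = sets P0" "sets (Q t) = sets Q0" if "\<bar>t\<bar> < \<epsilon>" for t
    using PQ[OF that] fam1 fam2 base by auto
  have "\<exists>K. is_density_quotient (P t) P0 K" if "\<bar>t\<bar> < \<epsilon>" for t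
    by (rule density_quotient_exists[OF pr(1)[OF that] P0.prob_space_axioms pr(3)[OF that]])
  then obtain L1 where L1: "\<And>t. \<bar>t\<bar> < \<epsilon> \<Longrightarrow> is_density_quotient (P t) P0 (L1 t)" by metis
  have "\<exists>K. is_density_quotient (Q t) Q0 K" if "\<bar>t\<bar> < \<epsilon>" for t
    by (rule density_quotient_exists[OF pr(2)[OF that] Q0.prob_space_axioms pr(4)[OF that]])
  then obtain L2 where L2: "\<And>t. \<bar>t\<bar> < \<epsilon> \<Longrightarrow> is_density_quotient (Q t) Q0 (L2 t)" by metis
  define \<xi>1 where "\<xi>1 t x = sqrt (enn2real (L1 t x))" for t x
  define \<xi>2 where "\<xi>2 t x = sqrt (enn2real (L2 t x))" for t x
  let ?N = "\<lambda>t. L2_norm ?R (\<lambda>x. 2 * (sqrt (enn2real (L t x)) - 1) - t * g x)"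
  let ?s = "\<lambda>t. measure (f t) {x \<in> space (f t). L t x = \<infinity>}"
  let ?s1 = "\<lambda>t. measure (P t) {x \<in> space (P t). L1 t x = \<infinity>}"
  let ?s2 = "\<lambda>t. measure (Q t) {x \<in> space (Q t). L2 t x = \<infinity>}"
  let ?G1 = "\<lambda>t. L2_norm P0 (\<lambda>x. 2 * (\<xi>1 t x - 1) - t * marginal1 Q0 g x)"
  let ?G2 = "\<lambda>t. L2_norm Q0 (\<lambda>x. 2 * (\<xi>2 t x - 1) - t * marginal2 P0 g x)"
  let ?q = "\<lambda>t. ((?N t + \<bar>t\<bar> * L2_norm ?R g)\<^sup>2 / 4 + ?s t) / 2"
  have main: "(1 - ?q t) * ?G1 t \<le> ?N t + ?q t * (2 + \<bar>t\<bar> * L2_norm ?R g) \<and>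
      (1 - ?q t) * ?G2 t \<le> ?N t + ?q t * (2 + \<bar>t\<bar> * L2_norm ?R g) \<and> ?s1 t \<le> ?s t \<and> ?s2 t \<le> ?s t"
    if t: "\<bar>t\<bar> < \<epsilon>" for t
  proof -
    note prt = pr[OF t]
    have ft: "f t = P t \<Otimes>\<^sub>M Q t" using PQ[OF t] by simp
    have sf: "sets (f t) = sets ?R" unfolding ft by (rule sets_pair_measure_cong[OF prt(3,4)])
    interpret Pt: prob_space "P t" by (rule prt)
    interpret Qt: prob_space "Q t" by (rule prt)
    interpret PQt: pair_prob_space "P t" "Q t" ..
    have prob_f: "prob_space (f t)" unfolding ft by unfold_locales
    note q1 = density_quotient_sqrt[OF L1[OF t] prt(1) P0.prob_space_axioms prt(3), folded \<xi>1_def]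
    note q2 = density_quotient_sqrt[OF L2[OF t] prt(2) Q0.prob_space_axioms prt(4), folded \<xi>2_def]
    note qf = density_quotient_sqrt[OF L(1)[OF t] prob_f PQ.prob_space_axioms sf]
    let ?K = "\<lambda>w. if L1 t (fst w) = \<infinity> \<or> L2 t (snd w) = \<infinity> then \<infinity> else L1 t (fst w) * L2 t (snd w)"
    have "is_density_quotient (f t) ?R ?K"
      unfolding ft by (rule density_quotient_pair[OF P0.prob_space_axioms Q0.prob_space_axioms prt(1,2,3,4) L1[OF t] L2[OF t]])
    from density_quotient_unique[OF L(1)[OF t] this PQ.prob_space_axioms sf]
    have ae: "AE w in ?R. sqrt (enn2real (L t w)) = \<xi>1 t (fst w) * \<xi>2 t (snd w)"
      by eventually_elim (auto simp: \<xi>1_def \<xi>2_def enn2real_mult real_sqrt_mult split: if_splits)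
    have [measurable]: "\<xi>1 t \<in> borel_measurable P0" "\<xi>2 t \<in> borel_measurable Q0" using q1 q2 by (auto simp: L2_space_def)
    have [measurable]: "(\<lambda>w. sqrt (enn2real (L t w))) \<in> borel_measurable ?R" "g \<in> borel_measurable ?R"
      using qf(1) g by (auto simp: L2_space_def)
    have pm [measurable]: "(\<lambda>w. \<xi>1 t (fst w) * \<xi>2 t (snd w)) \<in> borel_measurable ?R" by measurable
    have \<xi>L: "(\<lambda>w. \<xi>1 t (fst w) * \<xi>2 t (snd w)) \<in> L2_space ?R"
      by (rule L2_space_cong_AE[OF _ pm qf(1)]) (use ae in \<open>auto elim: eventually_mono\<close>)
    have N: "?N t = L2_norm ?R (\<lambda>w. 2 * (\<xi>1 t (fst w) * \<xi>2 t (snd w) - 1) - t * g w)"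
      by (rule L2_norm_cong_AE) (use ae in \<open>auto elim: eventually_mono\<close>)
    have i: "(\<integral>w. (sqrt (enn2real (L t w)))\<^sup>2 \<partial>?R) = (\<integral>w. (\<xi>1 t (fst w) * \<xi>2 t (snd w))\<^sup>2 \<partial>?R)"
      by (rule integral_cong_AE) (use ae in \<open>auto elim!: eventually_mono simp del: real_sqrt_pow2_iff real_sqrt_pow2\<close>)
    have s: "?s t = 1 - (\<integral>w. (\<xi>1 t (fst w) * \<xi>2 t (snd w))\<^sup>2 \<partial>?R)"
      using qf(2) unfolding i by simp
    have le1: "(\<integral>x. (\<xi>1 t x)\<^sup>2 \<partial>P0) \<le> 1" "(\<integral>x. (\<xi>2 t x)\<^sup>2 \<partial>Q0) \<le> 1" using q1(2) q2(2) by auto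
    have nn: "0 \<le> \<xi>1 t x" "0 \<le> \<xi>2 t y" for x y by (auto simp: \<xi>1_def \<xi>2_def)
    have prod: "(\<integral>w. (\<xi>1 t (fst w) * \<xi>2 t (snd w))\<^sup>2 \<partial>?R) = (\<integral>x. (\<xi>1 t x)\<^sup>2 \<partial>P0) * (\<integral>y. (\<xi>2 t y)\<^sup>2 \<partial>Q0)"
      using PQ.integral_fst'[OF L2_spaceD(2)[OF \<xi>L]] by (simp add: power_mult_distrib)
    \<comment> \<open>Both integrals are at most \<open>1\<close>, so the product is at most each of
      them: a factor loses no more mass to its singular part than the product does.\<close>
    have "(\<integral>x. (\<xi>1 t x)\<^sup>2 \<partial>P0) * (\<integral>y. (\<xi>2 t y)\<^sup>2 \<partial>Q0) \<le> (\<integral>x. (\<xi>1 t x)\<^sup>2 \<partial>P0)"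
      "(\<integral>x. (\<xi>1 t x)\<^sup>2 \<partial>P0) * (\<integral>y. (\<xi>2 t y)\<^sup>2 \<partial>Q0) \<le> (\<integral>y. (\<xi>2 t y)\<^sup>2 \<partial>Q0)"
      using le1 by (auto intro!: mult_left_le mult_left_le_one_le)
    then have s12: "?s1 t \<le> ?s t" "?s2 t \<le> ?s t" unfolding s prod using q1(2) q2(2) by auto
    have e1: "(1 - ?q t) * ?G1 t \<le> ?N t + ?q t * (2 + \<bar>t\<bar> * L2_norm ?R g)"
      unfolding N s by (rule PQ.marginal1_expansion[OF q1(1) nn(1) le1(1) q2(1) nn(2) le1(2) \<xi>L g])
    \<comment> \<open>The second factor is the first one of the swapped product; norms, lost mass
      and square-integrability are carried over by the swap.\<close>
    note sw = PQ.L2_swap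
    have \<xi>L': "(\<lambda>w. \<xi>2 t (fst w) * \<xi>1 t (snd w)) \<in> L2_space (Q0 \<Otimes>\<^sub>M P0)"
      using sw(1)[OF \<xi>L] by (simp add: mult.commute)
    have rL: "(\<lambda>w. 2 * (\<xi>1 t (fst w) * \<xi>2 t (snd w) - 1) - t * g w) \<in> L2_space ?R"
      by (intro L2_diff L2_cmult \<xi>L g PQ.L2_const)
    have N': "?N t = L2_norm (Q0 \<Otimes>\<^sub>M P0) (\<lambda>w. 2 * (\<xi>2 t (fst w) * \<xi>1 t (snd w) - 1) - t * g (snd w, fst w))"
      unfolding N using sw(2)[OF rL] by (simp add: mult.commute)
    have s': "?s t = 1 - (\<integral>w. (\<xi>2 t (fst w) * \<xi>1 t (snd w))\<^sup>2 \<partial>(Q0 \<Otimes>\<^sub>M P0))"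
    proof -
      have "(L2_norm (Q0 \<Otimes>\<^sub>M P0) (\<lambda>w. \<xi>2 t (fst w) * \<xi>1 t (snd w)))\<^sup>2 = (L2_norm ?R (\<lambda>w. \<xi>1 t (fst w) * \<xi>2 t (snd w)))\<^sup>2"
        using sw(2)[OF \<xi>L] by (simp add: mult.commute)
      then show ?thesis unfolding s L2_norm_power2 by simp
    qed
    have "(1 - ?q t) * L2_norm Q0 (\<lambda>x. 2 * (\<xi>2 t x - 1) - t * marginal1 P0 (\<lambda>w. g (snd w, fst w)) x)
       \<le> ?N t + ?q t * (2 + \<bar>t\<bar> * L2_norm ?R g)"
      unfolding N' s' sw(2)[OF g, symmetric]
      by (rule QP.marginal1_expansion[OF q2(1) nn(2) le1(2) q1(1) nn(1) le1(1) \<xi>L' sw(1)[OF g]])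
    then have e2: "(1 - ?q t) * ?G2 t \<le> ?N t + ?q t * (2 + \<bar>t\<bar> * L2_norm ?R g)"
      by (simp add: marginal1_def marginal2_def)
    show ?thesis using e1 e2 s12 by blast
  qed
  have ev: "\<forall>\<^sub>F t in at 0. \<bar>t\<bar> < \<epsilon>" using \<epsilon> by (auto simp: eventually_at intro!: exI[of _ \<epsilon>])
  have o1: "?G1 \<in> o[at 0](\<lambda>t. \<bar>t\<bar>)"
    by (rule expansion_smallo[OF L(2,3), of _ "L2_norm ?R g"]) (use ev main in \<open>auto elim!: eventually_mono\<close>)
  have o2: "?G2 \<in> o[at 0](\<lambda>t. \<bar>t\<bar>)"
    by (rule expansion_smallo[OF L(2,3), of _ "L2_norm ?R g"]) (use ev main in \<open>auto elim!: eventually_mono\<close>)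
  have os: "?s1 \<in> o[at 0](\<lambda>t. t\<^sup>2)" "?s2 \<in> o[at 0](\<lambda>t. t\<^sup>2)"
    by (rule smallo_mono[OF L(3)], use ev main in \<open>auto elim!: eventually_mono\<close>)+
  have P00: "P 0 = P0" "Q 0 = Q0" by (auto simp: P_def Q_def)
  have m2: "marginal2 P0 g \<in> L2_space Q0"
    using QP.marginal1_L2(1)[OF PQ.L2_swap(1)[OF g]] by (simp add: marginal1_def[abs_def] marginal2_def[abs_def])
  show thesis
  proof (rule that[OF P00 PQ])
    show "L2_differentiable_curve \<epsilon> P (marginal1 Q0 g)"
      unfolding L2_differentiable_curve_def P00
      using \<epsilon> PQ.marginal1_L2(1)[OF g] L1 o1 os(1) by (auto intro!: exI[of _ L1] simp: \<xi>1_def)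
    show "L2_differentiable_curve \<epsilon> Q (marginal2 P0 g)"
      unfolding L2_differentiable_curve_def P00
      using \<epsilon> m2 L2 o2 os(2) by (auto intro!: exI[of _ L2] simp: \<xi>2_def)
  qed
qed

section \<open>The tangent space of a product family\<close>

lemma fun_span_lincomb:
  assumes "f \<in> fun_span S" "g \<in> fun_span S"
  shows "(\<lambda>x. c * f x + c' * g x) \<in> fun_span S"
proof -
  obtain m :: nat and a u where f: "f = (\<lambda>x. \<Sum>i<m. a i * u i x)" "\<And>i. i < m \<Longrightarrow> u i \<in> S"
    using assms(1) unfolding fun_span_def by blast
  obtain l :: nat and b v where g: "g = (\<lambda>x. \<Sum>i<l. b i * v i x)" "\<And>i. i < l \<Longrightarrow> v i \<in> S"
    using assms(2) unfolding fun_span_def by blast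
  define a' where "a' i = (if i < m then c * a i else c' * b (i - m))" for i
  define u' where "u' i = (if i < m then u i else v (i - m))" for i
  have "c * f x + c' * g x = (\<Sum>i<m + l. a' i * u' i x)" for x
  proof -
    have "(\<Sum>i<m + l. a' i * u' i x) = (\<Sum>i<m. a' i * u' i x) + (\<Sum>i<l. a' (m + i) * u' (m + i) x)"
    proof -
      have "(\<Sum>i<m + k. G i) = (\<Sum>i<m. G i) + (\<Sum>i<k. G (m + i))" for G :: "nat \<Rightarrow> real" and k
        by (induction k) (simp_all add: add.assoc)
      then show ?thesis .
    qed
    also have "(\<Sum>i<m. a' i * u' i x) = c * f x"
      by (simp add: a'_def u'_def f(1) sum_distrib_left mult.assoc)
    also have "(\<Sum>i<l. a' (m + i) * u' (m + i) x) = c' * g x"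
      by (simp add: a'_def u'_def g(1) sum_distrib_left mult.assoc)
    finally show ?thesis ..
  qed
  moreover have "\<forall>i<m + l. u' i \<in> S" using f(2) g(2) by (auto simp: u'_def)
  ultimately show ?thesis unfolding fun_span_def by blast
qed

lemma fun_span_superset: "f \<in> S \<Longrightarrow> f \<in> fun_span S"
  unfolding fun_span_def
  by (rule CollectI, rule exI[of _ 1], rule exI[of _ "\<lambda>_. 1"], rule exI[of _ "\<lambda>_. f"]) simp

lemma fun_span_L2:
  assumes "S \<subseteq> L2_space M" "f \<in> fun_span S" shows "f \<in> L2_space M"
proof -
  obtain m :: nat and a u where f: "f = (\<lambda>x. \<Sum>i<m. a i * u i x)" "\<And>i. i < m \<Longrightarrow> u i \<in> S"
    using assms(2) unfolding fun_span_def by blast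
  show ?thesis unfolding f(1) by (intro L2_sum L2_cmult) (use f(2) assms(1) in auto)
qed

lemma L2_closure_lincomb:
  assumes S: "S \<subseteq> L2_space M" and cl: "\<And>f g c c'. f \<in> S \<Longrightarrow> g \<in> S \<Longrightarrow> (\<lambda>x. c * f x + c' * g x) \<in> S"
    and h: "h \<in> L2_closure M S" and k: "k \<in> L2_closure M S"
  shows "(\<lambda>x. c * h x + c' * k x) \<in> L2_closure M S"
  unfolding L2_closure_def
proof (intro CollectI conjI allI impI)
  have hk: "h \<in> L2_space M" "k \<in> L2_space M" using h k by (auto simp: L2_closure_def)
  show "(\<lambda>x. c * h x + c' * k x) \<in> L2_space M" by (intro L2_add L2_cmult hk)
  fix e :: real assume e: "0 < e"
  define r where "r = e / (1 + \<bar>c\<bar> + \<bar>c'\<bar>)"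
  have r: "r > 0" "(\<bar>c\<bar> + \<bar>c'\<bar>) * r < e" using e by (auto simp: r_def field_simps)
  obtain f where f: "f \<in> S" "L2_norm M (\<lambda>x. h x - f x) < r" using h r(1) by (auto simp: L2_closure_def)
  obtain g where g: "g \<in> S" "L2_norm M (\<lambda>x. k x - g x) < r" using k r(1) by (auto simp: L2_closure_def)
  have fg: "f \<in> L2_space M" "g \<in> L2_space M" using f g S by auto
  show "\<exists>f\<in>S. L2_norm M (\<lambda>x. c * h x + c' * k x - f x) < e"
  proof (rule bexI[OF _ cl[OF f(1) g(1), of c c']])
    have "(\<lambda>x. c * h x + c' * k x - (c * f x + c' * g x)) = (\<lambda>x. c * (h x - f x) + c' * (k x - g x))"
      by (simp add: algebra_simps)
    then have "L2_norm M (\<lambda>x. c * h x + c' * k x - (c * f x + c' * g x)) \<le>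
       \<bar>c\<bar> * L2_norm M (\<lambda>x. h x - f x) + \<bar>c'\<bar> * L2_norm M (\<lambda>x. k x - g x)"
      using L2_norm_triangle[OF L2_cmult[OF L2_diff[OF hk(1) fg(1)], of c] L2_cmult[OF L2_diff[OF hk(2) fg(2)], of c']]
      by (simp add: L2_norm_cmult)
    also have "\<dots> \<le> \<bar>c\<bar> * r + \<bar>c'\<bar> * r" using f(2) g(2) by (intro add_mono mult_left_mono) auto
    also have "\<dots> < e" using r(2) by (simp add: distrib_right)
    finally show "L2_norm M (\<lambda>x. c * h x + c' * k x - (c * f x + c' * g x)) < e" .
  qed
qed

lemma L2_closure_superset: "S \<subseteq> L2_space M \<Longrightarrow> f \<in> S \<Longrightarrow> f \<in> L2_closure M S"
  unfolding L2_closure_def by (auto intro!: bexI[of _ f] simp: L2_norm_def)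

text \<open>Tangents are functions rather than classes, and the parts of \<open>\<kappa>\<close>
  will be identified only almost everywhere; the closure absorbs the difference.\<close>

lemma L2_closure_cong_AE:
  assumes S: "S \<subseteq> L2_space M" and h: "h \<in> L2_closure M S" and ae: "AE x in M. h' x = h x" and m: "h' \<in> borel_measurable M"
  shows "h' \<in> L2_closure M S"
  unfolding L2_closure_def
proof (intro CollectI conjI allI impI)
  have hL: "h \<in> L2_space M" using h by (simp add: L2_closure_def)
  show hL': "h' \<in> L2_space M" by (rule L2_space_cong_AE[OF ae m hL])
  fix e :: real assume "0 < e"
  then obtain f where f: "f \<in> S" "L2_norm M (\<lambda>x. h x - f x) < e" using h by (auto simp: L2_closure_def)
  have fL: "f \<in> L2_space M" using f S by auto
  have "L2_norm M (\<lambda>x. h' x - f x) = L2_norm M (\<lambda>x. h x - f x)"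
    by (rule L2_norm_cong_AE[OF _ L2_spaceD(1)[OF L2_diff[OF hL' fL]] L2_spaceD(1)[OF L2_diff[OF hL fL]]])
       (use ae in \<open>auto elim: eventually_mono\<close>)
  then show "\<exists>f\<in>S. L2_norm M (\<lambda>x. h' x - f x) < e" using f(2) by (intro bexI[OF _ f(1)]) simp
qed

lemma (in pair_prob_space) marginal1_sum:
  fixes I :: "nat set"
  assumes h: "h \<in> L2_space (M1 \<Otimes>\<^sub>M M2)" and u: "\<And>i. i \<in> I \<Longrightarrow> u i \<in> L2_space (M1 \<Otimes>\<^sub>M M2)" and I: "finite I"
  shows "AE x in M1. marginal1 M2 (\<lambda>w. h w - (\<Sum>i\<in>I. a i * u i w)) x = marginal1 M2 h x - (\<Sum>i\<in>I. a i * marginal1 M2 (u i) x)"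
proof -
  have "AE x in M1. \<forall>i\<in>I. (\<lambda>y. u i (x, y)) \<in> L2_space M2"
    by (rule AE_finite_allI[OF I L2_section[OF u]])
  then show ?thesis using L2_section[OF h]
  proof eventually_elim
    case (elim x)
    then have "integrable M2 (\<lambda>y. h (x, y))" "\<And>i. i \<in> I \<Longrightarrow> integrable M2 (\<lambda>y. u i (x, y))"
      using M2.L2_integrable by auto
    then show ?case
      by (simp add: marginal1_def Bochner_Integration.integral_diff Bochner_Integration.integral_sum)
  qed
qed

section \<open>Splitting the tangent cone and the tangent space into marginal parts\<close>

locale two_sample_model =
  fixes M1 :: "'a measure" and M2 :: "'b measure"
    and \<P> :: "'a measure set" and \<Q> :: "'b measure set"
    and P0 :: "'a measure" and Q0 :: "'b measure"
  assumes family1: "\<And>P. P \<in> \<P> \<Longrightarrow> prob_space P \<and> sets P = sets M1"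
    and family2: "\<And>Q. Q \<in> \<Q> \<Longrightarrow> prob_space Q \<and> sets Q = sets M2"
    and base: "P0 \<in> \<P>" "Q0 \<in> \<Q>"
begin

sublocale P0: prob_space P0 using family1 base by auto
sublocale Q0: prob_space Q0 using family2 base by auto
sublocale PQ: pair_prob_space P0 Q0 ..
sublocale QP: pair_prob_space Q0 P0 ..

abbreviation "R0 \<equiv> P0 \<Otimes>\<^sub>M Q0"
abbreviation "\<R> \<equiv> product_family \<P> \<Q>"
abbreviation "T \<equiv> tangent_space R0 \<R>"
abbreviation "K \<equiv> tangent_cone R0 \<R>"

lemma marginal2_swap: "marginal2 P0 h = marginal1 P0 (\<lambda>w. h (snd w, fst w))"
  by (simp add: marginal1_def[abs_def] marginal2_def[abs_def])

lemma marginal2_L2: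
  assumes "h \<in> L2_space R0"
  shows "marginal2 P0 h \<in> L2_space Q0" "L2_norm Q0 (marginal2 P0 h) \<le> L2_norm R0 h"
  using QP.marginal1_L2[OF PQ.L2_swap(1)[OF assms]] unfolding marginal2_swap PQ.L2_swap(2)[OF assms] by auto

lemma L2_snd:
  assumes "f \<in> L2_space Q0"
  shows "(\<lambda>w. f (snd w)) \<in> L2_space R0" "L2_norm R0 (\<lambda>w. f (snd w)) = L2_norm Q0 f"
    "(\<integral>w. f (snd w) \<partial>R0) = (\<integral>x. f x \<partial>Q0)"
proof -
  note q = QP.L2_fst[OF assms]
  show "(\<lambda>w. f (snd w)) \<in> L2_space R0" using QP.L2_swap(1)[OF q(1)] by simp
  show "L2_norm R0 (\<lambda>w. f (snd w)) = L2_norm Q0 f" using QP.L2_swap(2)[OF q(1)] q(2) by simp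
  show "(\<integral>w. f (snd w) \<partial>R0) = (\<integral>x. f x \<partial>Q0)" using QP.L2_swap(3)[OF q(1)] q(3) by simp
qed

lemma marginal2_inner:
  assumes f: "f \<in> L2_space Q0" and h: "h \<in> L2_space R0"
  shows "(\<integral>x. f x * marginal2 P0 h x \<partial>Q0) = (\<integral>w. f (snd w) * h w \<partial>R0)"
proof -
  have "(\<integral>x. f x * marginal2 P0 h x \<partial>Q0) = (\<integral>w. f (fst w) * h (snd w, fst w) \<partial>(Q0 \<Otimes>\<^sub>M P0))"
    unfolding marginal2_swap by (rule QP.marginal1_inner[OF f PQ.L2_swap(1)[OF h]])
  also have "\<dots> = (\<integral>w. f (snd w) * h w \<partial>R0)"
    using PQ.integral_product_swap[of "\<lambda>w. f (snd w) * h w"] L2_spaceD(1)[OF L2_snd(1)[OF f]] L2_spaceD(1)[OF h]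
    by (simp add: case_prod_beta')
  finally show ?thesis .
qed

lemma marginal2_lincomb:
  assumes "h \<in> L2_space R0" "k \<in> L2_space R0"
  shows "AE x in Q0. marginal2 P0 (\<lambda>w. c * h w + c' * k w) x = c * marginal2 P0 h x + c' * marginal2 P0 k x"
  unfolding marginal2_swap by (rule QP.marginal1_lincomb[OF PQ.L2_swap(1)[OF assms(1)] PQ.L2_swap(1)[OF assms(2)]])

lemma marginal2_sum:
  fixes I :: "nat set"
  assumes h: "h \<in> L2_space R0" and u: "\<And>i. i \<in> I \<Longrightarrow> u i \<in> L2_space R0" and I: "finite I"
  shows "AE x in Q0. marginal2 P0 (\<lambda>w. h w - (\<Sum>i\<in>I. a i * u i w)) x = marginal2 P0 h x - (\<Sum>i\<in>I. a i * marginal2 P0 (u i) x)"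
  unfolding marginal2_swap by (rule QP.marginal1_sum[OF PQ.L2_swap(1)[OF h] PQ.L2_swap(1)[OF u] I])

lemma marginals_fst:
  assumes f: "f \<in> L2_space P0"
  shows "marginal1 Q0 (\<lambda>w. f (fst w)) = f" "marginal2 P0 (\<lambda>w. f (fst w)) = (\<lambda>_. \<integral>x. f x \<partial>P0)"
  by (simp_all add: marginal1_def[abs_def] marginal2_def[abs_def] Q0.prob_space)

lemma marginals_snd:
  assumes f: "f \<in> L2_space Q0"
  shows "marginal2 P0 (\<lambda>w. f (snd w)) = f" "marginal1 Q0 (\<lambda>w. f (snd w)) = (\<lambda>_. \<integral>x. f x \<partial>Q0)"
  by (simp_all add: marginal1_def[abs_def] marginal2_def[abs_def] P0.prob_space)

lemma K_L2: "K \<subseteq> L2_space R0"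
  by (auto simp: tangent_cone_def curve_through_def L2_differentiable_curve_def)

lemma span_L2: "fun_span K \<subseteq> L2_space R0" using fun_span_L2[OF K_L2] by blast

lemma T_L2: "T \<subseteq> L2_space R0" by (auto simp: tangent_space_def L2_closure_def)

lemma K_T: "g \<in> K \<Longrightarrow> g \<in> T"
  unfolding tangent_space_def by (rule L2_closure_superset[OF span_L2 fun_span_superset])

lemma T_lincomb: "h \<in> T \<Longrightarrow> k \<in> T \<Longrightarrow> (\<lambda>x. c * h x + c' * k x) \<in> T"
  unfolding tangent_space_def by (rule L2_closure_lincomb[OF span_L2 fun_span_lincomb])

lemma T_cong_AE: "h \<in> T \<Longrightarrow> AE x in R0. h' x = h x \<Longrightarrow> h' \<in> borel_measurable R0 \<Longrightarrow> h' \<in> T"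
  unfolding tangent_space_def by (rule L2_closure_cong_AE[OF span_L2])

text \<open>Freeze the second factor at \<open>Q0\<close>. Since the family consists of all
  products, the curve \<open>P t \<Otimes> Q0\<close> stays in it, and its tangent is the first
  marginal of \<open>g\<close>.\<close>

lemma K_fst:
  assumes "g \<in> K" shows "(\<lambda>w. marginal1 Q0 g (fst w)) \<in> K"
proof -
  obtain \<epsilon> f where c: "curve_through \<R> R0 \<epsilon> f g" using assms by (auto simp: tangent_cone_def)
  obtain P Q where PQ: "P 0 = P0" "Q 0 = Q0"
    "\<And>t. \<bar>t\<bar> < \<epsilon> \<Longrightarrow> P t \<in> \<P> \<and> Q t \<in> \<Q> \<and> f t = P t \<Otimes>\<^sub>M Q t"
    "L2_differentiable_curve \<epsilon> P (marginal1 Q0 g)" "L2_differentiable_curve \<epsilon> Q (marginal2 P0 g)"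
    using curve_marginals[OF family1 family2 base c] by blast
  let ?h = "marginal1 Q0 g"
  obtain L where \<epsilon>: "0 < \<epsilon>" and h: "?h \<in> L2_space P0"
    and L: "\<And>t. \<bar>t\<bar> < \<epsilon> \<Longrightarrow> is_density_quotient (P t) P0 (L t)"
    "(\<lambda>t. L2_norm P0 (\<lambda>x. 2 * (sqrt (enn2real (L t x)) - 1) - t * ?h x)) \<in> o[at 0](\<lambda>t. \<bar>t\<bar>)"
    "(\<lambda>t. measure (P t) {x \<in> space (P t). L t x = \<infinity>}) \<in> o[at 0](\<lambda>t. t\<^sup>2)"
    using PQ(4) by (auto simp: L2_differentiable_curve_def PQ(1))
  have pr: "prob_space (P t)" "sets (P t) = sets P0" if "\<bar>t\<bar> < \<epsilon>" for t
    using PQ(3)[OF that] family1 base by auto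
  have ev: "\<forall>\<^sub>F t in at 0. \<bar>t\<bar> < \<epsilon>" using \<epsilon> by (auto simp: eventually_at intro!: exI[of _ \<epsilon>])
  have q: "is_density_quotient (P t \<Otimes>\<^sub>M Q0) R0 (\<lambda>w. L t (fst w))" if t: "\<bar>t\<bar> < \<epsilon>" for t
  proof -
    have eq: "(\<lambda>w. if L t (fst w) = \<infinity> \<or> (1::ennreal) = \<infinity> then \<infinity> else L t (fst w) * 1) = (\<lambda>w. L t (fst w))" by auto
    show ?thesis
      using density_quotient_pair[OF P0.prob_space_axioms Q0.prob_space_axioms pr(1)[OF t] Q0.prob_space_axioms pr(2)[OF t] refl
          L(1)[OF t] density_quotient_refl[OF Q0.prob_space_axioms]] by (simp only: eq)
  qed
  have n: "L2_norm R0 (\<lambda>w. 2 * (sqrt (enn2real (L t (fst w))) - 1) - t * ?h (fst w)) =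
     L2_norm P0 (\<lambda>x. 2 * (sqrt (enn2real (L t x)) - 1) - t * ?h x)" if t: "\<bar>t\<bar> < \<epsilon>" for t
    by (rule PQ.L2_fst(2)[of "\<lambda>x. 2 * (sqrt (enn2real (L t x)) - 1) - t * ?h x"])
       (intro L2_diff L2_cmult h P0.L2_const density_quotient_sqrt(1)[OF L(1)[OF t] pr(1)[OF t] P0.prob_space_axioms pr(2)[OF t]])
  have s: "measure (P t \<Otimes>\<^sub>M Q0) {w \<in> space (P t \<Otimes>\<^sub>M Q0). L t (fst w) = \<infinity>} = measure (P t) {x \<in> space (P t). L t x = \<infinity>}"
    if t: "\<bar>t\<bar> < \<epsilon>" for t
  proof -
    have [measurable]: "L t \<in> borel_measurable P0" by (rule density_quotientD[OF L(1)[OF t] P0.prob_space_axioms])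
    have [measurable_cong]: "sets (P t) = sets P0" by (rule pr(2)[OF t])
    have eq: "{w \<in> space (P t \<Otimes>\<^sub>M Q0). L t (fst w) = \<infinity>} = {x \<in> space (P t). L t x = \<infinity>} \<times> space Q0"
      by (auto simp: space_pair_measure)
    have "{x \<in> space (P t). L t x = \<infinity>} \<in> sets (P t)" by measurable
    then have "emeasure (P t \<Otimes>\<^sub>M Q0) ({x \<in> space (P t). L t x = \<infinity>} \<times> space Q0) = emeasure (P t) {x \<in> space (P t). L t x = \<infinity>}"
      by (subst Q0.emeasure_pair_measure_Times) (auto simp: Q0.emeasure_space_1)
    then show ?thesis unfolding eq by (simp add: measure_def)
  qed
  have "L2_differentiable_curve \<epsilon> (\<lambda>t. P t \<Otimes>\<^sub>M Q0) (\<lambda>w. ?h (fst w))"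
    unfolding L2_differentiable_curve_def PQ(1)
  proof (intro conjI \<epsilon> PQ.L2_fst(1)[OF h] exI[of _ "\<lambda>t w. L t (fst w)"] allI impI q)
    show "(\<lambda>t. L2_norm R0 (\<lambda>w. 2 * (sqrt (enn2real (L t (fst w))) - 1) - t * ?h (fst w))) \<in> o[at 0](\<lambda>t. \<bar>t\<bar>)"
      by (rule smallo_mono[OF L(2)]) (use ev n in \<open>auto elim!: eventually_mono\<close>)
    show "(\<lambda>t. measure (P t \<Otimes>\<^sub>M Q0) {w \<in> space (P t \<Otimes>\<^sub>M Q0). L t (fst w) = \<infinity>}) \<in> o[at 0](\<lambda>t. t\<^sup>2)"
      by (rule smallo_mono[OF L(3)]) (use ev s in \<open>auto elim!: eventually_mono\<close>)
  qed
  then have "curve_through \<R> R0 \<epsilon> (\<lambda>t. P t \<Otimes>\<^sub>M Q0) (\<lambda>w. ?h (fst w))"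
    using PQ(3) base by (auto simp: curve_through_def PQ(1) product_family_def)
  then show ?thesis by (auto simp: tangent_cone_def)
qed

lemma K_snd:
  assumes "g \<in> K" shows "(\<lambda>w. marginal2 P0 g (snd w)) \<in> K"
proof -
  obtain \<epsilon> f where c: "curve_through \<R> R0 \<epsilon> f g" using assms by (auto simp: tangent_cone_def)
  obtain P Q where PQ: "P 0 = P0" "Q 0 = Q0"
    "\<And>t. \<bar>t\<bar> < \<epsilon> \<Longrightarrow> P t \<in> \<P> \<and> Q t \<in> \<Q> \<and> f t = P t \<Otimes>\<^sub>M Q t"
    "L2_differentiable_curve \<epsilon> P (marginal1 Q0 g)" "L2_differentiable_curve \<epsilon> Q (marginal2 P0 g)"
    using curve_marginals[OF family1 family2 base c] by blast
  let ?h = "marginal2 P0 g"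
  obtain L where \<epsilon>: "0 < \<epsilon>" and h: "?h \<in> L2_space Q0"
    and L: "\<And>t. \<bar>t\<bar> < \<epsilon> \<Longrightarrow> is_density_quotient (Q t) Q0 (L t)"
    "(\<lambda>t. L2_norm Q0 (\<lambda>x. 2 * (sqrt (enn2real (L t x)) - 1) - t * ?h x)) \<in> o[at 0](\<lambda>t. \<bar>t\<bar>)"
    "(\<lambda>t. measure (Q t) {x \<in> space (Q t). L t x = \<infinity>}) \<in> o[at 0](\<lambda>t. t\<^sup>2)"
    using PQ(5) by (auto simp: L2_differentiable_curve_def PQ(2))
  have pr: "prob_space (Q t)" "sets (Q t) = sets Q0" if "\<bar>t\<bar> < \<epsilon>" for t
    using PQ(3)[OF that] family2 base by auto
  have ev: "\<forall>\<^sub>F t in at 0. \<bar>t\<bar> < \<epsilon>" using \<epsilon> by (auto simp: eventually_at intro!: exI[of _ \<epsilon>])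
  have q: "is_density_quotient (P0 \<Otimes>\<^sub>M Q t) R0 (\<lambda>w. L t (snd w))" if t: "\<bar>t\<bar> < \<epsilon>" for t
  proof -
    have eq: "(\<lambda>w. if (1::ennreal) = \<infinity> \<or> L t (snd w) = \<infinity> then \<infinity> else 1 * L t (snd w)) = (\<lambda>w. L t (snd w))" by auto
    show ?thesis
      using density_quotient_pair[OF P0.prob_space_axioms Q0.prob_space_axioms P0.prob_space_axioms pr(1)[OF t] refl pr(2)[OF t]
          density_quotient_refl[OF P0.prob_space_axioms] L(1)[OF t]] by (simp only: eq)
  qed
  have n: "L2_norm R0 (\<lambda>w. 2 * (sqrt (enn2real (L t (snd w))) - 1) - t * ?h (snd w)) =
     L2_norm Q0 (\<lambda>x. 2 * (sqrt (enn2real (L t x)) - 1) - t * ?h x)" if t: "\<bar>t\<bar> < \<epsilon>" for t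
    by (rule L2_snd(2)[of "\<lambda>x. 2 * (sqrt (enn2real (L t x)) - 1) - t * ?h x"])
       (intro L2_diff L2_cmult h Q0.L2_const density_quotient_sqrt(1)[OF L(1)[OF t] pr(1)[OF t] Q0.prob_space_axioms pr(2)[OF t]])
  have s: "measure (P0 \<Otimes>\<^sub>M Q t) {w \<in> space (P0 \<Otimes>\<^sub>M Q t). L t (snd w) = \<infinity>} = measure (Q t) {x \<in> space (Q t). L t x = \<infinity>}"
    if t: "\<bar>t\<bar> < \<epsilon>" for t
  proof -
    interpret Qt: prob_space "Q t" by (rule pr(1)[OF t])
    have [measurable]: "L t \<in> borel_measurable Q0" by (rule density_quotientD[OF L(1)[OF t] Q0.prob_space_axioms])
    have [measurable_cong]: "sets (Q t) = sets Q0" by (rule pr(2)[OF t])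
    have eq: "{w \<in> space (P0 \<Otimes>\<^sub>M Q t). L t (snd w) = \<infinity>} = space P0 \<times> {x \<in> space (Q t). L t x = \<infinity>}"
      by (auto simp: space_pair_measure)
    have "{x \<in> space (Q t). L t x = \<infinity>} \<in> sets (Q t)" by measurable
    then have "emeasure (P0 \<Otimes>\<^sub>M Q t) (space P0 \<times> {x \<in> space (Q t). L t x = \<infinity>}) = emeasure (Q t) {x \<in> space (Q t). L t x = \<infinity>}"
      by (subst Qt.emeasure_pair_measure_Times) (auto simp: P0.emeasure_space_1)
    then show ?thesis unfolding eq by (simp add: measure_def)
  qed
  have "L2_differentiable_curve \<epsilon> (\<lambda>t. P0 \<Otimes>\<^sub>M Q t) (\<lambda>w. ?h (snd w))"
    unfolding L2_differentiable_curve_def PQ(2)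
  proof (intro conjI \<epsilon> L2_snd(1)[OF h] exI[of _ "\<lambda>t w. L t (snd w)"] allI impI q)
    show "(\<lambda>t. L2_norm R0 (\<lambda>w. 2 * (sqrt (enn2real (L t (snd w))) - 1) - t * ?h (snd w))) \<in> o[at 0](\<lambda>t. \<bar>t\<bar>)"
      by (rule smallo_mono[OF L(2)]) (use ev n in \<open>auto elim!: eventually_mono\<close>)
    show "(\<lambda>t. measure (P0 \<Otimes>\<^sub>M Q t) {w \<in> space (P0 \<Otimes>\<^sub>M Q t). L t (snd w) = \<infinity>}) \<in> o[at 0](\<lambda>t. t\<^sup>2)"
      by (rule smallo_mono[OF L(3)]) (use ev s in \<open>auto elim!: eventually_mono\<close>)
  qed
  then have "curve_through \<R> R0 \<epsilon> (\<lambda>t. P0 \<Otimes>\<^sub>M Q t) (\<lambda>w. ?h (snd w))"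
    using PQ(3) base by (auto simp: curve_through_def PQ(2) product_family_def)
  then show ?thesis by (auto simp: tangent_cone_def)
qed

text \<open>Taking the first marginal and lifting it back is linear up to null sets and does not
  increase the norm. By \<open>K_fst\<close> it maps the cone into itself, hence also its span and
  the closure of the span.\<close>

lemma T_fst:
  assumes h: "h \<in> T" shows "(\<lambda>w. marginal1 Q0 h (fst w)) \<in> T"
  unfolding tangent_space_def L2_closure_def
proof (intro CollectI conjI allI impI)
  have hL: "h \<in> L2_space R0" using h T_L2 by blast
  note mL = PQ.marginal1_L2(1)
  show "(\<lambda>w. marginal1 Q0 h (fst w)) \<in> L2_space R0" by (rule PQ.L2_fst(1)[OF mL[OF hL]])
  fix e :: real assume "0 < e"
  then obtain F where F: "F \<in> fun_span K" "L2_norm R0 (\<lambda>x. h x - F x) < e"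
    using h by (auto simp: tangent_space_def L2_closure_def)
  then obtain m :: nat and a u where f: "F = (\<lambda>x. \<Sum>i<m. a i * u i x)" "\<And>i. i < m \<Longrightarrow> u i \<in> K"
    unfolding fun_span_def by blast
  have uL: "u i \<in> L2_space R0" if "i \<in> {..<m}" for i using f(2) that K_L2 by auto
  let ?F = "\<lambda>w. \<Sum>i<m. a i * marginal1 Q0 (u i) (fst w)"
  have "?F \<in> fun_span K"
    unfolding fun_span_def using f(2)
    by (intro CollectI exI[of _ m] exI[of _ a] exI[of _ "\<lambda>i w. marginal1 Q0 (u i) (fst w)"]) (auto intro: K_fst)
  moreover have "L2_norm R0 (\<lambda>w. marginal1 Q0 h (fst w) - ?F w) < e"
  proof -
    have FL: "(\<lambda>x. \<Sum>i<m. a i * marginal1 Q0 (u i) x) \<in> L2_space P0"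
      by (intro L2_sum L2_cmult mL uL)
    have dL: "(\<lambda>w. h w - (\<Sum>i<m. a i * u i w)) \<in> L2_space R0"
      by (intro L2_diff L2_sum L2_cmult hL uL)
    have "L2_norm R0 (\<lambda>w. marginal1 Q0 h (fst w) - ?F w) = L2_norm P0 (\<lambda>x. marginal1 Q0 h x - (\<Sum>i<m. a i * marginal1 Q0 (u i) x))"
      by (rule PQ.L2_fst(2)[OF L2_diff[OF mL[OF hL] FL]])
    also have "\<dots> = L2_norm P0 (marginal1 Q0 (\<lambda>w. h w - (\<Sum>i<m. a i * u i w)))"
      using PQ.marginal1_sum[of h "{..<m}" u a, OF hL uL finite_lessThan]
      by (intro L2_norm_cong_AE L2_spaceD(1)[OF L2_diff[OF mL[OF hL] FL]] L2_spaceD(1)[OF mL[OF dL]]) (auto elim: eventually_mono)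
    also have "\<dots> \<le> L2_norm R0 (\<lambda>w. h w - (\<Sum>i<m. a i * u i w))" by (rule PQ.marginal1_L2(2)[OF dL])
    also have "\<dots> < e" using F(2) by (simp add: f(1))
    finally show ?thesis .
  qed
  ultimately show "\<exists>f\<in>fun_span K. L2_norm R0 (\<lambda>x. marginal1 Q0 h (fst x) - f x) < e"
    by - (rule bexI[where x="?F"])
qed

lemma T_snd:
  assumes h: "h \<in> T" shows "(\<lambda>w. marginal2 P0 h (snd w)) \<in> T"
  unfolding tangent_space_def L2_closure_def
proof (intro CollectI conjI allI impI)
  have hL: "h \<in> L2_space R0" using h T_L2 by blast
  note mL = marginal2_L2(1)
  show "(\<lambda>w. marginal2 P0 h (snd w)) \<in> L2_space R0" by (rule L2_snd(1)[OF mL[OF hL]])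
  fix e :: real assume "0 < e"
  then obtain F where F: "F \<in> fun_span K" "L2_norm R0 (\<lambda>x. h x - F x) < e"
    using h by (auto simp: tangent_space_def L2_closure_def)
  then obtain m :: nat and a u where f: "F = (\<lambda>x. \<Sum>i<m. a i * u i x)" "\<And>i. i < m \<Longrightarrow> u i \<in> K"
    unfolding fun_span_def by blast
  have uL: "u i \<in> L2_space R0" if "i \<in> {..<m}" for i using f(2) that K_L2 by auto
  let ?F = "\<lambda>w. \<Sum>i<m. a i * marginal2 P0 (u i) (snd w)"
  have "?F \<in> fun_span K"
    unfolding fun_span_def using f(2)
    by (intro CollectI exI[of _ m] exI[of _ a] exI[of _ "\<lambda>i w. marginal2 P0 (u i) (snd w)"]) (auto intro: K_snd)
  moreover have "L2_norm R0 (\<lambda>w. marginal2 P0 h (snd w) - ?F w) < e"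
  proof -
    have FL: "(\<lambda>x. \<Sum>i<m. a i * marginal2 P0 (u i) x) \<in> L2_space Q0"
      by (intro L2_sum L2_cmult mL uL)
    have dL: "(\<lambda>w. h w - (\<Sum>i<m. a i * u i w)) \<in> L2_space R0"
      by (intro L2_diff L2_sum L2_cmult hL uL)
    have "L2_norm R0 (\<lambda>w. marginal2 P0 h (snd w) - ?F w) = L2_norm Q0 (\<lambda>x. marginal2 P0 h x - (\<Sum>i<m. a i * marginal2 P0 (u i) x))"
      by (rule L2_snd(2)[OF L2_diff[OF mL[OF hL] FL]])
    also have "\<dots> = L2_norm Q0 (marginal2 P0 (\<lambda>w. h w - (\<Sum>i<m. a i * u i w)))"
      using marginal2_sum[of h "{..<m}" u a, OF hL uL finite_lessThan]
      by (intro L2_norm_cong_AE L2_spaceD(1)[OF L2_diff[OF mL[OF hL] FL]] L2_spaceD(1)[OF mL[OF dL]]) (auto elim: eventually_mono)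
    also have "\<dots> \<le> L2_norm R0 (\<lambda>w. h w - (\<Sum>i<m. a i * u i w))" by (rule marginal2_L2(2)[OF dL])
    also have "\<dots> < e" using F(2) by (simp add: f(1))
    finally show ?thesis .
  qed
  ultimately show "\<exists>f\<in>fun_span K. L2_norm R0 (\<lambda>x. marginal2 P0 h (snd x) - f x) < e"
    by - (rule bexI[where x="?F"])
qed

end

text \<open>As \<open>t n\<close> behaves like \<open>\<tau> / sqrt n\<close>, errors
  \<open>o(|t|)\<close> and \<open>o(t^2)\<close> become \<open>o(1 / sqrt n)\<close> and
  \<open>o(1 / n)\<close>; the scale \<open>\<tau>\<close> moves into the tangent.\<close>

lemma curve_local_seq:
  assumes P0: "prob_space P0" and P: "P 0 = P0" "\<And>t. \<bar>t\<bar> < \<epsilon> \<Longrightarrow> prob_space (P t) \<and> sets (P t) = sets P0"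
    and c: "L2_differentiable_curve \<epsilon> P h"
    and t: "t \<longlonglongrightarrow> 0" "(\<lambda>n. t n * sqrt (real n)) \<longlonglongrightarrow> \<tau>" "0 < \<tau>" "\<And>n. \<bar>t n\<bar> < \<epsilon>"
    and Ps: "\<And>n. Ps n = P (t n)"
  shows "local_seq P0 Ps (\<lambda>x. \<tau> * h x)"
proof -
  interpret prob_space P0 by (rule P0)
  obtain L where h: "h \<in> L2_space P0"
    and L: "\<And>t. \<bar>t\<bar> < \<epsilon> \<Longrightarrow> is_density_quotient (P t) P0 (L t)"
    "(\<lambda>t. L2_norm P0 (\<lambda>x. 2 * (sqrt (enn2real (L t x)) - 1) - t * h x)) \<in> o[at 0](\<lambda>t. \<bar>t\<bar>)"
    "(\<lambda>t. measure (P t) {x \<in> space (P t). L t x = \<infinity>}) \<in> o[at 0](\<lambda>t. t\<^sup>2)"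
    using c by (auto simp: L2_differentiable_curve_def P(1))
  define \<xi> where "\<xi> n x = sqrt (enn2real (L (t n) x))" for n x
  let ?N = "\<lambda>t. L2_norm P0 (\<lambda>x. 2 * (sqrt (enn2real (L t x)) - 1) - t * h x)"
  let ?s = "\<lambda>t. measure (P t) {x \<in> space (P t). L t x = \<infinity>}"
  have pr: "prob_space (Ps n)" "sets (Ps n) = sets P0" "is_density_quotient (Ps n) P0 (L (t n))" for n
    using P(2)[OF t(4)] L(1)[OF t(4)] by (auto simp: Ps)
  note q = density_quotient_sqrt[OF pr(3) pr(1) P0 pr(2), folded \<xi>_def]
  \<comment> \<open>The positive limit of \<open>t n * sqrt n\<close> forces \<open>t n\<close> to
    be eventually positive; in particular it avoids \<open>0\<close>, as the punctured filter
    \<open>at 0\<close> demands.\<close>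
  have pos: "\<forall>\<^sub>F n in sequentially. 0 < t n"
    using order_tendstoD(1)[OF t(2,3)] by eventually_elim (simp add: zero_less_mult_iff)
  have ft: "filterlim t (at 0) sequentially"
    unfolding filterlim_at using t(1) pos by (auto elim: eventually_mono)
  have l1: "(\<lambda>n. ?N (t n) / \<bar>t n\<bar>) \<longlonglongrightarrow> 0" by (rule filterlim_compose[OF smalloD_tendsto[OF L(2)] ft])
  have l2: "(\<lambda>n. ?s (t n) / (t n)\<^sup>2) \<longlonglongrightarrow> 0" by (rule filterlim_compose[OF smalloD_tendsto[OF L(3)] ft])
  have lN: "(\<lambda>n. sqrt (real n) * ?N (t n)) \<longlonglongrightarrow> 0"
  proof -
    have "(\<lambda>n. (t n * sqrt (real n)) * (?N (t n) / \<bar>t n\<bar>)) \<longlonglongrightarrow> \<tau> * 0" by (intro tendsto_mult t l1)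
    then have "(\<lambda>n. (t n * sqrt (real n)) * (?N (t n) / \<bar>t n\<bar>)) \<longlonglongrightarrow> 0" by simp
    then show ?thesis
    proof (rule Lim_transform_eventually)
      show "\<forall>\<^sub>F n in sequentially. (t n * sqrt (real n)) * (?N (t n) / \<bar>t n\<bar>) = sqrt (real n) * ?N (t n)"
        using pos by eventually_elim simp
    qed
  qed
  have ls: "(\<lambda>n. real n * ?s (t n)) \<longlonglongrightarrow> 0"
  proof -
    have "(\<lambda>n. (t n * sqrt (real n))\<^sup>2 * (?s (t n) / (t n)\<^sup>2)) \<longlonglongrightarrow> \<tau>\<^sup>2 * 0" by (intro tendsto_mult tendsto_power t l2)
    then have "(\<lambda>n. (t n * sqrt (real n))\<^sup>2 * (?s (t n) / (t n)\<^sup>2)) \<longlonglongrightarrow> 0" by simp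
    then show ?thesis
    proof (rule Lim_transform_eventually)
      show "\<forall>\<^sub>F n in sequentially. (t n * sqrt (real n))\<^sup>2 * (?s (t n) / (t n)\<^sup>2) = real n * ?s (t n)"
        using pos by eventually_elim (simp add: power_mult_distrib)
    qed
  qed
  have lt: "(\<lambda>n. \<bar>sqrt (real n) * t n - \<tau>\<bar>) \<longlonglongrightarrow> 0"
    using t(2) by (intro tendsto_rabs_zero) (simp add: LIM_zero_iff mult.commute)
  have L2t: "L2_tendsto P0 (\<lambda>n x. sqrt (real n) * (\<xi> n x - 1)) (\<lambda>x. \<tau> * h x / 2)"
  proof (rule L2_tendstoI)
    show "(\<lambda>x. sqrt (real n) * (\<xi> n x - 1)) \<in> L2_space P0" for n
      by (intro L2_cmult L2_diff q(1) L2_const)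
    show "(\<lambda>x. \<tau> * h x / 2) \<in> L2_space P0" using L2_cmult[OF h, of "\<tau> / 2"] by simp
    have "(\<lambda>n. (1/2) * (sqrt (real n) * ?N (t n)) + (1/2) * (\<bar>sqrt (real n) * t n - \<tau>\<bar> * L2_norm P0 h)) \<longlonglongrightarrow>
       (1/2) * 0 + (1/2) * (0 * L2_norm P0 h)"
      by (intro tendsto_intros lN lt)
    then show "(\<lambda>n. (1/2) * (sqrt (real n) * ?N (t n)) + (1/2) * (\<bar>sqrt (real n) * t n - \<tau>\<bar> * L2_norm P0 h)) \<longlonglongrightarrow> 0" by simp
    fix n
    have r: "(\<lambda>x. 2 * (\<xi> n x - 1) - t n * h x) \<in> L2_space P0"
      by (intro L2_cmult L2_diff q(1) L2_const h)
    have "(\<lambda>x. sqrt (real n) * (\<xi> n x - 1) - \<tau> * h x / 2) =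
      (\<lambda>x. (sqrt (real n) / 2) * (2 * (\<xi> n x - 1) - t n * h x) + ((sqrt (real n) * t n - \<tau>) / 2) * h x)"
      by (rule ext) (simp add: algebra_simps add_divide_distrib diff_divide_distrib)
    then show "L2_norm P0 (\<lambda>x. sqrt (real n) * (\<xi> n x - 1) - \<tau> * h x / 2) \<le>
       (1/2) * (sqrt (real n) * ?N (t n)) + (1/2) * (\<bar>sqrt (real n) * t n - \<tau>\<bar> * L2_norm P0 h)"
      using L2_norm_triangle[OF L2_cmult[OF r, of "sqrt (real n) / 2"] L2_cmult[OF h, of "(sqrt (real n) * t n - \<tau>) / 2"]]
      unfolding L2_norm_cmult by (simp add: \<xi>_def[symmetric] abs_divide)
  qed
  have mass: "(\<lambda>n. real n * ((\<integral>x. (\<xi> n x)\<^sup>2 \<partial>P0) - 1)) \<longlonglongrightarrow> 0"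
    using tendsto_minus[OF ls] unfolding q(2) by (simp add: Ps)
  show ?thesis
    unfolding local_seq_def using pr q L2t mass L2_cmult[OF h, of \<tau>] by (intro conjI allI exI[of _ \<xi>]) auto
qed

section \<open>Optimality\<close>

lemma marginal_scale:
  "marginal1 Q (\<lambda>w. c * h w) = (\<lambda>x. c * marginal1 Q h x)"
  "marginal2 P (\<lambda>w. c * h w) = (\<lambda>x. c * marginal2 P h x)"
  by (simp_all add: marginal1_def[abs_def] marginal2_def[abs_def])

lemma liminf_ge_complement:
  fixes x :: "nat \<Rightarrow> real"
  assumes "limsup (\<lambda>n. ereal (1 - x n)) \<le> ereal b"
  shows "ereal (1 - b) \<le> liminf (\<lambda>n. ereal (x n))"
  unfolding le_Liminf_iff
proof (intro allI impI)
  fix y assume y: "y < ereal (1 - b)"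
  show "\<forall>\<^sub>F n in sequentially. y < ereal (x n)"
  proof (cases y)
    case (real r)
    then have "ereal b < ereal (1 - r)" using y by simp
    then have "\<forall>\<^sub>F n in sequentially. ereal (1 - x n) < ereal (1 - r)"
      using assms unfolding Limsup_le_iff by blast
    then show ?thesis by eventually_elim (simp add: real)
  qed (use y in auto)
qed

lemma L2_norm_zero_AE:
  assumes "f \<in> L2_space M" "L2_norm M f \<le> 0"
  shows "AE x in M. f x = 0"
proof -
  have "(\<integral>x. (f x)\<^sup>2 \<partial>M) = 0"
    using assms(2) by (intro antisym) (auto simp: L2_norm_def)
  then show ?thesis using integral_nonneg_eq_0_iff_AE[of M "\<lambda>x. (f x)\<^sup>2"] assms(1) by (auto simp: L2_space_def)
qed

section \<open>Sequences attached to tangents, and their local parameters\<close>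

context two_sample_model
begin

text \<open>The stored factors coincide with the marginal curves by uniqueness of factors. For the
  parameter, the scaled increment of \<open>k\<close> is \<open>t n * sqrt n\<close> times a
  difference quotient, and eventual positivity of \<open>t n\<close> lets the one-sided limit of the
  gradient apply.\<close>

lemma curve_sequence:
  assumes grad: "is_gradient k R0 \<R> \<kappa>"
    and c: "curve_through \<R> R0 \<epsilon> f g"
    and t: "t \<longlonglongrightarrow> 0" "(\<lambda>n. t n * sqrt (real n)) \<longlonglongrightarrow> \<tau>" "0 < \<tau>" "\<And>n. \<bar>t n\<bar> < \<epsilon>"
    and s: "\<And>n. fst s n \<in> \<P>" "\<And>n. snd s n \<in> \<Q>" "\<And>n. f (t n) = fst s n \<Otimes>\<^sub>M snd s n"
  shows "local_seq P0 (fst s) (marginal1 Q0 (\<lambda>w. \<tau> * g w))"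
    "local_seq Q0 (snd s) (marginal2 P0 (\<lambda>w. \<tau> * g w))"
    "local_parameter k P0 Q0 s = (\<integral>w. \<kappa> w * (\<tau> * g w) \<partial>R0)"
proof -
  obtain P Q where PQ: "P 0 = P0" "Q 0 = Q0"
    "\<And>t. \<bar>t\<bar> < \<epsilon> \<Longrightarrow> P t \<in> \<P> \<and> Q t \<in> \<Q> \<and> f t = P t \<Otimes>\<^sub>M Q t"
    "L2_differentiable_curve \<epsilon> P (marginal1 Q0 g)" "L2_differentiable_curve \<epsilon> Q (marginal2 P0 g)"
    using curve_marginals[OF family1 family2 base c] by blast
  have eq: "fst s n = P (t n)" "snd s n = Q (t n)" for n
  proof -
    have a: "P (t n) \<in> \<P>" "Q (t n) \<in> \<Q>" "fst s n \<Otimes>\<^sub>M snd s n = P (t n) \<Otimes>\<^sub>M Q (t n)"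
      using PQ(3)[OF t(4)] s(3) by auto
    have b: "prob_space (fst s n)" "prob_space (snd s n)" "prob_space (P (t n))" "prob_space (Q (t n))"
      "sets (fst s n) = sets (P (t n))" "sets (snd s n) = sets (Q (t n))"
      using family1[OF s(1)] family2[OF s(2)] family1[OF a(1)] family2[OF a(2)] by auto
    show "fst s n = P (t n)" "snd s n = Q (t n)" by (rule pair_measure_factor_eq[OF b a(3)])+
  qed
  have P: "prob_space (P t) \<and> sets (P t) = sets P0" "prob_space (Q t) \<and> sets (Q t) = sets Q0" if "\<bar>t\<bar> < \<epsilon>" for t
    using PQ(3)[OF that] family1 family2 base by auto
  show "local_seq P0 (fst s) (marginal1 Q0 (\<lambda>w. \<tau> * g w))"
    unfolding marginal_scale by (rule curve_local_seq[OF P0.prob_space_axioms PQ(1) P(1) PQ(4) t eq(1)])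
  show "local_seq Q0 (snd s) (marginal2 P0 (\<lambda>w. \<tau> * g w))"
    unfolding marginal_scale by (rule curve_local_seq[OF Q0.prob_space_axioms PQ(2) P(2) PQ(5) t eq(2)])
  have pos: "\<forall>\<^sub>F n in sequentially. 0 < t n"
    using order_tendstoD(1)[OF t(2,3)] by eventually_elim (simp add: zero_less_mult_iff)
  have ft: "filterlim t (at_right 0) sequentially"
    unfolding filterlim_at using t(1) pos by (auto elim: eventually_mono)
  have "((\<lambda>t. (k (f t) - k R0) / t) \<longlongrightarrow> (\<integral>x. \<kappa> x * g x \<partial>R0)) (at_right 0)"
    using grad c by (auto simp: is_gradient_def)
  from filterlim_compose[OF this ft]
  have "(\<lambda>n. (t n * sqrt (real n)) * ((k (f (t n)) - k R0) / t n)) \<longlonglongrightarrow> \<tau> * (\<integral>x. \<kappa> x * g x \<partial>R0)"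
    by (intro tendsto_mult t)
  then have "(\<lambda>n. sqrt (real n) * (k (fst s n \<Otimes>\<^sub>M snd s n) - k R0)) \<longlonglongrightarrow> \<tau> * (\<integral>x. \<kappa> x * g x \<partial>R0)"
  proof (rule Lim_transform_eventually)
    show "\<forall>\<^sub>F n in sequentially. (t n * sqrt (real n)) * ((k (f (t n)) - k R0) / t n) = sqrt (real n) * (k (fst s n \<Otimes>\<^sub>M snd s n) - k R0)"
      using pos by eventually_elim (simp add: s(3))
  qed
  then show "local_parameter k P0 Q0 s = (\<integral>w. \<kappa> w * (\<tau> * g w) \<partial>R0)"
    unfolding local_parameter_def by (subst limI) (auto simp: mult.left_commute)
qed

lemma F2_tangent:
  assumes grad: "is_gradient k R0 \<R> \<kappa>" and s: "s \<in> F2 \<P> \<Q> P0 Q0"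
  obtains h where "h \<in> T" "local_seq P0 (fst s) (marginal1 Q0 h)" "local_seq Q0 (snd s) (marginal2 P0 h)"
    "local_parameter k P0 Q0 s = (\<integral>w. \<kappa> w * h w \<partial>R0)"
proof -
  obtain t \<tau> \<epsilon> f g where *: "t \<longlonglongrightarrow> 0" "(\<lambda>n. t n * sqrt (real n)) \<longlonglongrightarrow> \<tau>" "0 < \<tau>"
    "curve_through \<R> R0 \<epsilon> f g" "\<And>n. \<bar>t n\<bar> < \<epsilon>" "\<And>n. f (t n) = fst s n \<Otimes>\<^sub>M snd s n"
    "\<And>n. fst s n \<in> \<P>" "\<And>n. snd s n \<in> \<Q>"
    using s by (auto simp: F2_def)
  have g: "g \<in> T" using *(4) by (intro K_T) (auto simp: tangent_cone_def)
  have "(\<lambda>w. \<tau> * g w) \<in> T" using T_lincomb[OF g g, of \<tau> 0] by simp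
  then show thesis by (rule that[OF _ curve_sequence[OF grad *(4,1,2,3,5,7,8,6)]])
qed

text \<open>Choosing \<open>t n = 1 / sqrt n\<close> gives scale \<open>\<tau> = 1\<close>, so the
  tangent is \<open>g\<close> itself. This manufactures implicit hypotheses from tangents that are
  orthogonal to the gradient.\<close>

lemma cone_sequence:
  assumes grad: "is_gradient k R0 \<R> \<kappa>" and g: "g \<in> K"
  obtains s where "s \<in> F2 \<P> \<Q> P0 Q0" "local_seq P0 (fst s) (marginal1 Q0 g)" "local_seq Q0 (snd s) (marginal2 P0 g)"
    "local_parameter k P0 Q0 s = (\<integral>w. \<kappa> w * g w \<partial>R0)"
proof -
  obtain \<epsilon> f where c: "curve_through \<R> R0 \<epsilon> f g" using g by (auto simp: tangent_cone_def)
  then have \<epsilon>: "0 < \<epsilon>" and fR: "\<And>t. \<bar>t\<bar> < \<epsilon> \<Longrightarrow> f t \<in> \<R>" by (auto simp: curve_through_def L2_differentiable_curve_def)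
  \<comment> \<open>\<open>1 / sqrt n\<close> may leave the domain of the curve for finitely many
    \<open>n\<close>; there the base point \<open>t n = 0\<close> is used.\<close>
  define t where "t n = (if 1 / sqrt (real n) < \<epsilon> then 1 / sqrt (real n) else 0)" for n :: nat
  have l0: "(\<lambda>n. 1 / sqrt (real n)) \<longlonglongrightarrow> 0"
    by (rule tendsto_divide_0[OF tendsto_const] filterlim_at_top_imp_at_infinity
          filterlim_compose[OF sqrt_at_top] filterlim_real_sequentially)+
  have ev: "\<forall>\<^sub>F n in sequentially. 1 / sqrt (real n) = t n"
    using order_tendstoD(2)[OF l0 \<epsilon>] by eventually_elim (simp add: t_def)
  have t: "t \<longlonglongrightarrow> 0" by (rule Lim_transform_eventually[OF l0 ev])
  have "\<forall>\<^sub>F n in sequentially. 1 = t n * sqrt (real n)"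
    using ev eventually_gt_at_top[of 0] by eventually_elim (simp add: eq_commute[of _ "t _"])
  then have t1: "(\<lambda>n. t n * sqrt (real n)) \<longlonglongrightarrow> 1" by (rule Lim_transform_eventually[OF tendsto_const])
  have te: "\<bar>t n\<bar> < \<epsilon>" for n using \<epsilon> by (simp add: t_def)
  have "\<forall>n. \<exists>p. fst p \<in> \<P> \<and> snd p \<in> \<Q> \<and> f (t n) = fst p \<Otimes>\<^sub>M snd p"
    using fR[OF te] by (fastforce simp: product_family_def)
  then obtain p where p: "\<And>n. fst (p n) \<in> \<P>" "\<And>n. snd (p n) \<in> \<Q>" "\<And>n. f (t n) = fst (p n) \<Otimes>\<^sub>M snd (p n)"
    by metis
  define s where "s = (\<lambda>n. fst (p n), \<lambda>n. snd (p n))"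
  have s: "\<And>n. fst s n \<in> \<P>" "\<And>n. snd s n \<in> \<Q>" "\<And>n. f (t n) = fst s n \<Otimes>\<^sub>M snd s n"
    using p by (auto simp: s_def)
  have "s \<in> F2 \<P> \<Q> P0 Q0"
    unfolding F2_def s_def using p t t1 c te
    by (intro CollectI case_prodI conjI allI exI[of _ t] exI[of _ 1] exI[of _ \<epsilon>] exI[of _ f] exI[of _ g]) auto
  moreover note curve_sequence[OF grad c t t1 zero_less_one te s]
  ultimately show thesis using that[of s] by simp
qed

end

section \<open>The least favourable direction and the power bound\<close>

locale canonical_model = two_sample_model +
  fixes k :: "('a \<times> 'b) measure \<Rightarrow> real"
    and \<kappa> :: "'a \<times> 'b \<Rightarrow> real" and \<kappa>1 :: "'a \<Rightarrow> real" and \<kappa>2 :: "'b \<Rightarrow> real"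
    and n1 n2 :: "nat \<Rightarrow> nat" and d :: real
  assumes canonical: "is_canonical_gradient k R0 \<R> \<kappa>"
    and parts: "\<kappa>1 \<in> L2_centered P0" "\<kappa>2 \<in> L2_centered Q0"
    and decomposition: "AE w in R0. \<kappa> w = \<kappa>1 (fst w) + \<kappa>2 (snd w)"
    and nondegenerate: "L2_norm R0 \<kappa> \<noteq> 0"
    and sizes: "\<And>n. n1 n + n2 n = n"
    and proportion: "(\<lambda>n. real (n2 n) / real n) \<longlonglongrightarrow> d" "0 < d" "d < 1"
    and dense: "gradient_kernel \<kappa> R0 \<R> \<subseteq> L2_closure R0 (gradient_kernel \<kappa> R0 \<R> \<inter> K)"
begin

lemma gradient: "is_gradient k R0 \<R> \<kappa>" and \<kappa>T: "\<kappa> \<in> T"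
  using canonical by (auto simp: is_canonical_gradient_def)

lemma \<kappa>L: "\<kappa> \<in> L2_space R0" "\<kappa>1 \<in> L2_space P0" "\<kappa>2 \<in> L2_space Q0"
  using \<kappa>T T_L2 parts by (auto simp: L2_centered_def)

lemma \<kappa>m [measurable]: "\<kappa> \<in> borel_measurable R0" "\<kappa>1 \<in> borel_measurable P0" "\<kappa>2 \<in> borel_measurable Q0"
  using \<kappa>L by (auto simp: L2_space_def)

lemma \<kappa>_centered: "(\<integral>x. \<kappa>1 x \<partial>P0) = 0" "(\<integral>y. \<kappa>2 y \<partial>Q0) = 0"
  using parts by (auto simp: L2_centered_def)

lemma proportion1: "(\<lambda>n. real (n1 n) / real n) \<longlonglongrightarrow> 1 - d"
proof -
  have "(\<lambda>n. 1 - real (n2 n) / real n) \<longlonglongrightarrow> 1 - d" by (intro tendsto_intros proportion)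
  moreover have "\<forall>\<^sub>F n in sequentially. 1 - real (n2 n) / real n = real (n1 n) / real n"
  proof (rule eventually_sequentiallyI[of 1])
    fix n :: nat assume n: "1 \<le> n"
    have "real n = real (n1 n) + real (n2 n)" by (subst sizes[of n, symmetric]) simp
    then show "1 - real (n2 n) / real n = real (n1 n) / real n" using n by (simp add: field_simps)
  qed
  ultimately show ?thesis by (rule Lim_transform_eventually)
qed

definition v :: real where
  "v = 1 / (1 - d) * (\<integral>x. (\<kappa>1 x)\<^sup>2 \<partial>P0) + 1 / d * (\<integral>y. (\<kappa>2 y)\<^sup>2 \<partial>Q0)"

lemma v_pos: "0 < v"
proof (rule ccontr)
  let ?a = "\<integral>x. (\<kappa>1 x)\<^sup>2 \<partial>P0" and ?b = "\<integral>y. (\<kappa>2 y)\<^sup>2 \<partial>Q0"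
  assume "\<not> 0 < v"
  moreover have "0 \<le> 1 / (1 - d) * ?a" "0 \<le> 1 / d * ?b" using proportion by auto
  ultimately have "1 / (1 - d) * ?a = 0" "1 / d * ?b = 0" unfolding v_def by linarith+
  then have "L2_norm P0 \<kappa>1 = 0" "L2_norm Q0 \<kappa>2 = 0" using proportion by (auto simp: L2_norm_def)
  moreover have "L2_norm R0 \<kappa> = L2_norm R0 (\<lambda>w. \<kappa>1 (fst w) + \<kappa>2 (snd w))"
    by (rule L2_norm_cong_AE[OF decomposition]) auto
  moreover have "\<dots> \<le> L2_norm P0 \<kappa>1 + L2_norm Q0 \<kappa>2"
    using L2_norm_triangle[OF PQ.L2_fst(1)[OF \<kappa>L(2)] L2_snd(1)[OF \<kappa>L(3)]]
    unfolding PQ.L2_fst(2)[OF \<kappa>L(2)] L2_snd(2)[OF \<kappa>L(3)] .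
  ultimately have "L2_norm R0 \<kappa> \<le> 0" by simp
  then show False using nondegenerate L2_norm_nonneg[of R0 \<kappa>] by linarith
qed

lemma inner_\<kappa>:
  assumes h: "h \<in> L2_space R0"
  shows "(\<integral>w. \<kappa> w * h w \<partial>R0) = (\<integral>x. \<kappa>1 x * marginal1 Q0 h x \<partial>P0) + (\<integral>y. \<kappa>2 y * marginal2 P0 h y \<partial>Q0)"
proof -
  have [measurable]: "h \<in> borel_measurable R0" using h by (simp add: L2_space_def)
  have "(\<integral>w. \<kappa> w * h w \<partial>R0) = (\<integral>w. \<kappa>1 (fst w) * h w + \<kappa>2 (snd w) * h w \<partial>R0)"
    by (rule integral_cong_AE) (use decomposition in \<open>auto elim!: eventually_mono simp: distrib_right\<close>)
  also have "\<dots> = (\<integral>w. \<kappa>1 (fst w) * h w \<partial>R0) + (\<integral>w. \<kappa>2 (snd w) * h w \<partial>R0)"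
    by (intro Bochner_Integration.integral_add L2_mult_integrable PQ.L2_fst(1) L2_snd(1) \<kappa>L h)
  finally show ?thesis
    unfolding PQ.marginal1_inner[OF \<kappa>L(2) h] marginal2_inner[OF \<kappa>L(3) h] .
qed

text \<open>The representer of \<open>h \<mapsto> \<integral>\<kappa> h\<close> in the inner product
  \<open>(1 - d) \<langle>g\<^sub>1, h\<^sub>1\<rangle> + d \<langle>g\<^sub>2, h\<^sub>2\<rangle>\<close> that governs the two-sample experiment.\<close>

definition \<kappa>s :: "'a \<times> 'b \<Rightarrow> real" where
  "\<kappa>s w = 1 / (1 - d) * \<kappa>1 (fst w) + 1 / d * \<kappa>2 (snd w)"

lemma \<kappa>sL: "\<kappa>s \<in> L2_space R0"
  unfolding \<kappa>s_def[abs_def] by (intro L2_add L2_cmult PQ.L2_fst(1) L2_snd(1) \<kappa>L)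

lemma marginals_\<kappa>s:
  "AE x in P0. marginal1 Q0 \<kappa>s x = 1 / (1 - d) * \<kappa>1 x" "AE y in Q0. marginal2 P0 \<kappa>s y = 1 / d * \<kappa>2 y"
  using PQ.marginal1_lincomb[OF PQ.L2_fst(1)[OF \<kappa>L(2)] L2_snd(1)[OF \<kappa>L(3)], of "1 / (1 - d)" "1 / d"]
    marginal2_lincomb[OF PQ.L2_fst(1)[OF \<kappa>L(2)] L2_snd(1)[OF \<kappa>L(3)], of "1 / (1 - d)" "1 / d"]
  unfolding \<kappa>s_def[abs_def, symmetric] marginals_fst[OF \<kappa>L(2)] marginals_snd[OF \<kappa>L(3)] \<kappa>_centered
  by (auto elim: eventually_mono)

text \<open>The decomposition holds only almost everywhere on the product. The difference of its two
  sides has norm \<open>0\<close>, and since taking marginals is a contraction, so have the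
  marginals of this difference.\<close>

lemma marginals_\<kappa>:
  "AE x in P0. marginal1 Q0 \<kappa> x = \<kappa>1 x" "AE y in Q0. marginal2 P0 \<kappa> y = \<kappa>2 y"
proof -
  have L: "(\<lambda>w. 1 * \<kappa>1 (fst w) + 1 * \<kappa>2 (snd w)) \<in> L2_space R0"
    by (intro L2_add L2_cmult PQ.L2_fst(1) L2_snd(1) \<kappa>L)
  have D: "(\<lambda>w. 1 * \<kappa> w + (-1) * (1 * \<kappa>1 (fst w) + 1 * \<kappa>2 (snd w))) \<in> L2_space R0"
    by (intro L2_add L2_cmult PQ.L2_fst(1) L2_snd(1) \<kappa>L)
  have "L2_norm R0 (\<lambda>w. 1 * \<kappa> w + (-1) * (1 * \<kappa>1 (fst w) + 1 * \<kappa>2 (snd w))) = L2_norm R0 (\<lambda>w. 0)"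
    by (rule L2_norm_cong_AE[OF _ L2_spaceD(1)[OF D]]) (use decomposition in \<open>auto elim: eventually_mono\<close>)
  then have z: "L2_norm R0 (\<lambda>w. 1 * \<kappa> w + (-1) * (1 * \<kappa>1 (fst w) + 1 * \<kappa>2 (snd w))) = 0"
    by (simp add: L2_norm_def)
  show "AE x in P0. marginal1 Q0 \<kappa> x = \<kappa>1 x"
    using L2_norm_zero_AE[OF PQ.marginal1_L2(1)[OF D] PQ.marginal1_L2(2)[OF D, unfolded z]]
      PQ.marginal1_lincomb[OF \<kappa>L(1) L, of 1 "-1"]
      PQ.marginal1_lincomb[OF PQ.L2_fst(1)[OF \<kappa>L(2)] L2_snd(1)[OF \<kappa>L(3)], of 1 1]
    unfolding marginals_fst[OF \<kappa>L(2)] marginals_snd[OF \<kappa>L(3)] \<kappa>_centered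
    by eventually_elim simp
  show "AE y in Q0. marginal2 P0 \<kappa> y = \<kappa>2 y"
    using L2_norm_zero_AE[OF marginal2_L2(1)[OF D] marginal2_L2(2)[OF D, unfolded z]]
      marginal2_lincomb[OF \<kappa>L(1) L, of 1 "-1"]
      marginal2_lincomb[OF PQ.L2_fst(1)[OF \<kappa>L(2)] L2_snd(1)[OF \<kappa>L(3)], of 1 1]
    unfolding marginals_fst[OF \<kappa>L(2)] marginals_snd[OF \<kappa>L(3)] \<kappa>_centered
    by eventually_elim simp
qed

text \<open>The weights \<open>1 / (1 - d)\<close> and \<open>1 / d\<close> may differ, so
  \<open>\<kappa>s\<close> need not be a multiple of \<open>\<kappa>\<close>. Both lifted parts of
  \<open>\<kappa>\<close> are its marginals and lie in \<open>T\<close> separately by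
  \<open>T_fst\<close> and \<open>T_snd\<close>, so every combination of them does.\<close>

lemma \<kappa>s_T: "\<kappa>s \<in> T"
proof -
  have "AE w in R0. \<kappa>1 (fst w) - marginal1 Q0 \<kappa> (fst w) = 0"
  proof (rule L2_norm_zero_AE)
    note D = L2_diff[OF \<kappa>L(2) PQ.marginal1_L2(1)[OF \<kappa>L(1)]]
    show "(\<lambda>w. \<kappa>1 (fst w) - marginal1 Q0 \<kappa> (fst w)) \<in> L2_space R0" by (rule PQ.L2_fst(1)[OF D])
    have "L2_norm P0 (\<lambda>x. \<kappa>1 x - marginal1 Q0 \<kappa> x) = L2_norm P0 (\<lambda>_. 0)"
      by (rule L2_norm_cong_AE[OF _ L2_spaceD(1)[OF D]]) (use marginals_\<kappa>(1) in \<open>auto elim: eventually_mono\<close>)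
    then show "L2_norm R0 (\<lambda>w. \<kappa>1 (fst w) - marginal1 Q0 \<kappa> (fst w)) \<le> 0"
      unfolding PQ.L2_fst(2)[OF D] by (simp add: L2_norm_def)
  qed
  then have 1: "(\<lambda>w. \<kappa>1 (fst w)) \<in> T" by (intro T_cong_AE[OF T_fst[OF \<kappa>T]]) auto
  have "AE w in R0. \<kappa>2 (snd w) - marginal2 P0 \<kappa> (snd w) = 0"
  proof (rule L2_norm_zero_AE)
    note D = L2_diff[OF \<kappa>L(3) marginal2_L2(1)[OF \<kappa>L(1)]]
    show "(\<lambda>w. \<kappa>2 (snd w) - marginal2 P0 \<kappa> (snd w)) \<in> L2_space R0" by (rule L2_snd(1)[OF D])
    have "L2_norm Q0 (\<lambda>x. \<kappa>2 x - marginal2 P0 \<kappa> x) = L2_norm Q0 (\<lambda>_. 0)"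
      by (rule L2_norm_cong_AE[OF _ L2_spaceD(1)[OF D]]) (use marginals_\<kappa>(2) in \<open>auto elim: eventually_mono\<close>)
    then show "L2_norm R0 (\<lambda>w. \<kappa>2 (snd w) - marginal2 P0 \<kappa> (snd w)) \<le> 0"
      unfolding L2_snd(2)[OF D] by (simp add: L2_norm_def)
  qed
  then have 2: "(\<lambda>w. \<kappa>2 (snd w)) \<in> T" by (intro T_cong_AE[OF T_snd[OF \<kappa>T]]) auto
  show ?thesis unfolding \<kappa>s_def[abs_def] by (rule T_lincomb[OF 1 2])
qed

lemma inner_\<kappa>_\<kappa>s: "(\<integral>w. \<kappa> w * \<kappa>s w \<partial>R0) = v"
proof -
  have [measurable]: "marginal1 Q0 \<kappa>s \<in> borel_measurable P0" "marginal2 P0 \<kappa>s \<in> borel_measurable Q0"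
    using PQ.marginal1_L2(1)[OF \<kappa>sL] marginal2_L2(1)[OF \<kappa>sL] by (auto simp: L2_space_def)
  have "(\<integral>x. \<kappa>1 x * marginal1 Q0 \<kappa>s x \<partial>P0) = (\<integral>x. 1 / (1 - d) * (\<kappa>1 x)\<^sup>2 \<partial>P0)"
    by (rule integral_cong_AE) (use marginals_\<kappa>s(1) in \<open>auto elim!: eventually_mono simp: power2_eq_square\<close>)
  moreover have "(\<integral>y. \<kappa>2 y * marginal2 P0 \<kappa>s y \<partial>Q0) = (\<integral>y. 1 / d * (\<kappa>2 y)\<^sup>2 \<partial>Q0)"
    by (rule integral_cong_AE) (use marginals_\<kappa>s(2) in \<open>auto elim!: eventually_mono simp: power2_eq_square\<close>)
  ultimately show ?thesis unfolding inner_\<kappa>[OF \<kappa>sL] v_def by simp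
qed

abbreviation "\<psi> c \<equiv> \<lambda>n w. if test_statistic \<kappa>1 \<kappa>2 n1 n2 n w > c then 1 else 0 :: real"

lemma \<psi>_power:
  assumes s: "s \<in> F2 \<P> \<Q> P0 Q0"
  shows "expected_value n1 n2 (\<psi> (u * sqrt v)) s \<longlonglongrightarrow> 1 - \<Phi> (u - local_parameter k P0 Q0 s / sqrt v)"
proof -
  obtain h where h: "h \<in> T" "local_seq P0 (fst s) (marginal1 Q0 h)" "local_seq Q0 (snd s) (marginal2 P0 h)"
    "local_parameter k P0 Q0 s = (\<integral>w. \<kappa> w * h w \<partial>R0)"
    using F2_tangent[OF gradient s] by blast
  have hL: "h \<in> L2_space R0" using h(1) T_L2 by blast
  have "(u * sqrt v - local_parameter k P0 Q0 s) / sqrt v = u - local_parameter k P0 Q0 s / sqrt v"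
    using v_pos by (simp add: diff_divide_distrib)
  then show ?thesis
    using test_power_limit[OF P0.prob_space_axioms Q0.prob_space_axioms h(2,3) parts proportion1 proportion v_def v_pos
        h(4)[unfolded inner_\<kappa>[OF hL]], of "u * sqrt v"]
    unfolding expected_value_def[abs_def] by simp
qed

text \<open>The projection \<open>h0\<close> of \<open>h\<close> lies in the kernel of the gradient
  but perhaps not in the cone, so the level of \<open>\<phi>\<close> is not known along it. Tangents
  \<open>f j\<close> from kernel and cone approximate it, and for each of them
  \<open>neyman_pearson_limsup\<close> applies with the distance \<open>\<Delta> j\<close> from
  \<open>h\<close>; these distances tend to \<open>|\<theta>| / sqrt v\<close>.\<close>

lemma power_bound:
  assumes \<phi>: "is_test_seq P0 Q0 n1 n2 \<phi>"
    and level: "\<And>s. s \<in> F2 \<P> \<Q> P0 Q0 \<Longrightarrow> local_parameter k P0 Q0 s = 0 \<Longrightarrow> expected_value n1 n2 \<phi> s \<longlonglongrightarrow> 1 - \<Phi> u"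
    and s: "s \<in> F2 \<P> \<Q> P0 Q0" and \<theta>: "local_parameter k P0 Q0 s \<noteq> 0"
  shows "limsup (\<lambda>n. ereal (expected_value n1 n2 \<phi> s n)) \<le> ereal (1 - \<Phi> (u - \<bar>local_parameter k P0 Q0 s\<bar> / sqrt v))"
proof -
  define \<theta> where "\<theta> = local_parameter k P0 Q0 s"
  obtain h where h: "h \<in> T" "local_seq P0 (fst s) (marginal1 Q0 h)" "local_seq Q0 (snd s) (marginal2 P0 h)"
    "\<theta> = (\<integral>w. \<kappa> w * h w \<partial>R0)"
    unfolding \<theta>_def using F2_tangent[OF gradient s] by blast
  have hL: "h \<in> L2_space R0" using h(1) T_L2 by blast
  \<comment> \<open>Subtracting this multiple of the representer makes the inner product with
    \<open>\<kappa>\<close> vanish, because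
    \<open>\<integral>\<kappa> \<kappa>s = v\<close>.\<close>
  define h0 where "h0 w = 1 * h w + (- (\<theta> / v)) * \<kappa>s w" for w
  have h0T: "h0 \<in> T" unfolding h0_def[abs_def] by (rule T_lincomb[OF h(1) \<kappa>s_T])
  have h0L: "h0 \<in> L2_space R0" using h0T T_L2 by blast
  have "(\<integral>w. \<kappa> w * h0 w \<partial>R0) = (\<integral>w. \<kappa> w * h w + (- (\<theta> / v)) * (\<kappa> w * \<kappa>s w) \<partial>R0)"
    by (simp add: h0_def algebra_simps)
  also have "\<dots> = \<theta> - \<theta> / v * v"
    using L2_mult_integrable[OF \<kappa>L(1) hL] L2_mult_integrable[OF \<kappa>L(1) \<kappa>sL]
    by (simp add: h(4)[symmetric] inner_\<kappa>_\<kappa>s)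
  finally have "(\<integral>w. \<kappa> w * h0 w \<partial>R0) = 0" using v_pos by simp
  then have "h0 \<in> gradient_kernel \<kappa> R0 \<R>" using h0T by (simp add: gradient_kernel_def)
  then have "h0 \<in> L2_closure R0 (gradient_kernel \<kappa> R0 \<R> \<inter> K)" using dense by blast
  then have cl: "\<forall>e>0. \<exists>f\<in>gradient_kernel \<kappa> R0 \<R> \<inter> K. L2_norm R0 (\<lambda>x. h0 x - f x) < e"
    by (simp add: L2_closure_def)
  have "\<exists>f\<in>gradient_kernel \<kappa> R0 \<R> \<inter> K. L2_norm R0 (\<lambda>x. h0 x - f x) < inverse (real (Suc j))" for j
    by (rule cl[rule_format]) simp
  then obtain f where f: "\<And>j. f j \<in> gradient_kernel \<kappa> R0 \<R> \<inter> K" "\<And>j. L2_norm R0 (\<lambda>x. h0 x - f j x) < inverse (real (Suc j))"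
    by metis
  have fL: "f j \<in> L2_space R0" for j using f(1)[of j] K_L2 by auto
  have tf: "L2_tendsto R0 f h0"
    by (rule L2_tendstoI[OF fL h0L LIMSEQ_inverse_real_of_nat])
       (use f(2) in \<open>simp add: L2_norm_minus_commute[of R0 "f _"] less_imp_le\<close>)
  define r1 where "r1 j x = marginal1 Q0 h x - marginal1 Q0 (f j) x" for j x
  define r2 where "r2 j y = marginal2 P0 h y - marginal2 P0 (f j) y" for j y
  have t1: "L2_tendsto P0 r1 (\<lambda>x. \<theta> / v * (1 / (1 - d) * \<kappa>1 x))"
  proof (rule L2_tendstoI[OF _ _ L2_tendstoD(3)[OF tf]])
    show rL: "r1 j \<in> L2_space P0" for j
      unfolding r1_def[abs_def] by (intro L2_diff PQ.marginal1_L2(1) hL fL)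
    show kL: "(\<lambda>x. \<theta> / v * (1 / (1 - d) * \<kappa>1 x)) \<in> L2_space P0" by (intro L2_cmult \<kappa>L)
    fix j
    have D: "(\<lambda>w. 1 * h0 w + (-1) * f j w) \<in> L2_space R0" by (intro L2_add L2_cmult h0L fL)
    have "L2_norm P0 (\<lambda>x. r1 j x - \<theta> / v * (1 / (1 - d) * \<kappa>1 x)) = L2_norm P0 (marginal1 Q0 (\<lambda>w. 1 * h0 w + (-1) * f j w))"
    proof (rule L2_norm_cong_AE[OF _ L2_spaceD(1)[OF L2_diff[OF rL kL]] L2_spaceD(1)[OF PQ.marginal1_L2(1)[OF D]]])
      show "AE x in P0. r1 j x - \<theta> / v * (1 / (1 - d) * \<kappa>1 x) = marginal1 Q0 (\<lambda>w. 1 * h0 w + (-1) * f j w) x"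
        using PQ.marginal1_lincomb[OF h0L fL[of j], of 1 "-1"]
          PQ.marginal1_lincomb[OF hL \<kappa>sL, of 1 "- (\<theta> / v)", folded h0_def] marginals_\<kappa>s(1)
        by eventually_elim (simp add: r1_def)
    qed
    also have "\<dots> \<le> L2_norm R0 (\<lambda>w. 1 * h0 w + (-1) * f j w)" by (rule PQ.marginal1_L2(2)[OF D])
    also have "\<dots> = L2_norm R0 (\<lambda>w. f j w - h0 w)" using L2_norm_minus_commute[of R0 h0 "f j"] by simp
    finally show "L2_norm P0 (\<lambda>x. r1 j x - \<theta> / v * (1 / (1 - d) * \<kappa>1 x)) \<le> L2_norm R0 (\<lambda>w. f j w - h0 w)" .
  qed
  have t2: "L2_tendsto Q0 r2 (\<lambda>y. \<theta> / v * (1 / d * \<kappa>2 y))"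
  proof (rule L2_tendstoI[OF _ _ L2_tendstoD(3)[OF tf]])
    show rL: "r2 j \<in> L2_space Q0" for j
      unfolding r2_def[abs_def] by (intro L2_diff marginal2_L2(1) hL fL)
    show kL: "(\<lambda>x. \<theta> / v * (1 / d * \<kappa>2 x)) \<in> L2_space Q0" by (intro L2_cmult \<kappa>L)
    fix j
    have D: "(\<lambda>w. 1 * h0 w + (-1) * f j w) \<in> L2_space R0" by (intro L2_add L2_cmult h0L fL)
    have "L2_norm Q0 (\<lambda>x. r2 j x - \<theta> / v * (1 / d * \<kappa>2 x)) = L2_norm Q0 (marginal2 P0 (\<lambda>w. 1 * h0 w + (-1) * f j w))"
    proof (rule L2_norm_cong_AE[OF _ L2_spaceD(1)[OF L2_diff[OF rL kL]] L2_spaceD(1)[OF marginal2_L2(1)[OF D]]])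
      show "AE x in Q0. r2 j x - \<theta> / v * (1 / d * \<kappa>2 x) = marginal2 P0 (\<lambda>w. 1 * h0 w + (-1) * f j w) x"
        using marginal2_lincomb[OF h0L fL[of j], of 1 "-1"]
          marginal2_lincomb[OF hL \<kappa>sL, of 1 "- (\<theta> / v)", folded h0_def] marginals_\<kappa>s(2)
        by eventually_elim (simp add: r2_def)
    qed
    also have "\<dots> \<le> L2_norm R0 (\<lambda>w. 1 * h0 w + (-1) * f j w)" by (rule marginal2_L2(2)[OF D])
    also have "\<dots> = L2_norm R0 (\<lambda>w. f j w - h0 w)" using L2_norm_minus_commute[of R0 h0 "f j"] by simp
    finally show "L2_norm Q0 (\<lambda>x. r2 j x - \<theta> / v * (1 / d * \<kappa>2 x)) \<le> L2_norm R0 (\<lambda>w. f j w - h0 w)" .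
  qed
  define \<Delta> where "\<Delta> j = sqrt ((1 - d) * (L2_norm P0 (r1 j))\<^sup>2 + d * (L2_norm Q0 (r2 j))\<^sup>2)" for j
  have "\<Delta> \<longlonglongrightarrow> sqrt ((1 - d) * (L2_norm P0 (\<lambda>x. \<theta> / v * (1 / (1 - d) * \<kappa>1 x)))\<^sup>2 + d * (L2_norm Q0 (\<lambda>y. \<theta> / v * (1 / d * \<kappa>2 y)))\<^sup>2)"
    unfolding \<Delta>_def[abs_def] by (intro tendsto_intros L2_tendsto_norm[OF t1] L2_tendsto_norm[OF t2])
  \<comment> \<open>One of the two factors \<open>1 / (1 - d)\<close> cancels against the weight
    \<open>1 - d\<close>, likewise for \<open>d\<close>, and \<open>v\<close> reappears. The squared
    distance is therefore \<open>\<theta>^2 / v\<close>, the square of the shift in the limiting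
    power of the proposed test.\<close>
  also have "(1 - d) * (L2_norm P0 (\<lambda>x. \<theta> / v * (1 / (1 - d) * \<kappa>1 x)))\<^sup>2 + d * (L2_norm Q0 (\<lambda>y. \<theta> / v * (1 / d * \<kappa>2 y)))\<^sup>2
     = (\<theta> / v)\<^sup>2 * v"
  proof -
    have "(1 - d) * (L2_norm P0 (\<lambda>x. \<theta> / v * (1 / (1 - d) * \<kappa>1 x)))\<^sup>2 = (\<theta> / v)\<^sup>2 * (1 / (1 - d) * (\<integral>x. (\<kappa>1 x)\<^sup>2 \<partial>P0))"
      unfolding L2_norm_cmult power_mult_distrib L2_norm_power2 power2_abs
      using proportion by (simp add: power2_eq_square)
    moreover have "d * (L2_norm Q0 (\<lambda>y. \<theta> / v * (1 / d * \<kappa>2 y)))\<^sup>2 = (\<theta> / v)\<^sup>2 * (1 / d * (\<integral>x. (\<kappa>2 x)\<^sup>2 \<partial>Q0))"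
      unfolding L2_norm_cmult power_mult_distrib L2_norm_power2 power2_abs
      using proportion by (simp add: power2_eq_square)
    ultimately show ?thesis unfolding v_def by (simp only: distrib_left)
  qed
  also have "sqrt ((\<theta> / v)\<^sup>2 * v) = \<bar>\<theta>\<bar> / sqrt v"
    using v_pos by (simp add: real_sqrt_mult real_sqrt_divide[symmetric] abs_divide) (simp add: field_simps)
  finally have \<Delta>: "\<Delta> \<longlonglongrightarrow> \<bar>\<theta>\<bar> / sqrt v" .
  \<comment> \<open>\<open>neyman_pearson_limsup\<close> requires a positive distance;
    \<open>\<theta> \<noteq> 0\<close> provides it for all large \<open>j\<close>.\<close>
  have "0 < \<bar>\<theta>\<bar> / sqrt v" using \<theta> v_pos by (simp add: \<theta>_def)
  then have pos: "\<forall>\<^sub>F j in sequentially. 0 < \<Delta> j" by (rule order_tendstoD(1)[OF \<Delta>])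
  let ?l = "limsup (\<lambda>n. ereal (expected_value n1 n2 \<phi> s n))"
  have bd: "?l \<le> ereal (1 - \<Phi> (u - \<Delta> j))" if j: "0 < \<Delta> j" for j
  proof -
    obtain s' where s': "s' \<in> F2 \<P> \<Q> P0 Q0" "local_seq P0 (fst s') (marginal1 Q0 (f j))" "local_seq Q0 (snd s') (marginal2 P0 (f j))"
      "local_parameter k P0 Q0 s' = (\<integral>w. \<kappa> w * f j w \<partial>R0)"
      using cone_sequence[OF gradient, of "f j"] f(1)[of j] by blast
    have "local_parameter k P0 Q0 s' = 0" using f(1)[of j] s'(4) by (simp add: gradient_kernel_def)
    then have lev: "expected_value n1 n2 \<phi> s' \<longlonglongrightarrow> 1 - \<Phi> u" by (rule level[OF s'(1)])
    have sq: "(\<Delta> j)\<^sup>2 = (1 - d) * (\<integral>x. (marginal1 Q0 h x - marginal1 Q0 (f j) x)\<^sup>2 \<partial>P0)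
        + d * (\<integral>y. (marginal2 P0 h y - marginal2 P0 (f j) y)\<^sup>2 \<partial>Q0)"
      using proportion unfolding \<Delta>_def L2_norm_power2 r1_def r2_def by (subst real_sqrt_pow2) auto
    show ?thesis
      unfolding expected_value_def
      by (rule neyman_pearson_limsup[OF P0.prob_space_axioms Q0.prob_space_axioms s'(2,3) h(2,3) proportion1 proportion(1) sq j \<phi>
            lev[unfolded expected_value_def[abs_def]]])
  qed
  have "(\<lambda>j. ereal (1 - \<Phi> (u - \<Delta> j))) \<longlonglongrightarrow> ereal (1 - \<Phi> (u - \<bar>\<theta>\<bar> / sqrt v))"
    by (intro tendsto_ereal tendsto_diff tendsto_const isCont_tendsto_compose[OF isCont_\<Phi>] \<Delta>)
  then have "?l \<le> ereal (1 - \<Phi> (u - \<bar>\<theta>\<bar> / sqrt v))"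
    by (rule tendsto_lowerbound) (use pos bd in \<open>auto elim: eventually_mono\<close>)
  then show ?thesis by (simp add: \<theta>_def)
qed

theorem optimal:
  assumes level: "0 < \<alpha>" "\<alpha> < 1"
  shows "asymptotically_optimal (asymptotically_similar_tests M1 M2 \<P> \<Q> k P0 Q0 n1 n2 \<alpha>)
     (implicit_hypotheses \<P> \<Q> k P0 Q0) (implicit_alternatives \<P> \<Q> k P0 Q0) n1 n2
     (\<psi> (critical_value \<kappa>1 \<kappa>2 P0 Q0 d \<alpha>))"
proof -
  define u where "u = normal_quantile (1 - \<alpha>)"
  have u: "\<Phi> u = 1 - \<alpha>" unfolding u_def by (rule \<Phi>_normal_quantile) (use level in auto)
  have c: "critical_value \<kappa>1 \<kappa>2 P0 Q0 d \<alpha> = u * sqrt v" by (simp add: critical_value_def u_def v_def)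
  let ?\<psi> = "\<psi> (critical_value \<kappa>1 \<kappa>2 P0 Q0 d \<alpha>)"
  let ?\<theta> = "local_parameter k P0 Q0"
  have sM: "sets P0 = sets M1" "sets Q0 = sets M2" using family1 family2 base by auto
  have s2: "sets (two_sample a b M1 M2) = sets (two_sample a b P0 Q0)" for a b
    by (rule sets_two_sample_cong) (simp_all add: sM)
  have test_cong: "is_test_seq M1 M2 n1 n2 \<phi> \<longleftrightarrow> is_test_seq P0 Q0 n1 n2 \<phi>" for \<phi>
    unfolding is_test_seq_def measurable_cong_sets[OF s2 refl] sets_eq_imp_space_eq[OF s2] ..
  have lim: "expected_value n1 n2 ?\<psi> s \<longlonglongrightarrow> 1 - \<Phi> (u - ?\<theta> s / sqrt v)" if "s \<in> F2 \<P> \<Q> P0 Q0" for s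
    unfolding c by (rule \<psi>_power[OF that])
  have \<psi>t: "is_test_seq P0 Q0 n1 n2 ?\<psi>"
    unfolding is_test_seq_def
  proof (intro allI conjI)
    fix n
    have [measurable]: "test_statistic \<kappa>1 \<kappa>2 n1 n2 n \<in> borel_measurable (two_sample (n1 n) (n2 n) P0 Q0)"
      unfolding test_statistic_def[abs_def]
      by (intro borel_measurable_add borel_measurable_times borel_measurable_const borel_measurable_sum
          measurable_two_sample_fst measurable_two_sample_snd \<kappa>m)
    show "?\<psi> n \<in> borel_measurable (two_sample (n1 n) (n2 n) P0 Q0)" by measurable
  qed auto
  have pr: "prob_space (fst s n)" "prob_space (snd s n)" "sets (fst s n) = sets P0" "sets (snd s n) = sets Q0"
    if "s \<in> F2 \<P> \<Q> P0 Q0" for s n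
  proof -
    have "fst s n \<in> \<P>" "snd s n \<in> \<Q>" using that by (auto simp: F2_def)
    then show "prob_space (fst s n)" "prob_space (snd s n)" "sets (fst s n) = sets P0" "sets (snd s n) = sets Q0"
      using family1 family2 sM by auto
  qed
  show ?thesis
    unfolding asymptotically_optimal_def
  proof (intro conjI ballI)
    show "?\<psi> \<in> asymptotically_similar_tests M1 M2 \<P> \<Q> k P0 Q0 n1 n2 \<alpha>"
      unfolding asymptotically_similar_tests_def
    proof (intro CollectI conjI ballI impI)
      show "is_test_seq M1 M2 n1 n2 ?\<psi>" using \<psi>t test_cong by blast
      fix s assume s: "s \<in> implicit_hypotheses \<P> \<Q> k P0 Q0" "?\<theta> s = 0"
      then have "s \<in> F2 \<P> \<Q> P0 Q0" by (simp add: implicit_hypotheses_def)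
      from lim[OF this] show "expected_value n1 n2 ?\<psi> s \<longlonglongrightarrow> \<alpha>" using s(2) u by simp
    qed
    fix s assume "s \<in> implicit_hypotheses \<P> \<Q> k P0 Q0 \<union> implicit_alternatives \<P> \<Q> k P0 Q0"
    then have "s \<in> F2 \<P> \<Q> P0 Q0" by (auto simp: implicit_hypotheses_def implicit_alternatives_def)
    from lim[OF this] show "convergent (expected_value n1 n2 ?\<psi> s)" by (auto simp: convergent_def)
  next
    fix \<phi> assume \<phi>: "\<phi> \<in> asymptotically_similar_tests M1 M2 \<P> \<Q> k P0 Q0 n1 n2 \<alpha>"
    then have \<phi>t: "is_test_seq P0 Q0 n1 n2 \<phi>" by (simp add: asymptotically_similar_tests_def test_cong)
    have \<phi>l: "expected_value n1 n2 \<phi> s \<longlonglongrightarrow> \<alpha>" if "s \<in> F2 \<P> \<Q> P0 Q0" "?\<theta> s = 0" for s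
    proof -
      have "s \<in> implicit_hypotheses \<P> \<Q> k P0 Q0" using that by (simp add: implicit_hypotheses_def)
      then show ?thesis using \<phi> that(2) unfolding asymptotically_similar_tests_def by blast
    qed
    {
      fix s assume "s \<in> implicit_alternatives \<P> \<Q> k P0 Q0"
      then have s: "s \<in> F2 \<P> \<Q> P0 Q0" "0 < ?\<theta> s" by (auto simp: implicit_alternatives_def)
      have "limsup (\<lambda>n. ereal (expected_value n1 n2 \<phi> s n)) \<le> ereal (1 - \<Phi> (u - \<bar>?\<theta> s\<bar> / sqrt v))"
        by (rule power_bound[OF \<phi>t _ s(1)]) (use \<phi>l u s in auto)
      then show "limsup (\<lambda>n. ereal (expected_value n1 n2 \<phi> s n)) \<le> ereal (lim (expected_value n1 n2 ?\<psi> s))"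
        using limI[OF lim[OF s(1)]] s(2) by simp
    }
    fix s assume "s \<in> implicit_hypotheses \<P> \<Q> k P0 Q0"
    then have s: "s \<in> F2 \<P> \<Q> P0 Q0" "?\<theta> s \<le> 0" by (auto simp: implicit_hypotheses_def)
    show "ereal (lim (expected_value n1 n2 ?\<psi> s)) \<le> liminf (\<lambda>n. ereal (expected_value n1 n2 \<phi> s n))"
    \<comment> \<open>At parameter \<open>0\<close> both tests have the limit
      \<open>\<alpha>\<close> by similarity; \<open>power_bound\<close> speaks only of nonzero
      parameters.\<close>
    proof (cases "?\<theta> s = 0")
      case True
      have "liminf (\<lambda>n. ereal (expected_value n1 n2 \<phi> s n)) = ereal \<alpha>"
        using \<phi>l[OF s(1) True] by (intro lim_imp_Liminf) auto
      then show ?thesis using limI[OF lim[OF s(1)]] True u by simp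
    next
      case False
      \<comment> \<open>The complementary test has level
        \<open>1 - \<alpha> = 1 - \<Phi> (- u)\<close> along the sequences with parameter
        \<open>0\<close>. Its power bound involves only the modulus of the parameter, so it holds at
        negative values too and becomes a lower bound for \<open>\<phi>\<close>.\<close>
      define \<phi>' where "\<phi>' n w = 1 - \<phi> n w" for n w
      have ex: "expected_value n1 n2 \<phi>' s n = 1 - expected_value n1 n2 \<phi> s n" if s: "s \<in> F2 \<P> \<Q> P0 Q0" for s n
      proof -
        let ?S = "two_sample (n1 n) (n2 n) (fst s n) (snd s n)"
        interpret prob_space ?S by (rule prob_space_two_sample[OF pr(1,2)[OF s]])
        have sS: "sets ?S = sets (two_sample (n1 n) (n2 n) P0 Q0)" by (rule sets_two_sample_cong[OF pr(3,4)[OF s]])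
        have "integrable ?S (\<phi> n)"
        proof (rule integrable_const_bound[of _ 1])
          show "\<phi> n \<in> borel_measurable ?S"
            using \<phi>t measurable_cong_sets[OF sS refl, of borel] unfolding is_test_seq_def by blast
          show "AE w in ?S. norm (\<phi> n w) \<le> 1"
          proof (rule AE_I2)
            fix w assume "w \<in> space ?S"
            then have "0 \<le> \<phi> n w \<and> \<phi> n w \<le> 1"
              using \<phi>t sets_eq_imp_space_eq[OF sS] unfolding is_test_seq_def by blast
            then show "norm (\<phi> n w) \<le> 1" by simp
          qed
        qed
        then show ?thesis by (simp add: expected_value_def \<phi>'_def prob_space)
      qed
      have \<phi>'t: "is_test_seq P0 Q0 n1 n2 \<phi>'"
        unfolding is_test_seq_def
      proof (intro allI conjI ballI)
        fix n
        show "\<phi>' n \<in> borel_measurable (two_sample (n1 n) (n2 n) P0 Q0)"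
          unfolding \<phi>'_def[abs_def] using \<phi>t unfolding is_test_seq_def
          by (intro borel_measurable_diff borel_measurable_const) blast
        fix w assume "w \<in> space (two_sample (n1 n) (n2 n) P0 Q0)"
        then have "0 \<le> \<phi> n w \<and> \<phi> n w \<le> 1" using \<phi>t unfolding is_test_seq_def by blast
        then show "0 \<le> \<phi>' n w" "\<phi>' n w \<le> 1" by (simp_all add: \<phi>'_def)
      qed
      have "limsup (\<lambda>n. ereal (expected_value n1 n2 \<phi>' s n)) \<le> ereal (1 - \<Phi> ((- u) - \<bar>?\<theta> s\<bar> / sqrt v))"
      proof (rule power_bound[OF \<phi>'t _ s(1) False])
        fix s' assume s': "s' \<in> F2 \<P> \<Q> P0 Q0" "?\<theta> s' = 0"
        have "(\<lambda>n. 1 - expected_value n1 n2 \<phi> s' n) \<longlonglongrightarrow> 1 - \<alpha>" by (intro tendsto_intros \<phi>l s')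
        then show "expected_value n1 n2 \<phi>' s' \<longlonglongrightarrow> 1 - \<Phi> (- u)"
          unfolding \<Phi>_minus u ex[OF s'(1), abs_def] by simp
      qed
      also have "1 - \<Phi> ((- u) - \<bar>?\<theta> s\<bar> / sqrt v) = \<Phi> (u - ?\<theta> s / sqrt v)"
        using \<Phi>_minus[of "u - ?\<theta> s / sqrt v"] s(2) by simp
      finally have ls: "limsup (\<lambda>n. ereal (1 - expected_value n1 n2 \<phi> s n)) \<le> ereal (\<Phi> (u - ?\<theta> s / sqrt v))"
        unfolding ex[OF s(1)] .
      then show ?thesis using liminf_ge_complement[OF ls] limI[OF lim[OF s(1)]] by simp
    qed
  qed
qed

end

theorem mainTheorem13:
  fixes M1 :: "'a measure" and M2 :: "'b measure"
    and \<P> :: "'a measure set" and \<Q> :: "'b measure set"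
    and P0 :: "'a measure" and Q0 :: "'b measure"
    and k :: "('a \<times> 'b) measure \<Rightarrow> real"
    and \<kappa> :: "'a \<times> 'b \<Rightarrow> real" and \<kappa>1 :: "'a \<Rightarrow> real" and \<kappa>2 :: "'b \<Rightarrow> real"
    and n1 n2 :: "nat \<Rightarrow> nat" and d \<alpha> :: real
  assumes family1: "\<And>P. P \<in> \<P> \<Longrightarrow> prob_space P \<and> sets P = sets M1"
    and family2: "\<And>Q. Q \<in> \<Q> \<Longrightarrow> prob_space Q \<and> sets Q = sets M2"
    and base: "P0 \<in> \<P>" "Q0 \<in> \<Q>"
    and differentiable:
      "functional_differentiable k (P0 \<Otimes>\<^sub>M Q0) (product_family \<P> \<Q>)"
    and canonical:
      "is_canonical_gradient k (P0 \<Otimes>\<^sub>M Q0) (product_family \<P> \<Q>) \<kappa>"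
    and parts: "\<kappa>1 \<in> L2_centered P0" "\<kappa>2 \<in> L2_centered Q0"
    and decomposition: "AE w in P0 \<Otimes>\<^sub>M Q0. \<kappa> w = \<kappa>1 (fst w) + \<kappa>2 (snd w)"
    and nondegenerate: "L2_norm (P0 \<Otimes>\<^sub>M Q0) \<kappa> \<noteq> 0"
    and level: "0 < \<alpha>" "\<alpha> < 1"
    and sizes: "\<And>n. n1 n + n2 n = n"
    and proportion: "(\<lambda>n. real (n2 n) / real n) \<longlonglongrightarrow> d" "0 < d" "d < 1"
    and dense:
      "gradient_kernel \<kappa> (P0 \<Otimes>\<^sub>M Q0) (product_family \<P> \<Q>)
         \<subseteq> L2_closure (P0 \<Otimes>\<^sub>M Q0)
             (gradient_kernel \<kappa> (P0 \<Otimes>\<^sub>M Q0) (product_family \<P> \<Q>)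
                \<inter> tangent_cone (P0 \<Otimes>\<^sub>M Q0) (product_family \<P> \<Q>))"
  shows "asymptotically_optimal
           (asymptotically_similar_tests M1 M2 \<P> \<Q> k P0 Q0 n1 n2 \<alpha>)
           (implicit_hypotheses \<P> \<Q> k P0 Q0)
           (implicit_alternatives \<P> \<Q> k P0 Q0)
           n1 n2
           (\<lambda>n w. if test_statistic \<kappa>1 \<kappa>2 n1 n2 n w > critical_value \<kappa>1 \<kappa>2 P0 Q0 d \<alpha>
                  then 1 else 0)"
proof -
  interpret canonical_model M1 M2 \<P> \<Q> P0 Q0 k \<kappa> \<kappa>1 \<kappa>2 n1 n2 d
    using assms by unfold_locales auto
  show ?thesis by (rule optimal[OF level])
qed

end
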